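(* Assume the following. (i) For all $n\in\mathbb{N}^*$, the observation points $X_1,\dots,X_n$ are independent and uniformly distributed on $[0,n^{1/d}]^d$, and $Y$, $(X_1,\dots,X_n)$ and $\epsilon$ are mutually independent. (ii) The covariance function $K_0$ is stationary and continuous on $\mathbb{R}^d$, and there exists $C_0<+\infty$ such that $|K_0(t)|\le \frac{C_0}{1+|t|^{d+1}}$ for all $t\in\mathbb{R}^d$. (iii) For all $\theta\in\Theta$, $K_\theta$ is a stationary covariance function. For all fixed $t\in\mathbb{R}^d$, $K_\theta(t)$ is $p+1$ times continuously differentiable with respect to $\theta$. For all $i_1,\dots,i_p\in\mathbb{N}$ with $i_1+\dots+i_p\le p+1$ there exists $A_{i_1,\dots,i_p}<+\infty$ such that for all $t\in\mathbb{R}^d$, $\theta\in\Theta$, $\left|\frac{\partial^{i_1}}{\partial\theta_1^{i_1}}\cdots\frac{\partial^{i_p}}{\partial\theta_p^{i_p}}K_\theta(t)\right|\le\frac{A_{i_1,\dots,i_p}}{1+|t|^{d+1}}$. There exists a constant $C_{inf}>0$ such that $\delta_\theta\ge C_{inf}$ for all $\theta\in\Theta$. Furthermore $\delta_\theta$ is $p+1$ times continuously differentiable with respect to $\theta$, and for all $i_1,\dots,i_p\in\mathbb{N}$ with $i_1+\dots+i_p\le p+1$ there exists $B_{i_1,\dots,i_p}<+\infty$ such that for all $\theta\in\Theta$, $\left|\frac{\partial^{i_1}}{\partial\theta_1^{i_1}}\cdots\frac{\partial^{i_p}}{\partial\theta_p^{i_p}}\delta_\theta\right|\le B_{i_1,\dots,i_p}$.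 Then, for any sequence of random variables $\hat\theta_{CV}$ with $\hat\theta_{CV}\in\mathrm{argmin}_{\theta\in\Theta}CV_\theta$, as $n\to\infty$, $$E_{n,\hat\theta_{CV}}=\inf_{\theta\in\Theta}E_{n,\theta}+o_p(1),$$ where the $o_p(1)$ term is a function of $X$, $y$ and $Y$ only that goes to $0$ in probability as $n\to\infty$.
   Context: Fix $d,p\in\mathbb{N}^*$ and $\Theta=[\theta_{inf},\theta_{sup}]^p$ with $-\infty<\theta_{inf}<\theta_{sup}<+\infty$. For $t\in\mathbb{R}^d$, $|t|=\max_{i}|t_i|$. $Y$ is a stationary Gaussian process on $\mathbb{R}^d$ with zero mean and covariance function $K_0$, i.e. $\mathrm{Cov}(Y(s),Y(t))=K_0(s-t)$. For each $n$, $X=(X_1,\dots,X_n)$ is the random $n$-tuple of observation points in $\mathbb{R}^d$, $\epsilon=(\epsilon_1,\dots,\epsilon_n)^t\sim\mathcal{N}(0,\delta_0 I_n)$ with $\delta_0\ge 0$, and $y=(y_1,\dots,y_n)^t$ with $y_i=Y(X_i)+\epsilon_i$. The parametric model is $\{(K_\theta,\delta_\theta),\theta\in\Theta\}$ with $K_\theta$ a stationary covariance function on $\mathbb{R}^d$ and $\delta_\theta>0$; it need not contain $(K_0,\delta_0)$. Define the $n\times n$ random matrix $(R_\theta)_{i,j}=K_\theta(X_i-X_j)+\delta_\theta\mathbf{1}_{i=j}$. Leave-one-out (LOO) criterion: let $R_{i,\theta}$ be $R_\theta$ with row and column $i$ deleted, $r_{i,\theta}=(K_\theta(X_i-X_j))_{j\ne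 i}\in\mathbb{R}^{n-1}$, $y_{-i}=(y_j)_{j\neq i}$, and $\hat y_{i,\theta}=r_{i,\theta}^tR_{i,\theta}^{-1}y_{-i}$ (the conditional expectation of $y_i$ given $X$ and $y_{-i}$ under the model $(K_\theta,\delta_\theta)$). Then $$CV_\theta=\frac1n\sum_{i=1}^n(y_i-\hat y_{i,\theta})^2 .$$ $CV_\theta$ may have several global minimizers. Integrated square prediction error: for $t\in\mathbb{R}^d$ let $r_\theta(t)=(K_\theta(t-X_j))_{j=1,\dots,n}$ and $\hat y_\theta(t)=r_\theta(t)^tR_\theta^{-1}y$. Then $$E_{n,\theta}=\frac1n\int_{[0,n^{1/d}]^d}\left(\hat y_\theta(t)-Y(t)\right)^2dt,$$ where the integral is defined in the $L^2$ sense ($K_0$ being continuous) and $Y$ is the same process as the one generating $y$.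
   Formalization: That the o_p(1) term is a function of X, y and Y only is claimed when the minimizer is a function of (X, y) (false if ties are broken by outside randomness); Y is a measurable process, K_θ is Borel, and E_{n,θ} is its version almost surely continuous in θ. *)

theory Defs
  imports "HOL-Probability.Probability" "Jordan_Normal_Form.Determinant"
    "Jordan_Normal_Form.Gauss_Jordan_Elimination"
begin

section \<open>Gaussian families\<close>

text \<open>The standard deviation may be zero, so Dirac masses count as normal laws. This is needed for
  the case of a noise of variance zero.\<close>

definition normal_law :: "real \<Rightarrow> real \<Rightarrow> real measure" where
  "normal_law \<mu> \<sigma> =
    (if \<sigma> = 0 then return borel \<mu> else density lborel (\<lambda>x. ennreal (normal_density \<mu> \<sigma> x)))"

definition gaussian_family :: "'w measure \<Rightarrow> 'i set \<Rightarrow> ('i \<Rightarrow> 'w \<Rightarrow> real) \<Rightarrow> bool" where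
  "gaussian_family M I Z \<longleftrightarrow>
    (\<forall>i\<in>I. Z i \<in> borel_measurable M) \<and>
    (\<forall>J a. finite J \<and> J \<subseteq> I \<longrightarrow>
      (\<exists>\<mu> \<sigma>. 0 \<le> \<sigma> \<and> distr M borel (\<lambda>\<omega>. \<Sum>i\<in>J. a i * Z i \<omega>) = normal_law \<mu> \<sigma>))"

definition centered_gaussian ::
  "'w measure \<Rightarrow> 'i set \<Rightarrow> ('i \<Rightarrow> 'w \<Rightarrow> real) \<Rightarrow> ('i \<Rightarrow> 'i \<Rightarrow> real) \<Rightarrow> bool" where
  "centered_gaussian M I Z c \<longleftrightarrow>
    gaussian_family M I Z \<and>
    (\<forall>i\<in>I. (\<integral>\<omega>. Z i \<omega> \<partial>M) = 0) \<and>
    (\<forall>i\<in>I. \<forall>j\<in>I. (\<integral>\<omega>. Z i \<omega> * Z j \<omega> \<partial>M) = c i j)"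

definition stationary_covariance :: "('a::real_vector \<Rightarrow> real) \<Rightarrow> bool" where
  "stationary_covariance k \<longleftrightarrow>
    (\<forall>t. k (- t) = k t) \<and>
    (\<forall>T a. finite T \<longrightarrow> 0 \<le> (\<Sum>s\<in>T. \<Sum>t\<in>T. a s * a t * k (s - t)))"

section \<open>Generated sigma-algebras\<close>

definition generated ::
  "'w measure \<Rightarrow> 'i set \<Rightarrow> ('i \<Rightarrow> 'w \<Rightarrow> 'b::topological_space) \<Rightarrow> 'w measure" where
  "generated M I Z = sigma (space M) {Z i -` B \<inter> space M | i B. i \<in> I \<and> B \<in> sets borel}"

text \<open>Joint measurability is required with respect to the sigma-algebra of the process itself,
  and not merely that of \<open>M\<close>. It is what gives a meaning to the value of the process at a random
  point independent of it: adding \<open>1\<close> to a process exactly at \<open>t = X\<^sub>1\<close> changes neither its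
  finite-dimensional laws nor its independence of \<open>X\<^sub>1\<close>, and keeps it jointly measurable over \<open>M\<close>.
  A Gaussian process with continuous covariance function always has such a version.\<close>

definition measurable_process ::
  "'w measure \<Rightarrow> ('a::topological_space \<Rightarrow> 'w \<Rightarrow> real) \<Rightarrow> bool" where
  "measurable_process M Y \<longleftrightarrow>
    (\<lambda>(t, \<omega>). Y t \<omega>) \<in> borel_measurable (borel \<Otimes>\<^sub>M generated M UNIV Y)"

section \<open>Partial derivatives on a closed box\<close>

text \<open>On the boundary of \<open>S\<close> these are the one-sided derivatives from within \<open>S\<close>.\<close>

definition partial_deriv ::
  "(real^'p::finite) set \<Rightarrow> 'p \<Rightarrow> (real^'p \<Rightarrow> real) \<Rightarrow> real^'p \<Rightarrow> real" where
  "partial_deriv S j f \<theta> =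
    vector_derivative (\<lambda>s. f (\<theta> + s *\<^sub>R axis j 1)) (at 0 within {s. \<theta> + s *\<^sub>R axis j 1 \<in> S})"

fun times_cont_diff_on ::
  "nat \<Rightarrow> (real^'p::finite) set \<Rightarrow> (real^'p \<Rightarrow> real) \<Rightarrow> bool" where
  "times_cont_diff_on 0 S f \<longleftrightarrow> continuous_on S f"
| "times_cont_diff_on (Suc k) S f \<longleftrightarrow>
    continuous_on S f \<and>
    (\<forall>j. (\<forall>\<theta>\<in>S. (\<lambda>s. f (\<theta> + s *\<^sub>R axis j 1)) differentiable
                (at 0 within {s. \<theta> + s *\<^sub>R axis j 1 \<in> S})) \<and>
         times_cont_diff_on k S (partial_deriv S j f))"

text \<open>An index type carries no order, so an enumeration of the coordinates is fixed once and for
  all. By symmetry of the mixed partial derivatives its choice is immaterial for the functions the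
  operator is applied to.\<close>

definition coordinates :: "'p::finite list" where
  "coordinates = (SOME js. distinct js \<and> set js = UNIV)"

definition multi_partial ::
  "(real^'p::finite) set \<Rightarrow> ('p \<Rightarrow> nat) \<Rightarrow> (real^'p \<Rightarrow> real) \<Rightarrow> real^'p \<Rightarrow> real" where
  "multi_partial S \<alpha> f = foldr (\<lambda>j. partial_deriv S j ^^ \<alpha> j) coordinates f"

section \<open>Kriging predictors\<close>

text \<open>In this section \<open>k\<close> is a covariance function, \<open>v\<close> a noise variance, \<open>x\<close> the observation
  points and \<open>y\<close> the observed values, both indexed from \<open>0\<close> to \<open>n - 1\<close>.\<close>

definition cov_mat :: "('a::real_vector \<Rightarrow> real) \<Rightarrow> real \<Rightarrow> nat \<Rightarrow> (nat \<Rightarrow> 'a) \<Rightarrow> real mat" where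
  "cov_mat k v n x = mat n n (\<lambda>(i, j). k (x i - x j) + (if i = j then v else 0))"

definition pred ::
  "('a::real_vector \<Rightarrow> real) \<Rightarrow> real \<Rightarrow> nat \<Rightarrow> (nat \<Rightarrow> 'a) \<Rightarrow> (nat \<Rightarrow> real) \<Rightarrow> 'a \<Rightarrow> real" where
  "pred k v n x y t =
    scalar_prod (vec n (\<lambda>j. k (t - x j))) (the (mat_inverse (cov_mat k v n x)) *\<^sub>v vec n y)"

text \<open>The function \<open>insert_index i\<close> enumerates the indices different from \<open>i\<close>, in accordance
  with \<open>mat_delete\<close>.\<close>

definition loo_pred ::
  "('a::real_vector \<Rightarrow> real) \<Rightarrow> real \<Rightarrow> nat \<Rightarrow> (nat \<Rightarrow> 'a) \<Rightarrow> (nat \<Rightarrow> real) \<Rightarrow> nat \<Rightarrow> real" where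
  "loo_pred k v n x y i =
    scalar_prod (vec (n - 1) (\<lambda>j. k (x i - x (insert_index i j))))
      (the (mat_inverse (mat_delete (cov_mat k v n x) i i)) *\<^sub>v
        vec (n - 1) (\<lambda>j. y (insert_index i j)))"

definition CV ::
  "('a::real_vector \<Rightarrow> real) \<Rightarrow> real \<Rightarrow> nat \<Rightarrow> (nat \<Rightarrow> 'a) \<Rightarrow> (nat \<Rightarrow> real) \<Rightarrow> real" where
  "CV k v n x y = (\<Sum>i<n. (y i - loo_pred k v n x y i)\<^sup>2) / real n"

section \<open>Observations and integrated square prediction error\<close>

definition obs_domain :: "nat \<Rightarrow> (real^'d::finite) set" where
  "obs_domain n = cbox 0 (\<chi> i. root CARD('d) (real n))"

definition observations ::
  "('a \<Rightarrow> 'w \<Rightarrow> real) \<Rightarrow> (nat \<Rightarrow> nat \<Rightarrow> 'w \<Rightarrow> 'a) \<Rightarrow> (nat \<Rightarrow> nat \<Rightarrow> 'w \<Rightarrow> real) \<Rightarrow>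
    nat \<Rightarrow> nat \<Rightarrow> 'w \<Rightarrow> real" where
  "observations Y X \<epsilon> n i \<omega> = Y (X n i \<omega>) \<omega> + \<epsilon> n i \<omega>"

text \<open>Integral of a second-order process in the \<open>L\<^sup>2\<close> sense: the Riemann sums converge to \<open>J\<close> in
  mean square. This is the library's \<open>has_integral\<close> with the \<open>L\<^sup>2(M)\<close> norm in place of a norm on the
  values. Fine partitions are measured by gauges, as in \<open>has_integral\<close>; constant gauges give the
  mean-square Riemann integral, which may fail to exist here because the model covariance
  functions need not be continuous in space.\<close>

definition has_L2_integral ::
  "'w measure \<Rightarrow> ('a::euclidean_space \<Rightarrow> 'w \<Rightarrow> real) \<Rightarrow> ('w \<Rightarrow> real) \<Rightarrow> 'a set \<Rightarrow> bool" where
  "has_L2_integral M Z J S \<longleftrightarrow>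
    J \<in> borel_measurable M \<and> integrable M (\<lambda>\<omega>. (J \<omega>)\<^sup>2) \<and>
    (\<forall>t\<in>S. Z t \<in> borel_measurable M \<and> integrable M (\<lambda>\<omega>. (Z t \<omega>)\<^sup>2)) \<and>
    ((\<lambda>D. \<integral>\<omega>. ((\<Sum>(t, B)\<in>D. measure lborel B * Z t \<omega>) - J \<omega>)\<^sup>2 \<partial>M) \<longlongrightarrow> 0) (division_filter S)"

text \<open>For each fixed \<open>\<theta>\<close> an integral in the \<open>L\<^sup>2\<close> sense is determined only up to a null set. For its
  infimum over \<open>\<theta>\<close> and its value at a random \<open>\<theta>\<close> to make sense, one takes the version with
  almost surely continuous paths in \<open>\<theta>\<close>, which is unique up to a single null set.\<close>

definition is_ISPE ::
  "'w measure \<Rightarrow> (real^'d::finite \<Rightarrow> 'w \<Rightarrow> real) \<Rightarrow> (nat \<Rightarrow> nat \<Rightarrow> 'w \<Rightarrow> real^'d) \<Rightarrow>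
    (nat \<Rightarrow> nat \<Rightarrow> 'w \<Rightarrow> real) \<Rightarrow> (real^'p::finite) set \<Rightarrow> (real^'p \<Rightarrow> real^'d \<Rightarrow> real) \<Rightarrow>
    (real^'p \<Rightarrow> real) \<Rightarrow> nat \<Rightarrow> (real^'p \<Rightarrow> 'w \<Rightarrow> real) \<Rightarrow> bool" where
  "is_ISPE M Y X \<epsilon> \<Theta> K \<delta> n E \<longleftrightarrow>
    (\<forall>\<theta>\<in>\<Theta>. \<exists>J.
      has_L2_integral M
        (\<lambda>t \<omega>. (pred (K \<theta>) (\<delta> \<theta>) n (\<lambda>i. X n i \<omega>) (\<lambda>i. observations Y X \<epsilon> n i \<omega>) t - Y t \<omega>)\<^sup>2)
        J (obs_domain n) \<and>
      (\<forall>\<omega>\<in>space M. E \<theta> \<omega> = J \<omega> / real n)) \<and>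
    (AE \<omega> in M. continuous_on \<Theta> (\<lambda>\<theta>. E \<theta> \<omega>))"

end

theory Submission
  imports Defs
begin

text \<open>Since the estimator minimizes the cross validation criterion, its prediction error exceeds the
  infimum by at most twice the supremum over \<open>\<theta>\<close> of \<open>|CV\<^sub>\<theta> - \<delta>\<^sub>0 - E\<^sub>\<theta>|\<close>, and it suffices that this supremum
  tends to zero in probability.

  For fixed \<open>\<theta>\<close> and given the design, both criteria are quadratic forms in Gaussian variables, whose
  conditional variances are controlled by the numbers of neighbours of the observation points. Those
  have bounded exponential moments. The conditional mean of the \<open>i\<close>-th squared leave-one-out residual
  is \<open>\<delta>\<^sub>0\<close> plus the prediction variance at \<open>X\<^sub>i\<close> given the other points; as \<open>X\<^sub>i\<close> is uniform and
  independent of them, its average over \<open>X\<^sub>i\<close> is a prediction error with \<open>n - 1\<close> points. Adding or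
  deleting one point changes prediction variances little on average, so the conditional means of the
  two criteria agree up to \<open>\<delta>\<^sub>0\<close> and a remainder that vanishes in mean square.

  The supremum is handled by compactness: both criteria have a modulus of continuity in \<open>\<theta>\<close> whose
  constant is a nonnegative quadratic form in the observations that is bounded in probability
  for each single \<open>\<theta>\<close>.

  The mean square integral is identified with a pathwise Lebesgue integral by testing it against
  bounded random variables.\<close>

section \<open>The decay function\<close>

text \<open>The obstacle is clustering. Independent points may pile up anywhere, so neither the
  covariance matrix of the observations nor the model matrix has a bounded operator norm. Two
  estimates hold for every design nevertheless. The lower bound \<open>C\<close> on the model noise
  variance bounds the inverse of \<open>R\<close> by 1 / \<open>C\<close>. And the map from the data
  to the prediction function, square integrable for the normalized measure on the domain, has
  squared norm at most \<open>\<kappa> / (C * n)\<close>, by an argument in the reproducing kernel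
  Hilbert space of the model. What is left of clustering enters through the row sums
  \<open>near\<close> of \<open>decay\<close>, as averages over the points and never through a
  maximum that would have to stay bounded. The rates follow. One more point changes the prediction
  variance by order n^(-1/2) in mean square; decorrelating the leave-one-out terms costs another
  square root, so the criteria differ by order n^(-1/4) in mean square. This suffices, since the
  compactness argument uses finitely many parameters, with radii that do not depend on n.\<close>

definition decay :: "real^'d::finite \<Rightarrow> real" where
  "decay t = 1 / (1 + infnorm t ^ (CARD('d) + 1))"

definition decay_mass :: "'d::finite itself \<Rightarrow> real" where
  "decay_mass _ = integral\<^sup>L lborel (decay :: real^'d \<Rightarrow> real)"

lemma decay_pos: "0 < decay t"
  by (simp add: decay_def infnorm_pos_le add_pos_nonneg)

lemma decay_nonneg [simp]: "0 \<le> decay t"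
  using decay_pos[of t] by simp

lemma decay_le_1: "decay t \<le> 1"
proof -
  have "0 \<le> infnorm t ^ (CARD('a) + 1)" by (intro zero_le_power infnorm_pos_le)
  then show ?thesis by (simp add: decay_def del: power_Suc)
qed

lemma decay_minus [simp]: "decay (- t) = decay t"
  by (simp add: decay_def infnorm_neg)

lemma decay_diff_commute: "decay (s - t) = decay (t - s)"
  using decay_minus[of "s - t"] by simp

lemma decay_0 [simp]: "decay 0 = 1"
  by (simp add: decay_def infnorm_0)

lemma borel_measurable_infnorm [measurable]:
  "infnorm \<in> borel_measurable (borel :: 'a::euclidean_space measure)"
proof (rule borel_measurable_continuous_onI)
  show "continuous_on UNIV (infnorm :: 'a \<Rightarrow> real)"
    using continuous_infnorm[OF continuous_ident]
    by (auto simp: continuous_on_eq_continuous_within)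
qed

lemma borel_measurable_decay [measurable]: "decay \<in> borel_measurable borel"
  unfolding decay_def[abs_def] by measurable

text \<open>Doubling the norm costs at most a factor 2^(d+1): \<open>(2 * a) ^ m + 1\<close> is at
  most \<open>2 ^ m * (1 + a ^ m)\<close> because \<open>1 \<le> 2 ^ m\<close>.\<close>

lemma decay_le_of_infnorm_le:
  fixes s z :: "real^'d::finite"
  assumes "infnorm z \<le> 2 * infnorm s"
  shows "decay s \<le> 2 ^ (CARD('d) + 1) * decay z"
proof -
  let ?m = "CARD('d) + 1"
  have "infnorm z ^ ?m \<le> (2 * infnorm s) ^ ?m"
    by (intro power_mono assms infnorm_pos_le)
  moreover have "1 \<le> (2::real) ^ ?m" by (rule one_le_power) simp
  ultimately have "1 + infnorm z ^ ?m \<le> 2 ^ ?m + (2 * infnorm s) ^ ?m" by linarith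
  then have "1 + infnorm z ^ ?m \<le> 2 ^ ?m * (1 + infnorm s ^ ?m)"
    by (simp only: power_mult_distrib ring_distribs mult_1_right)
  moreover have "0 < 1 + infnorm z ^ ?m" "0 < 1 + infnorm s ^ ?m"
    by (simp_all add: add_pos_nonneg infnorm_pos_le)
  ultimately show ?thesis
    by (simp add: decay_def divide_simps del: power_Suc)
qed

text \<open>One of \<open>s\<close> and \<open>t\<close> has at least half the norm of
  \<open>s + t\<close>. That factor is traded for \<open>decay (s + t)\<close> and the other one is
  kept. After integration, the convolution of \<open>decay\<close> with itself is again of the size
  of \<open>decay\<close>.\<close>

lemma decay_mult_le:
  fixes s t :: "real^'d::finite"
  shows "decay s * decay t \<le> 2 ^ (CARD('d) + 1) * decay (s + t) * (decay s + decay t)"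
proof -
  have tri: "infnorm (s + t) \<le> infnorm s + infnorm t" by (rule infnorm_triangle)
  let ?c = "2 ^ (CARD('d) + 1) * decay (s + t)"
  have c: "0 \<le> ?c" by simp
  show ?thesis
  proof (cases "infnorm t \<le> infnorm s")
    case True
    then have "decay s \<le> ?c" using tri by (intro decay_le_of_infnorm_le) auto
    then have "decay s * decay t \<le> ?c * decay t" by (intro mult_right_mono) auto
    also have "\<dots> \<le> ?c * (decay s + decay t)" by (intro mult_left_mono c) auto
    finally show ?thesis .
  next
    case False
    then have "decay t \<le> ?c" using tri by (intro decay_le_of_infnorm_le) auto
    then have "decay s * decay t \<le> decay s * ?c" by (intro mult_left_mono) auto
    also have "\<dots> \<le> ?c * (decay s + decay t)"
      using mult_left_mono[OF _ c, of "decay s" "decay s + decay t"] by (simp add: mult.commute)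
    finally show ?thesis .
  qed
qed

text \<open>Dyadic shells: the shell of radius \<open>2^k\<close> has volume of order \<open>2^(k d)\<close>, and there
  \<open>decay\<close> is of order \<open>2^(- k (d + 1))\<close>.\<close>

lemma integrable_decay: "integrable lborel (decay :: real^'d::finite \<Rightarrow> real)"
proof -
  let ?d = "CARD('d)"
  let ?B = "\<lambda>r::real. cbox (- r *\<^sub>R One) (r *\<^sub>R One) :: (real^'d) set"
  have in_B: "t \<in> ?B r" if "infnorm t \<le> r" for t r
    using that Basis_le_infnorm[of _ t] by (force simp: mem_box abs_le_iff)
  have vol: "emeasure lborel (?B r) = ennreal ((2 * r) ^ ?d)" if "0 \<le> r" for r
  proof -
    have b: "(r *\<^sub>R One - - r *\<^sub>R One) \<bullet> b = 2 * r" if "b \<in> Basis" for b :: "real^'d"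
      using that by (simp only: inner_diff_left inner_scaleR_left inner_sum_left_Basis) simp
    have "emeasure lborel (?B r) = ennreal (\<Prod>b\<in>(Basis :: (real^'d) set). (r *\<^sub>R One - - r *\<^sub>R One) \<bullet> b)"
      by (rule emeasure_lborel_cbox) (use \<open>0 \<le> r\<close> in auto)
    also have "(\<Prod>b\<in>(Basis :: (real^'d) set). (r *\<^sub>R One - - r *\<^sub>R One) \<bullet> b) = (\<Prod>b\<in>(Basis :: (real^'d) set). 2 * r)"
      by (intro prod.cong refl b)
    finally show ?thesis by simp
  qed
  let ?f = "\<lambda>(k::nat) t. ennreal ((1/2) ^ (k * (?d + 1))) * indicator (?B (2 ^ (k + 1))) t"
  have ptw: "ennreal (decay t) \<le> indicator (?B 1) t + (\<Sum>k. ?f k t)" for t :: "real^'d"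
  proof (cases "infnorm t \<le> 1")
    case True
    then have "ennreal (decay t) \<le> indicator (?B 1) t"
      using in_B[of t 1] decay_le_1[of t] by (auto simp: indicator_def)
    then show ?thesis by (meson add_increasing2 order_trans zero_le)
  next
    case False
    \<comment> \<open>By minimality the norm of \<open>t\<close> is at least \<open>2 ^ k\<close>;
      for \<open>k = 0\<close> this is the case assumption that the norm exceeds 1.\<close>
    define k where "k = (LEAST k. infnorm t \<le> 2 ^ (k + 1))"
    obtain m where "infnorm t < 2 ^ m" using real_arch_pow[of 2] by auto
    then have "infnorm t \<le> 2 ^ (m + 1)"
      by (rule order_trans[OF less_imp_le]) simp
    then have k: "infnorm t \<le> 2 ^ (k + 1)" unfolding k_def by (rule LeastI)
    have k2: "2 ^ k \<le> infnorm t"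
    proof (cases k)
      case (Suc j)
      then have "\<not> infnorm t \<le> 2 ^ (j + 1)"
        using not_less_Least[of j "\<lambda>k. infnorm t \<le> 2 ^ (k + 1)"] by (simp add: k_def)
      then show ?thesis using Suc by simp
    qed (use False in simp)
    have "(2 ^ k) ^ (?d + 1) \<le> infnorm t ^ (?d + 1)" by (intro power_mono k2) simp
    then have "decay t \<le> 1 / (2 ^ k) ^ (?d + 1)"
      unfolding decay_def by (intro divide_left_mono mult_pos_pos add_pos_nonneg) (auto simp: infnorm_pos_le)
    then have "decay t \<le> (1/2) ^ (k * (?d + 1))"
      by (simp only: power_mult[symmetric] power_one_over)
    then have "ennreal (decay t) \<le> ?f k t" using in_B[OF k] by (simp add: ennreal_leI)
    also have "?f k t = sum (\<lambda>k. ?f k t) {k}" by (simp only: sum.insert[OF finite.emptyI] empty_iff not_False_eq_True sum.empty add_0_right)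
    also have "\<dots> \<le> (\<Sum>k. ?f k t)" by (rule sum_le_suminf) (auto intro: summableI)
    finally show ?thesis by (simp add: add_increasing)
  qed
  have int_f: "(\<integral>\<^sup>+t. ?f k t \<partial>lborel) = ennreal (4 ^ ?d * (1/2) ^ k)" for k
  proof -
    \<comment> \<open>The box has side \<open>4 * 2 ^ k\<close>, hence the factor
      \<open>4 ^ ?d\<close>. The exponent \<open>?d + 1\<close> exceeds that of the volume by one,
      and a geometric series remains.\<close>
    have "(1/2) ^ (k * (?d + 1)) * (2 * 2 ^ (k + 1)) ^ ?d = (4::real) ^ ?d * (1/2) ^ k"
    proof -
      have "(2 * 2 ^ (k + 1)) ^ ?d = (4::real) ^ ?d * 2 ^ (k * ?d)"
        by (simp add: power_mult power_mult_distrib)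
      moreover have "(1/2::real) ^ (k * (?d + 1)) = (1/2) ^ k * (1 / 2 ^ (k * ?d))"
        by (simp add: power_add power_one_over)
      ultimately show ?thesis by simp
    qed
    note eq = this
    have "(\<integral>\<^sup>+t. ?f k t \<partial>lborel) =
        ennreal ((1/2) ^ (k * (?d + 1))) * emeasure lborel (?B (2 ^ (k + 1)))"
      by (subst nn_integral_cmult) (auto simp del: emeasure_lborel_cbox)
    also have "\<dots> = ennreal ((1/2) ^ (k * (?d + 1))) * ennreal ((2 * 2 ^ (k + 1)) ^ ?d)"
      by (subst vol) simp_all
    also have "\<dots> = ennreal ((1/2) ^ (k * (?d + 1)) * (2 * 2 ^ (k + 1)) ^ ?d)"
      by (rule ennreal_mult'[symmetric]) simp
    finally show ?thesis
      unfolding eq .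
  qed
  have "(\<integral>\<^sup>+(t::real^'d). ennreal (decay t) \<partial>lborel) \<le>
      (\<integral>\<^sup>+t. indicator (?B 1) t + (\<Sum>k. ?f k t) \<partial>lborel)"
    by (intro nn_integral_mono ptw)
  also have "\<dots> = ennreal (2 ^ ?d) + (\<Sum>k. \<integral>\<^sup>+t. ?f k t \<partial>lborel)"
  proof -
    have "emeasure lborel (?B 1) = ennreal (2 ^ ?d)" using vol[of 1] by (simp del: emeasure_lborel_cbox)
    then show ?thesis
      by (subst nn_integral_add) (auto simp: nn_integral_suminf simp del: emeasure_lborel_cbox)
  qed
  also have "(\<Sum>k. \<integral>\<^sup>+t. ?f k t \<partial>lborel) = (\<Sum>k. ennreal (4 ^ ?d * (1/2) ^ k))"
    by (simp only: int_f)
  also have "(\<Sum>k. ennreal (4 ^ ?d * (1/2) ^ k)) = ennreal (\<Sum>k. 4 ^ ?d * (1/2) ^ k)"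
    by (intro suminf_ennreal2) (auto intro!: summable_mult summable_geometric)
  finally have "(\<integral>\<^sup>+(t::real^'d). ennreal (decay t) \<partial>lborel) < \<infinity>"
    by (simp add: ennreal_plus[symmetric] del: ennreal_plus) (meson ennreal_add_less_top ennreal_less_top le_less_trans ennreal_numeral_less_top)
  then show ?thesis by (intro integrableI_bounded) auto
qed

lemma decay_mass_nonneg: "0 \<le> decay_mass TYPE('d::finite)"
  unfolding decay_mass_def by (intro integral_nonneg_AE) simp

lemma nn_integral_decay_shift:
  "(\<integral>\<^sup>+t. ennreal (decay (t - a)) \<partial>lborel) = ennreal (decay_mass TYPE('d::finite))"
  for a :: "real^'d"
proof -
  have "(\<integral>\<^sup>+(t::real^'d). ennreal (decay t) \<partial>lborel) =
      (\<integral>\<^sup>+t. ennreal (decay t) \<partial>(distr lborel borel (\<lambda>t::real^'d. - a + t)))"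
    by (subst lborel_distr_plus) simp
  also have "\<dots> = (\<integral>\<^sup>+t. ennreal (decay (t - a)) \<partial>lborel)"
    by (subst nn_integral_distr) auto
  finally have "(\<integral>\<^sup>+t. ennreal (decay (t - a)) \<partial>lborel) = (\<integral>\<^sup>+(t::real^'d). ennreal (decay t) \<partial>lborel)" ..
  then show ?thesis
    using nn_integral_eq_integral[OF integrable_decay[where 'd='d]]
    by (simp add: decay_mass_def)
qed

section \<open>Finite systems of linear equations\<close>

text \<open>The definition sums over a set of distinct points, whereas two indices may share a
  point. The coefficients belonging to one point are therefore added up first.\<close>

lemma stationary_covariance_indexed:
  assumes "stationary_covariance k" "finite I"
  shows "0 \<le> (\<Sum>i\<in>I. \<Sum>j\<in>I. a i * a j * k (p i - p j))"
proof -
  define \<alpha> where "\<alpha> s = (\<Sum>i\<in>{i\<in>I. p i = s}. a i)" for s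
  have "0 \<le> (\<Sum>s\<in>p ` I. \<Sum>t\<in>p ` I. \<alpha> s * \<alpha> t * k (s - t))"
    using assms unfolding stationary_covariance_def by blast
  also have "\<dots> = (\<Sum>s\<in>p ` I. \<Sum>t\<in>p ` I. \<Sum>i\<in>{i\<in>I. p i = s}. \<Sum>j\<in>{j\<in>I. p j = t}.
      a i * a j * k (p i - p j))"
    unfolding \<alpha>_def sum_product by (simp add: sum_distrib_right)
  also have "\<dots> = (\<Sum>s\<in>p ` I. \<Sum>i\<in>{i\<in>I. p i = s}. \<Sum>t\<in>p ` I. \<Sum>j\<in>{j\<in>I. p j = t}.
      a i * a j * k (p i - p j))"
    by (intro sum.cong refl sum.swap)
  also have "\<dots> = (\<Sum>s\<in>p ` I. \<Sum>i\<in>{i\<in>I. p i = s}. \<Sum>j\<in>I. a i * a j * k (p i - p j))"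
    using assms(2) by (intro sum.cong refl sum.image_gen[symmetric])
  also have "\<dots> = (\<Sum>i\<in>I. \<Sum>j\<in>I. a i * a j * k (p i - p j))"
    using assms(2) by (intro sum.image_gen[symmetric])
  finally show ?thesis .
qed

lemma borel_measurable_det_mat:
  fixes F :: "'n \<Rightarrow> nat \<Rightarrow> nat \<Rightarrow> real"
  assumes [measurable]: "\<And>i j. i < m \<Longrightarrow> j < m \<Longrightarrow> (\<lambda>\<omega>. F \<omega> i j) \<in> borel_measurable N"
  shows "(\<lambda>\<omega>. Determinant.det (Matrix.mat m m (\<lambda>(i, j). F \<omega> i j))) \<in> borel_measurable N"
proof -
  have "Determinant.det (Matrix.mat m m (\<lambda>(i, j). F \<omega> i j)) =
      (\<Sum>p\<in>{p. p permutes {0..<m}}. signof p * (\<Prod>i = 0..<m. F \<omega> i (p i)))" for \<omega>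
    by (subst det_def'[of _ m]) (auto intro!: sum.cong prod.cong dest: permutes_in_image)
  moreover have "(\<lambda>\<omega>. \<Sum>p\<in>{p. p permutes {0..<m}}. signof p * (\<Prod>i = 0..<m. F \<omega> i (p i))) \<in> borel_measurable N"
    by (intro borel_measurable_sum borel_measurable_times borel_measurable_const borel_measurable_prod assms)
       (auto dest: permutes_in_image)
  ultimately show ?thesis by simp
qed

text \<open>Cramer's rule: the adjugate divided by the determinant is an explicit expression in the
  entries, so one measurable choice of the inverse serves all \<open>\<omega>\<close> at once.
  Injectivity keeps the determinant away from zero.\<close>

lemma measurable_matrix_inverse_nat:
  fixes F :: "'n \<Rightarrow> nat \<Rightarrow> nat \<Rightarrow> real"
  assumes meas: "\<And>i j. i < m \<Longrightarrow> j < m \<Longrightarrow> (\<lambda>\<omega>. F \<omega> i j) \<in> borel_measurable N"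
    and inj: "\<And>\<omega> z. \<omega> \<in> space N \<Longrightarrow> (\<And>i. i < m \<Longrightarrow> (\<Sum>j<m. F \<omega> i j * z j) = 0) \<Longrightarrow> (\<And>i. i < m \<Longrightarrow> z i = 0)"
  shows "\<exists>Q. (\<forall>i j. (\<lambda>\<omega>. Q \<omega> i j) \<in> borel_measurable N) \<and>
    (\<forall>\<omega>\<in>space N. \<forall>i<m. \<forall>l<m. (\<Sum>j<m. F \<omega> i j * Q \<omega> j l) = (if i = l then 1 else 0))"
proof -
  define W where "W \<omega> = Matrix.mat m m (\<lambda>(i, j). F \<omega> i j)" for \<omega>
  have W: "W \<omega> \<in> carrier_mat m m" for \<omega> by (simp add: W_def)
  define Q where "Q \<omega> i j = (if i < m \<and> j < m then cofactor (W \<omega>) j i / Determinant.det (W \<omega>) else 0)" for \<omega> i j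
  have det: "Determinant.det (W \<omega>) \<noteq> 0" if "\<omega> \<in> space N" for \<omega>
  proof
    assume "Determinant.det (W \<omega>) = 0"
    then obtain v where v: "v \<in> carrier_vec m" "v \<noteq> 0\<^sub>v m" "W \<omega> *\<^sub>v v = 0\<^sub>v m"
      using det_0_iff_vec_prod_zero_field[OF W] by auto
    have "(\<Sum>j<m. F \<omega> i j * vec_index v j) = 0" if "i < m" for i
    proof -
      have "vec_index (W \<omega> *\<^sub>v v) i = (\<Sum>j<m. F \<omega> i j * vec_index v j)"
        using that v(1) by (auto simp: W_def scalar_prod_def atLeast0LessThan intro!: sum.cong)
      then show ?thesis using v(3) that by simp
    qed
    then have "vec_index v i = 0" if "i < m" for i
      using inj[OF \<open>\<omega> \<in> space N\<close>, of "vec_index v" i] that by blast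
    then have "v = 0\<^sub>v m" using v(1) by (intro eq_vecI) auto
    with v(2) show False by simp
  qed
  have "(\<lambda>\<omega>. Q \<omega> i j) \<in> borel_measurable N" for i j
  proof (cases "i < m \<and> j < m")
    case True
    have "(\<lambda>\<omega>. Determinant.det (W \<omega>)) \<in> borel_measurable N"
      unfolding W_def by (intro borel_measurable_det_mat meas)
    moreover have "(\<lambda>\<omega>. Determinant.det (mat_delete (W \<omega>) j i)) \<in> borel_measurable N"
    proof -
      have "mat_delete (W \<omega>) j i = Matrix.mat (m - 1) (m - 1) (\<lambda>(a, b). F \<omega> (insert_index j a) (insert_index i b))" for \<omega>
        unfolding mat_delete_def W_def using True
        by (intro eq_matI) (auto simp: insert_index_def)
      then show ?thesis
        by (simp only:) (intro borel_measurable_det_mat meas, auto simp: insert_index_def)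
    qed
    ultimately show ?thesis using True unfolding Q_def cofactor_def by simp
  next
    case False
    then have "(\<lambda>\<omega>. Q \<omega> i j) = (\<lambda>\<omega>. 0)" by (auto simp: Q_def)
    then show ?thesis by simp
  qed
  moreover have "(\<Sum>j<m. F \<omega> i j * Q \<omega> j l) = (if i = l then 1 else 0)"
    if "\<omega> \<in> space N" "i < m" "l < m" for \<omega> i l
  proof -
    have "(\<Sum>j<m. F \<omega> i j * cofactor (W \<omega>) l j) = index_mat (W \<omega> * adj_mat (W \<omega>)) (i, l)"
      using that by (auto simp: W_def adj_mat_def scalar_prod_def atLeast0LessThan intro!: sum.cong)
    also have "\<dots> = Determinant.det (W \<omega>) * (if i = l then 1 else 0)"
      using that by (simp add: adj_mat(2)[OF W])
    finally show ?thesis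
      using det[OF that(1)] that by (simp add: Q_def sum_divide_distrib[symmetric])
  qed
  ultimately show ?thesis by blast
qed

text \<open>Transport along a bijection. Arbitrary finite index sets are wanted because the
  leave-one-out systems live on \<open>I - {i}\<close> and should not be renumbered.\<close>

lemma measurable_matrix_inverse:
  fixes F :: "'n \<Rightarrow> 'i \<Rightarrow> 'i \<Rightarrow> real"
  assumes fin: "finite I"
    and meas: "\<And>i j. i \<in> I \<Longrightarrow> j \<in> I \<Longrightarrow> (\<lambda>\<omega>. F \<omega> i j) \<in> borel_measurable N"
    and inj: "\<And>\<omega> z. \<omega> \<in> space N \<Longrightarrow> (\<And>i. i \<in> I \<Longrightarrow> (\<Sum>j\<in>I. F \<omega> i j * z j) = 0) \<Longrightarrow> (\<And>i. i \<in> I \<Longrightarrow> z i = 0)"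
  obtains Q where "\<And>i j. (\<lambda>\<omega>. Q \<omega> i j) \<in> borel_measurable N"
    "\<And>\<omega> i l. \<omega> \<in> space N \<Longrightarrow> i \<in> I \<Longrightarrow> l \<in> I \<Longrightarrow> (\<Sum>j\<in>I. F \<omega> i j * Q \<omega> j l) = (if i = l then 1 else 0)"
proof -
  define m where "m = card I"
  obtain f where f: "bij_betw f {..<m} I"
    using ex_bij_betw_nat_finite[OF fin] by (auto simp: m_def atLeast0LessThan)
  define g where "g = the_inv_into {..<m} f"
  have fI: "f i \<in> I" if "i < m" for i using f that by (auto simp: bij_betw_def)
  have g: "g i < m" "f (g i) = i" if "i \<in> I" for i
    using that f bij_betw_the_inv_into[OF f] f_the_inv_into_f_bij_betw[OF f]
    by (auto simp: g_def bij_betw_def)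
  have gf: "g (f i) = i" if "i < m" for i
    using that f by (simp add: g_def the_inv_into_f_f bij_betw_def)
  have sumI: "(\<Sum>j\<in>I. H j) = (\<Sum>j<m. H (f j))" for H :: "'i \<Rightarrow> real"
    by (rule sum.reindex_bij_betw[OF f, symmetric])
  have "\<exists>Q. (\<forall>i j. (\<lambda>\<omega>. Q \<omega> i j) \<in> borel_measurable N) \<and>
    (\<forall>\<omega>\<in>space N. \<forall>i<m. \<forall>l<m. (\<Sum>j<m. F \<omega> (f i) (f j) * Q \<omega> j l) = (if i = l then 1 else 0))"
  proof (rule measurable_matrix_inverse_nat)
    fix \<omega> z i assume *: "\<omega> \<in> space N" "\<And>i. i < m \<Longrightarrow> (\<Sum>j<m. F \<omega> (f i) (f j) * z j) = 0" "i < m"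
    have "z (g (f i)) = 0"
    proof (rule inj[OF *(1), of "\<lambda>i. z (g i)"])
      fix l assume "l \<in> I"
      then show "(\<Sum>j\<in>I. F \<omega> l j * z (g j)) = 0"
        using *(2)[of "g l"] by (simp add: sumI g gf)
    qed (intro fI *(3))
    then show "z i = 0" using * gf by simp
  next
    fix i j assume "i < m" "j < m"
    then show "(\<lambda>\<omega>. F \<omega> (f i) (f j)) \<in> borel_measurable N" by (intro meas fI)
  qed
  then obtain Q where Q: "\<And>i j. (\<lambda>\<omega>. Q \<omega> i j) \<in> borel_measurable N"
    "\<And>\<omega> i l. \<omega> \<in> space N \<Longrightarrow> i < m \<Longrightarrow> l < m \<Longrightarrow> (\<Sum>j<m. F \<omega> (f i) (f j) * Q \<omega> j l) = (if i = l then 1 else 0)"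
    by blast
  show thesis
  proof (rule that[of "\<lambda>\<omega> i j. Q \<omega> (g i) (g j)"])
    fix \<omega> i l assume "\<omega> \<in> space N" "i \<in> I" "l \<in> I"
    have "(\<Sum>j\<in>I. F \<omega> i j * Q \<omega> (g j) (g l)) = (\<Sum>j<m. F \<omega> (f (g i)) (f j) * Q \<omega> j (g l))"
      unfolding sumI using \<open>i \<in> I\<close> by (intro sum.cong) (simp_all add: gf g)
    also have "\<dots> = (if g i = g l then 1 else 0)"
      using \<open>\<omega> \<in> space N\<close> \<open>i \<in> I\<close> \<open>l \<in> I\<close> by (intro Q(2) g)
    also have "(g i = g l) = (i = l)" using g(2) \<open>i \<in> I\<close> \<open>l \<in> I\<close> by metis
    finally show "(\<Sum>j\<in>I. F \<omega> i j * Q \<omega> (g j) (g l)) = (if i = l then 1 else 0)" .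
  qed (rule Q(1))
qed

section \<open>Kriging weights for a fixed design\<close>

lemma sum_mult_le_half_squares:
  fixes f g :: "'i \<Rightarrow> real"
  shows "(\<Sum>i\<in>I. f i * g i) \<le> (\<Sum>i\<in>I. (f i)\<^sup>2) / 2 + (\<Sum>i\<in>I. (g i)\<^sup>2) / 2"
proof -
  have "f i * g i \<le> (f i)\<^sup>2 / 2 + (g i)\<^sup>2 / 2" for i
    using sum_squares_bound[of "f i" "g i"] by simp
  then have "(\<Sum>i\<in>I. f i * g i) \<le> (\<Sum>i\<in>I. (f i)\<^sup>2 / 2 + (g i)\<^sup>2 / 2)" by (rule sum_mono)
  then show ?thesis by (simp add: sum.distrib sum_divide_distrib)
qed

lemma weighted_square_sum_le:
  fixes w b :: "'i \<Rightarrow> real"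
  assumes "\<And>i. i \<in> I \<Longrightarrow> 0 \<le> w i"
  shows "(\<Sum>i\<in>I. w i * b i)\<^sup>2 \<le> (\<Sum>i\<in>I. w i) * (\<Sum>i\<in>I. w i * (b i)\<^sup>2)"
proof -
  have "(\<Sum>i\<in>I. sqrt (w i) * (sqrt (w i) * b i))\<^sup>2
      \<le> (\<Sum>i\<in>I. (sqrt (w i))\<^sup>2) * (\<Sum>i\<in>I. (sqrt (w i) * b i)\<^sup>2)"
    by (rule Cauchy_Schwarz_ineq_sum)
  also have "(\<Sum>i\<in>I. sqrt (w i) * (sqrt (w i) * b i)) = (\<Sum>i\<in>I. w i * b i)"
    using assms by (intro sum.cong) (auto simp: mult.assoc[symmetric])
  also have "(\<Sum>i\<in>I. (sqrt (w i))\<^sup>2) = (\<Sum>i\<in>I. w i)"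
    using assms by (intro sum.cong) auto
  also have "(\<Sum>i\<in>I. (sqrt (w i) * b i)\<^sup>2) = (\<Sum>i\<in>I. w i * (b i)\<^sup>2)"
    using assms by (intro sum.cong) (auto simp: power_mult_distrib)
  finally show ?thesis .
qed

text \<open>The constants \<open>A\<close> and \<open>C\<close> will be shared by all parameters and
  only \<open>k\<close> and \<open>\<delta>\<close> vary, so bounds in terms of \<open>A\<close> and
  \<open>C\<close> are uniform over the parameter set.\<close>

locale krig =
  fixes k :: "real^'d::finite \<Rightarrow> real" and A C \<delta> :: real
  assumes cov: "stationary_covariance k"
    and k_measurable [measurable]: "k \<in> borel_measurable borel"
    and k_bound: "\<bar>k t\<bar> \<le> A * decay t"
    and A_pos: "0 < A" and C_pos: "0 < C" and C_le: "C \<le> \<delta>"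
begin

lemma k_minus: "k (- t) = k t"
  using cov by (simp add: stationary_covariance_def)

lemma k_commute: "k (s - t) = k (t - s)"
  using k_minus[of "s - t"] by simp

lemma k_abs_le: "\<bar>k t\<bar> \<le> A"
  using k_bound[of t] mult_left_mono[OF decay_le_1[of t], of A] A_pos by linarith

lemma psd: "finite I \<Longrightarrow> 0 \<le> (\<Sum>i\<in>I. \<Sum>j\<in>I. a i * a j * k (p i - p j))"
  by (rule stationary_covariance_indexed[OF cov])

lemma \<delta>_pos: "0 < \<delta>" using C_pos C_le by simp

section \<open>Linear systems with the regularized covariance matrix\<close>

definition R :: "('i \<Rightarrow> real^'d) \<Rightarrow> 'i \<Rightarrow> 'i \<Rightarrow> real" where
  "R x i j = k (x i - x j) + (if i = j then \<delta> else 0)"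

text \<open>A predicate on functions instead of a matrix equation: the index set can lose or gain a
  point while the names of all other indices stay the same.\<close>

definition solves :: "'i set \<Rightarrow> ('i \<Rightarrow> real^'d) \<Rightarrow> ('i \<Rightarrow> real) \<Rightarrow> ('i \<Rightarrow> real) \<Rightarrow> bool" where
  "solves I x b z \<longleftrightarrow> (\<forall>i\<in>I. (\<Sum>j\<in>I. R x i j * z j) = b i)"

lemma R_sym: "R x i j = R x j i"
  by (simp add: R_def k_commute)

lemma R_quad:
  assumes "finite I"
  shows "(\<Sum>i\<in>I. \<Sum>j\<in>I. z i * z j * R x i j) =
    (\<Sum>i\<in>I. \<Sum>j\<in>I. z i * z j * k (x i - x j)) + \<delta> * (\<Sum>i\<in>I. (z i)\<^sup>2)"
proof -
  have "(\<Sum>i\<in>I. \<Sum>j\<in>I. z i * z j * R x i j) =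
    (\<Sum>i\<in>I. \<Sum>j\<in>I. z i * z j * k (x i - x j)) + (\<Sum>i\<in>I. \<Sum>j\<in>I. if j = i then z i * z j * \<delta> else 0)"
    unfolding R_def sum.distrib[symmetric] by (intro sum.cong) (auto simp: algebra_simps)
  also have "(\<Sum>i\<in>I. \<Sum>j\<in>I. if j = i then z i * z j * \<delta> else 0) = (\<Sum>i\<in>I. z i * z i * \<delta>)"
    using assms by (intro sum.cong) auto
  finally show ?thesis by (simp add: sum_distrib_left power2_eq_square mult.commute)
qed

lemma solves_energy:
  assumes "finite I" "solves I x b z"
  shows "(\<Sum>i\<in>I. \<Sum>j\<in>I. z i * z j * k (x i - x j)) + \<delta> * (\<Sum>i\<in>I. (z i)\<^sup>2) = (\<Sum>i\<in>I. z i * b i)"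
proof -
  have "(\<Sum>i\<in>I. \<Sum>j\<in>I. z i * z j * R x i j) = (\<Sum>i\<in>I. z i * (\<Sum>j\<in>I. R x i j * z j))"
    by (simp add: sum_distrib_left algebra_simps)
  also have "\<dots> = (\<Sum>i\<in>I. z i * b i)" using assms(2) by (auto simp: solves_def intro!: sum.cong)
  finally show ?thesis using R_quad[OF assms(1), of z x] by simp
qed

lemma solves_energy_ge:
  assumes "finite I" "solves I x b z"
  shows "C * (\<Sum>i\<in>I. (z i)\<^sup>2) \<le> (\<Sum>i\<in>I. z i * b i)"
proof -
  have "C * (\<Sum>i\<in>I. (z i)\<^sup>2) \<le> \<delta> * (\<Sum>i\<in>I. (z i)\<^sup>2)"
    by (intro mult_right_mono C_le sum_nonneg) auto
  then show ?thesis using solves_energy[OF assms] psd[OF assms(1), of z x] by linarith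
qed

text \<open>Expand the square of \<open>b - C * z\<close> and insert
  \<open>solves_energy_ge\<close>. In other words, the inverse of \<open>R\<close> has operator norm
  at most 1 / \<open>C\<close>, however the points are placed.\<close>

lemma solves_norm_le:
  assumes "finite I" "solves I x b z"
  shows "(\<Sum>i\<in>I. (z i)\<^sup>2) \<le> (\<Sum>i\<in>I. (b i)\<^sup>2) / C\<^sup>2"
proof -
  have "(\<Sum>i\<in>I. (b i - C * z i)\<^sup>2) =
      (\<Sum>i\<in>I. (b i)\<^sup>2 - 2 * C * (z i * b i) + C\<^sup>2 * (z i)\<^sup>2)"
    by (intro sum.cong) (auto simp: power2_eq_square algebra_simps)
  also have "\<dots> = (\<Sum>i\<in>I. (b i)\<^sup>2) - 2 * C * (\<Sum>i\<in>I. z i * b i) + C\<^sup>2 * (\<Sum>i\<in>I. (z i)\<^sup>2)"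
    by (simp add: sum.distrib sum_subtractf sum_distrib_left)
  finally have "0 \<le> (\<Sum>i\<in>I. (b i)\<^sup>2) - 2 * C * (\<Sum>i\<in>I. z i * b i) + C\<^sup>2 * (\<Sum>i\<in>I. (z i)\<^sup>2)"
    using sum_nonneg[of I "\<lambda>i. (b i - C * z i)\<^sup>2"] by simp
  moreover have "C * (C * (\<Sum>i\<in>I. (z i)\<^sup>2)) \<le> C * (\<Sum>i\<in>I. z i * b i)"
    using C_pos by (intro mult_left_mono solves_energy_ge[OF assms]) auto
  ultimately have "C\<^sup>2 * (\<Sum>i\<in>I. (z i)\<^sup>2) \<le> (\<Sum>i\<in>I. (b i)\<^sup>2)"
    by (simp add: power2_eq_square)
  then show ?thesis using C_pos by (simp add: field_simps)
qed

lemma solves_energy_le: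
  assumes "finite I" "solves I x b z"
  shows "(\<Sum>i\<in>I. z i * b i) \<le> (\<Sum>i\<in>I. (b i)\<^sup>2) / C"
proof -
  let ?z = "\<Sum>i\<in>I. (z i)\<^sup>2" and ?b = "\<Sum>i\<in>I. (b i)\<^sup>2"
  have "(\<Sum>i\<in>I. z i * b i)\<^sup>2 \<le> ?z * ?b" by (rule Cauchy_Schwarz_ineq_sum)
  also have "\<dots> \<le> ?b / C\<^sup>2 * ?b"
    by (intro mult_right_mono solves_norm_le[OF assms] sum_nonneg) auto
  also have "\<dots> = (?b / C)\<^sup>2" by (simp add: power2_eq_square)
  finally show ?thesis
    by (rule power2_le_imp_le) (use C_pos in \<open>auto intro!: divide_nonneg_pos sum_nonneg\<close>)
qed

lemma solves_diff:
  "solves I x b z \<Longrightarrow> solves I x b' z' \<Longrightarrow> solves I x (\<lambda>i. b i - b' i) (\<lambda>i. z i - z' i)"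
  by (simp add: solves_def right_diff_distrib sum_subtractf)

lemma solves_scale_diff:
  "solves I x b z \<Longrightarrow> solves I x b' z' \<Longrightarrow> solves I x (\<lambda>i. b i - c * b' i) (\<lambda>i. z i - c * z' i)"
proof -
  assume *: "solves I x b z" "solves I x b' z'"
  have "(\<Sum>j\<in>I. R x i j * (z j - c * z' j)) = (\<Sum>j\<in>I. R x i j * z j) - c * (\<Sum>j\<in>I. R x i j * z' j)" for i
    by (simp add: right_diff_distrib sum_subtractf sum_distrib_left mult.left_commute)
  with * show ?thesis by (simp add: solves_def)
qed

lemma solves_unique:
  assumes "finite I" "solves I x b z" "solves I x b z'" "i \<in> I"
  shows "z i = z' i"
proof -
  have "solves I x (\<lambda>_. 0) (\<lambda>i. z i - z' i)" using solves_diff[OF assms(2,3)] by simp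
  from solves_norm_le[OF assms(1) this] have "(\<Sum>i\<in>I. (z i - z' i)\<^sup>2) \<le> 0" by simp
  then have "(\<Sum>i\<in>I. (z i - z' i)\<^sup>2) = 0" by (intro antisym sum_nonneg) auto
  then show ?thesis using assms(1,4) by (simp add: sum_nonneg_eq_0_iff)
qed

lemma solves_sym:
  assumes "solves I x b z" "solves I x b' z'"
  shows "(\<Sum>i\<in>I. z i * b' i) = (\<Sum>i\<in>I. b i * z' i)"
proof -
  have "(\<Sum>i\<in>I. z i * b' i) = (\<Sum>i\<in>I. \<Sum>j\<in>I. z i * R x i j * z' j)"
    using assms(2) by (intro sum.cong) (auto simp: solves_def sum_distrib_left[symmetric] mult.assoc)
  also have "\<dots> = (\<Sum>j\<in>I. \<Sum>i\<in>I. z i * R x i j * z' j)" by (rule sum.swap)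
  also have "\<dots> = (\<Sum>j\<in>I. b j * z' j)"
  proof (intro sum.cong refl)
    fix j assume "j \<in> I"
    have "(\<Sum>i\<in>I. z i * R x i j * z' j) = (\<Sum>i\<in>I. R x j i * z i) * z' j"
      unfolding sum_distrib_right by (intro sum.cong refl) (simp add: R_sym[of x _ j])
    then show "(\<Sum>i\<in>I. z i * R x i j * z' j) = b j * z' j"
      using assms(1) \<open>j \<in> I\<close> by (simp add: solves_def)
  qed
  finally show ?thesis .
qed

lemma measurable_inverse:
  fixes x :: "'n \<Rightarrow> 'i \<Rightarrow> real^'d"
  assumes "finite I" and [measurable]: "\<And>i. i \<in> I \<Longrightarrow> (\<lambda>\<omega>. x \<omega> i) \<in> borel_measurable N"
  obtains Q where "\<And>i j. (\<lambda>\<omega>. Q \<omega> i j) \<in> borel_measurable N"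
    "\<And>\<omega> l. \<omega> \<in> space N \<Longrightarrow> l \<in> I \<Longrightarrow> solves I (x \<omega>) (\<lambda>i. if i = l then 1 else 0) (\<lambda>j. Q \<omega> j l)"
proof (rule measurable_matrix_inverse[of I "\<lambda>\<omega>. R (x \<omega>)" N])
  fix \<omega> z i assume "\<And>i. i \<in> I \<Longrightarrow> (\<Sum>j\<in>I. R (x \<omega>) i j * z j) = 0" "i \<in> I"
  then have "solves I (x \<omega>) (\<lambda>_. 0) z" "solves I (x \<omega>) (\<lambda>_. 0) (\<lambda>_. 0)" "i \<in> I"
    by (auto simp: solves_def)
  then show "z i = 0" using solves_unique[OF assms(1)] by blast
next
  fix i j assume [simp]: "i \<in> I" "j \<in> I"
  show "(\<lambda>\<omega>. R (x \<omega>) i j) \<in> borel_measurable N" unfolding R_def by measurable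
next
  fix Q
  assume "\<And>i j. (\<lambda>\<omega>. Q \<omega> i j) \<in> borel_measurable N"
    "\<And>\<omega> i l. \<omega> \<in> space N \<Longrightarrow> i \<in> I \<Longrightarrow> l \<in> I \<Longrightarrow> (\<Sum>j\<in>I. R (x \<omega>) i j * Q \<omega> j l) = (if i = l then 1 else 0)"
  then show thesis by (intro that[of Q]) (auto simp: solves_def)
qed (rule assms)

text \<open>Outside \<open>I\<close> the chosen vector is arbitrary, so it is only ever evaluated at
  indices in \<open>I\<close>; there it is unique.\<close>

definition solution :: "'i set \<Rightarrow> ('i \<Rightarrow> real^'d) \<Rightarrow> ('i \<Rightarrow> real) \<Rightarrow> 'i \<Rightarrow> real" where
  "solution I x b = (SOME z. solves I x b z)"

lemma solves_lincomb:
  assumes "finite I" "\<And>l. l \<in> I \<Longrightarrow> solves I x (\<lambda>i. if i = l then 1 else 0) (\<lambda>j. Q j l)"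
  shows "solves I x b (\<lambda>j. \<Sum>l\<in>I. Q j l * b l)"
  unfolding solves_def
proof
  fix i assume i: "i \<in> I"
  have "(\<Sum>j\<in>I. R x i j * (\<Sum>l\<in>I. Q j l * b l)) = (\<Sum>j\<in>I. \<Sum>l\<in>I. R x i j * Q j l * b l)"
    by (simp add: sum_distrib_left mult.assoc)
  also have "\<dots> = (\<Sum>l\<in>I. \<Sum>j\<in>I. R x i j * Q j l * b l)" by (rule sum.swap)
  also have "\<dots> = (\<Sum>l\<in>I. (if i = l then 1 else 0) * b l)"
    using assms(2) i by (intro sum.cong) (auto simp: solves_def sum_distrib_right[symmetric])
  also have "\<dots> = (\<Sum>l\<in>I. if i = l then b l else 0)" by (intro sum.cong) auto
  also have "\<dots> = b i" using assms(1) i by simp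
  finally show "(\<Sum>j\<in>I. R x i j * (\<Sum>l\<in>I. Q j l * b l)) = b i" .
qed

lemma solves_solution:
  assumes "finite I" shows "solves I x b (solution I x b)"
proof -
  \<comment> \<open>Existence for a single design is the measurable statement over a one-point
    space.\<close>
  obtain Q where "\<And>l. l \<in> I \<Longrightarrow> solves I x (\<lambda>i. if i = l then 1 else 0) (\<lambda>j. Q () j l)"
    by (rule measurable_inverse[of I "\<lambda>_. x" "count_space {()}"]) (use assms in auto)
  from solves_lincomb[OF assms this] show ?thesis
    unfolding solution_def by (rule someI[of "solves I x b"])
qed

lemma solution_eqI:
  "finite I \<Longrightarrow> solves I x b z \<Longrightarrow> i \<in> I \<Longrightarrow> solution I x b i = z i"
  by (rule solves_unique[OF _ solves_solution])

lemma solution_cong: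
  assumes "finite I" "\<And>i. i \<in> I \<Longrightarrow> x i = x' i" "\<And>i. i \<in> I \<Longrightarrow> b i = b' i" "i \<in> I"
  shows "solution I x b i = solution I x' b' i"
proof (rule solution_eqI[OF assms(1) _ assms(4)])
  have "solves I x' b' (solution I x' b')" using assms(1) by (rule solves_solution)
  then show "solves I x b (solution I x' b')"
    using assms(2,3) by (simp add: solves_def R_def)
qed

lemma borel_measurable_solution:
  assumes "finite I" "\<And>i. i \<in> I \<Longrightarrow> (\<lambda>\<omega>. x \<omega> i) \<in> borel_measurable N"
    "\<And>i. i \<in> I \<Longrightarrow> (\<lambda>\<omega>. b \<omega> i) \<in> borel_measurable N" "j \<in> I"
  shows "(\<lambda>\<omega>. solution I (x \<omega>) (b \<omega>) j) \<in> borel_measurable N"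
proof -
  obtain Q where Q: "\<And>i j. (\<lambda>\<omega>. Q \<omega> i j) \<in> borel_measurable N"
    "\<And>\<omega> l. \<omega> \<in> space N \<Longrightarrow> l \<in> I \<Longrightarrow> solves I (x \<omega>) (\<lambda>i. if i = l then 1 else 0) (\<lambda>j. Q \<omega> j l)"
    using measurable_inverse[of I x N] assms(1,2) by metis
  have "solution I (x \<omega>) (b \<omega>) j = (\<Sum>l\<in>I. Q \<omega> j l * b \<omega> l)" if "\<omega> \<in> space N" for \<omega>
    by (intro solution_eqI solves_lincomb assms Q that)
  moreover have "(\<lambda>\<omega>. \<Sum>l\<in>I. Q \<omega> j l * b \<omega> l) \<in> borel_measurable N"
    by (intro borel_measurable_sum borel_measurable_times Q assms)
  ultimately show ?thesis by (simp cong: measurable_cong)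
qed

section \<open>Kriging weights and columns of the inverse matrix\<close>

definition weight :: "'i set \<Rightarrow> ('i \<Rightarrow> real^'d) \<Rightarrow> real^'d \<Rightarrow> 'i \<Rightarrow> real" where
  "weight I x t = solution I x (\<lambda>j. k (t - x j))"

definition invcol :: "'i set \<Rightarrow> ('i \<Rightarrow> real^'d) \<Rightarrow> 'i \<Rightarrow> 'i \<Rightarrow> real" where
  "invcol I x l = solution I x (\<lambda>i. if i = l then 1 else 0)"

lemma solves_weight: "finite I \<Longrightarrow> solves I x (\<lambda>j. k (t - x j)) (weight I x t)"
  unfolding weight_def by (rule solves_solution)

lemma solves_invcol: "finite I \<Longrightarrow> solves I x (\<lambda>i. if i = l then 1 else 0) (invcol I x l)"
  unfolding invcol_def by (rule solves_solution)

text \<open>Positive semidefiniteness at the points \<open>t\<close> and \<open>x j\<close> with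
  coefficients 1 and minus the weights says that the posterior variance is nonnegative. The energy
  identity then eliminates the quadratic form of the weights and leaves the multiple of their
  squared norm that is due to the noise. The index \<open>None\<close> stands for
  \<open>t\<close>.\<close>

lemma weight_bound:
  fixes I :: "'i set"
  assumes I: "finite I"
  shows "(\<Sum>j\<in>I. weight I x t j * k (t - x j)) + C * (\<Sum>j\<in>I. (weight I x t j)\<^sup>2) \<le> k 0"
    and "0 \<le> (\<Sum>j\<in>I. weight I x t j * k (t - x j))"
proof -
  let ?w = "weight I x t"
  let ?p = "\<lambda>i. case i of None \<Rightarrow> t | Some i \<Rightarrow> x i"
  let ?a = "\<lambda>i. case i of None \<Rightarrow> 1 | Some i \<Rightarrow> - ?w i"
  let ?rw = "\<Sum>j\<in>I. ?w j * k (t - x j)" and ?q = "\<Sum>i\<in>I. \<Sum>j\<in>I. ?w i * ?w j * k (x i - x j)"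
  have split: "(\<Sum>i\<in>insert None (Some ` I). f i) = f None + (\<Sum>i\<in>I. f (Some i))" for f :: "'i option \<Rightarrow> real"
    using I by (simp add: sum.reindex)
  have "0 \<le> (\<Sum>i\<in>insert None (Some ` I). \<Sum>j\<in>insert None (Some ` I). ?a i * ?a j * k (?p i - ?p j))"
    by (rule psd) (use I in auto)
  also have "\<dots> = k 0 - 2 * ?rw + ?q"
    unfolding split by (simp add: sum.distrib sum_subtractf sum_negf k_commute[of _ t] algebra_simps)
  finally have "0 \<le> k 0 - 2 * ?rw + ?q" .
  moreover have "?q + \<delta> * (\<Sum>i\<in>I. (?w i)\<^sup>2) = ?rw"
    by (rule solves_energy[OF I solves_weight[OF I]])
  moreover have "C * (\<Sum>i\<in>I. (?w i)\<^sup>2) \<le> \<delta> * (\<Sum>i\<in>I. (?w i)\<^sup>2)"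
    by (intro mult_right_mono C_le sum_nonneg) auto
  moreover have "0 \<le> C * (\<Sum>i\<in>I. (?w i)\<^sup>2)" using C_pos by (auto intro!: mult_nonneg_nonneg sum_nonneg)
  moreover have "0 \<le> ?q" by (rule psd[OF I])
  ultimately show "?rw + C * (\<Sum>i\<in>I. (?w i)\<^sup>2) \<le> k 0" "0 \<le> ?rw" by linarith+
qed

lemma weight_bound_le:
  assumes "finite I" shows "(\<Sum>j\<in>I. weight I x t j * k (t - x j)) \<le> k 0"
proof -
  have "0 \<le> C * (\<Sum>j\<in>I. (weight I x t j)\<^sup>2)"
    using C_pos by (auto intro!: mult_nonneg_nonneg sum_nonneg)
  then show ?thesis using weight_bound(1)[OF assms, of x t] by linarith
qed

lemma weight_norm_le:
  assumes "finite I" shows "(\<Sum>j\<in>I. (weight I x t j)\<^sup>2) \<le> A / C"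
proof -
  have "C * (\<Sum>j\<in>I. (weight I x t j)\<^sup>2) \<le> A"
    using weight_bound[OF assms, where x=x and t=t] k_abs_le[of 0] by linarith
  then show ?thesis using C_pos by (simp add: field_simps)
qed

lemma invcol_norm_le:
  assumes "finite I" "l \<in> I" shows "(\<Sum>j\<in>I. (invcol I x l j)\<^sup>2) \<le> 1 / C\<^sup>2"
proof -
  have "(\<Sum>i\<in>I. (if i = l then 1 else 0)\<^sup>2) = (\<Sum>i\<in>I. if i = l then 1 else 0::real)"
    by (intro sum.cong) auto
  also have "\<dots> = 1" using assms by simp
  finally show ?thesis using solves_norm_le[OF assms(1) solves_invcol[OF assms(1)], of x l] by simp
qed

lemma invcol_sym:
  assumes I: "finite I" "i \<in> I" "j \<in> I" shows "invcol I x i j = invcol I x j i"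
proof -
  let ?e = "\<lambda>l i. if i = l then 1 else 0 :: real"
  have "(\<Sum>l\<in>I. invcol I x i l * ?e j l) = (\<Sum>l\<in>I. ?e i l * invcol I x j l)"
    by (intro solves_sym[of I x] solves_invcol I)
  moreover have "(\<Sum>l\<in>I. invcol I x i l * ?e j l) = (\<Sum>l\<in>I. if l = j then invcol I x i l else 0)"
    by (intro sum.cong) auto
  moreover have "(\<Sum>l\<in>I. ?e i l * invcol I x j l) = (\<Sum>l\<in>I. if l = i then invcol I x j l else 0)"
    by (intro sum.cong) auto
  ultimately show ?thesis using I by simp
qed

lemma solution_invcol:
  assumes I: "finite I" "i \<in> I"
  shows "solution I x b i = (\<Sum>j\<in>I. invcol I x i j * b j)"
proof -
  let ?e = "\<lambda>l i. if i = l then 1 else 0 :: real"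
  have "(\<Sum>j\<in>I. solution I x b j * ?e i j) = (\<Sum>j\<in>I. b j * invcol I x i j)"
    by (intro solves_sym[of I x] solves_invcol solves_solution I)
  moreover have "(\<Sum>j\<in>I. solution I x b j * ?e i j) = (\<Sum>j\<in>I. if j = i then solution I x b j else 0)"
    by (intro sum.cong) auto
  ultimately show ?thesis using I by (simp add: mult.commute)
qed

lemma invcol_row_norm_le:
  assumes "finite I" "j \<in> I" shows "(\<Sum>i\<in>I. (invcol I x i j)\<^sup>2) \<le> 1 / C\<^sup>2"
proof -
  have "(\<Sum>i\<in>I. (invcol I x i j)\<^sup>2) = (\<Sum>i\<in>I. (invcol I x j i)\<^sup>2)"
    using assms by (intro sum.cong) (auto simp: invcol_sym)
  then show ?thesis using invcol_norm_le[OF assms, of x] by simp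
qed

lemma sum_weight_eq_sum_solution:
  assumes "finite I"
  shows "(\<Sum>j\<in>I. weight I x t j * b j) = (\<Sum>j\<in>I. k (t - x j) * solution I x b j)"
  by (rule solves_sym[OF solves_weight solves_solution]) (rule assms)+

text \<open>The leave-one-out residual at \<open>x i\<close> is obtained from the complete system: the vector with
  entry 1 at \<open>i\<close> and minus the leave-one-out weights elsewhere is mapped by \<open>R\<close> to a multiple of
  the \<open>i\<close>-th unit vector.\<close>

definition loo_scale :: "'i set \<Rightarrow> ('i \<Rightarrow> real^'d) \<Rightarrow> 'i \<Rightarrow> real" where
  "loo_scale I x i = k 0 + \<delta> - (\<Sum>j\<in>I - {i}. weight (I - {i}) x (x i) j * k (x i - x j))"

lemma loo_scale_ge: "finite I \<Longrightarrow> C \<le> loo_scale I x i"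
  using weight_bound_le[of "I - {i}" x "x i"] C_le by (simp add: loo_scale_def)

lemma loo_scale_le: "finite I \<Longrightarrow> loo_scale I x i \<le> A + \<delta>"
  using weight_bound(2)[of "I - {i}" x "x i"] k_abs_le[of 0] by (simp add: loo_scale_def)

lemma solves_loo:
  assumes I: "finite I" "i \<in> I"
  shows "solves I x (\<lambda>j. if j = i then loo_scale I x i else 0)
    (\<lambda>j. if j = i then 1 else - weight (I - {i}) x (x i) j)"
  unfolding solves_def
proof
  let ?J = "I - {i}" and ?w = "weight (I - {i}) x (x i)"
  fix l assume l: "l \<in> I"
  have "(\<Sum>j\<in>I. R x l j * (if j = i then 1 else - ?w j)) = R x l i - (\<Sum>j\<in>?J. R x l j * ?w j)"
    using I by (subst sum.remove[of I i]) (auto simp: sum_negf[symmetric] intro!: sum.cong)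
  also have "\<dots> = (if l = i then loo_scale I x i else 0)"
  proof (cases "l = i")
    case True
    have "(\<Sum>j\<in>?J. R x i j * ?w j) = (\<Sum>j\<in>?J. ?w j * k (x i - x j))"
      by (intro sum.cong) (auto simp: R_def)
    then show ?thesis using True by (simp add: loo_scale_def R_def)
  next
    case False
    then have "(\<Sum>j\<in>?J. R x l j * ?w j) = k (x i - x l)"
      using solves_weight[of ?J x "x i"] I l by (simp add: solves_def)
    then show ?thesis using False by (simp add: R_def k_commute)
  qed
  finally show "(\<Sum>j\<in>I. R x l j * (if j = i then 1 else - ?w j)) = (if l = i then loo_scale I x i else 0)" .
qed

lemma loo_scale_pos: "finite I \<Longrightarrow> 0 < loo_scale I x i"
  using loo_scale_ge[of I x i] C_pos by simp

lemma loo_vector_eq: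
  assumes I: "finite I" "i \<in> I" "j \<in> I"
  shows "(if j = i then 1 else - weight (I - {i}) x (x i) j) = loo_scale I x i * invcol I x i j"
proof (rule solves_unique[OF I(1) solves_loo[OF I(1,2)] _ I(3)])
  have "solves I x (\<lambda>j. 0 - (- loo_scale I x i) * (if j = i then 1 else 0)) (\<lambda>j. 0 - (- loo_scale I x i) * invcol I x i j)"
    by (intro solves_scale_diff solves_invcol I) (simp add: solves_def)
  then show "solves I x (\<lambda>j. if j = i then loo_scale I x i else 0) (\<lambda>j. loo_scale I x i * invcol I x i j)"
    by (simp add: solves_def)
qed

lemma loo_scale_invcol:
  assumes I: "finite I" "i \<in> I" shows "loo_scale I x i = 1 / invcol I x i i" "invcol I x i i \<noteq> 0"
proof -
  have "loo_scale I x i * invcol I x i i = 1" using loo_vector_eq[OF I I(2), of x] by simp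
  then show "invcol I x i i \<noteq> 0" "loo_scale I x i = 1 / invcol I x i i"
    by (auto simp: eq_divide_eq)
qed

text \<open>Virtual cross validation: a single solve with the full matrix gives all leave-one-out
  residuals, each divided by a diagonal entry of the inverse. The criterion thereby becomes a
  diagonal quadratic form in the solution, with coefficients between fixed positive bounds.\<close>

lemma loo_residual:
  assumes I: "finite I" "i \<in> I"
  shows "y i - (\<Sum>j\<in>I - {i}. weight (I - {i}) x (x i) j * y j) = loo_scale I x i * solution I x y i"
proof -
  have "y i - (\<Sum>j\<in>I - {i}. weight (I - {i}) x (x i) j * y j) =
      (\<Sum>j\<in>I. (if j = i then 1 else - weight (I - {i}) x (x i) j) * y j)"
    using I by (subst sum.remove[of I i]) (auto simp: sum_negf[symmetric] intro!: sum.cong)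
  also have "\<dots> = (\<Sum>j\<in>I. loo_scale I x i * invcol I x i j * y j)"
    by (intro sum.cong refl) (simp add: loo_vector_eq[OF I])
  finally show ?thesis by (simp add: solution_invcol[OF I] sum_distrib_left mult.assoc)
qed

text \<open>The coefficient of the innovation at \<open>x a\<close> when the observation \<open>a\<close> is added to \<open>I\<close> for the
  prediction at \<open>t\<close>; the denominator is the variance of that innovation.\<close>

definition gain :: "'i set \<Rightarrow> ('i \<Rightarrow> real^'d) \<Rightarrow> 'i \<Rightarrow> real^'d \<Rightarrow> real" where
  "gain I x a t = (k (t - x a) - (\<Sum>j\<in>I. weight I x t j * k (x a - x j))) /
     (k 0 + \<delta> - (\<Sum>j\<in>I. weight I x (x a) j * k (x a - x j)))"

text \<open>Block elimination. The vector with entry 1 at \<open>a\<close> and minus the weights for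
  \<open>x a\<close> on \<open>I\<close> is mapped by \<open>R\<close> to zero on \<open>I\<close>
  and to the innovation variance at \<open>a\<close>. Adding the multiple \<open>gain\<close> of it
  to the old weights therefore repairs equation \<open>a\<close> and disturbs no other.\<close>

lemma weight_insert:
  assumes I: "finite I" "a \<notin> I"
  shows "weight (insert a I) x t a = gain I x a t"
    and "j \<in> I \<Longrightarrow> weight (insert a I) x t j = weight I x t j - gain I x a t * weight I x (x a) j"
proof -
  let ?c = "gain I x a t" and ?w = "weight I x t" and ?v = "weight I x (x a)"
  let ?z = "\<lambda>j. if j = a then ?c else ?w j - ?c * ?v j"
  have s0: "k 0 + \<delta> - (\<Sum>j\<in>I. ?v j * k (x a - x j)) > 0"
    using weight_bound_le[OF I(1), of x "x a"] \<delta>_pos by linarith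
  have c: "?c * (k 0 + \<delta> - (\<Sum>j\<in>I. ?v j * k (x a - x j))) = k (t - x a) - (\<Sum>j\<in>I. ?w j * k (x a - x j))"
    using s0 by (simp add: gain_def)
  have "solves (insert a I) x (\<lambda>j. k (t - x j)) ?z"
    unfolding solves_def
  proof
    fix l assume l: "l \<in> insert a I"
    have "(\<Sum>j\<in>insert a I. R x l j * ?z j) = R x l a * ?c + (\<Sum>j\<in>I. R x l j * (?w j - ?c * ?v j))"
      using I by (auto intro!: sum.cong)
    also have "(\<Sum>j\<in>I. R x l j * (?w j - ?c * ?v j)) = (\<Sum>j\<in>I. R x l j * ?w j) - ?c * (\<Sum>j\<in>I. R x l j * ?v j)"
      by (simp add: right_diff_distrib sum_subtractf sum_distrib_left mult.left_commute)
    also have "R x l a * ?c + \<dots> = k (t - x l)"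
    proof (cases "l = a")
      case True
      have eq: "(\<Sum>j\<in>I. R x a j * u j) = (\<Sum>j\<in>I. u j * k (x a - x j))" for u
        using I by (intro sum.cong) (auto simp: R_def)
      have Raa: "R x a a = k 0 + \<delta>" by (simp add: R_def)
      show ?thesis unfolding True eq Raa using c by (simp add: algebra_simps)
    next
      case False
      then have "l \<in> I" using l by simp
      then have "(\<Sum>j\<in>I. R x l j * ?w j) = k (t - x l)" "(\<Sum>j\<in>I. R x l j * ?v j) = k (x a - x l)"
        using solves_weight[OF I(1), of x] by (auto simp: solves_def)
      then show ?thesis using False by (simp add: R_def k_commute)
    qed
    finally show "(\<Sum>j\<in>insert a I. R x l j * ?z j) = k (t - x l)" .
  qed
  then have *: "weight (insert a I) x t j = ?z j" if "j \<in> insert a I" for j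
    unfolding weight_def using that I by (intro solution_eqI) auto
  show "weight (insert a I) x t a = ?c" using * by simp
  show "weight (insert a I) x t j = ?w j - ?c * ?v j" if "j \<in> I"
    using *[of j] that I by auto
qed

text \<open>The numerator of \<open>gain\<close> is a posterior covariance, hence bounded by the prior variance.\<close>

lemma abs_gain_le:
  assumes I: "finite I" shows "\<bar>gain I x a t\<bar> \<le> 2 * A / C"
proof -
  let ?w = "weight I x t" and ?v = "weight I x (x a)"
  let ?g = "\<Sum>j\<in>I. ?w j * k (x a - x j)"
  have s0: "k 0 + \<delta> - (\<Sum>j\<in>I. ?v j * k (x a - x j)) \<ge> C"
    using weight_bound_le[OF I, of x "x a"] C_le by linarith
  \<comment> \<open>In the inner product given by \<open>R\<close> the sum \<open>?g\<close> is the
    product of the two weight vectors, both of squared length at most \<open>A\<close>.\<close>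
  define q where "q z z' = (\<Sum>i\<in>I. \<Sum>j\<in>I. z i * z' j * R x i j)" for z z'
  have qpos: "0 \<le> q z z" for z
    unfolding q_def using R_quad[OF I, of z x] psd[OF I, of z x] \<delta>_pos
    by (simp add: sum_nonneg)
  have qv: "q z ?v = (\<Sum>j\<in>I. z j * k (x a - x j))" for z
  proof -
    have "q z ?v = (\<Sum>i\<in>I. z i * (\<Sum>j\<in>I. R x i j * ?v j))"
      by (simp add: q_def sum_distrib_left mult_ac)
    then show ?thesis using solves_weight[OF I, of x "x a"] by (simp add: solves_def)
  qed
  have qw: "q z ?w = (\<Sum>j\<in>I. z j * k (t - x j))" for z
  proof -
    have "q z ?w = (\<Sum>i\<in>I. z i * (\<Sum>j\<in>I. R x i j * ?w j))"
      by (simp add: q_def sum_distrib_left mult_ac)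
    then show ?thesis using solves_weight[OF I, of x t] by (simp add: solves_def)
  qed
  have qsym: "q z z' = q z' z" for z z'
    unfolding q_def by (subst sum.swap) (auto simp: R_sym mult_ac intro!: sum.cong)
  have qadd: "q (\<lambda>j. z j + s * z' j) (\<lambda>j. z j + s * z' j) = q z z + 2 * s * q z z' + s\<^sup>2 * q z' z'" for z z' s
  proof -
    have "q (\<lambda>j. z j + s * z' j) (\<lambda>j. z j + s * z' j) = q z z + s * q z z' + s * q z' z + s\<^sup>2 * q z' z'"
      by (simp add: q_def algebra_simps sum.distrib sum_distrib_left power2_eq_square)
    then show ?thesis using qsym[of z' z] by simp
  qed
  have le: "q ?w ?w \<le> A" "q ?v ?v \<le> A"
    using weight_bound_le[OF I, of x t] weight_bound_le[OF I, of x "x a"] k_abs_le[of 0]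
    by (simp_all add: qw qv)
  \<comment> \<open>Nonnegativity of \<open>q\<close> at \<open>?w + ?v\<close> and at
    \<open>?w - ?v\<close> bounds twice the absolute value by the sum of the two squared
    lengths.\<close>
  have "\<bar>?g\<bar> \<le> A"
    using qpos[of "\<lambda>j. ?w j + 1 * ?v j"] qpos[of "\<lambda>j. ?w j + (-1) * ?v j"] le
    unfolding qadd qv[symmetric] by (simp add: abs_le_iff)
  then have "\<bar>k (t - x a) - ?g\<bar> \<le> 2 * A" using k_abs_le[of "t - x a"] by linarith
  then show ?thesis
    unfolding gain_def abs_divide using s0 C_pos A_pos by (intro frac_le) auto
qed

end

section \<open>Uniform designs\<close>

text \<open>Redrawing one coordinate independently does not change a product measure. Every later
  use of the fact that one design point is uniform and independent of the others goes through this
  identity, which replaces conditional expectations. The bound \<open>B\<close> serves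
  integrability.\<close>

lemma integral_PiM_resample:
  fixes f :: "_ \<Rightarrow> real"
  assumes I: "finite I" "i \<in> I" and U: "\<And>j. prob_space (N j)"
    and f [measurable]: "f \<in> borel_measurable (Pi\<^sub>M I N)"
    and B: "\<And>x. x \<in> space (Pi\<^sub>M I N) \<Longrightarrow> \<bar>f x\<bar> \<le> B"
  shows "(\<integral>x. f x \<partial>Pi\<^sub>M I N) = (\<integral>x. (\<integral>t. f (x(i := t)) \<partial>N i) \<partial>Pi\<^sub>M I N)"
proof -
  interpret N: prob_space "N j" for j by (rule U)
  interpret product_sigma_finite N by unfold_locales
  interpret P: prob_space "Pi\<^sub>M I N" by (rule prob_space_PiM) (rule U)
  define J where "J = I - {i}"
  have J: "finite J" "i \<notin> J" "I = insert i J" using I by (auto simp: J_def)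
  have "(\<lambda>p. (fst p)(i := snd p)) \<in> measurable (Pi\<^sub>M I N \<Otimes>\<^sub>M N i) (Pi\<^sub>M I N)"
    by (rule measurable_fun_upd[where J=I]) (use I in auto)
  from measurable_compose[OF this f]
  have "(\<lambda>(x, t). f (x(i := t))) \<in> borel_measurable (Pi\<^sub>M I N \<Otimes>\<^sub>M N i)"
    by (simp add: case_prod_beta')
  note pair_meas = this
  then have [measurable]: "(\<lambda>x. \<integral>t. f (x(i := t)) \<partial>N i) \<in> borel_measurable (Pi\<^sub>M I N)"
    by (intro N.borel_measurable_lebesgue_integral) simp
  have upd: "x(i := t) \<in> space (Pi\<^sub>M I N)" if "x \<in> space (Pi\<^sub>M I N)" "t \<in> space (N i)" for x t
    using that I(2) by (auto simp: space_PiM PiE_iff extensional_def)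
  have bd: "\<bar>\<integral>t. f (x(i := t)) \<partial>N i\<bar> \<le> B" if "x \<in> space (Pi\<^sub>M I N)" for x
  proof -
    have "(\<lambda>t. f (x(i := t))) \<in> borel_measurable (N i)"
      using measurable_Pair2[OF pair_meas that] by simp
    moreover have "0 \<le> B" using B[OF that] by linarith
    ultimately have "\<bar>\<integral>t. f (x(i := t)) \<partial>N i\<bar> \<le> (\<integral>t. B \<partial>N i)"
      by (intro order_trans[OF integral_abs_bound] integral_mono N.integrable_const_bound[of _ B])
         (auto intro!: AE_I2 B upd that)
    then show ?thesis by (simp add: N.prob_space)
  qed
  have "(\<integral>x. (\<integral>t. f (x(i := t)) \<partial>N i) \<partial>Pi\<^sub>M I N)
      = (\<integral>x. (\<integral>s. (\<integral>t. f ((x(i := s))(i := t)) \<partial>N i) \<partial>N i) \<partial>Pi\<^sub>M J N)"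
    unfolding J(3)
    by (rule product_integral_insert[OF J(1,2)], unfold J(3)[symmetric])
       (intro P.integrable_const_bound[of _ B] AE_I2, auto intro: bd)
  also have "\<dots> = (\<integral>x. (\<integral>t. f (x(i := t)) \<partial>N i) \<partial>Pi\<^sub>M J N)"
    by (simp add: N.prob_space)
  also have "\<dots> = (\<integral>x. f x \<partial>Pi\<^sub>M I N)"
    unfolding J(3)
    by (rule product_integral_insert[OF J(1,2), symmetric], unfold J(3)[symmetric])
       (intro P.integrable_const_bound[of _ B] AE_I2, auto intro: B)
  finally show ?thesis ..
qed

definition unif :: "nat \<Rightarrow> (real^'d::finite) measure" where
  "unif n = uniform_measure lborel (obs_domain n)"

lemma sets_unif [measurable_cong, simp]: "sets (unif n) = sets borel"
  by (simp add: unif_def)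

lemma space_unif [simp]: "space (unif n) = UNIV"
  by (simp add: unif_def)

lemma obs_domain_borel [measurable]: "obs_domain n \<in> sets borel"
  by (simp add: obs_domain_def)

lemma emeasure_obs_domain: "0 < n \<Longrightarrow> emeasure lborel (obs_domain n :: (real^'d::finite) set) = ennreal (real n)"
proof -
  assume n: "0 < n"
  let ?r = "root CARD('d) (real n)"
  have b: "((\<chi> i. ?r) - 0 :: real^'d) \<bullet> b = ?r" if "b \<in> Basis" for b
    using that by (auto simp: Basis_vec_def inner_axis)
  have "emeasure lborel (obs_domain n :: (real^'d) set) =
      ennreal (\<Prod>b\<in>(Basis :: (real^'d) set). ((\<chi> i. ?r) - 0 :: real^'d) \<bullet> b)"
    unfolding obs_domain_def by (rule emeasure_lborel_cbox) (use b n in auto)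
  also have "(\<Prod>b\<in>(Basis :: (real^'d) set). ((\<chi> i. ?r) - 0 :: real^'d) \<bullet> b) = (\<Prod>b\<in>(Basis :: (real^'d) set). ?r)"
    by (intro prod.cong refl b)
  finally show ?thesis using n by simp
qed

lemma prob_space_unif: "0 < n \<Longrightarrow> prob_space (unif n)"
  unfolding unif_def by (intro prob_space_uniform_measure) (auto simp: emeasure_obs_domain)

lemma nn_integral_unif:
  assumes "0 < n" "f \<in> borel_measurable borel"
  shows "(\<integral>\<^sup>+t. f t \<partial>unif n) = (\<integral>\<^sup>+t. f t * indicator (obs_domain n) t \<partial>lborel) / ennreal (real n)"
  unfolding unif_def using assms by (subst nn_integral_uniform_measure) (auto simp: emeasure_obs_domain)

lemma integrable_unif:
  fixes f :: "real^'d::finite \<Rightarrow> real"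
  assumes "0 < n" "f \<in> borel_measurable borel" "\<And>t. \<bar>f t\<bar> \<le> B"
  shows "integrable (unif n) f"
proof -
  interpret prob_space "unif n :: (real^'d) measure" by (rule prob_space_unif) fact
  show ?thesis by (rule integrable_const_bound[of _ B]) (use assms in auto)
qed

lemma integral_decay_unif:
  fixes a :: "real^'d::finite"
  assumes n: "0 < n"
  shows "(\<integral>t. decay (t - a) \<partial>unif n) \<le> decay_mass TYPE('d) / real n"
proof -
  have "(\<integral>\<^sup>+t. ennreal (decay (t - a)) \<partial>unif n) \<le> (\<integral>\<^sup>+t. ennreal (decay (t - a)) \<partial>lborel) / ennreal (real n)"
    by (subst nn_integral_unif[OF n])
       (auto intro!: divide_right_mono_ennreal nn_integral_mono simp: indicator_def)
  also have "\<dots> = ennreal (decay_mass TYPE('d) / real n)"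
    unfolding nn_integral_decay_shift using n by (simp add: divide_ennreal decay_mass_nonneg)
  finally have "(\<integral>\<^sup>+t. ennreal (decay (t - a)) \<partial>unif n) \<le> ennreal (decay_mass TYPE('d) / real n)" .
  moreover have "integrable (unif n) (\<lambda>t. decay (t - a))"
    by (rule integrable_unif[OF n, of _ 1]) (auto simp: decay_le_1)
  ultimately show ?thesis
    by (subst (asm) nn_integral_eq_integral) (auto simp: decay_mass_nonneg)
qed

abbreviation design :: "nat \<Rightarrow> (nat \<Rightarrow> real^'d::finite) measure" where
  "design n \<equiv> Pi\<^sub>M {..<n} (\<lambda>_. unif n)"

lemma prob_space_design: "0 < n \<Longrightarrow> prob_space (design n)"
  by (intro prob_space_PiM prob_space_unif)

text \<open>If \<open>f\<close> lies in the reproducing kernel Hilbert space of \<open>k\<close>, then the square of its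
  \<open>L\<^sup>2\<close> norm is at most the integral of \<open>|k|\<close> times the square of its Hilbert space norm. This is
  obtained from positive semidefiniteness at the points \<open>x\<close> and \<open>m\<close> further independent uniform
  points, as \<open>m\<close> tends to infinity.\<close>

context krig
begin

lemma integral_kernel_sum_square_le:
  fixes x :: "'i \<Rightarrow> real^'d"
  assumes n: "0 < n" and I: "finite I"
  shows "(\<integral>t. (\<Sum>i\<in>I. v i * k (t - x i))\<^sup>2 \<partial>unif n)
    \<le> A * decay_mass TYPE('d) / real n * (\<Sum>i\<in>I. \<Sum>j\<in>I. v i * v j * k (x i - x j))"
proof -
  define \<phi> where "\<phi> t = (\<Sum>i\<in>I. v i * k (t - x i))" for t
  define q where "q = (\<Sum>i\<in>I. \<Sum>j\<in>I. v i * v j * k (x i - x j))"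
  define h where "h = decay_mass TYPE('d) / real n"
  define F where "F = (\<integral>t. (\<phi> t)\<^sup>2 \<partial>unif n)"
  define B where "B = (\<Sum>i\<in>I. \<bar>v i\<bar> * A)"
  interpret U: prob_space "unif n :: (real^'d) measure" by (rule prob_space_unif) fact
  have [measurable]: "\<phi> \<in> borel_measurable borel" unfolding \<phi>_def by measurable
  have \<phi>B: "\<bar>\<phi> t\<bar> \<le> B" for t
    unfolding \<phi>_def B_def
    by (intro order_trans[OF sum_abs] sum_mono) (auto simp: abs_mult intro!: mult_left_mono k_abs_le)
  then have \<phi>2: "(\<phi> t)\<^sup>2 \<le> B\<^sup>2" for t by (meson abs_le_square_iff abs_le_iff abs_ge_self order_trans)
  have h0: "0 \<le> h" using n by (simp add: h_def decay_mass_nonneg)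
  have F0: "0 \<le> F" unfolding F_def by (intro integral_nonneg_AE) simp
  have intF: "integrable (unif n) (\<lambda>t. (\<phi> t)\<^sup>2)" by (rule integrable_unif[OF n, of _ "B\<^sup>2"]) (auto simp: \<phi>2)
  have main_m: "2 * b * F \<le> q + b\<^sup>2 * A * F / real m + b\<^sup>2 * A * h * F" if m: "0 < m" and b: "0 \<le> b" for m :: nat and b :: real
  proof -
    let ?P = "Pi\<^sub>M {..<m} (\<lambda>_. unif n :: (real^'d) measure)"
    interpret P: prob_space ?P by (intro prob_space_PiM prob_space_unif n)
    let ?J = "Inl ` I \<union> Inr ` {..<m}"
    have ptw: "2 * (b / m) * (\<Sum>j<m. (\<phi> (T j))\<^sup>2) \<le> q + (b / m)\<^sup>2 * A * (\<Sum>j<m. (\<phi> (T j))\<^sup>2)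
        + (b / m)\<^sup>2 * A * (\<Sum>j<m. \<Sum>l\<in>{..<m} - {j}. (\<phi> (T j))\<^sup>2 * decay (T l - T j))" for T :: "nat \<Rightarrow> real^'d"
    proof -
      \<comment> \<open>The coefficients at the sample points \<open>T\<close> imitate integration
        against \<open>- b * \<phi>\<close>. The scale \<open>b\<close> is optimized once
        \<open>m\<close> has gone to infinity.\<close>
      let ?p = "case_sum x T" and ?a = "case_sum v (\<lambda>j. - (b / m) * \<phi> (T j))"
      have split: "(\<Sum>i\<in>?J. f i) = (\<Sum>i\<in>I. f (Inl i)) + (\<Sum>j<m. f (Inr j))" for f :: "'i + nat \<Rightarrow> real"
        using I by (subst sum.union_disjoint) (auto simp: sum.reindex)
      define S where "S = (\<Sum>j<m. \<Sum>l<m. \<phi> (T j) * \<phi> (T l) * k (T j - T l))"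
      have c1: "(\<Sum>i\<in>I. \<Sum>j<m. v i * (- (b / m) * \<phi> (T j)) * k (x i - T j)) = - (b / m) * (\<Sum>j<m. (\<phi> (T j))\<^sup>2)"
      proof -
        have "(\<Sum>i\<in>I. \<Sum>j<m. v i * (- (b / m) * \<phi> (T j)) * k (x i - T j)) =
            (\<Sum>j<m. \<Sum>i\<in>I. (- (b / m) * \<phi> (T j)) * (v i * k (T j - x i)))"
          by (subst sum.swap) (auto simp: k_commute mult_ac intro!: sum.cong)
        also have "\<dots> = (\<Sum>j<m. (- (b / m) * \<phi> (T j)) * \<phi> (T j))"
          unfolding \<phi>_def by (simp only: sum_distrib_left)
        finally show ?thesis by (simp add: sum_distrib_left power2_eq_square mult.assoc)
      qed
      have c2: "(\<Sum>j<m. \<Sum>i\<in>I. (- (b / m) * \<phi> (T j)) * v i * k (T j - x i)) = - (b / m) * (\<Sum>j<m. (\<phi> (T j))\<^sup>2)"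
        unfolding c1[symmetric] by (subst sum.swap) (auto simp: k_commute mult_ac intro!: sum.cong)
      have c3: "(\<Sum>j<m. \<Sum>l<m. (- (b / m) * \<phi> (T j)) * (- (b / m) * \<phi> (T l)) * k (T j - T l)) = (b / m)\<^sup>2 * S"
        by (simp add: S_def sum_distrib_left power2_eq_square mult_ac)
      have "0 \<le> (\<Sum>i\<in>?J. \<Sum>j\<in>?J. ?a i * ?a j * k (?p i - ?p j))"
        by (rule psd) (use I in auto)
      also have "\<dots> = q + (\<Sum>i\<in>I. \<Sum>j<m. v i * (- (b / m) * \<phi> (T j)) * k (x i - T j))
          + ((\<Sum>j<m. \<Sum>i\<in>I. (- (b / m) * \<phi> (T j)) * v i * k (T j - x i))
          + (\<Sum>j<m. \<Sum>l<m. (- (b / m) * \<phi> (T j)) * (- (b / m) * \<phi> (T l)) * k (T j - T l)))"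
        unfolding split q_def by (simp add: sum.distrib)
      finally have 1: "2 * (b / m) * (\<Sum>j<m. (\<phi> (T j))\<^sup>2) \<le> q + (b / m)\<^sup>2 * S"
        unfolding c1 c2 c3 by simp
      let ?D = "\<lambda>j l. (\<phi> (T j))\<^sup>2 * (A * decay (T l - T j))"
      have "S \<le> (\<Sum>j<m. \<Sum>l<m. ?D j l / 2 + ?D l j / 2)"
        unfolding S_def
      proof (intro sum_mono)
        fix j l
        have "\<phi> (T j) * \<phi> (T l) * k (T j - T l) \<le> \<bar>\<phi> (T j) * \<phi> (T l)\<bar> * \<bar>k (T j - T l)\<bar>"
          by (simp add: abs_mult[symmetric])
        also have "\<dots> \<le> ((\<phi> (T j))\<^sup>2 + (\<phi> (T l))\<^sup>2) / 2 * (A * decay (T l - T j))"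
          using sum_squares_bound[of "\<bar>\<phi> (T j)\<bar>" "\<bar>\<phi> (T l)\<bar>"] k_bound[of "T j - T l"]
          by (intro mult_mono) (auto simp: abs_mult decay_diff_commute)
        finally show "\<phi> (T j) * \<phi> (T l) * k (T j - T l) \<le> ?D j l / 2 + ?D l j / 2"
          by (simp add: decay_diff_commute[of "T j"] algebra_simps add_divide_distrib)
      qed
      also have "\<dots> = (\<Sum>j<m. \<Sum>l<m. ?D j l / 2) + (\<Sum>j<m. \<Sum>l<m. ?D l j / 2)"
        by (simp add: sum.distrib)
      also have "(\<Sum>j<m. \<Sum>l<m. ?D l j / 2) = (\<Sum>j<m. \<Sum>l<m. ?D j l / 2)"
        by (rule sum.swap)
      finally have "S \<le> (\<Sum>j<m. \<Sum>l<m. ?D j l)"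
        by (simp add: sum_divide_distrib[symmetric])
      \<comment> \<open>The diagonal is of order 1 / \<open>m\<close> after scaling and vanishes in
        the limit. Off the diagonal the two points are independent, and resampling one of them
        produces the integral of \<open>decay\<close>.\<close>
      also have "\<dots> = (\<Sum>j<m. ?D j j + (\<Sum>l\<in>{..<m} - {j}. ?D j l))"
        by (intro sum.cong refl sum.remove) auto
      also have "\<dots> = A * (\<Sum>j<m. (\<phi> (T j))\<^sup>2) + A * (\<Sum>j<m. \<Sum>l\<in>{..<m} - {j}. (\<phi> (T j))\<^sup>2 * decay (T l - T j))"
        by (simp add: sum.distrib sum_distrib_left mult_ac)
      finally have "(b / m)\<^sup>2 * S \<le> (b / m)\<^sup>2 * (A * (\<Sum>j<m. (\<phi> (T j))\<^sup>2) + A * (\<Sum>j<m. \<Sum>l\<in>{..<m} - {j}. (\<phi> (T j))\<^sup>2 * decay (T l - T j)))"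
        by (intro mult_left_mono) auto
      with 1 show ?thesis by (simp add: algebra_simps)
    qed
    have int1: "integrable ?P (\<lambda>T. (\<phi> (T j))\<^sup>2)" if "j < m" for j
      by (rule P.integrable_const_bound[of _ "B\<^sup>2"]) (use that \<phi>2 in \<open>auto intro!: AE_I2\<close>)
    have D2: "\<bar>(\<phi> s)\<^sup>2 * decay t\<bar> \<le> B\<^sup>2" for s t
      using mult_mono[OF \<phi>2 decay_le_1[of t], of s] by (simp add: abs_mult)
    have int2: "integrable ?P (\<lambda>T. (\<phi> (T j))\<^sup>2 * decay (T l - T j))" if "j < m" "l < m" for j l
      by (rule P.integrable_const_bound[of _ "B\<^sup>2"]) (use that D2 in \<open>auto intro!: AE_I2\<close>)
    have E1: "(\<integral>T. (\<phi> (T j))\<^sup>2 \<partial>?P) = F" if j: "j < m" for j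
    proof -
      have "(\<integral>T. (\<phi> (T j))\<^sup>2 \<partial>?P) = (\<integral>T. (\<integral>t. (\<phi> ((T(j := t)) j))\<^sup>2 \<partial>unif n) \<partial>?P)"
        by (rule integral_PiM_resample[where B="B\<^sup>2"]) (use j \<phi>2 in \<open>auto intro: prob_space_unif n\<close>)
      then show ?thesis by (simp add: F_def P.prob_space)
    qed
    have E2: "(\<integral>T. (\<phi> (T j))\<^sup>2 * decay (T l - T j) \<partial>?P) \<le> h * F" if jl: "j < m" "l < m" "l \<noteq> j" for j l
    proof -
      have "(\<integral>T. (\<phi> (T j))\<^sup>2 * decay (T l - T j) \<partial>?P) =
          (\<integral>T. (\<integral>t. (\<phi> ((T(l := t)) j))\<^sup>2 * decay ((T(l := t)) l - (T(l := t)) j) \<partial>unif n) \<partial>?P)"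
        by (rule integral_PiM_resample[where B="B\<^sup>2"]) (use jl D2 in \<open>auto intro: prob_space_unif n\<close>)
      also have "\<dots> = (\<integral>T. (\<phi> (T j))\<^sup>2 * (\<integral>t. decay (t - T j) \<partial>unif n) \<partial>?P)"
        using jl by simp
      also have "\<dots> \<le> (\<integral>T. (\<phi> (T j))\<^sup>2 * h \<partial>?P)"
      proof (rule integral_mono')
        show "integrable ?P (\<lambda>T. (\<phi> (T j))\<^sup>2 * h)" using int1[OF jl(1)] by simp
        show "(\<phi> (T j))\<^sup>2 * (\<integral>t. decay (t - T j) \<partial>unif n) \<le> (\<phi> (T j))\<^sup>2 * h" for T
          by (intro mult_left_mono integral_decay_unif[OF n, of "T j", folded h_def]) simp
      qed (use h0 in auto)
      also have "\<dots> = h * F" using E1[OF jl(1)] by simp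
      finally show ?thesis .
    qed
    have "2 * (b / m) * (\<Sum>j<m. F) = (\<integral>T. 2 * (b / m) * (\<Sum>j<m. (\<phi> (T j))\<^sup>2) \<partial>?P)"
      using int1 E1 by simp
    also have "\<dots> \<le> (\<integral>T. q + (b / m)\<^sup>2 * A * (\<Sum>j<m. (\<phi> (T j))\<^sup>2)
        + (b / m)\<^sup>2 * A * (\<Sum>j<m. \<Sum>l\<in>{..<m} - {j}. (\<phi> (T j))\<^sup>2 * decay (T l - T j)) \<partial>?P)"
      by (intro integral_mono ptw) (auto intro!: Bochner_Integration.integrable_add integrable_mult_right Bochner_Integration.integrable_sum int1 int2)
    also have "\<dots> = q + (b / m)\<^sup>2 * A * (\<Sum>j<m. F)
        + (b / m)\<^sup>2 * A * (\<Sum>j<m. \<Sum>l\<in>{..<m} - {j}. (\<integral>T. (\<phi> (T j))\<^sup>2 * decay (T l - T j) \<partial>?P))"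
    proof -
      have i: "integrable ?P (\<lambda>T. \<Sum>j<m. (\<phi> (T j))\<^sup>2)"
          "integrable ?P (\<lambda>T. \<Sum>j<m. \<Sum>l\<in>{..<m} - {j}. (\<phi> (T j))\<^sup>2 * decay (T l - T j))"
        by (intro Bochner_Integration.integrable_sum int1 int2; simp)+
      have "(\<integral>T. (\<Sum>j<m. (\<phi> (T j))\<^sup>2) \<partial>?P) = (\<Sum>j<m. F)" using int1 E1 by simp
      moreover have "(\<integral>T. (\<Sum>j<m. \<Sum>l\<in>{..<m} - {j}. (\<phi> (T j))\<^sup>2 * decay (T l - T j)) \<partial>?P) =
          (\<Sum>j<m. \<Sum>l\<in>{..<m} - {j}. (\<integral>T. (\<phi> (T j))\<^sup>2 * decay (T l - T j) \<partial>?P))"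
        by (subst Bochner_Integration.integral_sum, (intro Bochner_Integration.integrable_sum int2; simp),
            intro sum.cong refl Bochner_Integration.integral_sum int2) auto
      ultimately show ?thesis using i by (simp add: P.prob_space)
    qed
    also have "(\<Sum>j<m. \<Sum>l\<in>{..<m} - {j}. (\<integral>T. (\<phi> (T j))\<^sup>2 * decay (T l - T j) \<partial>?P)) \<le> (\<Sum>j<m. \<Sum>l\<in>{..<m} - {j}. h * F)"
      by (intro sum_mono E2) auto
    also have "\<dots> \<le> (\<Sum>j<m. \<Sum>l<m. h * F)"
      using h0 F0 by (intro sum_mono sum_mono2) auto
    finally have "2 * (b / m) * (m * F) \<le> q + (b / m)\<^sup>2 * A * (m * F) + (b / m)\<^sup>2 * A * (m * (m * (h * F)))"
      using A_pos by (simp add: mult_left_mono)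
    then show ?thesis using m by (simp add: power2_eq_square field_simps)
  qed
  have main: "2 * b * F \<le> q + b\<^sup>2 * A * h * F" if b: "0 \<le> b" for b
  proof (rule LIMSEQ_le_const)
    show "(\<lambda>m. q + b\<^sup>2 * A * F / real m + b\<^sup>2 * A * h * F) \<longlonglongrightarrow> q + b\<^sup>2 * A * h * F"
    proof -
      have "(\<lambda>m. q + b\<^sup>2 * A * F / real m + b\<^sup>2 * A * h * F) \<longlonglongrightarrow> q + 0 + b\<^sup>2 * A * h * F"
        by (intro tendsto_intros lim_const_over_n)
      then show ?thesis by simp
    qed
    show "\<exists>N. \<forall>m\<ge>N. 2 * b * F \<le> q + b\<^sup>2 * A * F / real m + b\<^sup>2 * A * h * F"
      using main_m[OF _ b] by (intro exI[of _ 1]) auto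
  qed
  have "F \<le> A * h * q"
  \<comment> \<open>If \<open>h = 0\<close> then \<open>2 * b * F \<le> q\<close> for every
    \<open>b\<close>, which forces \<open>F\<close> to vanish. Otherwise the optimal choice is
    \<open>b = 1 / (A * h)\<close>.\<close>
  proof (cases "h = 0")
    case True
    have q: "0 \<le> q" unfolding q_def by (rule psd[OF I])
    have "F \<le> 0"
    proof (rule ccontr)
      assume "\<not> F \<le> 0"
      then have "0 < F" by simp
      then have "2 * ((q + 1) / F) * F \<le> q"
        using main[of "(q + 1) / F"] True q by simp
      then show False using \<open>0 < F\<close> q by simp
    qed
    then show ?thesis using True by simp
  next
    case False
    define c where "c = A * h"
    have c: "0 < c" using False h0 A_pos by (simp add: c_def)
    have "(1 / c)\<^sup>2 * A * h * F = (1 / c)\<^sup>2 * c * F" by (simp add: c_def)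
    also have "\<dots> = F / c" using c by (simp add: power2_eq_square)
    finally have "2 * (1 / c) * F \<le> q + F / c" using main[of "1 / c"] c by simp
    then have "F / c \<le> q" by simp
    then show ?thesis using c by (simp add: c_def[symmetric] field_simps)
  qed
  then show ?thesis by (simp add: F_def \<phi>_def q_def h_def)
qed

text \<open>A bound for the integral of the absolute value of \<open>k\<close>, and so for the norm
  of the integral operator with this kernel.\<close>

definition \<kappa> :: real where "\<kappa> = A * decay_mass TYPE('d)"

lemma \<kappa>_nonneg: "0 \<le> \<kappa>"
  using A_pos by (simp add: \<kappa>_def decay_mass_nonneg)

text \<open>The prediction function has squared Hilbert space norm equal to the kernel form of the
  solution, which the energy bound limits by the squared norm of \<open>b\<close> divided by
  \<open>C\<close>. No property of the design enters, so clusters do no harm here.\<close>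

lemma integral_prediction_square_le:
  assumes n: "0 < n" and I: "finite I"
  shows "(\<integral>t. (\<Sum>j\<in>I. k (t - x j) * solution I x b j)\<^sup>2 \<partial>unif n) \<le> \<kappa> / (C * real n) * (\<Sum>j\<in>I. (b j)\<^sup>2)"
proof -
  let ?z = "solution I x b"
  let ?q = "\<Sum>i\<in>I. \<Sum>j\<in>I. ?z i * ?z j * k (x i - x j)"
  have "?q + \<delta> * (\<Sum>i\<in>I. (?z i)\<^sup>2) = (\<Sum>i\<in>I. ?z i * b i)"
    by (rule solves_energy[OF I solves_solution[OF I]])
  moreover have "0 \<le> \<delta> * (\<Sum>i\<in>I. (?z i)\<^sup>2)"
    using \<delta>_pos by (auto intro!: mult_nonneg_nonneg sum_nonneg)
  moreover have "(\<Sum>i\<in>I. ?z i * b i) \<le> (\<Sum>i\<in>I. (b i)\<^sup>2) / C"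
    by (rule solves_energy_le[OF I solves_solution[OF I]])
  ultimately have q: "?q \<le> (\<Sum>i\<in>I. (b i)\<^sup>2) / C" by linarith
  have "(\<integral>t. (\<Sum>j\<in>I. k (t - x j) * ?z j)\<^sup>2 \<partial>unif n) = (\<integral>t. (\<Sum>j\<in>I. ?z j * k (t - x j))\<^sup>2 \<partial>unif n)"
    by (simp add: mult.commute)
  also have "\<dots> \<le> \<kappa> / real n * ?q"
    using integral_kernel_sum_square_le[OF n I, of ?z x] by (simp add: \<kappa>_def)
  also have "\<dots> \<le> \<kappa> / real n * ((\<Sum>i\<in>I. (b i)\<^sup>2) / C)"
    using \<kappa>_nonneg by (intro mult_left_mono q) auto
  finally show ?thesis by (simp add: mult.commute)
qed

lemma integral_weight_sum_square_le:
  assumes n: "0 < n" and I: "finite I"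
  shows "(\<integral>t. (\<Sum>j\<in>I. weight I x t j * b j)\<^sup>2 \<partial>unif n) \<le> \<kappa> / (C * real n) * (\<Sum>j\<in>I. (b j)\<^sup>2)"
  unfolding sum_weight_eq_sum_solution[OF I] by (rule integral_prediction_square_le[OF n I])

lemma borel_measurable_weight [measurable]:
  assumes [simp]: "finite I" "j \<in> I" shows "(\<lambda>t. weight I x t j) \<in> borel_measurable borel"
  unfolding weight_def by (rule borel_measurable_solution) auto

lemma abs_weight_le:
  assumes "finite I" "j \<in> I" shows "(weight I x t j)\<^sup>2 \<le> A / C"
  using member_le_sum[of j I "\<lambda>j. (weight I x t j)\<^sup>2"] assms weight_norm_le[OF assms(1), of x t] by simp

lemma integral_weight_square_le:
  assumes n: "0 < n" and I: "finite I" "j \<in> I"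
  shows "(\<integral>t. (weight I x t j)\<^sup>2 \<partial>unif n) \<le> \<kappa> / (C * real n)"
proof -
  let ?e = "\<lambda>i. if i = j then 1 else 0 :: real"
  have 1: "(\<Sum>i\<in>I. weight I x t i * ?e i) = weight I x t j" for t
  proof -
    have "(\<Sum>i\<in>I. weight I x t i * ?e i) = (\<Sum>i\<in>I. if i = j then weight I x t i else 0)"
      by (intro sum.cong) auto
    then show ?thesis using I by simp
  qed
  have "(\<Sum>i\<in>I. (?e i)\<^sup>2) = (\<Sum>i\<in>I. ?e i)" by (intro sum.cong) auto
  then have 2: "(\<Sum>i\<in>I. (?e i)\<^sup>2) = 1" using I by simp
  show ?thesis using integral_weight_sum_square_le[OF n I(1), of x ?e] unfolding 1 2 by simp
qed

lemma borel_measurable_gain [measurable]: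
  "finite I \<Longrightarrow> (\<lambda>t. gain I x a t) \<in> borel_measurable borel"
  unfolding gain_def by measurable

text \<open>The kernel term in the numerator is integrated through its decay. The correction is, by
  symmetry of the inverse, the kernel sum with the weights for \<open>x a\<close>, whose Hilbert
  space norm is bounded by the prior variance. Both are of order 1 / \<open>n\<close>, and the
  denominator is at least \<open>C\<close>.\<close>

lemma integral_gain_square_le:
  assumes n: "0 < n" and I: "finite I"
  shows "(\<integral>t. (gain I x a t)\<^sup>2 \<partial>unif n) \<le> 4 * A * \<kappa> / (C\<^sup>2 * real n)"
proof -
  let ?v = "weight I x (x a)"
  let ?b = "\<lambda>j. k (x a - x j)"
  let ?p = "\<lambda>t. \<Sum>j\<in>I. weight I x t j * ?b j"
  let ?s = "k 0 + \<delta> - (\<Sum>j\<in>I. ?v j * ?b j)"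
  have s: "C \<le> ?s" using weight_bound_le[OF I, of x "x a"] C_le by linarith
  have p: "?p t = (\<Sum>j\<in>I. ?v j * k (t - x j))" for t
    by (subst sum_weight_eq_sum_solution[OF I]) (simp add: weight_def mult.commute)
  have q: "(\<Sum>i\<in>I. \<Sum>j\<in>I. ?v i * ?v j * k (x i - x j)) \<le> A"
  proof -
    have "0 \<le> \<delta> * (\<Sum>i\<in>I. (?v i)\<^sup>2)" using \<delta>_pos by (auto intro!: mult_nonneg_nonneg sum_nonneg)
    then show ?thesis
      using solves_energy[OF I solves_weight[OF I], of x "x a"] weight_bound_le[OF I, of x "x a"] k_abs_le[of 0] by linarith
  qed
  have int_p: "(\<integral>t. (?p t)\<^sup>2 \<partial>unif n) \<le> \<kappa> / real n * A"
    using integral_kernel_sum_square_le[OF n I, of ?v x] mult_left_mono[OF q, of "\<kappa> / real n"] \<kappa>_nonneg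
    unfolding p by (simp add: \<kappa>_def)
  have k2: "(k t)\<^sup>2 \<le> A\<^sup>2 * decay t" for t
  proof -
    have "(k t)\<^sup>2 = \<bar>k t\<bar> * \<bar>k t\<bar>" by (simp add: power2_eq_square)
    also have "\<dots> \<le> A * (A * decay t)" using A_pos by (intro mult_mono k_abs_le k_bound) auto
    finally show ?thesis by (simp add: power2_eq_square)
  qed
  have "integrable (unif n) (\<lambda>t. A\<^sup>2 * decay (t - x a))"
    by (rule integrable_unif[OF n, of _ "A\<^sup>2 * 1"]) (auto intro!: mult_left_le simp: decay_le_1 abs_mult)
  then have "(\<integral>t. (k (t - x a))\<^sup>2 \<partial>unif n) \<le> (\<integral>t. A\<^sup>2 * decay (t - x a) \<partial>unif n)"
    by (intro integral_mono' k2) auto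
  also have "\<dots> \<le> A\<^sup>2 * (decay_mass TYPE('d) / real n)"
    using mult_left_mono[OF integral_decay_unif[OF n, of "x a"], of "A\<^sup>2"] by simp
  finally have int_k: "(\<integral>t. (k (t - x a))\<^sup>2 \<partial>unif n) \<le> \<kappa> / real n * A"
    by (simp add: \<kappa>_def power2_eq_square mult_ac)
  have k2': "(k t)\<^sup>2 \<le> A\<^sup>2" for t using k_abs_le[of t] by (metis abs_le_square_iff abs_of_pos A_pos)
  have i1: "integrable (unif n) (\<lambda>t. (k (t - x a))\<^sup>2)"
    by (rule integrable_unif[OF n, of _ "A\<^sup>2"]) (auto simp: k2')
  have pB: "\<bar>?p t\<bar> \<le> (\<Sum>j\<in>I. \<bar>?v j\<bar> * A)" for t
    unfolding p by (intro order_trans[OF sum_abs] sum_mono) (auto simp: abs_mult intro!: mult_left_mono k_abs_le)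
  have i2: "integrable (unif n) (\<lambda>t. (?p t)\<^sup>2)"
  proof (rule integrable_unif[OF n, of _ "(\<Sum>j\<in>I. \<bar>?v j\<bar> * A)\<^sup>2"])
    show "(\<lambda>t. (?p t)\<^sup>2) \<in> borel_measurable borel" unfolding p by measurable
    show "\<bar>(?p t)\<^sup>2\<bar> \<le> (\<Sum>j\<in>I. \<bar>?v j\<bar> * A)\<^sup>2" for t
      using power_mono[OF pB, of t 2] by simp
  qed
  have "(gain I x a t)\<^sup>2 \<le> 2 / C\<^sup>2 * ((k (t - x a))\<^sup>2 + (?p t)\<^sup>2)" for t
  proof -
    have "(gain I x a t)\<^sup>2 = (k (t - x a) - ?p t)\<^sup>2 / ?s\<^sup>2" by (simp add: gain_def power_divide)
    also have "\<dots> \<le> (2 * ((k (t - x a))\<^sup>2 + (?p t)\<^sup>2)) / C\<^sup>2"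
    proof (intro frac_le)
      show "(k (t - x a) - ?p t)\<^sup>2 \<le> 2 * ((k (t - x a))\<^sup>2 + (?p t)\<^sup>2)"
        using sum_squares_ge_zero[of "k (t - x a) + ?p t" 0] by (simp add: power2_eq_square algebra_simps)
      show "C\<^sup>2 \<le> ?s\<^sup>2" using s C_pos by (intro power_mono) auto
    qed (use C_pos in auto)
    finally show ?thesis by simp
  qed
  then have "(\<integral>t. (gain I x a t)\<^sup>2 \<partial>unif n) \<le> (\<integral>t. 2 / C\<^sup>2 * ((k (t - x a))\<^sup>2 + (?p t)\<^sup>2) \<partial>unif n)"
    using i1 i2 by (intro integral_mono') auto
  also have "\<dots> = 2 / C\<^sup>2 * ((\<integral>t. (k (t - x a))\<^sup>2 \<partial>unif n) + (\<integral>t. (?p t)\<^sup>2 \<partial>unif n))"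
    using i1 i2 by simp
  also have "\<dots> \<le> 2 / C\<^sup>2 * (\<kappa> / real n * A + \<kappa> / real n * A)"
    by (intro mult_left_mono add_mono int_k int_p) auto
  finally show ?thesis by (simp add: mult_ac)
qed

end

section \<open>Moments of Gaussian families\<close>

lemma normal_law_moments:
  assumes "0 \<le> \<sigma>"
  shows "integrable (normal_law \<mu> \<sigma>) (\<lambda>x. x)" "(\<integral>x. x \<partial>normal_law \<mu> \<sigma>) = \<mu>"
proof -
  have "integrable (normal_law \<mu> \<sigma>) (\<lambda>x. x) \<and> (\<integral>x. x \<partial>normal_law \<mu> \<sigma>) = \<mu>"
  proof (cases "\<sigma> = 0")
    case True
    then show ?thesis
      by (auto simp: normal_law_def integral_return intro!: integrableI_bounded simp: nn_integral_return)
  next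
    case False
    then show ?thesis
      using normal_moment_nz_1[of \<sigma> \<mu>] assms
      by (auto simp: normal_law_def integrable_real_density integral_real_density has_bochner_integral_iff)
  qed
  then show "integrable (normal_law \<mu> \<sigma>) (\<lambda>x. x)" "(\<integral>x. x \<partial>normal_law \<mu> \<sigma>) = \<mu>" by auto
qed

lemma normal_law_central_moments:
  assumes "0 \<le> \<sigma>"
  shows "integrable (normal_law 0 \<sigma>) (\<lambda>x. x ^ 4)"
    and "(\<integral>x. x ^ 4 \<partial>normal_law 0 \<sigma>) = 3 * (\<integral>x. x\<^sup>2 \<partial>normal_law 0 \<sigma>)\<^sup>2"
proof -
  have "integrable (normal_law 0 \<sigma>) (\<lambda>x. x ^ 4) \<and>
    (\<integral>x. x ^ 4 \<partial>normal_law 0 \<sigma>) = 3 * (\<integral>x. x\<^sup>2 \<partial>normal_law 0 \<sigma>)\<^sup>2"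
  proof (cases "\<sigma> = 0")
    case True
    then show ?thesis
      by (auto simp: normal_law_def integral_return intro!: integrableI_bounded simp: nn_integral_return)
  next
    case False
    then have \<sigma>: "0 < \<sigma>" using assms by simp
    have "(\<integral>x. x ^ 4 \<partial>normal_law 0 \<sigma>) = 3 * \<sigma> ^ 4"
      using integral_normal_moment_even[OF \<sigma>, of 0 2] \<sigma>
      by (simp add: normal_law_def integral_real_density fact_numeral power_divide)
    moreover have "(\<integral>x. x\<^sup>2 \<partial>normal_law 0 \<sigma>) = \<sigma>\<^sup>2"
      using integral_normal_moment_even[OF \<sigma>, of 0 1] \<sigma>
      by (simp add: normal_law_def integral_real_density)
    moreover have "integrable (normal_law 0 \<sigma>) (\<lambda>x. x ^ 4)"
      using integrable_normal_moment[OF \<sigma>, of 0 4] \<sigma>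
      by (simp add: normal_law_def integrable_real_density)
    ultimately show ?thesis by simp
  qed
  then show "integrable (normal_law 0 \<sigma>) (\<lambda>x. x ^ 4)"
    "(\<integral>x. x ^ 4 \<partial>normal_law 0 \<sigma>) = 3 * (\<integral>x. x\<^sup>2 \<partial>normal_law 0 \<sigma>)\<^sup>2" by auto
qed

text \<open>The trace of Gaussianity that the second moment calculus needs: mean zero and kurtosis
  three. It survives sums of independent variables, and by polarization it yields the covariances of
  squares.\<close>

definition gauss4 :: "'w measure \<Rightarrow> ('w \<Rightarrow> real) \<Rightarrow> bool" where
  "gauss4 M L \<longleftrightarrow> L \<in> borel_measurable M \<and> integrable M (\<lambda>\<omega>. L \<omega> ^ 4) \<and>
    (\<integral>\<omega>. L \<omega> \<partial>M) = 0 \<and> (\<integral>\<omega>. L \<omega> ^ 4 \<partial>M) = 3 * (\<integral>\<omega>. (L \<omega>)\<^sup>2 \<partial>M)\<^sup>2"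

lemma gaussian_family_lawE:
  assumes "gaussian_family M I Z" "finite J" "J \<subseteq> I"
  obtains \<mu> \<sigma> where "0 \<le> \<sigma>" "distr M borel (\<lambda>\<omega>. \<Sum>i\<in>J. a i * Z i \<omega>) = normal_law \<mu> \<sigma>"
  using assms unfolding gaussian_family_def by blast

lemma centered_gaussian_integrable:
  assumes "centered_gaussian M I Z c" "i \<in> I"
  shows "integrable M (Z i)"
proof -
  have [measurable]: "Z i \<in> borel_measurable M"
    using assms by (auto simp: centered_gaussian_def gaussian_family_def)
  have sub: "{i} \<subseteq> I" using assms by simp
  have fam: "gaussian_family M I Z" using assms(1) by (simp add: centered_gaussian_def)
  obtain \<mu> \<sigma> where d: "0 \<le> \<sigma>" "distr M borel (\<lambda>\<omega>. \<Sum>i\<in>{i}. 1 * Z i \<omega>) = normal_law \<mu> \<sigma>"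
    by (rule gaussian_family_lawE[OF fam _ sub, of "\<lambda>_. 1"]) simp
  from normal_law_moments(1)[OF d(1), of \<mu>] have "integrable (distr M borel (Z i)) (\<lambda>x. x)"
    using d(2) by simp
  then show ?thesis by (subst (asm) integrable_distr_eq) auto
qed

lemma centered_gaussian_gauss4:
  assumes "centered_gaussian M I Z c" "finite J" "J \<subseteq> I"
  shows "gauss4 M (\<lambda>\<omega>. \<Sum>i\<in>J. a i * Z i \<omega>)"
proof -
  let ?L = "\<lambda>\<omega>. \<Sum>i\<in>J. a i * Z i \<omega>"
  have Zm: "Z i \<in> borel_measurable M" if "i \<in> J" for i
    using assms that by (auto simp: centered_gaussian_def gaussian_family_def)
  have [measurable]: "?L \<in> borel_measurable M" using Zm by (intro borel_measurable_sum) auto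
  obtain \<mu> \<sigma> where d: "0 \<le> \<sigma>" "distr M borel ?L = normal_law \<mu> \<sigma>"
    using gaussian_family_lawE[of M I Z J a] assms(2,3) assms(1)[unfolded centered_gaussian_def, THEN conjunct1] by metis
  have int: "integrable M (Z i)" if "i \<in> J" for i
    using centered_gaussian_integrable[OF assms(1)] that assms(3) by auto
  have "(\<integral>\<omega>. ?L \<omega> \<partial>M) = (\<Sum>i\<in>J. a i * (\<integral>\<omega>. Z i \<omega> \<partial>M))"
    using int by (subst Bochner_Integration.integral_sum) auto
  also have "\<dots> = 0" using assms by (intro sum.neutral) (auto simp: centered_gaussian_def)
  finally have m0: "(\<integral>\<omega>. ?L \<omega> \<partial>M) = 0" .
  have "(\<integral>x. x \<partial>distr M borel ?L) = 0" by (subst integral_distr) (auto simp: m0)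
  then have \<mu>: "\<mu> = 0" using normal_law_moments(2)[OF d(1), of \<mu>] d(2) by simp
  have "integrable (distr M borel ?L) (\<lambda>x. x ^ 4)"
    "(\<integral>x. x ^ 4 \<partial>distr M borel ?L) = 3 * (\<integral>x. x\<^sup>2 \<partial>distr M borel ?L)\<^sup>2"
    using normal_law_central_moments[OF d(1)] d(2) \<mu> by simp_all
  then have "integrable M (\<lambda>\<omega>. ?L \<omega> ^ 4)" "(\<integral>\<omega>. ?L \<omega> ^ 4 \<partial>M) = 3 * (\<integral>\<omega>. (?L \<omega>)\<^sup>2 \<partial>M)\<^sup>2"
    by (auto simp: integrable_distr_eq integral_distr)
  then show ?thesis using m0 by (simp add: gauss4_def)
qed

lemma (in prob_space) integrable_of_power4:
  fixes f g :: "'a \<Rightarrow> real"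
  assumes [measurable]: "f \<in> borel_measurable M" "g \<in> borel_measurable M"
    and f: "integrable M (\<lambda>\<omega>. f \<omega> ^ 4)" and g: "integrable M (\<lambda>\<omega>. g \<omega> ^ 4)"
  shows "integrable M f" "integrable M (\<lambda>\<omega>. (f \<omega>)\<^sup>2)" "integrable M (\<lambda>\<omega>. f \<omega> ^ 3)"
    "integrable M (\<lambda>\<omega>. f \<omega> * g \<omega>)" "integrable M (\<lambda>\<omega>. (f \<omega>)\<^sup>2 * (g \<omega>)\<^sup>2)"
    "integrable M (\<lambda>\<omega>. f \<omega> ^ 3 * g \<omega>)"
    "integrable M (\<lambda>\<omega>. (f \<omega> + g \<omega>) ^ 4)"
proof -
  have 0: "0 \<le> a ^ 4" for a :: real by (rule zero_le_even_power) simp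
  have 2: "a\<^sup>2 \<le> 1 + a ^ 4" for a :: real
  proof -
    have "0 \<le> (a\<^sup>2 - 1)\<^sup>2" by simp
    also have "\<dots> = a ^ 4 - 2 * a\<^sup>2 + 1" by (simp add: power2_eq_square algebra_simps power4_eq_xxxx)
    finally show ?thesis using zero_le_power2[of a] by linarith
  qed
  have 22: "a\<^sup>2 * b\<^sup>2 \<le> a ^ 4 + b ^ 4" for a b :: real
  proof -
    have "0 \<le> (a\<^sup>2 - b\<^sup>2)\<^sup>2" by simp
    also have "\<dots> = a ^ 4 - 2 * (a\<^sup>2 * b\<^sup>2) + b ^ 4" by (simp add: power2_eq_square algebra_simps power4_eq_xxxx)
    finally show ?thesis using mult_nonneg_nonneg[OF zero_le_power2[of a] zero_le_power2[of b]] by linarith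
  qed
  have 11: "\<bar>a * b\<bar> \<le> a\<^sup>2 + b\<^sup>2" for a b :: real
  proof -
    have "2 * (\<bar>a\<bar> * \<bar>b\<bar>) \<le> a\<^sup>2 + b\<^sup>2" using sum_squares_bound[of "\<bar>a\<bar>" "\<bar>b\<bar>"] by simp
    moreover have "0 \<le> \<bar>a\<bar> * \<bar>b\<bar>" by simp
    ultimately show ?thesis unfolding abs_mult by linarith
  qed
  have 1: "\<bar>a\<bar> \<le> 2 + a ^ 4" for a :: real using 11[of 1 a] 2[of a] by simp
  have i1: "integrable M (\<lambda>\<omega>. c + f \<omega> ^ 4)" "integrable M (\<lambda>\<omega>. c + f \<omega> ^ 4 + g \<omega> ^ 4)" for c
    using f g by auto
  show "integrable M f"
    by (rule Bochner_Integration.integrable_bound[OF i1(1)[of 2]]) (use 1 0 in \<open>auto intro!: AE_I2 simp: add_nonneg_nonneg\<close>)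
  show "integrable M (\<lambda>\<omega>. (f \<omega>)\<^sup>2)"
    by (rule Bochner_Integration.integrable_bound[OF i1(1)[of 1]]) (use 2 0 in \<open>auto intro!: AE_I2 simp: add_nonneg_nonneg\<close>)
  have 3: "\<bar>a ^ 3\<bar> \<le> 1 + 2 * a ^ 4" for a :: real
    using 11[of a "a\<^sup>2"] 2[of a] by (simp add: power2_eq_square power3_eq_cube power4_eq_xxxx mult.assoc)
  have "integrable M (\<lambda>\<omega>. 1 + 2 * f \<omega> ^ 4)" using f by auto
  then show "integrable M (\<lambda>\<omega>. f \<omega> ^ 3)"
    by (rule Bochner_Integration.integrable_bound) (use 3 0 in \<open>auto intro!: AE_I2 simp: add_nonneg_nonneg\<close>)
  have 4: "\<bar>a * b\<bar> \<le> 2 + a ^ 4 + b ^ 4" for a b :: real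
    using 11[of a b] 2[of a] 2[of b] by linarith
  show "integrable M (\<lambda>\<omega>. f \<omega> * g \<omega>)"
    by (rule Bochner_Integration.integrable_bound[OF i1(2)[of 2]]) (use 4 0 in \<open>auto intro!: AE_I2 simp: add_nonneg_nonneg\<close>)
  show "integrable M (\<lambda>\<omega>. (f \<omega>)\<^sup>2 * (g \<omega>)\<^sup>2)"
    by (rule Bochner_Integration.integrable_bound[OF i1(2)[of 0]]) (use 22 0 in \<open>auto intro!: AE_I2 simp: add_nonneg_nonneg\<close>)
  have 31: "\<bar>a ^ 3 * b\<bar> \<le> 2 * (a ^ 4 + b ^ 4)" for a b :: real
  proof -
    have "\<bar>a ^ 3 * b\<bar> = \<bar>a\<^sup>2 * (a * b)\<bar>" by (simp add: power2_eq_square power3_eq_cube mult.assoc)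
    also have "\<dots> \<le> (a\<^sup>2)\<^sup>2 + (a * b)\<^sup>2" by (rule 11)
    also have "\<dots> = a ^ 4 + a\<^sup>2 * b\<^sup>2" by (simp add: power_mult_distrib)
    finally show ?thesis using 22[of a b] 0[of b] 0[of a] unfolding distrib_left by linarith
  qed
  have "integrable M (\<lambda>\<omega>. 2 * (f \<omega> ^ 4 + g \<omega> ^ 4))" using f g by auto
  then show "integrable M (\<lambda>\<omega>. f \<omega> ^ 3 * g \<omega>)"
    by (rule Bochner_Integration.integrable_bound) (use 31 0 in \<open>auto intro!: AE_I2 simp: add_nonneg_nonneg\<close>)
  have s4: "(a + b) ^ 4 \<le> 8 * (a ^ 4 + b ^ 4)" for a b :: real
  proof -
    have sq: "(c + d)\<^sup>2 \<le> 2 * (c\<^sup>2 + d\<^sup>2)" for c d :: real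
      using sum_squares_bound[of c d] by (simp add: power2_sum)
    have "(a + b) ^ 4 = ((a + b)\<^sup>2)\<^sup>2" by simp
    also have "\<dots> \<le> (2 * (a\<^sup>2 + b\<^sup>2))\<^sup>2" by (intro power_mono sq) simp
    also have "\<dots> = 4 * (a\<^sup>2 + b\<^sup>2)\<^sup>2" by (simp only: power_mult_distrib) simp
    also have "\<dots> \<le> 4 * (2 * ((a\<^sup>2)\<^sup>2 + (b\<^sup>2)\<^sup>2))" by (intro mult_left_mono sq) simp
    finally show ?thesis by simp
  qed
  have "integrable M (\<lambda>\<omega>. 8 * (f \<omega> ^ 4 + g \<omega> ^ 4))" using f g by auto
  then show "integrable M (\<lambda>\<omega>. (f \<omega> + g \<omega>) ^ 4)"
    by (rule Bochner_Integration.integrable_bound) (use s4 0 in \<open>auto intro!: AE_I2 simp: add_nonneg_nonneg\<close>)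
qed

text \<open>Process and noise are Gaussian separately and independent of each other. In the fourth
  power of the sum the odd mixed moments vanish, and the term with coefficient 6 completes
  \<open>3 * a\<^sup>2 + 3 * b\<^sup>2\<close> to three times the square of the total
  variance.\<close>

lemma (in prob_space) gauss4_add_indep:
  assumes U: "gauss4 M U" and V: "gauss4 M V" and ind: "indep_var borel U borel V"
  shows "gauss4 M (\<lambda>\<omega>. U \<omega> + V \<omega>)" "expectation (\<lambda>\<omega>. U \<omega> * V \<omega>) = 0"
proof -
  have m [measurable]: "U \<in> borel_measurable M" "V \<in> borel_measurable M"
    and i4: "integrable M (\<lambda>\<omega>. U \<omega> ^ 4)" "integrable M (\<lambda>\<omega>. V \<omega> ^ 4)"
    using U V by (auto simp: gauss4_def)
  note iU = integrable_of_power4[OF m i4]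
  note iV = integrable_of_power4[OF m(2,1) i4(2,1)]
  have pow: "indep_var borel (\<lambda>\<omega>. U \<omega> ^ a) borel (\<lambda>\<omega>. V \<omega> ^ b)" for a b :: nat
    using indep_var_compose[OF ind, of "\<lambda>x. x ^ a" borel "\<lambda>x. x ^ b" borel] by (simp add: comp_def)
  have e31: "expectation (\<lambda>\<omega>. U \<omega> ^ 3 * V \<omega>) = 0"
    using indep_var_lebesgue_integral[OF pow[of 3 1]] iU iV V by (simp add: gauss4_def)
  have e13: "expectation (\<lambda>\<omega>. V \<omega> ^ 3 * U \<omega>) = 0"
    using indep_var_lebesgue_integral[OF pow[of 1 3]] iU iV U by (simp add: gauss4_def mult.commute)
  have e22: "expectation (\<lambda>\<omega>. (U \<omega>)\<^sup>2 * (V \<omega>)\<^sup>2) = expectation (\<lambda>\<omega>. (U \<omega>)\<^sup>2) * expectation (\<lambda>\<omega>. (V \<omega>)\<^sup>2)"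
    using indep_var_lebesgue_integral[OF pow[of 2 2]] iU iV by simp
  show e11: "expectation (\<lambda>\<omega>. U \<omega> * V \<omega>) = 0"
    using indep_var_lebesgue_integral[OF ind] iU iV U by (simp add: gauss4_def)
  have x4: "(U \<omega> + V \<omega>) ^ 4 = U \<omega> ^ 4 + V \<omega> ^ 4 + 4 * (U \<omega> ^ 3 * V \<omega>) + 4 * (V \<omega> ^ 3 * U \<omega>) + 6 * ((U \<omega>)\<^sup>2 * (V \<omega>)\<^sup>2)" for \<omega>
    by (simp add: power2_eq_square power3_eq_cube power4_eq_xxxx algebra_simps)
  have "expectation (\<lambda>\<omega>. (U \<omega> + V \<omega>) ^ 4) = expectation (\<lambda>\<omega>. U \<omega> ^ 4) + expectation (\<lambda>\<omega>. V \<omega> ^ 4) +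
      4 * expectation (\<lambda>\<omega>. U \<omega> ^ 3 * V \<omega>) + 4 * expectation (\<lambda>\<omega>. V \<omega> ^ 3 * U \<omega>) +
      6 * expectation (\<lambda>\<omega>. (U \<omega>)\<^sup>2 * (V \<omega>)\<^sup>2)"
    unfolding x4 using i4 iU iV by simp
  moreover have "(U \<omega> + V \<omega>)\<^sup>2 = (U \<omega>)\<^sup>2 + (V \<omega>)\<^sup>2 + 2 * (U \<omega> * V \<omega>)" for \<omega>
    by (simp add: power2_eq_square algebra_simps)
  then have "expectation (\<lambda>\<omega>. (U \<omega> + V \<omega>)\<^sup>2) = expectation (\<lambda>\<omega>. (U \<omega>)\<^sup>2) + expectation (\<lambda>\<omega>. (V \<omega>)\<^sup>2)"
    using iU iV e11 by simp
  ultimately have "expectation (\<lambda>\<omega>. (U \<omega> + V \<omega>) ^ 4) = 3 * (expectation (\<lambda>\<omega>. (U \<omega> + V \<omega>)\<^sup>2))\<^sup>2"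
    using U V e31 e13 e22 by (simp add: gauss4_def power2_eq_square algebra_simps)
  moreover have "expectation (\<lambda>\<omega>. U \<omega> + V \<omega>) = 0" using U V iU iV by (simp add: gauss4_def)
  ultimately show "gauss4 M (\<lambda>\<omega>. U \<omega> + V \<omega>)" using iU by (simp add: gauss4_def)
qed

text \<open>Isserlis' formula is obtained from the fourth moments of \<open>f + g\<close> and \<open>f - g\<close>.\<close>

lemma (in prob_space) isserlis:
  assumes f: "gauss4 M f" and g: "gauss4 M g"
    and p: "gauss4 M (\<lambda>\<omega>. f \<omega> + g \<omega>)" and d: "gauss4 M (\<lambda>\<omega>. f \<omega> - g \<omega>)"
  shows "expectation (\<lambda>\<omega>. (f \<omega>)\<^sup>2 * (g \<omega>)\<^sup>2) =
    expectation (\<lambda>\<omega>. (f \<omega>)\<^sup>2) * expectation (\<lambda>\<omega>. (g \<omega>)\<^sup>2) + 2 * (expectation (\<lambda>\<omega>. f \<omega> * g \<omega>))\<^sup>2"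
proof -
  have m [measurable]: "f \<in> borel_measurable M" "g \<in> borel_measurable M"
    and i4: "integrable M (\<lambda>\<omega>. f \<omega> ^ 4)" "integrable M (\<lambda>\<omega>. g \<omega> ^ 4)"
    and p4: "integrable M (\<lambda>\<omega>. (f \<omega> + g \<omega>) ^ 4)" "integrable M (\<lambda>\<omega>. (f \<omega> - g \<omega>) ^ 4)"
    using assms by (auto simp: gauss4_def)
  note iU = integrable_of_power4[OF m i4]
  note iV = integrable_of_power4[OF m(2,1) i4(2,1)]
  have x4: "(f \<omega> + g \<omega>) ^ 4 + (f \<omega> - g \<omega>) ^ 4 = 2 * f \<omega> ^ 4 + 2 * g \<omega> ^ 4 + 12 * ((f \<omega>)\<^sup>2 * (g \<omega>)\<^sup>2)" for \<omega>
    by (simp add: power2_eq_square power4_eq_xxxx algebra_simps)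
  have "expectation (\<lambda>\<omega>. (f \<omega> + g \<omega>) ^ 4 + (f \<omega> - g \<omega>) ^ 4) =
      2 * expectation (\<lambda>\<omega>. f \<omega> ^ 4) + 2 * expectation (\<lambda>\<omega>. g \<omega> ^ 4) + 12 * expectation (\<lambda>\<omega>. (f \<omega>)\<^sup>2 * (g \<omega>)\<^sup>2)"
    unfolding x4 using i4 iU by simp
  then have 1: "expectation (\<lambda>\<omega>. (f \<omega> + g \<omega>) ^ 4) + expectation (\<lambda>\<omega>. (f \<omega> - g \<omega>) ^ 4) =
      2 * expectation (\<lambda>\<omega>. f \<omega> ^ 4) + 2 * expectation (\<lambda>\<omega>. g \<omega> ^ 4) + 12 * expectation (\<lambda>\<omega>. (f \<omega>)\<^sup>2 * (g \<omega>)\<^sup>2)"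
    using p4 by simp
  have "(f \<omega> + g \<omega>)\<^sup>2 = (f \<omega>)\<^sup>2 + (g \<omega>)\<^sup>2 + 2 * (f \<omega> * g \<omega>)" for \<omega>
    by (simp add: power2_eq_square algebra_simps)
  then have 2: "expectation (\<lambda>\<omega>. (f \<omega> + g \<omega>)\<^sup>2) = expectation (\<lambda>\<omega>. (f \<omega>)\<^sup>2) + expectation (\<lambda>\<omega>. (g \<omega>)\<^sup>2) + 2 * expectation (\<lambda>\<omega>. f \<omega> * g \<omega>)"
    using iU iV by simp
  have "(f \<omega> - g \<omega>)\<^sup>2 = (f \<omega>)\<^sup>2 + (g \<omega>)\<^sup>2 - 2 * (f \<omega> * g \<omega>)" for \<omega>
    by (simp add: power2_eq_square algebra_simps)
  then have 3: "expectation (\<lambda>\<omega>. (f \<omega> - g \<omega>)\<^sup>2) = expectation (\<lambda>\<omega>. (f \<omega>)\<^sup>2) + expectation (\<lambda>\<omega>. (g \<omega>)\<^sup>2) - 2 * expectation (\<lambda>\<omega>. f \<omega> * g \<omega>)"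
    using iU iV by simp
  define a b c where "a = expectation (\<lambda>\<omega>. (f \<omega>)\<^sup>2)" and "b = expectation (\<lambda>\<omega>. (g \<omega>)\<^sup>2)"
    and "c = expectation (\<lambda>\<omega>. f \<omega> * g \<omega>)"
  have "3 * (a + b + 2 * c)\<^sup>2 + 3 * (a + b - 2 * c)\<^sup>2 = 2 * (3 * a\<^sup>2) + 2 * (3 * b\<^sup>2) + 12 * expectation (\<lambda>\<omega>. (f \<omega>)\<^sup>2 * (g \<omega>)\<^sup>2)"
    using 1 assms unfolding gauss4_def 2 3 a_def b_def c_def by (elim conjE) (simp only: 2 3)
  then have "expectation (\<lambda>\<omega>. (f \<omega>)\<^sup>2 * (g \<omega>)\<^sup>2) = a * b + 2 * c\<^sup>2"
    by (simp add: power2_eq_square algebra_simps)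
  then show ?thesis by (simp add: a_def b_def c_def)
qed

section \<open>The observed process\<close>

text \<open>The sample size is fixed and the random design is absent: design points appear as a
  deterministic argument \<open>x\<close>. An expectation over \<open>M\<close> in this locale thus
  plays the part of a conditional moment given the design.\<close>

locale observed = prob_space M
  for M :: "'w measure" +
  fixes Y :: "real^'d::finite \<Rightarrow> 'w \<Rightarrow> real" and K\<^sub>0 :: "real^'d \<Rightarrow> real"
    and \<epsilon> :: "nat \<Rightarrow> 'w \<Rightarrow> real" and \<delta>\<^sub>0 C\<^sub>0 :: real and n :: nat
  assumes Y_gauss: "centered_gaussian M UNIV Y (\<lambda>s t. K\<^sub>0 (s - t))"
    and Y_meas: "measurable_process M Y"
    and \<delta>0_nonneg: "0 \<le> \<delta>\<^sub>0"
    and eps_gauss: "centered_gaussian M {..<n} \<epsilon> (\<lambda>i j. if i = j then \<delta>\<^sub>0 else 0)"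
    and Y_eps_indep: "indep_set (sets (generated M UNIV Y)) (sets (generated M {..<n} \<epsilon>))"
    and K0_bound: "\<bar>K\<^sub>0 t\<bar> \<le> C\<^sub>0 * decay t"
    and n_pos: "0 < n"
begin

lemma C0_nonneg: "0 \<le> C\<^sub>0"
  using K0_bound[of 0] by simp

lemma K0_abs_le: "\<bar>K\<^sub>0 t\<bar> \<le> C\<^sub>0"
  using K0_bound[of t] mult_left_mono[OF decay_le_1[of t] C0_nonneg] by simp

lemma Y_borel [measurable]: "Y t \<in> borel_measurable M"
  using Y_gauss by (auto simp: centered_gaussian_def gaussian_family_def)

lemma eps_borel [measurable]: "i < n \<Longrightarrow> \<epsilon> i \<in> borel_measurable M"
  using eps_gauss by (auto simp: centered_gaussian_def gaussian_family_def)

lemma space_generated [simp]: "space (generated M I Z) = space M"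
  unfolding generated_def by (rule space_measure_of) auto

lemma sets_generated: "sets (generated M I Z) = sigma_sets (space M) {Z i -` B \<inter> space M | i B. i \<in> I \<and> B \<in> sets borel}"
  unfolding generated_def by (rule sets_measure_of) auto

lemma generated_subset:
  assumes "\<And>i. i \<in> I \<Longrightarrow> Z i \<in> borel_measurable M"
  shows "sets (generated M I Z) \<subseteq> sets M"
  unfolding sets_generated using assms by (intro sets.sigma_sets_subset) (auto intro: measurable_sets)

lemma generated_measurable: "i \<in> I \<Longrightarrow> Z i \<in> borel_measurable (generated M I Z)"
  by (rule measurableI) (auto simp: sets_generated intro!: sigma_sets.Basic)

text \<open>The linear span of process and noise. Being closed under sums and differences and
  consisting of \<open>gauss4\<close> variables, it satisfies Isserlis' formula for any two of its
  elements.\<close>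

definition lin :: "('w \<Rightarrow> real) set" where
  "lin = {L. \<exists>J a b. finite J \<and> L = (\<lambda>\<omega>. (\<Sum>s\<in>J. a s * Y s \<omega>) + (\<Sum>i<n. b i * \<epsilon> i \<omega>))}"

lemma linI:
  assumes "finite J" "\<And>\<omega>. L \<omega> = (\<Sum>s\<in>J. a s * Y s \<omega>) + (\<Sum>i<n. b i * \<epsilon> i \<omega>)"
  shows "L \<in> lin"
  unfolding lin_def using assms by (intro CollectI exI[of _ J] exI[of _ a] exI[of _ b]) auto

lemma lin_add:
  assumes "L \<in> lin" "L' \<in> lin" shows "(\<lambda>\<omega>. L \<omega> + L' \<omega>) \<in> lin"
proof -
  obtain J a b where L: "finite J" "L = (\<lambda>\<omega>. (\<Sum>s\<in>J. a s * Y s \<omega>) + (\<Sum>i<n. b i * \<epsilon> i \<omega>))"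
    using assms by (auto simp: lin_def)
  obtain J' a' b' where L': "finite J'" "L' = (\<lambda>\<omega>. (\<Sum>s\<in>J'. a' s * Y s \<omega>) + (\<Sum>i<n. b' i * \<epsilon> i \<omega>))"
    using assms by (auto simp: lin_def)
  let ?a = "\<lambda>s. if s \<in> J then a s else 0" and ?a' = "\<lambda>s. if s \<in> J' then a' s else 0"
  have 1: "(\<Sum>s\<in>J. a s * Y s \<omega>) = (\<Sum>s\<in>J \<union> J'. ?a s * Y s \<omega>)" for \<omega>
    using L(1) L'(1) by (intro sum.mono_neutral_cong_left) auto
  have 2: "(\<Sum>s\<in>J'. a' s * Y s \<omega>) = (\<Sum>s\<in>J \<union> J'. ?a' s * Y s \<omega>)" for \<omega>
    using L(1) L'(1) by (intro sum.mono_neutral_cong_left) auto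
  show ?thesis
  proof (rule linI[of "J \<union> J'" _ "\<lambda>s. ?a s + ?a' s" "\<lambda>i. b i + b' i"])
    show "L \<omega> + L' \<omega> = (\<Sum>s\<in>J \<union> J'. (?a s + ?a' s) * Y s \<omega>) + (\<Sum>i<n. (b i + b' i) * \<epsilon> i \<omega>)" for \<omega>
      unfolding L(2) L'(2) 1 2 by (simp only: distrib_right sum.distrib add_ac)
  qed (use L(1) L'(1) in simp)
qed

lemma lin_scale:
  assumes "L \<in> lin" shows "(\<lambda>\<omega>. c * L \<omega>) \<in> lin"
proof -
  obtain J a b where L: "finite J" "L = (\<lambda>\<omega>. (\<Sum>s\<in>J. a s * Y s \<omega>) + (\<Sum>i<n. b i * \<epsilon> i \<omega>))"
    using assms by (auto simp: lin_def)
  show ?thesis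
    by (rule linI[OF L(1), of _ "\<lambda>s. c * a s" "\<lambda>i. c * b i"])
       (simp only: L(2) distrib_left sum_distrib_left mult.assoc)
qed

lemma lin_Y: "Y t \<in> lin"
  by (rule linI[of "{t}" _ "\<lambda>_. 1" "\<lambda>_. 0"]) simp_all

lemma lin_eps:
  assumes "i < n" shows "\<epsilon> i \<in> lin"
proof -
  have "(\<Sum>j<n. (if j = i then 1 else 0) * \<epsilon> j \<omega>) = (\<Sum>j<n. if j = i then \<epsilon> j \<omega> else 0)" for \<omega>
    by (intro sum.cong) auto
  then show ?thesis
    using assms by (intro linI[of "{}" _ "\<lambda>_. 0" "\<lambda>j. if j = i then 1 else 0"]) simp_all
qed

lemma lin_zero: "(\<lambda>\<omega>. 0) \<in> lin"
  using lin_scale[OF lin_Y[of 0], of 0] by simp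

lemma lin_sum:
  assumes "finite I" "\<And>i. i \<in> I \<Longrightarrow> L i \<in> lin" shows "(\<lambda>\<omega>. \<Sum>i\<in>I. L i \<omega>) \<in> lin"
  using assms by (induction I rule: finite_induct) (auto intro!: lin_zero lin_add)

lemma lin_diff:
  "L \<in> lin \<Longrightarrow> L' \<in> lin \<Longrightarrow> (\<lambda>\<omega>. L \<omega> - L' \<omega>) \<in> lin"
  using lin_add[OF _ lin_scale[of L' "-1"], of L] by simp

lemma indep_Y_eps:
  assumes U: "U \<in> borel_measurable (generated M UNIV Y)"
    and V: "V \<in> borel_measurable (generated M {..<n} \<epsilon>)"
  shows "indep_var borel U borel V"
  unfolding indep_var_eq
proof (intro conjI)
  show "random_variable borel U"
    by (rule measurable_from_subalg[OF _ U]) (use generated_subset[of UNIV Y] in \<open>auto simp: subalgebra_def\<close>)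
  show "random_variable borel V"
    by (rule measurable_from_subalg[OF _ V]) (use generated_subset[of "{..<n}" \<epsilon>] in \<open>auto simp: subalgebra_def\<close>)
  have "sigma_sets (space M) {U -` A \<inter> space M | A. A \<in> sets borel} \<subseteq> sets (generated M UNIV Y)"
    using sets.sigma_sets_subset[of "{U -` A \<inter> space M | A. A \<in> sets borel}" "generated M UNIV Y"]
      measurable_sets[OF U] by auto
  moreover have "sigma_sets (space M) {V -` A \<inter> space M | A. A \<in> sets borel} \<subseteq> sets (generated M {..<n} \<epsilon>)"
    using sets.sigma_sets_subset[of "{V -` A \<inter> space M | A. A \<in> sets borel}" "generated M {..<n} \<epsilon>"]
      measurable_sets[OF V] by auto
  ultimately show "indep_set (sigma_sets (space M) {U -` A \<inter> space M | A. A \<in> sets borel})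
      (sigma_sets (space M) {V -` A \<inter> space M | A. A \<in> sets borel})"
    using Y_eps_indep unfolding indep_set_def
    by (elim indep_sets_mono_sets) (auto split: bool.split)
qed

lemma lin_gauss4:
  assumes "L \<in> lin" shows "gauss4 M L"
proof -
  obtain J a b where L: "finite J" "L = (\<lambda>\<omega>. (\<Sum>s\<in>J. a s * Y s \<omega>) + (\<Sum>i<n. b i * \<epsilon> i \<omega>))"
    using assms by (auto simp: lin_def)
  have "indep_var borel (\<lambda>\<omega>. \<Sum>s\<in>J. a s * Y s \<omega>) borel (\<lambda>\<omega>. \<Sum>i<n. b i * \<epsilon> i \<omega>)"
    by (intro indep_Y_eps borel_measurable_sum borel_measurable_times borel_measurable_const generated_measurable) auto
  from gauss4_add_indep(1)[OF _ _ this] show ?thesis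
    unfolding L(2) using L(1) by (auto intro: centered_gaussian_gauss4[OF Y_gauss] centered_gaussian_gauss4[OF eps_gauss])
qed

lemma lin_borel [measurable_dest]: "L \<in> lin \<Longrightarrow> L \<in> borel_measurable M"
  using lin_gauss4 by (auto simp: gauss4_def)

lemma lin_integrable:
  assumes "L \<in> lin" "L' \<in> lin"
  shows "integrable M L" "integrable M (\<lambda>\<omega>. (L \<omega>)\<^sup>2)" "integrable M (\<lambda>\<omega>. L \<omega> * L' \<omega>)"
    "integrable M (\<lambda>\<omega>. (L \<omega>)\<^sup>2 * (L' \<omega>)\<^sup>2)" "integrable M (\<lambda>\<omega>. L \<omega> ^ 4)"
proof -
  have m: "L \<in> borel_measurable M" "L' \<in> borel_measurable M"
    and i4: "integrable M (\<lambda>\<omega>. L \<omega> ^ 4)" "integrable M (\<lambda>\<omega>. L' \<omega> ^ 4)"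
    using lin_gauss4[OF assms(1)] lin_gauss4[OF assms(2)] by (simp_all add: gauss4_def)
  show "integrable M L" "integrable M (\<lambda>\<omega>. (L \<omega>)\<^sup>2)" "integrable M (\<lambda>\<omega>. L \<omega> * L' \<omega>)"
    "integrable M (\<lambda>\<omega>. (L \<omega>)\<^sup>2 * (L' \<omega>)\<^sup>2)"
    by (rule integrable_of_power4[OF m i4])+
  show "integrable M (\<lambda>\<omega>. L \<omega> ^ 4)" by (rule i4)
qed

lemma lin_isserlis:
  assumes "L \<in> lin" "L' \<in> lin"
  shows "expectation (\<lambda>\<omega>. (L \<omega>)\<^sup>2 * (L' \<omega>)\<^sup>2) =
    expectation (\<lambda>\<omega>. (L \<omega>)\<^sup>2) * expectation (\<lambda>\<omega>. (L' \<omega>)\<^sup>2) + 2 * (expectation (\<lambda>\<omega>. L \<omega> * L' \<omega>))\<^sup>2"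
  by (intro isserlis lin_gauss4 lin_add lin_diff assms)

lemma cov_YY: "expectation (\<lambda>\<omega>. Y s \<omega> * Y t \<omega>) = K\<^sub>0 (s - t)"
  using Y_gauss by (simp add: centered_gaussian_def)

lemma cov_Y_eps: "i < n \<Longrightarrow> expectation (\<lambda>\<omega>. Y s \<omega> * \<epsilon> i \<omega>) = 0"
proof -
  assume i: "i < n"
  have "gauss4 M (Y s)" "gauss4 M (\<epsilon> i)" using lin_gauss4 lin_Y lin_eps i by auto
  then show ?thesis
    by (rule gauss4_add_indep(2)) (use i in \<open>auto intro!: indep_Y_eps generated_measurable\<close>)
qed

lemma cov_eps: "i < n \<Longrightarrow> j < n \<Longrightarrow> expectation (\<lambda>\<omega>. \<epsilon> i \<omega> * \<epsilon> j \<omega>) = (if i = j then \<delta>\<^sub>0 else 0)"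
  using eps_gauss by (simp add: centered_gaussian_def)

lemma cov_sum:
  assumes "finite I" "finite J" "\<And>i. i \<in> I \<Longrightarrow> L i \<in> lin" "\<And>j. j \<in> J \<Longrightarrow> L' j \<in> lin"
  shows "expectation (\<lambda>\<omega>. (\<Sum>i\<in>I. a i * L i \<omega>) * (\<Sum>j\<in>J. b j * L' j \<omega>)) =
    (\<Sum>i\<in>I. \<Sum>j\<in>J. a i * b j * expectation (\<lambda>\<omega>. L i \<omega> * L' j \<omega>))"
proof -
  have int: "integrable M (\<lambda>\<omega>. a i * b j * (L i \<omega> * L' j \<omega>))" if "i \<in> I" "j \<in> J" for i j
    using lin_integrable(3) assms that by auto
  have "(\<lambda>\<omega>. (\<Sum>i\<in>I. a i * L i \<omega>) * (\<Sum>j\<in>J. b j * L' j \<omega>)) =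
      (\<lambda>\<omega>. \<Sum>i\<in>I. \<Sum>j\<in>J. a i * b j * (L i \<omega> * L' j \<omega>))"
    unfolding sum_product by (intro ext sum.cong) (auto simp: mult_ac)
  then show ?thesis
    using int assms(1,2) by (simp add: Bochner_Integration.integral_sum Bochner_Integration.integrable_sum)
qed

section \<open>Covariances of the observations\<close>

definition obs :: "(nat \<Rightarrow> real^'d) \<Rightarrow> nat \<Rightarrow> 'w \<Rightarrow> real" where
  "obs x i \<omega> = Y (x i) \<omega> + \<epsilon> i \<omega>"

lemma lin_obs: "i < n \<Longrightarrow> obs x i \<in> lin"
  unfolding obs_def[abs_def] by (intro lin_add lin_Y lin_eps)

lemma cov_obs:
  assumes "i < n" "j < n"
  shows "expectation (\<lambda>\<omega>. obs x i \<omega> * obs x j \<omega>) = K\<^sub>0 (x i - x j) + (if i = j then \<delta>\<^sub>0 else 0)"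
proof -
  have i: "integrable M (\<lambda>\<omega>. Y (x i) \<omega> * Y (x j) \<omega>)" "integrable M (\<lambda>\<omega>. Y (x i) \<omega> * \<epsilon> j \<omega>)"
    "integrable M (\<lambda>\<omega>. Y (x j) \<omega> * \<epsilon> i \<omega>)" "integrable M (\<lambda>\<omega>. \<epsilon> i \<omega> * \<epsilon> j \<omega>)"
    by (intro lin_integrable(3) lin_Y lin_eps assms)+
  have "(\<lambda>\<omega>. obs x i \<omega> * obs x j \<omega>) = (\<lambda>\<omega>. Y (x i) \<omega> * Y (x j) \<omega> + Y (x i) \<omega> * \<epsilon> j \<omega> + Y (x j) \<omega> * \<epsilon> i \<omega> + \<epsilon> i \<omega> * \<epsilon> j \<omega>)"
    by (auto simp: obs_def algebra_simps)
  then show ?thesis using i assms by (simp add: cov_YY cov_Y_eps cov_eps)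
qed

lemma cov_obs_Y:
  assumes "i < n"
  shows "expectation (\<lambda>\<omega>. Y t \<omega> * obs x i \<omega>) = K\<^sub>0 (t - x i)"
proof -
  have i: "integrable M (\<lambda>\<omega>. Y t \<omega> * Y (x i) \<omega>)" "integrable M (\<lambda>\<omega>. Y t \<omega> * \<epsilon> i \<omega>)"
    by (intro lin_integrable(3) lin_Y lin_eps assms)+
  then show ?thesis using assms by (simp add: obs_def distrib_left cov_YY cov_Y_eps)
qed

text \<open>A smoothed count of the points of \<open>I\<close> close to \<open>x i\<close>. The
  index \<open>i\<close> itself contributes 1 if it belongs to \<open>I\<close>.\<close>

definition near :: "nat set \<Rightarrow> (nat \<Rightarrow> real^'d) \<Rightarrow> nat \<Rightarrow> real" where
  "near I x i = (\<Sum>j\<in>I. decay (x i - x j))"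

lemma near_nonneg: "0 \<le> near I x i"
  by (simp add: near_def sum_nonneg)

lemma abs_cov_obs_le:
  assumes "i < n" "j < n"
  shows "\<bar>expectation (\<lambda>\<omega>. obs x i \<omega> * obs x j \<omega>)\<bar> \<le> (C\<^sub>0 + \<delta>\<^sub>0) * decay (x i - x j)"
proof (cases "i = j")
  case True
  then show ?thesis using assms K0_bound[of 0] \<delta>0_nonneg by (simp add: cov_obs)
next
  case False
  have "C\<^sub>0 * decay (x i - x j) \<le> (C\<^sub>0 + \<delta>\<^sub>0) * decay (x i - x j)"
    using \<delta>0_nonneg by (intro mult_right_mono) auto
  then show ?thesis using assms False K0_bound[of "x i - x j"] by (simp add: cov_obs)
qed

text \<open>Schur's test for the symmetric matrix of \<open>decay\<close> values. The row sums are
  kept as weights under the sum, since their maximum is unbounded as the sample grows.\<close>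

lemma var_obs_sum_le:
  assumes "I \<subseteq> {..<n}"
  shows "expectation (\<lambda>\<omega>. (\<Sum>i\<in>I. z i * obs x i \<omega>)\<^sup>2) \<le> (C\<^sub>0 + \<delta>\<^sub>0) * (\<Sum>i\<in>I. (z i)\<^sup>2 * near I x i)"
proof -
  have fin: "finite I" using assms finite_subset by blast
  have c: "0 \<le> C\<^sub>0 + \<delta>\<^sub>0" using C0_nonneg \<delta>0_nonneg by simp
  let ?D = "\<lambda>i j. (z i)\<^sup>2 * decay (x i - x j)"
  have "expectation (\<lambda>\<omega>. (\<Sum>i\<in>I. z i * obs x i \<omega>)\<^sup>2) =
      (\<Sum>i\<in>I. \<Sum>j\<in>I. z i * z j * expectation (\<lambda>\<omega>. obs x i \<omega> * obs x j \<omega>))"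
    unfolding power2_eq_square using assms fin by (intro cov_sum lin_obs) auto
  also have "\<dots> \<le> (\<Sum>i\<in>I. \<Sum>j\<in>I. (C\<^sub>0 + \<delta>\<^sub>0) * (?D i j / 2 + ?D j i / 2))"
  proof (intro sum_mono)
    fix i j assume "i \<in> I" "j \<in> I"
    then have ij: "i < n" "j < n" using assms by auto
    have "z i * z j * expectation (\<lambda>\<omega>. obs x i \<omega> * obs x j \<omega>) \<le>
        \<bar>z i * z j\<bar> * \<bar>expectation (\<lambda>\<omega>. obs x i \<omega> * obs x j \<omega>)\<bar>"
      by (simp add: abs_mult[symmetric])
    also have "\<dots> \<le> ((z i)\<^sup>2 + (z j)\<^sup>2) / 2 * ((C\<^sub>0 + \<delta>\<^sub>0) * decay (x i - x j))"
      using sum_squares_bound[of "\<bar>z i\<bar>" "\<bar>z j\<bar>"] abs_cov_obs_le[OF ij, of x] c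
      by (intro mult_mono) (auto simp: abs_mult)
    finally show "z i * z j * expectation (\<lambda>\<omega>. obs x i \<omega> * obs x j \<omega>) \<le> (C\<^sub>0 + \<delta>\<^sub>0) * (?D i j / 2 + ?D j i / 2)"
      by (simp add: decay_diff_commute[of "x j"] algebra_simps add_divide_distrib)
  qed
  also have "\<dots> = (C\<^sub>0 + \<delta>\<^sub>0) * ((\<Sum>i\<in>I. \<Sum>j\<in>I. ?D i j / 2) + (\<Sum>i\<in>I. \<Sum>j\<in>I. ?D j i / 2))"
    by (simp only: sum.distrib distrib_left sum_distrib_left)
  also have "(\<Sum>i\<in>I. \<Sum>j\<in>I. ?D j i / 2) = (\<Sum>i\<in>I. \<Sum>j\<in>I. ?D i j / 2)"
    by (rule sum.swap)
  also have "(\<Sum>i\<in>I. \<Sum>j\<in>I. ?D i j / 2) = (\<Sum>i\<in>I. (z i)\<^sup>2 * near I x i) / 2"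
    by (simp add: near_def sum_distrib_left sum_divide_distrib)
  finally show ?thesis by simp
qed

text \<open>By Isserlis' formula the covariance of two squares is twice the square of the
  covariance.\<close>

lemma var_quadratic_form:
  fixes b :: "'i \<Rightarrow> real"
  assumes "finite I" and "\<And>i. i \<in> I \<Longrightarrow> L i \<in> lin"
  defines "m \<equiv> \<Sum>i\<in>I. b i * expectation (\<lambda>\<omega>. (L i \<omega>)\<^sup>2)"
  shows "expectation (\<lambda>\<omega>. ((\<Sum>i\<in>I. b i * (L i \<omega>)\<^sup>2) - m)\<^sup>2) =
      2 * (\<Sum>i\<in>I. \<Sum>j\<in>I. b i * b j * (expectation (\<lambda>\<omega>. L i \<omega> * L j \<omega>))\<^sup>2)"
    and "integrable M (\<lambda>\<omega>. ((\<Sum>i\<in>I. b i * (L i \<omega>)\<^sup>2) - m)\<^sup>2)"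
    and "expectation (\<lambda>\<omega>. \<Sum>i\<in>I. b i * (L i \<omega>)\<^sup>2) = m"
    and "integrable M (\<lambda>\<omega>. \<Sum>i\<in>I. b i * (L i \<omega>)\<^sup>2)"
proof -
  let ?S = "\<lambda>\<omega>. \<Sum>i\<in>I. b i * (L i \<omega>)\<^sup>2" and ?v = "\<lambda>i. expectation (\<lambda>\<omega>. (L i \<omega>)\<^sup>2)"
  have i2: "integrable M (\<lambda>\<omega>. (L i \<omega>)\<^sup>2)" if "i \<in> I" for i using lin_integrable(2) assms that by auto
  have i4: "integrable M (\<lambda>\<omega>. b i * b j * ((L i \<omega>)\<^sup>2 * (L j \<omega>)\<^sup>2))" if "i \<in> I" "j \<in> I" for i j
    using lin_integrable(4) assms that by auto
  show iS: "integrable M ?S" using i2 by auto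
  show ES: "expectation ?S = m" unfolding m_def using i2 by (subst Bochner_Integration.integral_sum) auto
  have S2: "(?S \<omega>)\<^sup>2 = (\<Sum>i\<in>I. \<Sum>j\<in>I. b i * b j * ((L i \<omega>)\<^sup>2 * (L j \<omega>)\<^sup>2))" for \<omega>
    unfolding power2_eq_square[of "?S \<omega>"] sum_product by (intro sum.cong) (auto simp: mult_ac)
  have iS2: "integrable M (\<lambda>\<omega>. (?S \<omega>)\<^sup>2)" unfolding S2 using i4 by auto
  have "expectation (\<lambda>\<omega>. (?S \<omega>)\<^sup>2) = (\<Sum>i\<in>I. \<Sum>j\<in>I. b i * b j * expectation (\<lambda>\<omega>. (L i \<omega>)\<^sup>2 * (L j \<omega>)\<^sup>2))"
    unfolding S2 using i4 by (simp add: Bochner_Integration.integral_sum Bochner_Integration.integrable_sum)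
  also have "\<dots> = (\<Sum>i\<in>I. \<Sum>j\<in>I. (b i * ?v i) * (b j * ?v j) + 2 * (b i * b j * (expectation (\<lambda>\<omega>. L i \<omega> * L j \<omega>))\<^sup>2))"
    using assms(2) by (intro sum.cong refl) (simp add: lin_isserlis algebra_simps)
  also have "\<dots> = m * m + 2 * (\<Sum>i\<in>I. \<Sum>j\<in>I. b i * b j * (expectation (\<lambda>\<omega>. L i \<omega> * L j \<omega>))\<^sup>2)"
    unfolding m_def sum_product by (simp add: sum.distrib sum_distrib_left)
  finally have E2: "expectation (\<lambda>\<omega>. (?S \<omega>)\<^sup>2) = m * m + 2 * (\<Sum>i\<in>I. \<Sum>j\<in>I. b i * b j * (expectation (\<lambda>\<omega>. L i \<omega> * L j \<omega>))\<^sup>2)" .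
  have eq: "(?S \<omega> - m)\<^sup>2 = (?S \<omega>)\<^sup>2 - 2 * m * ?S \<omega> + m\<^sup>2" for \<omega>
    by (simp add: power2_diff)
  show "integrable M (\<lambda>\<omega>. (?S \<omega> - m)\<^sup>2)" unfolding eq using iS iS2 by auto
  show "expectation (\<lambda>\<omega>. (?S \<omega> - m)\<^sup>2) = 2 * (\<Sum>i\<in>I. \<Sum>j\<in>I. b i * b j * (expectation (\<lambda>\<omega>. L i \<omega> * L j \<omega>))\<^sup>2)"
    unfolding eq using iS iS2 ES E2 by (simp add: prob_space power2_eq_square)
qed

end

section \<open>Conditional moments given the design\<close>

lemma power4_add_le: "(a + b) ^ 4 \<le> 8 * (a ^ 4 + b ^ 4)" for a b :: real
proof -
  have sq: "(c + d)\<^sup>2 \<le> 2 * (c\<^sup>2 + d\<^sup>2)" for c d :: real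
    using sum_squares_bound[of c d] by (simp add: power2_sum)
  have "(a + b) ^ 4 = ((a + b)\<^sup>2)\<^sup>2" by simp
  also have "\<dots> \<le> (2 * (a\<^sup>2 + b\<^sup>2))\<^sup>2" by (intro power_mono sq) simp
  also have "\<dots> = 4 * (a\<^sup>2 + b\<^sup>2)\<^sup>2" by (simp only: power_mult_distrib) simp
  also have "\<dots> \<le> 4 * (2 * ((a\<^sup>2)\<^sup>2 + (b\<^sup>2)\<^sup>2))" by (intro mult_left_mono sq) simp
  finally show ?thesis by simp
qed

lemma power4_add3_le: "(a + b + c) ^ 4 \<le> 64 * (a ^ 4 + b ^ 4 + c ^ 4)" for a b c :: real
proof -
  have "0 \<le> c ^ 4" by (rule zero_le_even_power) simp
  then have "(a + b) ^ 4 + c ^ 4 \<le> 8 * (a ^ 4 + b ^ 4) + 8 * c ^ 4"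
    by (intro add_mono power4_add_le) auto
  then have "8 * ((a + b) ^ 4 + c ^ 4) \<le> 8 * (8 * (a ^ 4 + b ^ 4) + 8 * c ^ 4)"
    by (intro mult_left_mono) auto
  then have "(a + b + c) ^ 4 \<le> 8 * (8 * (a ^ 4 + b ^ 4) + 8 * c ^ 4)"
    by (rule order_trans[OF power4_add_le])
  then show ?thesis by (simp add: distrib_left)
qed

lemma square_diff_le: "(a - b)\<^sup>2 \<le> 2 * a\<^sup>2 + 2 * b\<^sup>2" for a b :: real
  using sum_squares_bound[of a "- b"] by (simp add: power2_diff)

lemma power_le_fact_exp:
  fixes z :: real
  assumes "0 \<le> z" shows "z ^ m \<le> fact m * exp z"
proof -
  have "z ^ m / fact m \<le> (\<Sum>i<Suc m. z ^ i / fact i)"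
    using assms by (simp add: sum_nonneg)
  also have "\<dots> = (\<Sum>i<Suc m. z ^ i /\<^sub>R fact i)"
    by (intro sum.cong) (auto simp: divide_inverse mult.commute)
  also have "\<dots> \<le> exp z"
    unfolding exp_def using assms
    by (intro sum_le_suminf[OF summable_exp_generic]) (auto intro!: mult_nonneg_nonneg)
  finally show ?thesis by (simp add: field_simps)
qed

lemma measurable_design_component [measurable (raw)]:
  fixes j n :: nat
  assumes "j < n" shows "(\<lambda>x. x j) \<in> borel_measurable (design n :: (nat \<Rightarrow> real^'d::finite) measure)"
proof -
  have "(\<lambda>x. x j) \<in> measurable (design n) (unif n :: (real^'d) measure)"
    using assms by (intro measurable_component_singleton) simp
  then show ?thesis by (simp cong: measurable_cong_sets)
qed

locale model = observed M Y K\<^sub>0 \<epsilon> \<delta>\<^sub>0 C\<^sub>0 n + krig k A C \<delta>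
  for M :: "'w measure" and Y :: "real^'d::finite \<Rightarrow> 'w \<Rightarrow> real" and K\<^sub>0 :: "real^'d \<Rightarrow> real"
    and \<epsilon> :: "nat \<Rightarrow> 'w \<Rightarrow> real" and \<delta>\<^sub>0 C\<^sub>0 :: real and n :: nat
    and k :: "real^'d \<Rightarrow> real" and A C \<delta> :: real
begin

definition S\<^sub>0 :: real where "S\<^sub>0 = C\<^sub>0 + \<delta>\<^sub>0"

lemma S0_nonneg: "0 \<le> S\<^sub>0"
  using C0_nonneg \<delta>0_nonneg by (simp add: S\<^sub>0_def)

definition resid :: "nat set \<Rightarrow> (nat \<Rightarrow> real^'d) \<Rightarrow> real^'d \<Rightarrow> 'w \<Rightarrow> real" where
  "resid I x t \<omega> = Y t \<omega> - (\<Sum>j\<in>I. weight I x t j * obs x j \<omega>)"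

text \<open>The weights come from the model \<open>k\<close>, the mean from the true law. For a
  wrong model this is not the kriging variance computed from \<open>k\<close>, so every bound on it
  has to go through the true covariance.\<close>

definition phi :: "nat set \<Rightarrow> (nat \<Rightarrow> real^'d) \<Rightarrow> real^'d \<Rightarrow> real" where
  "phi I x t = expectation (\<lambda>\<omega>. (resid I x t \<omega>)\<^sup>2)"

lemma phi_nonneg: "0 \<le> phi I x t"
  unfolding phi_def by (intro integral_nonneg_AE) simp

lemma finite_below: "I \<subseteq> {..<n} \<Longrightarrow> finite I"
  using finite_subset by blast

lemma lin_resid: "I \<subseteq> {..<n} \<Longrightarrow> resid I x t \<in> lin"
  unfolding resid_def[abs_def] by (intro lin_diff lin_Y lin_sum lin_scale lin_obs finite_below) auto

text \<open>The algebra \<open>G\<close> is left open because two instances are needed: that of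
  \<open>M\<close>, and the one generated by process and noise alone, which is independent of the
  design.\<close>

lemma measurable_Y_compose:
  assumes G: "sets (generated M UNIV Y) \<subseteq> sets G" "space G = space M"
    and \<tau> [measurable]: "\<tau> \<in> borel_measurable N"
  shows "(\<lambda>(p, \<omega>). Y (\<tau> p) \<omega>) \<in> borel_measurable (N \<Otimes>\<^sub>M G)"
proof -
  have "(\<lambda>\<omega>. \<omega>) \<in> measurable G (generated M UNIV Y)"
  proof (rule measurableI)
    fix B assume B: "B \<in> sets (generated M UNIV Y)"
    then have "B \<subseteq> space G" using sets.sets_into_space[OF B] G(2) by simp
    then have "(\<lambda>\<omega>. \<omega>) -` B \<inter> space G = B" by auto
    then show "(\<lambda>\<omega>. \<omega>) -` B \<inter> space G \<in> sets G" using B G(1) by auto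
  qed (simp add: G(2))
  then have "(\<lambda>(p, \<omega>). (\<tau> p, \<omega>)) \<in> measurable (N \<Otimes>\<^sub>M G) (borel \<Otimes>\<^sub>M generated M UNIV Y)"
    by (auto simp: case_prod_beta' intro!: measurable_Pair measurable_compose[OF measurable_fst] measurable_compose[OF measurable_snd])
  from measurable_compose[OF this Y_meas[unfolded measurable_process_def]]
  show ?thesis by (simp add: case_prod_beta')
qed

lemma measurable_resid:
  assumes G: "sets (generated M UNIV Y) \<subseteq> sets G" "space G = space M"
    and eps: "\<And>i. i < n \<Longrightarrow> \<epsilon> i \<in> borel_measurable G"
    and I: "I \<subseteq> {..<n}"
    and \<xi>: "\<And>j. j \<in> I \<Longrightarrow> (\<lambda>p. \<xi> p j) \<in> borel_measurable N" and \<tau>: "\<tau> \<in> borel_measurable N"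
  shows "(\<lambda>(p, \<omega>). resid I (\<xi> p) (\<tau> p) \<omega>) \<in> borel_measurable (N \<Otimes>\<^sub>M G)"
proof -
  have w: "(\<lambda>p. weight I (\<xi> p) (\<tau> p) j) \<in> borel_measurable N" if "j \<in> I" for j
    unfolding weight_def
    by (intro borel_measurable_solution finite_below[OF I] that \<xi> measurable_compose[OF _ k_measurable]
        borel_measurable_diff \<tau>)
  have o: "(\<lambda>(p, \<omega>). obs (\<xi> p) j \<omega>) \<in> borel_measurable (N \<Otimes>\<^sub>M G)" if "j \<in> I" for j
  proof -
    have "(\<lambda>q. \<epsilon> j (snd q)) \<in> borel_measurable (N \<Otimes>\<^sub>M G)"
      by (rule measurable_compose[OF measurable_snd eps]) (use I that in auto)
    then show ?thesis
      using measurable_Y_compose[OF G \<xi>[OF that]]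
      by (auto simp: obs_def case_prod_beta')
  qed
  have "(\<lambda>(p, \<omega>). resid I (\<xi> p) (\<tau> p) \<omega>) =
      (\<lambda>q. (case q of (p, \<omega>) \<Rightarrow> Y (\<tau> p) \<omega>) - (\<Sum>j\<in>I. weight I (\<xi> (fst q)) (\<tau> (fst q)) j * (case q of (p, \<omega>) \<Rightarrow> obs (\<xi> p) j \<omega>)))"
    by (auto simp: resid_def)
  also have "\<dots> \<in> borel_measurable (N \<Otimes>\<^sub>M G)"
    by (intro borel_measurable_diff borel_measurable_sum borel_measurable_times measurable_Y_compose[OF G \<tau>] o
        measurable_compose[OF measurable_fst w])
  finally show ?thesis .
qed

lemma M_generated: "sets (generated M UNIV Y) \<subseteq> sets M" "space M = space M"
  using generated_subset[of UNIV Y] by auto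

lemma borel_measurable_phi:
  assumes "I \<subseteq> {..<n}" "\<And>j. j \<in> I \<Longrightarrow> (\<lambda>p. \<xi> p j) \<in> borel_measurable N" "\<tau> \<in> borel_measurable N"
  shows "(\<lambda>p. phi I (\<xi> p) (\<tau> p)) \<in> borel_measurable N"
proof -
  have "(\<lambda>(p, \<omega>). (resid I (\<xi> p) (\<tau> p) \<omega>)\<^sup>2) \<in> borel_measurable (N \<Otimes>\<^sub>M M)"
    using measurable_resid[OF M_generated _ assms] by (simp add: case_prod_beta')
  then show ?thesis unfolding phi_def by (rule borel_measurable_lebesgue_integral)
qed

lemma phi_le:
  assumes I: "I \<subseteq> {..<n}"
  shows "phi I x t \<le> 2 * C\<^sub>0 + 2 * S\<^sub>0 * (\<Sum>j\<in>I. (weight I x t j)\<^sup>2 * near I x j)"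
proof -
  let ?P = "\<lambda>\<omega>. \<Sum>j\<in>I. weight I x t j * obs x j \<omega>"
  have P: "?P \<in> lin" by (intro lin_sum lin_scale lin_obs finite_below[OF I]) (use I in auto)
  have "phi I x t \<le> expectation (\<lambda>\<omega>. 2 * (Y t \<omega>)\<^sup>2 + 2 * (?P \<omega>)\<^sup>2)"
    unfolding phi_def
    by (intro integral_mono lin_integrable(2)[OF lin_resid[OF I] lin_zero] Bochner_Integration.integrable_add
        integrable_mult_right lin_integrable(2)[OF lin_Y lin_zero] lin_integrable(2)[OF P lin_zero])
       (simp add: resid_def square_diff_le)
  also have "\<dots> = 2 * expectation (\<lambda>\<omega>. (Y t \<omega>)\<^sup>2) + 2 * expectation (\<lambda>\<omega>. (?P \<omega>)\<^sup>2)"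
    using lin_integrable(2)[OF lin_Y lin_zero] lin_integrable(2)[OF P lin_zero] by simp
  also have "expectation (\<lambda>\<omega>. (Y t \<omega>)\<^sup>2) \<le> C\<^sub>0"
    using cov_YY[of t t] K0_abs_le[of 0] by (simp add: power2_eq_square)
  also have "expectation (\<lambda>\<omega>. (?P \<omega>)\<^sup>2) \<le> S\<^sub>0 * (\<Sum>j\<in>I. (weight I x t j)\<^sup>2 * near I x j)"
    unfolding S\<^sub>0_def by (rule var_obs_sum_le[OF I])
  finally show ?thesis by simp
qed

text \<open>Two applications of the weighted Cauchy-Schwarz inequality, with the squared weights as
  a measure of total mass at most \<open>A / C\<close>. The weights stay squared in the result, so
  that averaging over \<open>t\<close> gains a factor 1 / \<open>n\<close> per index.\<close>

lemma phi_power4_le: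
  assumes I: "I \<subseteq> {..<n}"
  shows "phi I x t ^ 4 \<le> 8 * (2 * C\<^sub>0) ^ 4 + 8 * (2 * S\<^sub>0) ^ 4 * (A / C) ^ 3 * (\<Sum>j\<in>I. (weight I x t j)\<^sup>2 * near I x j ^ 4)"
proof -
  let ?w = "\<lambda>j. (weight I x t j)\<^sup>2" and ?h = "near I x"
  let ?s = "\<Sum>j\<in>I. ?w j * ?h j" and ?W = "\<Sum>j\<in>I. ?w j"
  have fin: "finite I" by (rule finite_below[OF I])
  have W: "0 \<le> ?W" "?W \<le> A / C" using weight_norm_le[OF fin] by (auto simp: sum_nonneg)
  have s0: "0 \<le> ?s" by (intro sum_nonneg mult_nonneg_nonneg near_nonneg) auto
  have 1: "?s\<^sup>2 \<le> ?W * (\<Sum>j\<in>I. ?w j * (?h j)\<^sup>2)"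
    by (rule weighted_square_sum_le) auto
  have 2: "(\<Sum>j\<in>I. ?w j * (?h j)\<^sup>2)\<^sup>2 \<le> ?W * (\<Sum>j\<in>I. ?w j * ((?h j)\<^sup>2)\<^sup>2)"
    by (rule weighted_square_sum_le) auto
  have "?s ^ 4 = (?s\<^sup>2)\<^sup>2" by simp
  also have "\<dots> \<le> (?W * (\<Sum>j\<in>I. ?w j * (?h j)\<^sup>2))\<^sup>2" by (intro power_mono 1) simp
  also have "\<dots> = ?W\<^sup>2 * (\<Sum>j\<in>I. ?w j * (?h j)\<^sup>2)\<^sup>2" by (simp add: power_mult_distrib)
  also have "\<dots> \<le> ?W\<^sup>2 * (?W * (\<Sum>j\<in>I. ?w j * ((?h j)\<^sup>2)\<^sup>2))" by (intro mult_left_mono 2) simp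
  also have "\<dots> = ?W ^ 3 * (\<Sum>j\<in>I. ?w j * ?h j ^ 4)" by (simp add: power3_eq_cube power2_eq_square[of ?W] mult.assoc)
  also have "\<dots> \<le> (A / C) ^ 3 * (\<Sum>j\<in>I. ?w j * ?h j ^ 4)"
    by (intro mult_right_mono power_mono W sum_nonneg mult_nonneg_nonneg) auto
  finally have s4: "?s ^ 4 \<le> (A / C) ^ 3 * (\<Sum>j\<in>I. ?w j * ?h j ^ 4)" .
  have "phi I x t ^ 4 \<le> (2 * C\<^sub>0 + 2 * S\<^sub>0 * ?s) ^ 4"
    by (intro power_mono phi_le[OF I] phi_nonneg)
  also have "\<dots> \<le> 8 * ((2 * C\<^sub>0) ^ 4 + (2 * S\<^sub>0 * ?s) ^ 4)" by (rule power4_add_le)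
  also have "(2 * S\<^sub>0 * ?s) ^ 4 = (2 * S\<^sub>0) ^ 4 * ?s ^ 4" by (rule power_mult_distrib)
  also have "\<dots> \<le> (2 * S\<^sub>0) ^ 4 * ((A / C) ^ 3 * (\<Sum>j\<in>I. ?w j * ?h j ^ 4))"
    by (intro mult_left_mono s4) simp
  finally show ?thesis by (simp only: distrib_left mult.assoc)
qed

definition c4 :: real where
  "c4 = 8 * (2 * C\<^sub>0) ^ 4 + 8 * (2 * S\<^sub>0) ^ 4 * (A / C) ^ 3 * (\<kappa> / C)"

lemma c4_nonneg: "0 \<le> c4"
  using \<kappa>_nonneg A_pos C_pos S0_nonneg C0_nonneg by (simp add: c4_def)

lemma near_le: "finite I \<Longrightarrow> near I x j \<le> card I"
  unfolding near_def using sum_bounded_above[of I "\<lambda>i. decay (x j - x i)" 1] by (simp add: decay_le_1)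

lemma phi_bounded:
  assumes I: "I \<subseteq> {..<n}"
  shows "phi I x t \<le> 2 * C\<^sub>0 + 2 * S\<^sub>0 * (A / C * n)"
proof -
  have fin: "finite I" by (rule finite_below[OF I])
  have "real (card I) \<le> real n" using card_mono[OF finite_lessThan I] by simp
  then have "near I x j \<le> n" for j using near_le[OF fin, of x j] by linarith
  then have "(\<Sum>j\<in>I. (weight I x t j)\<^sup>2 * near I x j) \<le> (\<Sum>j\<in>I. (weight I x t j)\<^sup>2 * n)"
    by (intro sum_mono mult_left_mono) auto
  also have "\<dots> \<le> A / C * n" unfolding sum_distrib_right[symmetric]
    by (intro mult_right_mono weight_norm_le fin) auto
  finally show ?thesis using phi_le[OF I, of x t] mult_left_mono[of _ _ "2 * S\<^sub>0"] S0_nonneg by fastforce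
qed

text \<open>It grows with \<open>n\<close>. It is used for boundedness and integrability conditions
  and never enters a final estimate.\<close>

definition phimax :: real where "phimax = 2 * C\<^sub>0 + 2 * S\<^sub>0 * (A / C * n)"

lemma abs_phi_le: "I \<subseteq> {..<n} \<Longrightarrow> \<bar>phi I x t\<bar> \<le> phimax"
  using phi_bounded[of I x t] phi_nonneg[of I x t] by (simp add: phimax_def)

lemma phimax_nonneg: "0 \<le> phimax"
  using order_trans[OF abs_ge_zero abs_phi_le[of "{}"]] by simp

lemma borel_measurable_phi_t [measurable]: "I \<subseteq> {..<n} \<Longrightarrow> (\<lambda>t. phi I x t) \<in> borel_measurable borel"
  by (rule borel_measurable_phi[where \<xi>="\<lambda>_. x" and \<tau>="\<lambda>t. t"]) simp_all

lemma integral_phi_power4_le: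
  assumes I: "I \<subseteq> {..<n}"
  shows "(\<integral>t. phi I x t ^ 4 \<partial>unif n) \<le> c4 * (1 + (\<Sum>j\<in>I. near I x j ^ 4) / n)"
proof -
  have fin: "finite I" by (rule finite_below[OF I])
  let ?a = "8 * (2 * C\<^sub>0) ^ 4" and ?b = "8 * (2 * S\<^sub>0) ^ 4 * (A / C) ^ 3"
  have b: "0 \<le> ?a" "0 \<le> ?b" using A_pos C_pos S0_nonneg C0_nonneg by auto
  interpret U: prob_space "unif n :: (real^'d) measure" by (rule prob_space_unif[OF n_pos])
  have i: "integrable (unif n) (\<lambda>t. (weight I x t j)\<^sup>2 * near I x j ^ 4)" if "j \<in> I" for j
    using that fin by (intro integrable_mult_left integrable_unif[OF n_pos, of _ "A / C"]) (auto intro: abs_weight_le)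
  have "(\<integral>t. phi I x t ^ 4 \<partial>unif n) \<le> (\<integral>t. ?a + ?b * (\<Sum>j\<in>I. (weight I x t j)\<^sup>2 * near I x j ^ 4) \<partial>unif n)"
    using i b A_pos C_pos by (intro integral_mono' phi_power4_le[OF I])
      (auto intro!: add_nonneg_nonneg mult_nonneg_nonneg sum_nonneg Bochner_Integration.integrable_add integrable_mult_right Bochner_Integration.integrable_sum)
  also have "\<dots> = ?a + ?b * (\<Sum>j\<in>I. (\<integral>t. (weight I x t j)\<^sup>2 \<partial>unif n) * near I x j ^ 4)"
    using i by (simp add: U.prob_space[simplified] Bochner_Integration.integral_sum)
  also have "\<dots> \<le> ?a + ?b * (\<Sum>j\<in>I. \<kappa> / (C * n) * near I x j ^ 4)"
    using b by (intro add_left_mono mult_left_mono sum_mono mult_right_mono integral_weight_square_le n_pos fin) auto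
  also have "\<dots> = ?a + ?b * (\<kappa> / C) * ((\<Sum>j\<in>I. near I x j ^ 4) / n)"
    unfolding sum_distrib_left[symmetric] by simp
  also have "\<dots> \<le> c4 * (1 + (\<Sum>j\<in>I. near I x j ^ 4) / n)"
  proof -
    let ?s = "(\<Sum>j\<in>I. near I x j ^ 4) / n" and ?d = "?b * (\<kappa> / C)"
    have "0 \<le> ?s" by (intro divide_nonneg_nonneg sum_nonneg) auto
    moreover have "0 \<le> ?d" using b(2) \<kappa>_nonneg C_pos A_pos by (intro mult_nonneg_nonneg) auto
    ultimately have "0 \<le> ?a * ?s" "0 \<le> ?d" using mult_nonneg_nonneg[OF b(1)] by blast+
    then show ?thesis unfolding c4_def by (simp only: distrib_left distrib_right mult_1_right)
  qed
  finally show ?thesis .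
qed

section \<open>The effect of one additional observation\<close>

lemma cov_resid_eps:
  assumes I: "I \<subseteq> {..<n}" "a < n" "a \<notin> I"
  shows "expectation (\<lambda>\<omega>. resid I x t \<omega> * \<epsilon> a \<omega>) = 0"
proof -
  have o: "expectation (\<lambda>\<omega>. obs x j \<omega> * \<epsilon> a \<omega>) = 0" "integrable M (\<lambda>\<omega>. obs x j \<omega> * \<epsilon> a \<omega>)" if "j \<in> I" for j
  proof -
    have j: "j < n" "j \<noteq> a" using that I by auto
    have i: "integrable M (\<lambda>\<omega>. Y (x j) \<omega> * \<epsilon> a \<omega>)" "integrable M (\<lambda>\<omega>. \<epsilon> j \<omega> * \<epsilon> a \<omega>)"
      by (intro lin_integrable(3) lin_Y lin_eps I j)+
    then show "expectation (\<lambda>\<omega>. obs x j \<omega> * \<epsilon> a \<omega>) = 0"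
      using j I by (simp add: obs_def distrib_right cov_Y_eps cov_eps)
    show "integrable M (\<lambda>\<omega>. obs x j \<omega> * \<epsilon> a \<omega>)"
      by (intro lin_integrable(3) lin_obs lin_eps I j)
  qed
  have "expectation (\<lambda>\<omega>. resid I x t \<omega> * \<epsilon> a \<omega>) =
      expectation (\<lambda>\<omega>. Y t \<omega> * \<epsilon> a \<omega> - (\<Sum>j\<in>I. weight I x t j * (obs x j \<omega> * \<epsilon> a \<omega>)))"
    by (simp add: resid_def left_diff_distrib sum_distrib_right mult.assoc)
  also have "\<dots> = expectation (\<lambda>\<omega>. Y t \<omega> * \<epsilon> a \<omega>) - (\<Sum>j\<in>I. weight I x t j * expectation (\<lambda>\<omega>. obs x j \<omega> * \<epsilon> a \<omega>))"
    using o(2) lin_integrable(3)[OF lin_Y lin_eps[OF I(2)]]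
    by (simp add: Bochner_Integration.integral_diff Bochner_Integration.integral_sum Bochner_Integration.integrable_sum)
  finally show ?thesis using o(1) I by (simp add: cov_Y_eps)
qed

lemma resid_insert:
  assumes I: "I \<subseteq> {..<n}" "a \<notin> I"
  shows "resid (insert a I) x t \<omega> = resid I x t \<omega> - gain I x a t * (resid I x (x a) \<omega> + \<epsilon> a \<omega>)"
proof -
  have fin: "finite I" by (rule finite_below[OF I(1)])
  have "(\<Sum>j\<in>insert a I. weight (insert a I) x t j * obs x j \<omega>) =
      gain I x a t * obs x a \<omega> + (\<Sum>j\<in>I. (weight I x t j - gain I x a t * weight I x (x a) j) * obs x j \<omega>)"
    using fin I by (simp add: weight_insert)
  also have "(\<Sum>j\<in>I. (weight I x t j - gain I x a t * weight I x (x a) j) * obs x j \<omega>) =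
      (\<Sum>j\<in>I. weight I x t j * obs x j \<omega>) - gain I x a t * (\<Sum>j\<in>I. weight I x (x a) j * obs x j \<omega>)"
    by (simp add: left_diff_distrib sum_subtractf sum_distrib_left mult.assoc)
  finally show ?thesis by (simp add: resid_def obs_def algebra_simps)
qed

text \<open>Expand the square of the updated residual. The noise at \<open>a\<close> is uncorrelated
  with the old residuals, the covariance of the two residuals is bounded by the mean of their
  variances, and of the two factors \<open>gain\<close> in the quadratic term one is replaced by its
  bound.\<close>

lemma phi_insert_diff_le:
  assumes I: "I \<subseteq> {..<n}" "a < n" "a \<notin> I"
  shows "\<bar>phi (insert a I) x t - phi I x t\<bar> \<le> (1 + 2 * A / C) * \<bar>gain I x a t\<bar> * (phi I x t + phi I x (x a) + \<delta>\<^sub>0)"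
proof -
  let ?e = "resid I x t" and ?f = "resid I x (x a)" and ?g = "gain I x a t"
  have l: "?e \<in> lin" "?f \<in> lin" "\<epsilon> a \<in> lin" by (intro lin_resid lin_eps I)+
  note i = lin_integrable(2)[OF l(1) lin_zero] lin_integrable(2)[OF l(2) lin_zero] lin_integrable(2)[OF l(3) lin_zero]
    lin_integrable(3)[OF l(1,2)] lin_integrable(3)[OF l(1,3)] lin_integrable(3)[OF l(2,3)]
  have x: "(resid (insert a I) x t \<omega>)\<^sup>2 = (?e \<omega>)\<^sup>2 - 2 * ?g * (?e \<omega> * ?f \<omega>) - 2 * ?g * (?e \<omega> * \<epsilon> a \<omega>)
      + ?g\<^sup>2 * ((?f \<omega>)\<^sup>2 + 2 * (?f \<omega> * \<epsilon> a \<omega>) + (\<epsilon> a \<omega>)\<^sup>2)" for \<omega>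
    unfolding resid_insert[OF I(1,3)] by (simp add: power2_eq_square algebra_simps)
  define c where "c = expectation (\<lambda>\<omega>. ?e \<omega> * ?f \<omega>)"
  have "phi (insert a I) x t = phi I x t - 2 * ?g * c + ?g\<^sup>2 * (phi I x (x a) + \<delta>\<^sub>0)"
  proof -
    have "expectation (\<lambda>\<omega>. (\<epsilon> a \<omega>)\<^sup>2) = \<delta>\<^sub>0" using cov_eps[OF I(2,2)] by (simp add: power2_eq_square)
    then show ?thesis unfolding phi_def[of "insert a I"] x
      using i cov_resid_eps[OF I, of x] by (simp add: phi_def c_def)
  qed
  moreover have "2 * \<bar>c\<bar> \<le> phi I x t + phi I x (x a)"
  proof -
    have "0 \<le> expectation (\<lambda>\<omega>. (?e \<omega> + ?f \<omega>)\<^sup>2)" by (intro integral_nonneg_AE) simp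
    also have "\<dots> = expectation (\<lambda>\<omega>. (?e \<omega>)\<^sup>2 + (?f \<omega>)\<^sup>2 + 2 * (?e \<omega> * ?f \<omega>))"
      by (simp add: power2_sum mult.assoc)
    also have "\<dots> = phi I x t + phi I x (x a) + 2 * c"
      using i by (simp add: phi_def c_def)
    finally have 1: "0 \<le> phi I x t + phi I x (x a) + 2 * c" .
    have "0 \<le> expectation (\<lambda>\<omega>. (?e \<omega> - ?f \<omega>)\<^sup>2)" by (intro integral_nonneg_AE) simp
    also have "\<dots> = expectation (\<lambda>\<omega>. (?e \<omega>)\<^sup>2 + (?f \<omega>)\<^sup>2 - 2 * (?e \<omega> * ?f \<omega>))"
      by (simp add: power2_diff mult.assoc)
    also have "\<dots> = phi I x t + phi I x (x a) - 2 * c"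
      using i by (simp add: phi_def c_def)
    finally show ?thesis using 1 by linarith
  qed
  ultimately have "\<bar>phi (insert a I) x t - phi I x t\<bar> \<le> \<bar>?g\<bar> * (phi I x t + phi I x (x a)) + \<bar>?g\<bar> * \<bar>?g\<bar> * (phi I x (x a) + \<delta>\<^sub>0)"
  proof -
    assume 1: "phi (insert a I) x t = phi I x t - 2 * ?g * c + ?g\<^sup>2 * (phi I x (x a) + \<delta>\<^sub>0)"
      and 2: "2 * \<bar>c\<bar> \<le> phi I x t + phi I x (x a)"
    have "\<bar>phi (insert a I) x t - phi I x t\<bar> \<le> \<bar>?g\<bar> * (2 * \<bar>c\<bar>) + \<bar>?g\<^sup>2 * (phi I x (x a) + \<delta>\<^sub>0)\<bar>"
      unfolding 1 using abs_triangle_ineq[of "- 2 * ?g * c" "?g\<^sup>2 * (phi I x (x a) + \<delta>\<^sub>0)"] by (simp add: abs_mult mult_ac)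
    also have "\<dots> \<le> \<bar>?g\<bar> * (phi I x t + phi I x (x a)) + \<bar>?g\<^sup>2 * (phi I x (x a) + \<delta>\<^sub>0)\<bar>"
      by (intro add_right_mono mult_left_mono 2) simp
    also have "\<bar>?g\<^sup>2 * (phi I x (x a) + \<delta>\<^sub>0)\<bar> = \<bar>?g\<bar> * \<bar>?g\<bar> * (phi I x (x a) + \<delta>\<^sub>0)"
      using phi_nonneg[of I x "x a"] \<delta>0_nonneg by (simp add: abs_mult power2_eq_square)
    finally show ?thesis .
  qed
  also have "\<dots> \<le> \<bar>?g\<bar> * (phi I x t + phi I x (x a) + \<delta>\<^sub>0) + \<bar>?g\<bar> * (2 * A / C) * (phi I x t + phi I x (x a) + \<delta>\<^sub>0)"
  proof (rule add_mono)
    note p = phi_nonneg[of I x "x a"] phi_nonneg[of I x t] \<delta>0_nonneg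
    show "\<bar>?g\<bar> * (phi I x t + phi I x (x a)) \<le> \<bar>?g\<bar> * (phi I x t + phi I x (x a) + \<delta>\<^sub>0)"
      using p by (intro mult_left_mono) auto
    have "\<bar>?g\<bar> * \<bar>?g\<bar> \<le> \<bar>?g\<bar> * (2 * A / C)"
      by (intro mult_left_mono abs_gain_le finite_below[OF I(1)]) auto
    moreover have "phi I x (x a) + \<delta>\<^sub>0 \<le> phi I x t + phi I x (x a) + \<delta>\<^sub>0" using p by simp
    ultimately show "\<bar>?g\<bar> * \<bar>?g\<bar> * (phi I x (x a) + \<delta>\<^sub>0) \<le> \<bar>?g\<bar> * (2 * A / C) * (phi I x t + phi I x (x a) + \<delta>\<^sub>0)"
      by (rule mult_mono) (use p A_pos C_pos in auto)
  qed
  finally show ?thesis by (simp add: algebra_simps)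
qed

text \<open>The factor \<open>sqrt n\<close> balances the integral of the squared gain, which is of order \<open>1 / n\<close>,
  against the fourth moments of the prediction variances.\<close>

definition cg :: real where "cg = (1 + 2 * A / C)\<^sup>2 / 2"

lemma phi_insert_square_diff_le:
  assumes I: "I \<subseteq> {..<n}" "a < n" "a \<notin> I"
  shows "(phi (insert a I) x t - phi I x t)\<^sup>2 \<le>
    cg * (sqrt n * (2 * A / C)\<^sup>2 * (gain I x a t)\<^sup>2 + 64 * (phi I x t ^ 4 + phi I x (x a) ^ 4 + \<delta>\<^sub>0 ^ 4) / sqrt n)"
proof -
  let ?g = "gain I x a t" and ?P = "phi I x t + phi I x (x a) + \<delta>\<^sub>0" and ?s = "sqrt n"
  have s: "0 < ?s" using n_pos by simp
  have "(phi (insert a I) x t - phi I x t)\<^sup>2 \<le> ((1 + 2 * A / C) * \<bar>?g\<bar> * ?P)\<^sup>2"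
    using power_mono[OF phi_insert_diff_le[OF I, of x t], of 2] by simp
  also have "\<dots> = (1 + 2 * A / C)\<^sup>2 * (?g\<^sup>2 * ?P\<^sup>2)" by (simp add: power_mult_distrib mult.assoc)
  also have "?g\<^sup>2 * ?P\<^sup>2 \<le> (?s * ?g ^ 4 + ?P ^ 4 / ?s) / 2"
  proof -
    have "0 \<le> (?s * ?g\<^sup>2 - ?P\<^sup>2)\<^sup>2 / ?s" using s by simp
    also have "\<dots> = ?s * ?g ^ 4 + ?P ^ 4 / ?s - 2 * (?g\<^sup>2 * ?P\<^sup>2)"
      using s by (simp add: power2_eq_square power4_eq_xxxx field_simps)
    finally show ?thesis by simp
  qed
  \<comment> \<open>Lowers the fourth power of the gain to its square, whose integral over the
    domain is of order 1 / \<open>n\<close>.\<close>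
  also have "?g ^ 4 \<le> (2 * A / C)\<^sup>2 * ?g\<^sup>2"
  proof -
    have "?g\<^sup>2 \<le> (2 * A / C)\<^sup>2"
      using power_mono[OF abs_gain_le[OF finite_below[OF I(1)], of x a t], of 2] by simp
    then have "?g\<^sup>2 * ?g\<^sup>2 \<le> (2 * A / C)\<^sup>2 * ?g\<^sup>2" by (intro mult_right_mono) auto
    then show ?thesis by (simp add: power2_eq_square power4_eq_xxxx mult.assoc)
  qed
  also have "?P ^ 4 \<le> 64 * (phi I x t ^ 4 + phi I x (x a) ^ 4 + \<delta>\<^sub>0 ^ 4)"
    by (rule power4_add3_le)
  finally show ?thesis using s unfolding cg_def
    by (simp add: mult_left_mono divide_right_mono mult.assoc)
qed

lemma borel_measurable_phi_coord:
  assumes "I \<subseteq> {..<n}" "a < n"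
  shows "(\<lambda>x. phi I x (x a)) \<in> borel_measurable (design n)"
  by (rule borel_measurable_phi) (use assms in auto)

lemma borel_measurable_phi_pair:
  assumes "I \<subseteq> {..<n}"
  shows "(\<lambda>(x, t). phi I x t) \<in> borel_measurable (design n \<Otimes>\<^sub>M unif n)"
proof -
  have "(\<lambda>p. phi I (fst p) (snd p)) \<in> borel_measurable (design n \<Otimes>\<^sub>M unif n)"
    by (rule borel_measurable_phi) (use assms in auto)
  then show ?thesis by (simp add: case_prod_beta')
qed

lemma phi_cong:
  assumes I: "I \<subseteq> {..<n}" and x: "\<And>j. j \<in> I \<Longrightarrow> x j = x' j"
  shows "phi I x t = phi I x' t"
proof -
  have "weight I x t j = weight I x' t j" if "j \<in> I" for j
    unfolding weight_def by (rule solution_cong) (use that x finite_below[OF I] in auto)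
  then have "resid I x t = resid I x' t"
    by (auto simp: resid_def obs_def x intro!: sum.cong)
  then show ?thesis by (simp add: phi_def)
qed

lemma phi_fun_upd: "I \<subseteq> {..<n} \<Longrightarrow> i \<notin> I \<Longrightarrow> phi I (x(i := s)) t = phi I x t"
  by (rule phi_cong) auto

end

section \<open>Exponential moments of the number of neighbours\<close>

text \<open>Given \<open>x i = t\<close> the other points are independent, so the expectation
  factorizes. Since \<open>decay\<close> is at most 1, the exponential is at most
  \<open>1 + 2 * z\<close> and each factor at most \<open>exp (2 * decay_mass / n)\<close>; fewer
  than \<open>n\<close> of them are multiplied. The summand 1 in the exponent is the contribution of
  \<open>i\<close> itself.\<close>

lemma nn_integral_exp_near_le:
  assumes i: "i < n"
  shows "(\<integral>\<^sup>+x. ennreal (exp (\<Sum>j<n. decay (x i - x j))) \<partial>(design n :: (nat \<Rightarrow> real^'d::finite) measure))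
    \<le> ennreal (exp (1 + 2 * decay_mass TYPE('d)))"
    (is "(\<integral>\<^sup>+x. ?F x \<partial>_) \<le> _")
proof -
  let ?U = "unif n :: (real^'d) measure" and ?h = "decay_mass TYPE('d)"
  have n: "0 < n" using i by simp
  interpret U: prob_space ?U by (rule prob_space_unif[OF n])
  interpret product_sigma_finite "\<lambda>_::nat. ?U" by unfold_locales
  define J where "J = {..<n} - {i}"
  have J: "finite J" "i \<notin> J" "insert i J = {..<n}" "card J \<le> n" using i by (auto simp: J_def)
  have h: "0 \<le> ?h" by (rule decay_mass_nonneg)
  have meas: "?F \<in> borel_measurable (Pi\<^sub>M (insert i J) (\<lambda>_. ?U))"
    unfolding J(3) using i by (intro measurable_compose[OF _ measurable_ennreal] borel_measurable_exp measurable_compose[OF _ borel_measurable_exp] borel_measurable_sum measurable_compose[OF _ borel_measurable_decay] borel_measurable_diff measurable_design_component) auto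
  have "(\<integral>\<^sup>+x. ?F x \<partial>Pi\<^sub>M (insert i J) (\<lambda>_. ?U)) = (\<integral>\<^sup>+t. (\<integral>\<^sup>+x. ?F (x(i := t)) \<partial>Pi\<^sub>M J (\<lambda>_. ?U)) \<partial>?U)"
    by (rule product_nn_integral_insert_rev[OF J(1,2) meas])
  also have "\<dots> = (\<integral>\<^sup>+t. (\<integral>\<^sup>+x. ennreal (exp 1) * (\<Prod>j\<in>J. ennreal (exp (decay (t - x j)))) \<partial>Pi\<^sub>M J (\<lambda>_. ?U)) \<partial>?U)"
  proof (intro nn_integral_cong)
    fix t :: "real^'d" and x :: "nat \<Rightarrow> real^'d"
    have "(\<Sum>j<n. decay ((x(i := t)) i - (x(i := t)) j)) = 1 + (\<Sum>j\<in>J. decay (t - x j))"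
      unfolding J(3)[symmetric] using J(1,2) by (auto intro!: sum.cong)
    then show "?F (x(i := t)) = ennreal (exp 1) * (\<Prod>j\<in>J. ennreal (exp (decay (t - x j))))"
      using J(1) by (simp add: exp_add exp_sum prod_ennreal ennreal_mult')
  qed
  also have "\<dots> = (\<integral>\<^sup>+t. ennreal (exp 1) * (\<Prod>j\<in>J. \<integral>\<^sup>+s. ennreal (exp (decay (t - s))) \<partial>?U) \<partial>?U)"
  proof (intro nn_integral_cong)
    fix t :: "real^'d"
    have "(\<integral>\<^sup>+x. ennreal (exp 1) * (\<Prod>j\<in>J. ennreal (exp (decay (t - x j)))) \<partial>Pi\<^sub>M J (\<lambda>_. ?U)) =
        ennreal (exp 1) * (\<integral>\<^sup>+x. (\<Prod>j\<in>J. ennreal (exp (decay (t - x j)))) \<partial>Pi\<^sub>M J (\<lambda>_. ?U))"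
      by (rule nn_integral_cmult) (intro borel_measurable_prod_ennreal, measurable)
    also have "(\<integral>\<^sup>+x. (\<Prod>j\<in>J. ennreal (exp (decay (t - x j)))) \<partial>Pi\<^sub>M J (\<lambda>_. ?U)) =
        (\<Prod>j\<in>J. \<integral>\<^sup>+s. ennreal (exp (decay (t - s))) \<partial>?U)"
      by (rule product_nn_integral_prod[OF J(1), of "\<lambda>_ s. ennreal (exp (decay (t - s)))"]) measurable
    finally show "(\<integral>\<^sup>+x. ennreal (exp 1) * (\<Prod>j\<in>J. ennreal (exp (decay (t - x j)))) \<partial>Pi\<^sub>M J (\<lambda>_. ?U)) =
        ennreal (exp 1) * (\<Prod>j\<in>J. \<integral>\<^sup>+s. ennreal (exp (decay (t - s))) \<partial>?U)" .
  qed
  also have "\<dots> \<le> (\<integral>\<^sup>+t. ennreal (exp (1 + 2 * ?h)) \<partial>?U)"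
  proof (intro nn_integral_mono)
    fix t :: "real^'d"
    have 1: "(\<integral>\<^sup>+s. ennreal (exp (decay (t - s))) \<partial>?U) \<le> ennreal (exp (2 * ?h / n))"
    proof -
      have int: "integrable ?U (\<lambda>s. decay (t - s))" by (rule integrable_unif[OF n, of _ 1]) (auto simp: decay_le_1)
      have "exp z \<le> 1 + 2 * z" if "0 \<le> z" "z \<le> 1" for z :: real
        using exp_bound[OF that] mult_left_mono[OF that(2) that(1)] by (simp add: power2_eq_square)
      then have "(\<integral>\<^sup>+s. ennreal (exp (decay (t - s))) \<partial>?U) \<le> (\<integral>\<^sup>+s. ennreal (1 + 2 * decay (t - s)) \<partial>?U)"
        by (intro nn_integral_mono ennreal_leI) (auto simp: decay_le_1)
      also have "\<dots> = ennreal (\<integral>s. 1 + 2 * decay (t - s) \<partial>?U)"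
        using int by (intro nn_integral_eq_integral) auto
      also have "(\<integral>s. 1 + 2 * decay (t - s) \<partial>?U) = 1 + 2 * (\<integral>s. decay (s - t) \<partial>?U)"
        using int by (simp add: U.prob_space[simplified] decay_diff_commute[of t])
      also have "\<dots> \<le> 1 + 2 * ?h / n" using integral_decay_unif[OF n, of t] by simp
      also have "\<dots> \<le> exp (2 * ?h / n)" by (rule exp_ge_add_one_self)
      finally show ?thesis by (simp add: ennreal_leI)
    qed
    have "(\<Prod>j\<in>J. \<integral>\<^sup>+s. ennreal (exp (decay (t - s))) \<partial>?U) \<le> (\<Prod>j\<in>J. ennreal (exp (2 * ?h / n)))"
      using J(1) by (induction J rule: finite_induct) (auto intro!: mult_mono 1)
    also have "\<dots> = ennreal (exp (2 * ?h / n) ^ card J)" by (simp add: ennreal_power)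
    also have "exp (2 * ?h / n) ^ card J = exp (card J * (2 * ?h / n))" by (simp only: exp_of_nat_mult)
    also have "card J * (2 * ?h / n) \<le> n * (2 * ?h / n)"
      using h J(4) by (intro mult_right_mono) auto
    also have "n * (2 * ?h / n) = 2 * ?h" using n by simp
    finally have "(\<Prod>j\<in>J. \<integral>\<^sup>+s. ennreal (exp (decay (t - s))) \<partial>?U) \<le> ennreal (exp (2 * ?h))"
      by (simp add: ennreal_leI)
    then have "ennreal (exp 1) * (\<Prod>j\<in>J. \<integral>\<^sup>+s. ennreal (exp (decay (t - s))) \<partial>?U) \<le> ennreal (exp 1) * ennreal (exp (2 * ?h))"
      by (intro mult_left_mono) auto
    then show "ennreal (exp 1) * (\<Prod>j\<in>J. \<integral>\<^sup>+s. ennreal (exp (decay (t - s))) \<partial>?U) \<le> ennreal (exp (1 + 2 * ?h))"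
      by (simp add: exp_add ennreal_mult')
  qed
  also have "\<dots> = ennreal (exp (1 + 2 * ?h))" by (simp add: U.emeasure_space_1[simplified])
  finally show ?thesis unfolding J(3) .
qed

section \<open>Cross validation and prediction error have the same conditional mean\<close>

lemma (in prob_space) square_expectation_le:
  fixes f :: "'a \<Rightarrow> real"
  assumes "integrable M f" "integrable M (\<lambda>\<omega>. (f \<omega>)\<^sup>2)"
  shows "(expectation f)\<^sup>2 \<le> expectation (\<lambda>\<omega>. (f \<omega>)\<^sup>2)"
  using variance_positive[of f] variance_eq[OF assms] by simp

lemma mult_le_weighted_squares:
  fixes a b r :: real
  assumes "0 < r" shows "a * b \<le> (r * a\<^sup>2 + b\<^sup>2 / r) / 2"
proof -
  have "0 \<le> (r * a - b)\<^sup>2 / r" using assms by simp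
  also have "\<dots> = r * a\<^sup>2 + b\<^sup>2 / r - 2 * (a * b)"
    using assms by (simp add: power2_eq_square field_simps)
  finally show ?thesis by simp
qed

lemma sqrt_cancel:
  fixes s m :: real
  assumes "s * s = m" "0 < s" shows "s * b * (z / (c * m)) = b * (z / c) / s"
  using assms(2) unfolding assms(1)[symmetric] by simp

context model
begin

lemma integrable_design:
  fixes f :: "(nat \<Rightarrow> real^'d) \<Rightarrow> real"
  assumes "f \<in> borel_measurable (design n)" "\<And>x. \<bar>f x\<bar> \<le> B"
  shows "integrable (design n) f"
proof -
  interpret D: prob_space "design n :: (nat \<Rightarrow> real^'d) measure" by (rule prob_space_design[OF n_pos])
  show ?thesis by (rule D.integrable_const_bound[of _ B]) (use assms in auto)
qed

lemma prob_design: "prob_space (design n :: (nat \<Rightarrow> real^'d) measure)"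
  by (rule prob_space_design[OF n_pos])

lemma prob_unif: "prob_space (unif n :: (real^'d) measure)"
  by (rule prob_space_unif[OF n_pos])

lemma integral_unif_abs_le:
  fixes f :: "real^'d \<Rightarrow> real"
  assumes "\<And>t. \<bar>f t\<bar> \<le> B" "f \<in> borel_measurable borel"
  shows "\<bar>\<integral>t. f t \<partial>unif n\<bar> \<le> B"
proof -
  interpret U: prob_space "unif n :: (real^'d) measure" by (rule prob_unif)
  have "integrable (unif n) (\<lambda>t. \<bar>f t\<bar>)"
    by (rule integrable_unif[OF n_pos, of _ B]) (use assms in auto)
  then have "(\<integral>t. \<bar>f t\<bar> \<partial>unif n) \<le> (\<integral>t. B \<partial>(unif n :: (real^'d) measure))"
    using assms by (intro integral_mono) auto
  moreover have "(\<integral>t. B \<partial>(unif n :: (real^'d) measure)) = B" by (simp add: U.prob_space[simplified])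
  ultimately show ?thesis using order_trans[OF integral_abs_bound] by metis
qed

lemma borel_measurable_integral_unif:
  fixes f :: "(nat \<Rightarrow> real^'d) \<Rightarrow> real^'d \<Rightarrow> real"
  assumes "(\<lambda>(x, t). f x t) \<in> borel_measurable (design n \<Otimes>\<^sub>M unif n)"
  shows "(\<lambda>x. \<integral>t. f x t \<partial>unif n) \<in> borel_measurable (design n)"
proof -
  interpret U: prob_space "unif n :: (real^'d) measure" by (rule prob_unif)
  show ?thesis using assms by (rule U.borel_measurable_lebesgue_integral)
qed

section \<open>Averages over the design of neighbour counts and prediction variances\<close>

definition e0 :: real where "e0 = exp (1 + 2 * decay_mass TYPE('d))"

lemma near_mono: "finite J \<Longrightarrow> I \<subseteq> J \<Longrightarrow> near I x i \<le> near J x i"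
  unfolding near_def by (intro sum_mono2) auto

lemma borel_measurable_near [measurable]:
  "i < n \<Longrightarrow> (\<lambda>x. near {..<n} x i) \<in> borel_measurable (design n)"
  unfolding near_def by measurable

lemma near_le_n: "near {..<n} x i \<le> n"
  using near_le[of "{..<n}" x i] by simp

lemma integral_exp_near_le:
  assumes "i < n"
  shows "(\<integral>x. exp (near {..<n} x i) \<partial>design n) \<le> e0"
proof -
  have int: "integrable (design n) (\<lambda>x. exp (near {..<n} x i))"
    by (rule integrable_design[of _ "exp n"]) (use assms near_le_n in auto)
  have "ennreal (\<integral>x. exp (near {..<n} x i) \<partial>design n) = (\<integral>\<^sup>+x. ennreal (exp (near {..<n} x i)) \<partial>design n)"
    by (rule nn_integral_eq_integral[symmetric, OF int]) simp
  also have "\<dots> \<le> ennreal e0"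
    unfolding near_def e0_def by (rule nn_integral_exp_near_le[OF assms])
  finally show ?thesis by (simp add: e0_def)
qed

lemma integral_near_power4_le:
  assumes "i < n"
  shows "(\<integral>x. near {..<n} x i ^ 4 \<partial>design n) \<le> 24 * e0"
proof -
  have "(\<integral>x. near {..<n} x i ^ 4 \<partial>design n) \<le> (\<integral>x. 24 * exp (near {..<n} x i) \<partial>design n)"
  proof (intro integral_mono')
    show "integrable (design n) (\<lambda>x. 24 * exp (near {..<n} x i))"
      by (rule integrable_design[of _ "24 * exp n"]) (use assms near_le_n in auto)
    show "near {..<n} x i ^ 4 \<le> 24 * exp (near {..<n} x i)" for x
      using power_le_fact_exp[OF near_nonneg, of "{..<n}" x i 4] by (simp add: fact_numeral)
  qed simp
  also have "\<dots> \<le> 24 * e0" using integral_exp_near_le[OF assms] by simp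
  finally show ?thesis .
qed

definition near4 :: "(nat \<Rightarrow> real^'d) \<Rightarrow> real" where
  "near4 x = (\<Sum>j<n. near {..<n} x j ^ 4) / n"

lemma near4_nonneg: "0 \<le> near4 x"
  unfolding near4_def by (intro divide_nonneg_nonneg sum_nonneg) auto

lemma integrable_near_power4: "i < n \<Longrightarrow> integrable (design n) (\<lambda>x. near {..<n} x i ^ 4)"
  by (rule integrable_design[of _ "real n ^ 4"])
     (auto simp del: of_nat_power intro!: power_mono near_le_n near_nonneg)

lemma integrable_near4: "integrable (design n) near4"
  unfolding near4_def by (intro Bochner_Integration.integrable_divide Bochner_Integration.integrable_sum integrable_near_power4) auto

lemma integral_near4_le: "(\<integral>x. near4 x \<partial>design n) \<le> 24 * e0"
proof -
  have "(\<integral>x. near4 x \<partial>design n) = (\<Sum>j<n. \<integral>x. near {..<n} x j ^ 4 \<partial>design n) / n"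
    unfolding near4_def
    by (simp add: Bochner_Integration.integral_sum integrable_near_power4)
  also have "\<dots> \<le> (\<Sum>j<n. 24 * e0) / n"
    by (intro divide_right_mono sum_mono integral_near_power4_le) auto
  finally show ?thesis using n_pos by simp
qed

lemma integral_phi_power4_le_near4:
  assumes J: "J \<subseteq> {..<n}"
  shows "(\<integral>t. phi J x t ^ 4 \<partial>unif n) \<le> c4 * (1 + near4 x)"
proof -
  have "(\<Sum>j\<in>J. near J x j ^ 4) \<le> (\<Sum>j\<in>J. near {..<n} x j ^ 4)"
    using J by (intro sum_mono power_mono near_mono near_nonneg) auto
  also have "\<dots> \<le> (\<Sum>j<n. near {..<n} x j ^ 4)" using J by (intro sum_mono2) auto
  finally have "(\<Sum>j\<in>J. near J x j ^ 4) / n \<le> near4 x"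
    unfolding near4_def by (intro divide_right_mono) auto
  then have "c4 * (1 + (\<Sum>j\<in>J. near J x j ^ 4) / n) \<le> c4 * (1 + near4 x)"
    using c4_nonneg by (intro mult_left_mono) auto
  with integral_phi_power4_le[OF J, of x] show ?thesis by linarith
qed

lemma abs_phi_power_le: "J \<subseteq> {..<n} \<Longrightarrow> \<bar>phi J x t ^ m\<bar> \<le> phimax ^ m"
  unfolding power_abs by (intro power_mono abs_phi_le) auto

text \<open>As \<open>a\<close> is not in \<open>J\<close>, the point \<open>x a\<close> is a fresh
  uniform point for the predictor built on \<open>J\<close>.\<close>

lemma integral_phi_coord_power:
  assumes J: "J \<subseteq> {..<n}" and a: "a < n" "a \<notin> J"
  shows "(\<integral>x. phi J x (x a) ^ m \<partial>design n) = (\<integral>x. (\<integral>t. phi J x t ^ m \<partial>unif n) \<partial>design n)"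
proof -
  have "(\<integral>x. phi J x (x a) ^ m \<partial>design n) = (\<integral>x. (\<integral>t. phi J (x(a := t)) ((x(a := t)) a) ^ m \<partial>unif n) \<partial>design n)"
    by (rule integral_PiM_resample[where B="phimax ^ m"])
       (use a in \<open>auto intro: prob_unif abs_phi_power_le[OF J] borel_measurable_power borel_measurable_phi_coord[OF J]\<close>)
  then show ?thesis by (simp add: phi_fun_upd[OF J a(2)])
qed

text \<open>For \<open>J = {..<n}\<close> this is the conditional mean of the integrated prediction
  error given the design.\<close>

definition Phi :: "nat set \<Rightarrow> (nat \<Rightarrow> real^'d) \<Rightarrow> real" where
  "Phi J x = (\<integral>t. phi J x t \<partial>unif n)"

lemma borel_measurable_Phi: "J \<subseteq> {..<n} \<Longrightarrow> Phi J \<in> borel_measurable (design n)"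
  unfolding Phi_def by (rule borel_measurable_integral_unif[OF borel_measurable_phi_pair])

lemma abs_Phi_le: "J \<subseteq> {..<n} \<Longrightarrow> \<bar>Phi J x\<bar> \<le> phimax"
  unfolding Phi_def by (rule integral_unif_abs_le) (auto intro: abs_phi_le)

lemma integral_phi_power4_design_le:
  assumes J: "J \<subseteq> {..<n}"
  shows "(\<integral>x. (\<integral>t. phi J x t ^ 4 \<partial>unif n) \<partial>design n) \<le> c4 * (1 + 24 * e0)"
proof -
  interpret D: prob_space "design n :: (nat \<Rightarrow> real^'d) measure" by (rule prob_design)
  have "(\<integral>x. (\<integral>t. phi J x t ^ 4 \<partial>unif n) \<partial>design n) \<le> (\<integral>x. c4 * (1 + near4 x) \<partial>design n)"
    using c4_nonneg near4_nonneg integrable_near4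
    by (intro integral_mono' integral_phi_power4_le_near4[OF J])
       (auto intro!: Bochner_Integration.integrable_add integrable_mult_right mult_nonneg_nonneg add_nonneg_nonneg)
  also have "\<dots> = c4 * (1 + (\<integral>x. near4 x \<partial>design n))"
    using integrable_near4 D.prob_space by simp
  also have "\<dots> \<le> c4 * (1 + 24 * e0)"
    using integral_near4_le c4_nonneg by (intro mult_left_mono) auto
  finally show ?thesis .
qed

definition cs :: real where
  "cs = cg * ((2 * A / C)\<^sup>2 * (4 * A * \<kappa> / C\<^sup>2) + 64 * (2 * (c4 * (1 + 24 * e0)) + \<delta>\<^sub>0 ^ 4))"

lemma cg_nonneg: "0 \<le> cg"
  by (simp add: cg_def)

text \<open>Integrate the pointwise bound. The squared gain brings \<open>sqrt n\<close> times order
  1 / \<open>n\<close>, the fourth powers bring a bounded average divided by \<open>sqrt n\<close>.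
  The value at \<open>x a\<close> is treated as the value at a fresh uniform point.\<close>

lemma phi_stability:
  assumes J: "J \<subseteq> {..<n}" "a < n" "a \<notin> J"
  shows "(\<integral>x. (\<integral>t. (phi (insert a J) x t - phi J x t)\<^sup>2 \<partial>unif n) \<partial>design n) \<le> cs / sqrt n"
proof -
  interpret D: prob_space "design n :: (nat \<Rightarrow> real^'d) measure" by (rule prob_design)
  interpret U: prob_space "unif n :: (real^'d) measure" by (rule prob_unif)
  let ?s = "sqrt n" and ?b = "(2 * A / C)\<^sup>2"
  have s: "0 < ?s" "?s * ?s = n" using n_pos by simp_all
  have J': "insert a J \<subseteq> {..<n}" using J by simp
  have fin: "finite J" by (rule finite_below[OF J(1)])
  have p4: "0 \<le> z ^ 4" for z :: real by (rule zero_le_even_power) simp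
  have inner: "(\<integral>t. (phi (insert a J) x t - phi J x t)\<^sup>2 \<partial>unif n)
      \<le> cg * (?b * (4 * A * \<kappa> / C\<^sup>2) + 64 * (c4 * (1 + near4 x) + phi J x (x a) ^ 4 + \<delta>\<^sub>0 ^ 4)) / ?s" for x
  proof -
    have i1: "integrable (unif n) (\<lambda>t. (gain J x a t)\<^sup>2)"
    proof (rule integrable_unif[OF n_pos, of _ "(2 * A / C)\<^sup>2"])
      show "\<bar>(gain J x a t)\<^sup>2\<bar> \<le> (2 * A / C)\<^sup>2" for t
        using power_mono[OF abs_gain_le[OF fin, of x a t], of 2] by simp
    qed (use fin in measurable)
    have i2: "integrable (unif n) (\<lambda>t. phi J x t ^ 4)"
      by (rule integrable_unif[OF n_pos _ abs_phi_power_le[OF J(1)]]) (intro borel_measurable_power borel_measurable_phi_t J(1))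
    have "(\<integral>t. (phi (insert a J) x t - phi J x t)\<^sup>2 \<partial>unif n) \<le>
        (\<integral>t. cg * (?s * ?b * (gain J x a t)\<^sup>2 + 64 * (phi J x t ^ 4 + phi J x (x a) ^ 4 + \<delta>\<^sub>0 ^ 4) / ?s) \<partial>unif n)"
      using i1 i2 cg_nonneg s p4
      by (intro integral_mono' phi_insert_square_diff_le J) (auto intro!: mult_nonneg_nonneg add_nonneg_nonneg divide_nonneg_nonneg)
    also have "\<dots> = cg * (?s * ?b * (\<integral>t. (gain J x a t)\<^sup>2 \<partial>unif n) + 64 * ((\<integral>t. phi J x t ^ 4 \<partial>unif n) + phi J x (x a) ^ 4 + \<delta>\<^sub>0 ^ 4) / ?s)"
      using i1 i2 by (simp add: U.prob_space[simplified])
    also have "\<dots> \<le> cg * (?s * ?b * (4 * A * \<kappa> / (C\<^sup>2 * n)) + 64 * (c4 * (1 + near4 x) + phi J x (x a) ^ 4 + \<delta>\<^sub>0 ^ 4) / ?s)"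
      using s cg_nonneg
      by (intro mult_left_mono add_mono divide_right_mono integral_gain_square_le[OF n_pos fin] integral_phi_power4_le_near4[OF J(1)] order_refl)
         (auto intro!: mult_nonneg_nonneg)
    also have "?s * ?b * (4 * A * \<kappa> / (C\<^sup>2 * n)) = ?b * (4 * A * \<kappa> / C\<^sup>2) / ?s"
      by (rule sqrt_cancel[OF s(2,1)])
    finally show ?thesis unfolding add_divide_distrib[symmetric] by simp
  qed
  have i3: "integrable (design n) (\<lambda>x. phi J x (x a) ^ 4)"
    by (rule integrable_design[OF _ abs_phi_power_le[OF J(1)]])
       (intro borel_measurable_power borel_measurable_phi_coord J)
  have "(\<integral>x. (\<integral>t. (phi (insert a J) x t - phi J x t)\<^sup>2 \<partial>unif n) \<partial>design n) \<le>
      (\<integral>x. cg * (?b * (4 * A * \<kappa> / C\<^sup>2) + 64 * (c4 * (1 + near4 x) + phi J x (x a) ^ 4 + \<delta>\<^sub>0 ^ 4)) / ?s \<partial>design n)"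
  proof (intro integral_mono' inner)
    show "integrable (design n) (\<lambda>x. cg * (?b * (4 * A * \<kappa> / C\<^sup>2) + 64 * (c4 * (1 + near4 x) + phi J x (x a) ^ 4 + \<delta>\<^sub>0 ^ 4)) / ?s)"
      using i3 integrable_near4 by auto
    show "0 \<le> cg * (?b * (4 * A * \<kappa> / C\<^sup>2) + 64 * (c4 * (1 + near4 x) + phi J x (x a) ^ 4 + \<delta>\<^sub>0 ^ 4)) / ?s" for x
      using order_trans[OF _ inner, of 0 x] by (simp add: integral_nonneg_AE)
  qed
  also have "\<dots> = cg * (?b * (4 * A * \<kappa> / C\<^sup>2) + 64 * (c4 * (1 + (\<integral>x. near4 x \<partial>design n)) + (\<integral>x. phi J x (x a) ^ 4 \<partial>design n) + \<delta>\<^sub>0 ^ 4)) / ?s"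
    using i3 integrable_near4 D.prob_space by simp
  also have "\<dots> \<le> cg * (?b * (4 * A * \<kappa> / C\<^sup>2) + 64 * (c4 * (1 + 24 * e0) + c4 * (1 + 24 * e0) + \<delta>\<^sub>0 ^ 4)) / ?s"
    using cg_nonneg c4_nonneg s integral_near4_le integral_phi_power4_design_le[OF J(1)]
    by (intro divide_right_mono mult_left_mono add_mono order_refl) (simp_all add: integral_phi_coord_power[OF J])
  also have "\<dots> = cs / ?s" by (simp add: cs_def)
  finally show ?thesis .
qed

text \<open>The bias left once the Gaussian fluctuations are removed: the conditional mean of the
  cross validation criterion, less the noise variance, minus that of the prediction error.\<close>

definition mean_diff :: "(nat \<Rightarrow> real^'d) \<Rightarrow> real" where
  "mean_diff x = (\<Sum>i<n. phi ({..<n} - {i}) x (x i)) / n - Phi {..<n} x"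

definition c3 :: real where "c3 = 4 * (1 + c4 * (1 + 24 * e0))"

lemma Phi_square_diff_le:
  assumes "I \<subseteq> {..<n}" "J \<subseteq> {..<n}"
  shows "(Phi I x - Phi J x)\<^sup>2 \<le> (\<integral>t. (phi I x t - phi J x t)\<^sup>2 \<partial>unif n)"
proof -
  interpret U: prob_space "unif n :: (real^'d) measure" by (rule prob_unif)
  have i: "integrable (unif n) (\<lambda>t. phi I x t)" "integrable (unif n) (\<lambda>t. phi J x t)"
    using assms by (auto intro!: integrable_unif[OF n_pos, of _ phimax] abs_phi_le)
  have "\<bar>phi I x t - phi J x t\<bar> \<le> 2 * phimax" for t
    using abs_phi_le[OF assms(1), of x t] abs_phi_le[OF assms(2), of x t] by linarith
  then have "\<bar>(phi I x t - phi J x t)\<^sup>2\<bar> \<le> (2 * phimax)\<^sup>2" for t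
    using power_mono[of "\<bar>phi I x t - phi J x t\<bar>" "2 * phimax" 2] by simp
  then have i2: "integrable (unif n) (\<lambda>t. (phi I x t - phi J x t)\<^sup>2)"
    using assms by (intro integrable_unif[OF n_pos]) auto
  have "Phi I x - Phi J x = (\<integral>t. phi I x t - phi J x t \<partial>unif n)"
    unfolding Phi_def using i by simp
  then show ?thesis using U.square_expectation_le[OF _ i2] i by simp
qed

text \<open>The terms \<open>phi ({..<n} - {i}) x (x i) - Phi ({..<n} - {i}) x\<close> are centred given the other
  points, and become orthogonal once the point \<open>j\<close> is also removed from the \<open>i\<close>-th of them.\<close>

lemma integral_mean_diff_square_le:
  "(\<integral>x. (mean_diff x)\<^sup>2 \<partial>design n) \<le> 2 * c3 / n + (4 * cs + c3) / sqrt (sqrt n) + 2 * cs / sqrt n"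
proof -
  interpret D: prob_space "design n :: (nat \<Rightarrow> real^'d) measure" by (rule prob_design)
  interpret U: prob_space "unif n :: (real^'d) measure" by (rule prob_unif)
  let ?N = "{..<n}" and ?s = "sqrt n" and ?r = "sqrt (sqrt n)"
  define psi where "psi J i x = phi J x (x i) - Phi J x" for J i x
  have sub: "?N - S \<subseteq> ?N" for S by auto
  have psi_meas: "psi J i \<in> borel_measurable (design n)" if "J \<subseteq> ?N" "i < n" for J i
    unfolding psi_def[abs_def] by (intro borel_measurable_diff borel_measurable_phi_coord borel_measurable_Phi that)
  have psi_bd: "\<bar>psi J i x\<bar> \<le> 2 * phimax" if "J \<subseteq> ?N" for J i x
    using abs_phi_le[OF that, of x "x i"] abs_Phi_le[OF that, of x] unfolding psi_def by linarith
  have prod_bd: "\<bar>f x * g x\<bar> \<le> (2 * phimax) * (2 * phimax)"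
    if "\<bar>f x\<bar> \<le> 2 * phimax" "\<bar>g x\<bar> \<le> 2 * phimax" for f g :: "_ \<Rightarrow> real" and x :: "nat \<Rightarrow> real^'d"
    unfolding abs_mult using that phimax_nonneg by (intro mult_mono) auto
  have prod_int: "integrable (design n) (\<lambda>x. psi I i x * psi J j x)" if "I \<subseteq> ?N" "J \<subseteq> ?N" "i < n" "j < n" for I J i j
    by (rule integrable_design[of _ "(2 * phimax) * (2 * phimax)"],
        intro borel_measurable_times psi_meas that, intro prod_bd psi_bd that)
  have sq_int: "integrable (design n) (\<lambda>x. (psi J j x)\<^sup>2)" if "J \<subseteq> ?N" "j < n" for J j
    unfolding power2_eq_square by (intro prod_int that)
  have Esq: "(\<integral>x. (psi J j x)\<^sup>2 \<partial>design n) \<le> c3" if J: "J \<subseteq> ?N" "j < n" "j \<notin> J" for J j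
  proof -
    have ip: "integrable (design n) (\<lambda>x. phi J x (x j) ^ 2)"
      by (rule integrable_design[OF _ abs_phi_power_le[OF J(1)]])
         (intro borel_measurable_power borel_measurable_phi_coord J)
    have iP: "integrable (design n) (\<lambda>x. (Phi J x)\<^sup>2)"
    proof (rule integrable_design[of _ "phimax ^ 2"])
      show "\<bar>(Phi J x)\<^sup>2\<bar> \<le> phimax\<^sup>2" for x using power_mono[OF abs_Phi_le[OF J(1)], of x 2] by simp
    qed (intro borel_measurable_power borel_measurable_Phi J)
    have m2: "(\<lambda>x. \<integral>t. phi J x t ^ m \<partial>unif n) \<in> borel_measurable (design n)" for m
      by (rule borel_measurable_integral_unif)
         (use borel_measurable_phi_pair[OF J(1)] in \<open>auto simp: case_prod_beta' intro: borel_measurable_power\<close>)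
    have ii: "integrable (design n) (\<lambda>x. \<integral>t. phi J x t ^ m \<partial>unif n)" for m
      by (rule integrable_design[OF m2, of _ "phimax ^ m"])
         (intro integral_unif_abs_le abs_phi_power_le borel_measurable_power borel_measurable_phi_t J(1))
    have it: "integrable (unif n) (\<lambda>t. phi J x t ^ m)" for x m
      by (rule integrable_unif[OF n_pos _ abs_phi_power_le[OF J(1)]]) (intro borel_measurable_power borel_measurable_phi_t J(1))
    have "(\<integral>x. (psi J j x)\<^sup>2 \<partial>design n) \<le> (\<integral>x. 2 * phi J x (x j) ^ 2 + 2 * (Phi J x)\<^sup>2 \<partial>design n)"
      using ip iP sq_int[OF J(1,2)] by (intro integral_mono) (auto simp: psi_def square_diff_le)
    also have "\<dots> = 2 * (\<integral>x. phi J x (x j) ^ 2 \<partial>design n) + 2 * (\<integral>x. (Phi J x)\<^sup>2 \<partial>design n)"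
      using ip iP by simp
    also have "(\<integral>x. (Phi J x)\<^sup>2 \<partial>design n) \<le> (\<integral>x. (\<integral>t. phi J x t ^ 2 \<partial>unif n) \<partial>design n)"
    proof (intro integral_mono iP ii)
      show "(Phi J x)\<^sup>2 \<le> (\<integral>t. phi J x t ^ 2 \<partial>unif n)" for x
        unfolding Phi_def using it[of x 1] it[of x 2] by (intro U.square_expectation_le) auto
    qed
    also have "(\<integral>x. phi J x (x j) ^ 2 \<partial>design n) = (\<integral>x. (\<integral>t. phi J x t ^ 2 \<partial>unif n) \<partial>design n)"
      by (rule integral_phi_coord_power[OF J])
    also have "(\<integral>x. (\<integral>t. phi J x t ^ 2 \<partial>unif n) \<partial>design n) \<le> (\<integral>x. 1 + (\<integral>t. phi J x t ^ 4 \<partial>unif n) \<partial>design n)"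
    proof (rule integral_mono[OF ii])
      show "integrable (design n) (\<lambda>x. 1 + (\<integral>t. phi J x t ^ 4 \<partial>unif n))" using ii[of 4] by auto
      fix x
      have le: "z\<^sup>2 \<le> 1 + z ^ 4" for z :: real
      proof -
        have "2 * z\<^sup>2 \<le> z ^ 4 + 1" using mult_le_weighted_squares[of 1 "z\<^sup>2" 1] by simp
        with zero_le_power2[of z] show ?thesis by linarith
      qed
      have "(\<integral>t. phi J x t ^ 2 \<partial>unif n) \<le> (\<integral>t. 1 + phi J x t ^ 4 \<partial>unif n)"
        using it[of x 4] it[of x 2] by (intro integral_mono le) auto
      also have "\<dots> = 1 + (\<integral>t. phi J x t ^ 4 \<partial>unif n)" using it[of x 4] by (simp add: U.prob_space[simplified])
      finally show "(\<integral>t. phi J x t ^ 2 \<partial>unif n) \<le> 1 + (\<integral>t. phi J x t ^ 4 \<partial>unif n)" .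
    qed
    also have "\<dots> = 1 + (\<integral>x. (\<integral>t. phi J x t ^ 4 \<partial>unif n) \<partial>design n)" using ii[of 4] D.prob_space by simp
    also have "\<dots> \<le> 1 + c4 * (1 + 24 * e0)" using integral_phi_power4_design_le[OF J(1)] by simp
    finally show ?thesis by (simp add: c3_def)
  qed
  \<comment> \<open>Redraw the point \<open>j\<close>: the first factor does not involve it, and the
    second one then integrates to zero by the definition of \<open>Phi\<close>.\<close>
  have orth: "(\<integral>x. psi (?N - {i, j}) i x * psi (?N - {j}) j x \<partial>design n) = 0" if ij: "i < n" "j < n" "i \<noteq> j" for i j
  proof -
    let ?f = "\<lambda>x. psi (?N - {i, j}) i x * psi (?N - {j}) j x"
    have Ph: "Phi J (x(j := t)) = Phi J x" if "J \<subseteq> ?N" "j \<notin> J" for J x t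
      unfolding Phi_def by (intro Bochner_Integration.integral_cong refl phi_fun_upd that)
    have it: "integrable (unif n) (\<lambda>t. phi (?N - {j}) x t)" for x
      by (rule integrable_unif[OF n_pos, of _ phimax]) (auto intro!: abs_phi_le)
    have "(\<integral>x. ?f x \<partial>design n) = (\<integral>x. (\<integral>t. ?f (x(j := t)) \<partial>unif n) \<partial>design n)"
    proof (rule integral_PiM_resample[where B="(2 * phimax) * (2 * phimax)"])
      show "?f \<in> borel_measurable (design n)" by (intro borel_measurable_times psi_meas sub ij)
      show "\<bar>?f x\<bar> \<le> (2 * phimax) * (2 * phimax)" for x by (intro prod_bd psi_bd sub)
    qed (use ij in \<open>auto intro: prob_unif\<close>)
    also have "\<dots> = (\<integral>x. (\<integral>t. psi (?N - {i, j}) i x * (phi (?N - {j}) x t - Phi (?N - {j}) x) \<partial>unif n) \<partial>design n)"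
      using ij by (simp add: psi_def Ph phi_fun_upd sub)
    also have "\<dots> = (\<integral>x. 0 \<partial>(design n :: (nat \<Rightarrow> real^'d) measure))"
      using it by (intro Bochner_Integration.integral_cong refl) (simp add: U.prob_space[simplified] Phi_def)
    finally show ?thesis by simp
  qed
  have stab: "(\<integral>x. (\<integral>t. (phi (?N - S) x t - phi (?N - S - {j}) x t)\<^sup>2 \<partial>unif n) \<partial>design n) \<le> cs / ?s" if "j < n" "j \<notin> S" for j S
  proof -
    have "insert j (?N - S - {j}) = ?N - S" using that by auto
    then show ?thesis using phi_stability[of "?N - S - {j}" j] that by auto
  qed
  have sq_bd: "\<bar>(z - w)\<^sup>2\<bar> \<le> (2 * phimax)\<^sup>2" if "\<bar>z\<bar> \<le> phimax" "\<bar>w\<bar> \<le> phimax" for z w :: real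
  proof -
    have "\<bar>z - w\<bar> \<le> 2 * phimax" using that by linarith
    from power_mono[OF this, of 2] show ?thesis by simp
  qed
  have dI: "integrable (design n) (\<lambda>x. \<integral>t. (phi I x t - phi J x t)\<^sup>2 \<partial>unif n)" if IJ: "I \<subseteq> ?N" "J \<subseteq> ?N" for I J
  proof (rule integrable_design[of _ "(2 * phimax)\<^sup>2"])
    show "(\<lambda>x. \<integral>t. (phi I x t - phi J x t)\<^sup>2 \<partial>unif n) \<in> borel_measurable (design n)"
      by (rule borel_measurable_integral_unif)
         (use borel_measurable_phi_pair[OF IJ(1)] borel_measurable_phi_pair[OF IJ(2)] in
           \<open>auto simp: case_prod_beta' intro!: borel_measurable_power borel_measurable_diff\<close>)
    show "\<bar>\<integral>t. (phi I x t - phi J x t)\<^sup>2 \<partial>unif n\<bar> \<le> (2 * phimax)\<^sup>2" for x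
      by (intro integral_unif_abs_le sq_bd abs_phi_le IJ borel_measurable_power borel_measurable_diff borel_measurable_phi_t)
  qed
  have PhiI: "integrable (design n) (\<lambda>x. (Phi I x - Phi J x)\<^sup>2)" if IJ: "I \<subseteq> ?N" "J \<subseteq> ?N" for I J
    by (rule integrable_design[of _ "(2 * phimax)\<^sup>2"],
        intro borel_measurable_power borel_measurable_diff borel_measurable_Phi IJ, intro sq_bd abs_Phi_le IJ)
  have diff2: "(\<integral>x. (psi (?N - {i}) i x - psi (?N - {i, j}) i x)\<^sup>2 \<partial>design n) \<le> 4 * cs / ?s" if ij: "i < n" "j < n" "i \<noteq> j" for i j
  proof -
    let ?I = "?N - {i}" and ?J = "?N - {i, j}"
    have eqJ: "?N - {i} - {j} = ?J" by auto
    let ?d = "\<lambda>x. phi ?I x (x i) - phi ?J x (x i)" and ?D = "\<lambda>x. Phi ?I x - Phi ?J x"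
    have md: "?d \<in> borel_measurable (design n)"
      by (intro borel_measurable_diff borel_measurable_phi_coord sub ij)
    have id: "integrable (design n) (\<lambda>x. (?d x)\<^sup>2)"
      by (rule integrable_design[of _ "(2 * phimax)\<^sup>2"], intro borel_measurable_power md, intro sq_bd abs_phi_le sub)
    have "(\<integral>x. (psi ?I i x - psi ?J i x)\<^sup>2 \<partial>design n) \<le> (\<integral>x. 2 * (?d x)\<^sup>2 + 2 * (?D x)\<^sup>2 \<partial>design n)"
    proof (intro integral_mono')
      show "integrable (design n) (\<lambda>x. 2 * (?d x)\<^sup>2 + 2 * (?D x)\<^sup>2)" using id PhiI[OF sub sub] by auto
      show "(psi ?I i x - psi ?J i x)\<^sup>2 \<le> 2 * (?d x)\<^sup>2 + 2 * (?D x)\<^sup>2" for x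
        using square_diff_le[of "?d x" "?D x"] by (simp add: psi_def algebra_simps)
    qed auto
    also have "\<dots> = 2 * (\<integral>x. (?d x)\<^sup>2 \<partial>design n) + 2 * (\<integral>x. (?D x)\<^sup>2 \<partial>design n)"
      using id PhiI[OF sub sub] by simp
    also have "(\<integral>x. (?D x)\<^sup>2 \<partial>design n) \<le> (\<integral>x. (\<integral>t. (phi ?I x t - phi ?J x t)\<^sup>2 \<partial>unif n) \<partial>design n)"
      by (intro integral_mono PhiI dI sub Phi_square_diff_le)
    also have "(\<integral>x. (?d x)\<^sup>2 \<partial>design n) = (\<integral>x. (\<integral>t. (phi ?I x t - phi ?J x t)\<^sup>2 \<partial>unif n) \<partial>design n)"
    proof -
      have "(\<integral>x. (?d x)\<^sup>2 \<partial>design n) = (\<integral>x. (\<integral>t. (?d (x(i := t)))\<^sup>2 \<partial>unif n) \<partial>design n)"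
      proof (rule integral_PiM_resample[where B="(2 * phimax)\<^sup>2"])
        show "(\<lambda>x. (?d x)\<^sup>2) \<in> borel_measurable (design n)" by (intro borel_measurable_power md)
        show "\<bar>(?d x)\<^sup>2\<bar> \<le> (2 * phimax)\<^sup>2" for x by (intro sq_bd abs_phi_le sub)
      qed (use ij in \<open>auto intro: prob_unif\<close>)
      then show ?thesis by (simp add: phi_fun_upd sub)
    qed
    also have "(\<integral>x. (\<integral>t. (phi ?I x t - phi ?J x t)\<^sup>2 \<partial>unif n) \<partial>design n) \<le> cs / ?s"
      using stab[of j "{i}"] ij unfolding eqJ by auto
    finally show ?thesis by simp
  qed
  have r: "0 < ?r" "?r * ?r = ?s" "0 < ?s" using n_pos by simp_all
  \<comment> \<open>Removing \<open>j\<close> from the first factor costs a term of order 1 /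
    \<open>?s\<close> in mean square, while the other factor is merely bounded in mean square. The
    weight \<open>?r\<close>, the fourth root of \<open>n\<close>, makes both halves of the
    arithmetic-geometric bound of order 1 / \<open>?r\<close>.\<close>
  have cross: "(\<integral>x. psi (?N - {i}) i x * psi (?N - {j}) j x \<partial>design n) \<le> (4 * cs + c3) / (2 * ?r)" if ij: "i < n" "j < n" "i \<noteq> j" for i j
  proof -
    let ?I = "psi (?N - {i}) i" and ?J = "psi (?N - {i, j}) i" and ?K = "psi (?N - {j}) j"
    have id: "integrable (design n) (\<lambda>x. (?I x - ?J x)\<^sup>2)"
    proof -
      have "(?I x - ?J x)\<^sup>2 = ?I x * ?I x - 2 * (?I x * ?J x) + ?J x * ?J x" for x
        by (simp add: power2_eq_square algebra_simps)
      then show ?thesis using prod_int[OF sub sub ij(1,1)] by simp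
    qed
    have "(\<integral>x. ?I x * ?K x \<partial>design n) = (\<integral>x. (?I x - ?J x) * ?K x + ?J x * ?K x \<partial>design n)"
      by (intro Bochner_Integration.integral_cong refl) (simp add: algebra_simps)
    also have "\<dots> = (\<integral>x. (?I x - ?J x) * ?K x \<partial>design n)"
      using prod_int[OF sub sub ij(1,2)] orth[OF ij] by (simp add: left_diff_distrib)
    also have "\<dots> \<le> (\<integral>x. (?r * (?I x - ?J x)\<^sup>2 + (?K x)\<^sup>2 / ?r) / 2 \<partial>design n)"
      using prod_int[OF sub sub ij(1,2)] id sq_int[OF sub ij(2)]
      by (intro integral_mono mult_le_weighted_squares r) (auto simp: left_diff_distrib)
    also have "\<dots> = (?r * (\<integral>x. (?I x - ?J x)\<^sup>2 \<partial>design n) + (\<integral>x. (?K x)\<^sup>2 \<partial>design n) / ?r) / 2"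
      using id sq_int[OF sub ij(2)] by simp
    also have "\<dots> \<le> (?r * (4 * cs / ?s) + c3 / ?r) / 2"
      using r ij by (intro divide_right_mono add_mono mult_left_mono diff2 Esq) auto
    also have "?r * (4 * cs / ?s) = 4 * cs / ?r" using sqrt_cancel[OF r(2,1), of 1 "4 * cs" 1] by simp
    finally show ?thesis by (simp add: add_divide_distrib)
  qed
  \<comment> \<open>\<open>mean_diff\<close> is the sum of a centred part \<open>?P\<close> and a
    part \<open>?Q\<close> that passes from \<open>n - 1\<close> points to \<open>n\<close>. The
    first is handled by near orthogonality, the second by stability alone.\<close>
  let ?P = "\<lambda>x. (\<Sum>i<n. psi (?N - {i}) i x) / n"
  let ?Q = "\<lambda>x. (\<Sum>i<n. Phi (?N - {i}) x - Phi ?N x) / n"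
  have c3: "0 \<le> c3" using c4_nonneg by (simp add: c3_def e0_def)
  have cs: "0 \<le> cs"
    unfolding cs_def using cg_nonneg c4_nonneg A_pos \<kappa>_nonneg
    by (intro mult_nonneg_nonneg add_nonneg_nonneg) (auto simp: e0_def)
  have P2: "(?P x)\<^sup>2 = (\<Sum>i<n. \<Sum>j<n. psi (?N - {i}) i x * psi (?N - {j}) j x) / (real n)\<^sup>2" for x
    by (simp add: power_divide power2_eq_square[of "\<Sum>i<n. psi (?N - {i}) i x"] sum_product)
  have iP2: "integrable (design n) (\<lambda>x. (?P x)\<^sup>2)"
    unfolding P2 by (intro Bochner_Integration.integrable_divide Bochner_Integration.integrable_sum prod_int sub) auto
  have EP: "(\<integral>x. (?P x)\<^sup>2 \<partial>design n) \<le> c3 / n + (4 * cs + c3) / (2 * ?r)"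
  proof -
    have "(\<integral>x. (?P x)\<^sup>2 \<partial>design n) = (\<Sum>i<n. \<Sum>j<n. \<integral>x. psi (?N - {i}) i x * psi (?N - {j}) j x \<partial>design n) / (real n)\<^sup>2"
    proof -
      have "(\<integral>x. (\<Sum>i<n. \<Sum>j<n. psi (?N - {i}) i x * psi (?N - {j}) j x) \<partial>design n) =
          (\<Sum>i<n. \<integral>x. (\<Sum>j<n. psi (?N - {i}) i x * psi (?N - {j}) j x) \<partial>design n)"
        by (intro Bochner_Integration.integral_sum Bochner_Integration.integrable_sum prod_int sub) auto
      also have "\<dots> = (\<Sum>i<n. \<Sum>j<n. \<integral>x. psi (?N - {i}) i x * psi (?N - {j}) j x \<partial>design n)"
        by (intro sum.cong refl Bochner_Integration.integral_sum prod_int sub) auto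
      finally show ?thesis unfolding P2 by simp
    qed
    also have "\<dots> \<le> (\<Sum>i<n. \<Sum>j<n. (if j = i then c3 else 0) + (4 * cs + c3) / (2 * ?r)) / (real n)\<^sup>2"
    proof (intro divide_right_mono sum_mono)
      fix i j assume "i \<in> ?N" "j \<in> ?N"
      then have ij: "i < n" "j < n" by auto
      have "0 \<le> (4 * cs + c3) / (2 * ?r)" using cs c3 r by simp
      then show "(\<integral>x. psi (?N - {i}) i x * psi (?N - {j}) j x \<partial>design n) \<le> (if j = i then c3 else 0) + (4 * cs + c3) / (2 * ?r)"
        using cross[OF ij] Esq[OF sub ij(1), of "{i}"] by (cases "i = j") (auto simp: power2_eq_square)
    qed simp
    also have "\<dots> = (real n * c3 + real n * (real n * ((4 * cs + c3) / (2 * ?r)))) / (real n)\<^sup>2"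
    proof -
      have "(\<Sum>i<n. \<Sum>j<n. (if j = i then c else 0) + q) = real n * c + real n * (real n * q)" for c q :: real
        by (simp add: sum.distrib distrib_left)
      then show ?thesis by (simp only:)
    qed
    also have "\<dots> = c3 / n + (4 * cs + c3) / (2 * ?r)"
    proof -
      have "(real n * c + real n * (real n * q)) / (real n)\<^sup>2 = c / n + q" for c q :: real
        using n_pos by (simp add: power2_eq_square field_simps)
      then show ?thesis .
    qed
    finally show ?thesis .
  qed
  have Q2: "(?Q x)\<^sup>2 \<le> (\<Sum>i<n. (Phi (?N - {i}) x - Phi ?N x)\<^sup>2) / n" for x
  proof -
    have "(\<Sum>i<n. 1 * (Phi (?N - {i}) x - Phi ?N x))\<^sup>2 \<le> (\<Sum>i<n. 1) * (\<Sum>i<n. 1 * (Phi (?N - {i}) x - Phi ?N x)\<^sup>2)"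
      by (rule weighted_square_sum_le) auto
    then have "(?Q x)\<^sup>2 \<le> (real n * (\<Sum>i<n. (Phi (?N - {i}) x - Phi ?N x)\<^sup>2)) / (real n)\<^sup>2"
      unfolding power_divide by (intro divide_right_mono) auto
    then show ?thesis using n_pos by (simp add: power2_eq_square)
  qed
  have iQ: "integrable (design n) (\<lambda>x. (\<Sum>i<n. (Phi (?N - {i}) x - Phi ?N x)\<^sup>2) / n)"
    by (intro Bochner_Integration.integrable_divide Bochner_Integration.integrable_sum PhiI sub order_refl)
  have EQ: "(\<integral>x. (\<Sum>i<n. (Phi (?N - {i}) x - Phi ?N x)\<^sup>2) / n \<partial>design n) \<le> cs / ?s"
  proof -
    have "(\<integral>x. (\<Sum>i<n. (Phi (?N - {i}) x - Phi ?N x)\<^sup>2) / n \<partial>design n) =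
        (\<Sum>i<n. \<integral>x. (Phi (?N - {i}) x - Phi ?N x)\<^sup>2 \<partial>design n) / n"
      using PhiI[OF sub order_refl] by (simp add: Bochner_Integration.integral_sum)
    also have "\<dots> \<le> (\<Sum>i<n. cs / ?s) / n"
    proof (intro divide_right_mono sum_mono)
      fix i assume i: "i \<in> ?N"
      have "(\<integral>x. (Phi (?N - {i}) x - Phi ?N x)\<^sup>2 \<partial>design n) \<le> (\<integral>x. (\<integral>t. (phi ?N x t - phi (?N - {i}) x t)\<^sup>2 \<partial>unif n) \<partial>design n)"
        using Phi_square_diff_le[OF order_refl sub] by (intro integral_mono PhiI dI sub order_refl) (simp add: power2_commute)
      also have "\<dots> \<le> cs / ?s" using stab[of i "{}"] i by simp
      finally show "(\<integral>x. (Phi (?N - {i}) x - Phi ?N x)\<^sup>2 \<partial>design n) \<le> cs / ?s" .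
    qed simp
    finally show ?thesis using n_pos by simp
  qed
  define q where "q x = (\<Sum>i<n. (Phi (?N - {i}) x - Phi ?N x)\<^sup>2) / n" for x
  define p where "p x = (?P x)\<^sup>2" for x
  have q: "integrable (design n) q" "(\<integral>x. q x \<partial>design n) \<le> cs / ?s" "0 \<le> q x" for x
    using iQ EQ by (auto simp: q_def[abs_def] intro!: divide_nonneg_nonneg sum_nonneg)
  have p: "integrable (design n) p" "(\<integral>x. p x \<partial>design n) \<le> c3 / n + (4 * cs + c3) / (2 * ?r)" "0 \<le> p x" for x
    using iP2 EP by (auto simp: p_def[abs_def])
  have "(mean_diff x)\<^sup>2 \<le> 2 * p x + 2 * q x" for x
  proof -
    have "mean_diff x = ?P x - (- ?Q x)"
      using n_pos by (simp add: mean_diff_def psi_def sum_subtractf diff_divide_distrib)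
    then have "(mean_diff x)\<^sup>2 \<le> 2 * (?P x)\<^sup>2 + 2 * (?Q x)\<^sup>2" using square_diff_le[of "?P x" "- ?Q x"] by simp
    then show ?thesis using Q2[of x] unfolding p_def q_def by linarith
  qed
  then have "(\<integral>x. (mean_diff x)\<^sup>2 \<partial>design n) \<le> (\<integral>x. 2 * p x + 2 * q x \<partial>design n)"
    using p(1,3) q(1,3) by (intro integral_mono') auto
  also have "\<dots> = 2 * (\<integral>x. p x \<partial>design n) + 2 * (\<integral>x. q x \<partial>design n)"
    using p(1) q(1) by simp
  also have "\<dots> \<le> 2 * (c3 / n + (4 * cs + c3) / (2 * ?r)) + 2 * (cs / ?s)"
    by (intro add_mono mult_left_mono p(2) q(2)) auto
  also have "\<dots> = 2 * c3 / n + (4 * cs + c3) / ?r + 2 * cs / ?s"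
  proof -
    have "2 * (c + z / (2 * r)) + 2 * w = 2 * c + z / r + 2 * w" for c z r w :: real by simp
    note eq = this
    show ?thesis by (subst eq) (simp only: times_divide_eq_right)
  qed
  finally show ?thesis .
qed

end

section \<open>Conditional variances given the design\<close>

lemma integral_decay_conv_le:
  fixes a b :: "real^'d::finite"
  assumes n: "0 < n"
  shows "(\<integral>t. decay (t - a) * decay (t - b) \<partial>unif n) \<le> 2 ^ (CARD('d) + 2) * decay_mass TYPE('d) / n * decay (a - b)"
proof -
  have i: "integrable (unif n) (\<lambda>t. decay (t - a))" for a :: "real^'d"
    by (rule integrable_unif[OF n, of _ 1]) (auto simp: decay_le_1)
  have "(\<integral>t. decay (t - a) * decay (t - b) \<partial>unif n) \<le>
      (\<integral>t. 2 ^ (CARD('d) + 1) * decay (a - b) * (decay (t - a) + decay (t - b)) \<partial>unif n)"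
  proof (intro integral_mono')
    show "decay (t - a) * decay (t - b) \<le> 2 ^ (CARD('d) + 1) * decay (a - b) * (decay (t - a) + decay (t - b))" for t
      using decay_mult_le[of "a - t" "t - b"] by (simp add: decay_diff_commute[of a t])
  qed (use i in auto)
  also have "\<dots> = 2 ^ (CARD('d) + 1) * decay (a - b) * ((\<integral>t. decay (t - a) \<partial>unif n) + (\<integral>t. decay (t - b) \<partial>unif n))"
    using i by simp
  also have "\<dots> \<le> 2 ^ (CARD('d) + 1) * decay (a - b) * (decay_mass TYPE('d) / n + decay_mass TYPE('d) / n)"
    by (intro mult_left_mono add_mono integral_decay_unif[OF n]) auto
  finally show ?thesis by (simp add: mult_ac)
qed

context model
begin

definition cc :: real where "cc = 2 ^ (CARD('d) + 2) * decay_mass TYPE('d)"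

lemma cc_nonneg: "0 \<le> cc"
  by (simp add: cc_def decay_mass_nonneg)

lemma integral_decay_sum_square_le:
  assumes "finite I"
  shows "(\<integral>t. (\<Sum>i\<in>I. decay (t - x i) * a i)\<^sup>2 \<partial>unif n) \<le> cc / n * (\<Sum>i\<in>I. (a i)\<^sup>2 * near I x i)"
proof -
  have i: "integrable (unif n) (\<lambda>t. decay (t - x i) * decay (t - x j))" for i j
    by (rule integrable_unif[OF n_pos, of _ "1 * 1"]) (auto simp: abs_mult intro!: mult_le_one decay_le_1)
  have "(\<Sum>i\<in>I. decay (t - x i) * a i)\<^sup>2 \<le> (\<Sum>i\<in>I. \<Sum>j\<in>I. (a i)\<^sup>2 * (decay (t - x i) * decay (t - x j)))" for t
  proof -
    have "(\<Sum>i\<in>I. decay (t - x i) * a i)\<^sup>2 \<le> (\<Sum>j\<in>I. decay (t - x j)) * (\<Sum>i\<in>I. decay (t - x i) * (a i)\<^sup>2)"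
      by (rule weighted_square_sum_le) simp
    also have "\<dots> = (\<Sum>i\<in>I. \<Sum>j\<in>I. (a i)\<^sup>2 * (decay (t - x i) * decay (t - x j)))"
      unfolding sum_product by (subst sum.swap) (simp add: mult_ac)
    finally show ?thesis .
  qed
  then have "(\<integral>t. (\<Sum>i\<in>I. decay (t - x i) * a i)\<^sup>2 \<partial>unif n) \<le>
      (\<integral>t. (\<Sum>i\<in>I. \<Sum>j\<in>I. (a i)\<^sup>2 * (decay (t - x i) * decay (t - x j))) \<partial>unif n)"
    by (intro integral_mono' Bochner_Integration.integrable_sum integrable_mult_right i) (auto intro!: sum_nonneg)
  also have "\<dots> = (\<Sum>i\<in>I. \<Sum>j\<in>I. (a i)\<^sup>2 * (\<integral>t. decay (t - x i) * decay (t - x j) \<partial>unif n))"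
    using i by (simp add: Bochner_Integration.integral_sum Bochner_Integration.integrable_sum)
  also have "\<dots> \<le> (\<Sum>i\<in>I. \<Sum>j\<in>I. (a i)\<^sup>2 * (cc / n * decay (x i - x j)))"
    unfolding cc_def by (intro sum_mono mult_left_mono integral_decay_conv_le n_pos) auto
  also have "\<dots> = cc / n * (\<Sum>i\<in>I. (a i)\<^sup>2 * near I x i)"
    by (simp add: near_def sum_distrib_left mult_ac)
  finally show ?thesis .
qed

section \<open>Conditional variance of the cross validation criterion\<close>

abbreviation nr :: "(nat \<Rightarrow> real^'d) \<Rightarrow> nat \<Rightarrow> real" where "nr \<equiv> near {..<n}"

definition u :: "(nat \<Rightarrow> real^'d) \<Rightarrow> nat \<Rightarrow> 'w \<Rightarrow> real" where
  "u x i \<omega> = solution {..<n} x (\<lambda>j. obs x j \<omega>) i"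

lemma u_eq: "i < n \<Longrightarrow> u x i = (\<lambda>\<omega>. \<Sum>j<n. invcol {..<n} x i j * obs x j \<omega>)"
  unfolding u_def[abs_def] by (intro ext solution_invcol) auto

lemma lin_u: "i < n \<Longrightarrow> u x i \<in> lin"
  unfolding u_eq by (intro lin_sum lin_scale lin_obs) auto

definition cov_u :: "(nat \<Rightarrow> real^'d) \<Rightarrow> nat \<Rightarrow> nat \<Rightarrow> real" where
  "cov_u x i j = expectation (\<lambda>\<omega>. u x i \<omega> * u x j \<omega>)"

lemma sum_cov_obs_square_le:
  "(\<Sum>i<n. \<Sum>j<n. (expectation (\<lambda>\<omega>. obs x i \<omega> * obs x j \<omega>))\<^sup>2) \<le> S\<^sub>0\<^sup>2 * (\<Sum>i<n. nr x i)"
proof -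
  have "(expectation (\<lambda>\<omega>. obs x i \<omega> * obs x j \<omega>))\<^sup>2 \<le> S\<^sub>0\<^sup>2 * decay (x i - x j)" if "i < n" "j < n" for i j
  proof -
    have "(expectation (\<lambda>\<omega>. obs x i \<omega> * obs x j \<omega>))\<^sup>2 \<le> (S\<^sub>0 * decay (x i - x j))\<^sup>2"
      using power_mono[OF abs_cov_obs_le[OF that, of x], of 2] by (simp add: S\<^sub>0_def)
    also have "\<dots> = S\<^sub>0\<^sup>2 * (decay (x i - x j) * decay (x i - x j))" by (simp add: power2_eq_square)
    also have "\<dots> \<le> S\<^sub>0\<^sup>2 * decay (x i - x j)" by (intro mult_left_mono mult_left_le decay_le_1) auto
    finally show ?thesis .
  qed
  then have "(\<Sum>i<n. \<Sum>j<n. (expectation (\<lambda>\<omega>. obs x i \<omega> * obs x j \<omega>))\<^sup>2) \<le> (\<Sum>i<n. \<Sum>j<n. S\<^sub>0\<^sup>2 * decay (x i - x j))"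
    by (intro sum_mono) auto
  then show ?thesis by (simp add: near_def sum_distrib_left)
qed

text \<open>The covariance matrix of \<open>u\<close> is that of the observations multiplied by the
  inverse of \<open>R\<close> from both sides. Each multiplication shrinks the Hilbert-Schmidt norm
  by \<open>C\<close>. This norm, unlike the operator norm, needs no control of the most crowded
  point: for the observations it is bounded by the sum of the neighbour counts.\<close>

lemma sum_cov_u_square_le: "(\<Sum>i<n. \<Sum>j<n. (cov_u x i j)\<^sup>2) \<le> S\<^sub>0\<^sup>2 / C ^ 4 * (\<Sum>i<n. nr x i)"
proof -
  let ?N = "{..<n}"
  define \<Sigma> where "\<Sigma> a b = expectation (\<lambda>\<omega>. obs x a \<omega> * obs x b \<omega>)" for a b
  define T where "T j a = solution ?N x (\<Sigma> a) j" for j a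
  have V: "cov_u x i j = solution ?N x (T j) i" if "i < n" "j < n" for i j
  proof -
    have "cov_u x i j = (\<Sum>a<n. \<Sum>b<n. invcol ?N x i a * invcol ?N x j b * \<Sigma> a b)"
      unfolding cov_u_def u_eq[OF that(1)] u_eq[OF that(2)] \<Sigma>_def
      by (rule cov_sum) (auto intro: lin_obs)
    also have "\<dots> = (\<Sum>a<n. invcol ?N x i a * (\<Sum>b<n. invcol ?N x j b * \<Sigma> a b))"
      by (simp add: sum_distrib_left mult.assoc)
    also have "\<dots> = (\<Sum>a<n. invcol ?N x i a * T j a)"
      using that by (simp add: T_def solution_invcol)
    also have "\<dots> = solution ?N x (T j) i" using that by (simp add: solution_invcol)
    finally show ?thesis .
  qed
  have "(\<Sum>i<n. \<Sum>j<n. (cov_u x i j)\<^sup>2) = (\<Sum>j<n. \<Sum>i<n. (solution ?N x (T j) i)\<^sup>2)"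
    by (subst sum.swap) (auto simp: V intro!: sum.cong)
  also have "\<dots> \<le> (\<Sum>j<n. (\<Sum>a<n. (T j a)\<^sup>2) / C\<^sup>2)"
    by (intro sum_mono solves_norm_le[OF _ solves_solution]) auto
  also have "\<dots> = (\<Sum>a<n. \<Sum>j<n. (solution ?N x (\<Sigma> a) j)\<^sup>2) / C\<^sup>2"
    unfolding T_def sum_divide_distrib[symmetric] by (subst sum.swap) simp
  also have "\<dots> \<le> (\<Sum>a<n. (\<Sum>b<n. (\<Sigma> a b)\<^sup>2) / C\<^sup>2) / C\<^sup>2"
    by (intro divide_right_mono sum_mono solves_norm_le[OF _ solves_solution]) auto
  also have "\<dots> = (\<Sum>a<n. \<Sum>b<n. (\<Sigma> a b)\<^sup>2) / C ^ 4"
    by (simp add: sum_divide_distrib[symmetric])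
  also have "\<dots> \<le> (S\<^sub>0\<^sup>2 * (\<Sum>i<n. nr x i)) / C ^ 4"
    using C_pos sum_cov_obs_square_le[of x] by (intro divide_right_mono) (auto simp: \<Sigma>_def)
  finally show ?thesis by simp
qed

lemma nr_ge_1: "i < n \<Longrightarrow> 1 \<le> nr x i"
  using member_le_sum[of i "{..<n}" "\<lambda>j. decay (x i - x j)"] by (simp add: near_def)

lemma cov_u_diag_square_le: "(\<Sum>i<n. (cov_u x i i)\<^sup>2) \<le> S\<^sub>0\<^sup>2 / C ^ 4 * (\<Sum>i<n. nr x i)"
proof -
  have "(\<Sum>i<n. (cov_u x i i)\<^sup>2) \<le> (\<Sum>i<n. \<Sum>j<n. (cov_u x i j)\<^sup>2)"
    by (intro sum_mono member_le_sum) auto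
  then show ?thesis using sum_cov_u_square_le[of x] by linarith
qed

lemma cov_u_diag: "cov_u x i i = expectation (\<lambda>\<omega>. (u x i \<omega>)\<^sup>2)"
  by (simp add: cov_u_def power2_eq_square)

definition cv :: "(nat \<Rightarrow> real^'d) \<Rightarrow> 'w \<Rightarrow> real" where
  "cv x \<omega> = (\<Sum>i<n. (loo_scale {..<n} x i)\<^sup>2 * (u x i \<omega>)\<^sup>2) / n"

definition ispe :: "(nat \<Rightarrow> real^'d) \<Rightarrow> 'w \<Rightarrow> real" where
  "ispe x \<omega> = (\<integral>t. (resid {..<n} x t \<omega>)\<^sup>2 \<partial>unif n)"

text \<open>The leave-one-out residual is the prediction error at \<open>x i\<close> plus the noise
  of the observation \<open>i\<close>, and the two are uncorrelated. This is the origin of the shift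
  by the noise variance between the two criteria.\<close>

lemma expectation_loo_square:
  assumes i: "i < n"
  shows "(loo_scale {..<n} x i)\<^sup>2 * expectation (\<lambda>\<omega>. (u x i \<omega>)\<^sup>2) = phi ({..<n} - {i}) x (x i) + \<delta>\<^sub>0"
proof -
  let ?J = "{..<n} - {i}"
  let ?e = "resid ?J x (x i)"
  have eq: "loo_scale {..<n} x i * u x i \<omega> = ?e \<omega> + \<epsilon> i \<omega>" for \<omega>
    using loo_residual[of "{..<n}" i "\<lambda>j. obs x j \<omega>" x] i by (simp add: u_def resid_def obs_def)
  have l: "?e \<in> lin" "\<epsilon> i \<in> lin" by (intro lin_resid lin_eps i; auto)+
  note int = lin_integrable(2)[OF l(1) lin_zero] lin_integrable(2)[OF l(2) lin_zero] lin_integrable(3)[OF l]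
  have "(loo_scale {..<n} x i)\<^sup>2 * expectation (\<lambda>\<omega>. (u x i \<omega>)\<^sup>2) = expectation (\<lambda>\<omega>. (loo_scale {..<n} x i * u x i \<omega>)\<^sup>2)"
    by (simp add: power_mult_distrib)
  also have "\<dots> = expectation (\<lambda>\<omega>. (?e \<omega>)\<^sup>2 + (\<epsilon> i \<omega>)\<^sup>2 + 2 * (?e \<omega> * \<epsilon> i \<omega>))"
    unfolding eq by (simp add: power2_sum mult.assoc)
  also have "\<dots> = phi ?J x (x i) + expectation (\<lambda>\<omega>. (\<epsilon> i \<omega>)\<^sup>2) + 2 * expectation (\<lambda>\<omega>. ?e \<omega> * \<epsilon> i \<omega>)"
    using int by (simp add: phi_def)
  also have "expectation (\<lambda>\<omega>. ?e \<omega> * \<epsilon> i \<omega>) = 0" by (rule cov_resid_eps) (use i in auto)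
  also have "expectation (\<lambda>\<omega>. (\<epsilon> i \<omega>)\<^sup>2) = \<delta>\<^sub>0" using cov_eps[OF i i] by (simp add: power2_eq_square)
  finally show ?thesis by simp
qed

lemma var_cv_le:
  "(\<integral>\<^sup>+\<omega>. ennreal ((cv x \<omega> - \<delta>\<^sub>0 - (\<Sum>i<n. phi ({..<n} - {i}) x (x i)) / n)\<^sup>2) \<partial>M)
    \<le> ennreal (2 * (A + \<delta>) ^ 4 * S\<^sub>0\<^sup>2 / C ^ 4 * ((\<Sum>i<n. nr x i) / n) / n)"
proof -
  let ?b = "\<lambda>i. (loo_scale {..<n} x i)\<^sup>2"
  define m where "m = (\<Sum>i<n. ?b i * expectation (\<lambda>\<omega>. (u x i \<omega>)\<^sup>2))"
  define Q where "Q \<omega> = (\<Sum>i<n. ?b i * (u x i \<omega>)\<^sup>2)" for \<omega>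
  have v: "expectation (\<lambda>\<omega>. (Q \<omega> - m)\<^sup>2) = 2 * (\<Sum>i<n. \<Sum>j<n. ?b i * ?b j * (cov_u x i j)\<^sup>2)"
    "integrable M (\<lambda>\<omega>. (Q \<omega> - m)\<^sup>2)"
    unfolding m_def Q_def cov_u_def by (rule var_quadratic_form; auto intro: lin_u)+
  have m: "m = (\<Sum>i<n. phi ({..<n} - {i}) x (x i)) + n * \<delta>\<^sub>0"
    unfolding m_def by (simp add: expectation_loo_square sum.distrib)
  have b: "0 \<le> ?b i" "?b i \<le> (A + \<delta>)\<^sup>2" for i
    using loo_scale_le[of "{..<n}" x i] loo_scale_pos[of "{..<n}" x i] by (auto intro!: power_mono)
  have "(\<Sum>i<n. \<Sum>j<n. ?b i * ?b j * (cov_u x i j)\<^sup>2) \<le> (\<Sum>i<n. \<Sum>j<n. (A + \<delta>)\<^sup>2 * (A + \<delta>)\<^sup>2 * (cov_u x i j)\<^sup>2)"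
    by (intro sum_mono mult_mono b) auto
  also have "\<dots> = (A + \<delta>) ^ 4 * (\<Sum>i<n. \<Sum>j<n. (cov_u x i j)\<^sup>2)"
    by (simp add: sum_distrib_left power_add[symmetric])
  also have "\<dots> \<le> (A + \<delta>) ^ 4 * (S\<^sub>0\<^sup>2 / C ^ 4 * (\<Sum>i<n. nr x i))"
    by (intro mult_left_mono sum_cov_u_square_le) simp
  finally have V: "expectation (\<lambda>\<omega>. (Q \<omega> - m)\<^sup>2) \<le> 2 * ((A + \<delta>) ^ 4 * (S\<^sub>0\<^sup>2 / C ^ 4 * (\<Sum>i<n. nr x i)))"
    using v(1) by simp
  have eq: "(cv x \<omega> - \<delta>\<^sub>0 - (\<Sum>i<n. phi ({..<n} - {i}) x (x i)) / n)\<^sup>2 = (Q \<omega> - m)\<^sup>2 / (real n)\<^sup>2" for \<omega>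
  proof -
    have "cv x \<omega> - \<delta>\<^sub>0 - (\<Sum>i<n. phi ({..<n} - {i}) x (x i)) / n = (Q \<omega> - m) / n"
      using n_pos by (simp add: cv_def Q_def m field_simps)
    then show ?thesis by (simp add: power_divide)
  qed
  have "(\<integral>\<^sup>+\<omega>. ennreal ((cv x \<omega> - \<delta>\<^sub>0 - (\<Sum>i<n. phi ({..<n} - {i}) x (x i)) / n)\<^sup>2) \<partial>M) =
      ennreal (expectation (\<lambda>\<omega>. (Q \<omega> - m)\<^sup>2 / (real n)\<^sup>2))"
    unfolding eq using v(2) by (intro nn_integral_eq_integral) auto
  also have "\<dots> \<le> ennreal (2 * ((A + \<delta>) ^ 4 * (S\<^sub>0\<^sup>2 / C ^ 4 * (\<Sum>i<n. nr x i))) / (real n)\<^sup>2)"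
    by (intro ennreal_leI, subst Bochner_Integration.integral_divide_zero, rule divide_right_mono[OF V]) simp
  finally show ?thesis by (simp add: power2_eq_square mult_ac)
qed

section \<open>Conditional variance of the integrated prediction error\<close>

definition cov_resid :: "(nat \<Rightarrow> real^'d) \<Rightarrow> real^'d \<Rightarrow> real^'d \<Rightarrow> real" where
  "cov_resid x s t = expectation (\<lambda>\<omega>. resid {..<n} x s \<omega> * resid {..<n} x t \<omega>)"

lemma cov_resid_eq:
  "cov_resid x s t = K\<^sub>0 (s - t) - (\<Sum>j<n. weight {..<n} x t j * K\<^sub>0 (s - x j)) - (\<Sum>j<n. weight {..<n} x s j * K\<^sub>0 (t - x j))
    + (\<Sum>i<n. weight {..<n} x s i * (\<Sum>j<n. weight {..<n} x t j * expectation (\<lambda>\<omega>. obs x i \<omega> * obs x j \<omega>)))"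
proof -
  let ?P = "\<lambda>t \<omega>. \<Sum>j<n. weight {..<n} x t j * obs x j \<omega>"
  have P: "?P t \<in> lin" for t by (intro lin_sum lin_scale lin_obs) auto
  have YP: "expectation (\<lambda>\<omega>. Y s \<omega> * ?P t \<omega>) = (\<Sum>j<n. weight {..<n} x t j * K\<^sub>0 (s - x j))" for s t
  proof -
    have "expectation (\<lambda>\<omega>. (\<Sum>i\<in>{s}. 1 * Y i \<omega>) * ?P t \<omega>) =
        (\<Sum>i\<in>{s}. \<Sum>j<n. 1 * weight {..<n} x t j * expectation (\<lambda>\<omega>. Y i \<omega> * obs x j \<omega>))"
      by (rule cov_sum) (auto intro: lin_Y lin_obs)
    then show ?thesis by (simp add: cov_obs_Y)
  qed
  have PP: "expectation (\<lambda>\<omega>. ?P s \<omega> * ?P t \<omega>) =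
      (\<Sum>i<n. weight {..<n} x s i * (\<Sum>j<n. weight {..<n} x t j * expectation (\<lambda>\<omega>. obs x i \<omega> * obs x j \<omega>)))"
    by (subst cov_sum) (auto intro: lin_obs simp: sum_distrib_left mult.assoc)
  have alg: "(y - p) * (z - q) = y * z - y * q - z * p + p * q" for y p z q :: real
    by (simp add: algebra_simps)
  have "cov_resid x s t = expectation (\<lambda>\<omega>. Y s \<omega> * Y t \<omega> - Y s \<omega> * ?P t \<omega> - Y t \<omega> * ?P s \<omega> + ?P s \<omega> * ?P t \<omega>)"
    unfolding cov_resid_def resid_def
    by (intro Bochner_Integration.integral_cong refl alg)
  also have "\<dots> = expectation (\<lambda>\<omega>. Y s \<omega> * Y t \<omega>) - expectation (\<lambda>\<omega>. Y s \<omega> * ?P t \<omega>)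
      - expectation (\<lambda>\<omega>. Y t \<omega> * ?P s \<omega>) + expectation (\<lambda>\<omega>. ?P s \<omega> * ?P t \<omega>)"
    using lin_integrable(3)[OF lin_Y[of s] lin_Y[of t]] lin_integrable(3)[OF lin_Y[of s] P[of t]]
      lin_integrable(3)[OF lin_Y[of t] P[of s]] lin_integrable(3)[OF P[of s] P[of t]]
    by (simp only: Bochner_Integration.integral_add Bochner_Integration.integral_diff
        Bochner_Integration.integrable_diff Bochner_Integration.integrable_add)
  finally show ?thesis unfolding YP PP cov_YY .
qed

lemma K0_measurable [measurable]: "K\<^sub>0 \<in> borel_measurable borel"
proof -
  have "(\<lambda>(t, \<omega>). Y t \<omega> * Y 0 \<omega>) \<in> borel_measurable (borel \<Otimes>\<^sub>M M)"
    using measurable_Y_compose[OF M_generated, of "\<lambda>t. t" borel]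
    by (auto simp: case_prod_beta' intro!: borel_measurable_times)
  then have "(\<lambda>t. expectation (\<lambda>\<omega>. Y t \<omega> * Y 0 \<omega>)) \<in> borel_measurable borel"
    by (rule borel_measurable_lebesgue_integral)
  then show ?thesis by (simp add: cov_YY)
qed

definition cV :: real where
  "cV = 4 * (C\<^sub>0\<^sup>2 * decay_mass TYPE('d) * (1 + \<kappa> / C) + C\<^sub>0\<^sup>2 * cc * \<kappa> / C + \<kappa>\<^sup>2 * S\<^sub>0\<^sup>2 / C\<^sup>2)"

lemma K0_square_le: "(K\<^sub>0 t)\<^sup>2 \<le> C\<^sub>0\<^sup>2 * decay t"
proof -
  have "(K\<^sub>0 t)\<^sup>2 = \<bar>K\<^sub>0 t\<bar> * \<bar>K\<^sub>0 t\<bar>" by (simp add: power2_eq_square)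
  also have "\<dots> \<le> C\<^sub>0 * (C\<^sub>0 * decay t)" using C0_nonneg by (intro mult_mono K0_abs_le K0_bound) auto
  finally show ?thesis by (simp add: power2_eq_square)
qed

lemma integral_K0_square_le: "(\<integral>t. (K\<^sub>0 (t - a))\<^sup>2 \<partial>unif n) \<le> C\<^sub>0\<^sup>2 * decay_mass TYPE('d) / n"
proof -
  have i: "integrable (unif n) (\<lambda>t. decay (t - a))"
    by (rule integrable_unif[OF n_pos, of _ 1]) (auto simp: decay_le_1)
  have "(\<integral>t. (K\<^sub>0 (t - a))\<^sup>2 \<partial>unif n) \<le> (\<integral>t. C\<^sub>0\<^sup>2 * decay (t - a) \<partial>unif n)"
    using i by (intro integral_mono' K0_square_le) auto
  also have "\<dots> \<le> C\<^sub>0\<^sup>2 * (decay_mass TYPE('d) / n)"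
    using mult_left_mono[OF integral_decay_unif[OF n_pos, of a], of "C\<^sub>0\<^sup>2"] by simp
  finally show ?thesis by simp
qed

lemma abs_cov_resid_le: "\<bar>cov_resid x s t\<bar> \<le> phimax"
proof -
  let ?e = "resid {..<n} x s" and ?f = "resid {..<n} x t"
  have l: "?e \<in> lin" "?f \<in> lin" by (intro lin_resid order_refl)+
  note i = lin_integrable(2)[OF l(1) lin_zero] lin_integrable(2)[OF l(2) lin_zero] lin_integrable(3)[OF l]
  have "\<bar>cov_resid x s t\<bar> \<le> expectation (\<lambda>\<omega>. \<bar>?e \<omega> * ?f \<omega>\<bar>)"
    unfolding cov_resid_def by (rule integral_abs_bound)
  also have "\<dots> \<le> expectation (\<lambda>\<omega>. ((?e \<omega>)\<^sup>2 + (?f \<omega>)\<^sup>2) / 2)"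
  proof (rule integral_mono)
    show "\<bar>?e \<omega> * ?f \<omega>\<bar> \<le> ((?e \<omega>)\<^sup>2 + (?f \<omega>)\<^sup>2) / 2" for \<omega>
      using sum_squares_bound[of "\<bar>?e \<omega>\<bar>" "\<bar>?f \<omega>\<bar>"] by (simp add: abs_mult)
  qed (use i in auto)
  also have "\<dots> = (phi {..<n} x s + phi {..<n} x t) / 2" using i by (simp add: phi_def)
  also have "\<dots> \<le> phimax" using abs_phi_le[of "{..<n}" x s] abs_phi_le[of "{..<n}" x t] by simp
  finally show ?thesis .
qed

lemma borel_measurable_cov_resid:
  assumes "\<sigma> \<in> borel_measurable N" "\<tau> \<in> borel_measurable N"
  shows "(\<lambda>p. cov_resid x (\<sigma> p) (\<tau> p)) \<in> borel_measurable N"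
proof -
  have "(\<lambda>(p, \<omega>). resid {..<n} x (\<rho> p) \<omega>) \<in> borel_measurable (N \<Otimes>\<^sub>M M)" if "\<rho> \<in> borel_measurable N" for \<rho>
    using measurable_resid[OF M_generated eps_borel order_refl _ that, of "\<lambda>_. x"] by simp
  from this[OF assms(1)] this[OF assms(2)]
  have "(\<lambda>(p, \<omega>). resid {..<n} x (\<sigma> p) \<omega> * resid {..<n} x (\<tau> p) \<omega>) \<in> borel_measurable (N \<Otimes>\<^sub>M M)"
    by (simp add: case_prod_beta')
  then show ?thesis unfolding cov_resid_def by (rule borel_measurable_lebesgue_integral)
qed

text \<open>The four terms of \<open>cov_resid_eq\<close> are squared separately and integrated
  first in \<open>s\<close>, then in \<open>t\<close>. Every term gains a factor 1 /
  \<open>n\<close> from decay or from the bound on weighted sums; what remains is a constant or the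
  average neighbour count.\<close>

lemma nn_integral_cov_resid_square_le:
  "(\<integral>\<^sup>+t. (\<integral>\<^sup>+s. ennreal ((cov_resid x s t)\<^sup>2) \<partial>unif n) \<partial>unif n) \<le> ennreal (cV * (1 + (\<Sum>i<n. nr x i) / n) / n)"
proof -
  interpret U: prob_space "unif n :: (real^'d) measure" by (rule prob_unif)
  let ?w = "\<lambda>t. weight {..<n} x t" and ?S = "\<lambda>i j. expectation (\<lambda>\<omega>. obs x i \<omega> * obs x j \<omega>)"
  let ?h = "decay_mass TYPE('d)"
  define b where "b t i = (\<Sum>j<n. ?w t j * ?S i j)" for t i
  define g1 where "g1 t = (\<Sum>j<n. (?w t j)\<^sup>2 * nr x j)" for t
  define g2 where "g2 t = (\<Sum>j<n. (K\<^sub>0 (t - x j))\<^sup>2)" for t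
  define g3 where "g3 t = (\<Sum>i<n. (b t i)\<^sup>2)" for t
  define g where "g t = 4 * (C\<^sub>0\<^sup>2 * ?h / n + C\<^sub>0\<^sup>2 * cc / n * g1 t + \<kappa> / (C * n) * g2 t + \<kappa> / (C * n) * g3 t)" for t
  have intK: "integrable (unif n) (\<lambda>t. (K\<^sub>0 (t - a))\<^sup>2)" for a
  proof (rule integrable_unif[OF n_pos, of _ "C\<^sub>0\<^sup>2"])
    show "\<bar>(K\<^sub>0 (t - a))\<^sup>2\<bar> \<le> C\<^sub>0\<^sup>2" for t using power_mono[OF K0_abs_le, of "t - a" 2] by simp
  qed measurable
  have int_w: "integrable (unif n) (\<lambda>t. (?w t j)\<^sup>2)" if "j < n" for j
    by (rule integrable_unif[OF n_pos, of _ "A / C"]) (use that in \<open>auto intro: abs_weight_le\<close>)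
  have w_meas: "(\<lambda>t. \<Sum>j<n. ?w t j * c j) \<in> borel_measurable borel" for c
    by (intro borel_measurable_sum borel_measurable_times borel_measurable_weight) auto
  have w_bd: "\<bar>(\<Sum>j<n. ?w t j * c j)\<^sup>2\<bar> \<le> A / C * (\<Sum>j<n. (c j)\<^sup>2)" for c t
  proof -
    have "(\<Sum>j<n. ?w t j * c j)\<^sup>2 \<le> (\<Sum>j<n. (?w t j)\<^sup>2) * (\<Sum>j<n. (c j)\<^sup>2)"
      by (rule Cauchy_Schwarz_ineq_sum)
    also have "\<dots> \<le> A / C * (\<Sum>j<n. (c j)\<^sup>2)"
      by (intro mult_right_mono weight_norm_le sum_nonneg) auto
    finally show ?thesis by simp
  qed
  have int_wc: "integrable (unif n) (\<lambda>t. (\<Sum>j<n. ?w t j * c j)\<^sup>2)" for c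
    by (rule integrable_unif[OF n_pos _ w_bd]) (intro borel_measurable_power w_meas)
  have inner: "(\<integral>s. (cov_resid x s t)\<^sup>2 \<partial>unif n) \<le> g t" for t
  proof -
    let ?a1 = "\<lambda>s. K\<^sub>0 (s - t)" and ?a2 = "\<lambda>s. \<Sum>j<n. ?w t j * K\<^sub>0 (s - x j)"
    let ?a3 = "\<lambda>s. \<Sum>j<n. ?w s j * K\<^sub>0 (t - x j)" and ?a4 = "\<lambda>s. \<Sum>i<n. ?w s i * b t i"
    let ?a5 = "\<lambda>s. \<Sum>j<n. decay (s - x j) * \<bar>?w t j\<bar>"
    \<comment> \<open>In this term the integration variable sits in \<open>K\<^sub>0\<close>, which
      is unrelated to the Hilbert space of \<open>k\<close>. The decay of \<open>K\<^sub>0\<close>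
      and the convolution bound are used instead.\<close>
    have a2: "(?a2 s)\<^sup>2 \<le> C\<^sub>0\<^sup>2 * (?a5 s)\<^sup>2" for s
    proof -
      have "\<bar>?a2 s\<bar> \<le> (\<Sum>j<n. \<bar>?w t j\<bar> * (C\<^sub>0 * decay (s - x j)))"
        by (intro order_trans[OF sum_abs] sum_mono) (auto simp: abs_mult intro!: mult_left_mono K0_bound)
      also have "\<dots> = C\<^sub>0 * ?a5 s" by (simp add: sum_distrib_left mult_ac)
      finally have "\<bar>?a2 s\<bar> \<le> C\<^sub>0 * ?a5 s" .
      from power_mono[OF this, of 2] show ?thesis by (simp add: power_mult_distrib)
    qed
    have "?a5 s \<le> (\<Sum>j<n. 1 * \<bar>?w t j\<bar>)" "0 \<le> ?a5 s" for s
      by ((intro sum_mono mult_right_mono decay_le_1; simp), (intro sum_nonneg; simp))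
    then have a5: "(?a5 s)\<^sup>2 \<le> (\<Sum>j<n. \<bar>?w t j\<bar>)\<^sup>2" for s by (intro power_mono) auto
    have int5: "integrable (unif n) (\<lambda>s. (?a5 s)\<^sup>2)"
      by (rule integrable_unif[OF n_pos, of _ "(\<Sum>j<n. \<bar>?w t j\<bar>)\<^sup>2"]) (use a5 in auto)
    have "(cov_resid x s t)\<^sup>2 \<le> 4 * ((?a1 s)\<^sup>2 + C\<^sub>0\<^sup>2 * (?a5 s)\<^sup>2 + (?a3 s)\<^sup>2 + (?a4 s)\<^sup>2)" for s
    proof -
      have q: "(p - q - r + z)\<^sup>2 \<le> 4 * (p\<^sup>2 + q\<^sup>2 + r\<^sup>2 + z\<^sup>2)" for p q r z :: real
        using square_diff_le[of "p - q" "r - z"] square_diff_le[of p q] square_diff_le[of r z] by (simp add: algebra_simps)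
      have "cov_resid x s t = ?a1 s - ?a2 s - ?a3 s + ?a4 s" by (simp add: cov_resid_eq b_def)
      then have "(cov_resid x s t)\<^sup>2 \<le> 4 * ((?a1 s)\<^sup>2 + (?a2 s)\<^sup>2 + (?a3 s)\<^sup>2 + (?a4 s)\<^sup>2)" by (simp only: q)
      also have "\<dots> \<le> 4 * ((?a1 s)\<^sup>2 + C\<^sub>0\<^sup>2 * (?a5 s)\<^sup>2 + (?a3 s)\<^sup>2 + (?a4 s)\<^sup>2)"
        by (intro mult_left_mono add_mono a2 order_refl) simp
      finally show ?thesis .
    qed
    then have "(\<integral>s. (cov_resid x s t)\<^sup>2 \<partial>unif n) \<le> (\<integral>s. 4 * ((?a1 s)\<^sup>2 + C\<^sub>0\<^sup>2 * (?a5 s)\<^sup>2 + (?a3 s)\<^sup>2 + (?a4 s)\<^sup>2) \<partial>unif n)"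
      by (intro integral_mono' integrable_mult_right Bochner_Integration.integrable_add intK int5 int_wc) auto
    also have "\<dots> = 4 * ((\<integral>s. (?a1 s)\<^sup>2 \<partial>unif n) + C\<^sub>0\<^sup>2 * (\<integral>s. (?a5 s)\<^sup>2 \<partial>unif n) + (\<integral>s. (?a3 s)\<^sup>2 \<partial>unif n) + (\<integral>s. (?a4 s)\<^sup>2 \<partial>unif n))"
      using intK[of t] int5 int_wc[of "\<lambda>j. K\<^sub>0 (t - x j)"] int_wc[of "b t"] by simp
    also have "\<dots> \<le> 4 * (C\<^sub>0\<^sup>2 * ?h / n + C\<^sub>0\<^sup>2 * (cc / n * (\<Sum>j<n. (\<bar>?w t j\<bar>)\<^sup>2 * nr x j)) + \<kappa> / (C * n) * g2 t + \<kappa> / (C * n) * g3 t)"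
      unfolding g2_def g3_def
      by (intro mult_left_mono add_mono integral_K0_square_le integral_decay_sum_square_le integral_weight_sum_square_le n_pos) auto
    finally show ?thesis by (simp add: g_def g1_def)
  qed
  have i1: "integrable (unif n) g1" unfolding g1_def[abs_def] using int_w by auto
  have i2: "integrable (unif n) g2" unfolding g2_def[abs_def] using intK by auto
  have i3: "integrable (unif n) g3" unfolding g3_def[abs_def] b_def using int_wc by auto
  have e1: "(\<integral>t. g1 t \<partial>unif n) \<le> \<kappa> / (C * n) * (\<Sum>j<n. nr x j)"
  proof -
    have "(\<integral>t. g1 t \<partial>unif n) = (\<Sum>j<n. (\<integral>t. (?w t j)\<^sup>2 \<partial>unif n) * nr x j)"
      unfolding g1_def using int_w by (simp add: Bochner_Integration.integral_sum)
    also have "\<dots> \<le> (\<Sum>j<n. \<kappa> / (C * n) * nr x j)"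
      by (intro sum_mono mult_right_mono integral_weight_square_le n_pos near_nonneg) auto
    finally show ?thesis by (simp only: sum_distrib_left)
  qed
  have e2: "(\<integral>t. g2 t \<partial>unif n) \<le> C\<^sub>0\<^sup>2 * ?h"
  proof -
    have "(\<integral>t. g2 t \<partial>unif n) = (\<Sum>j<n. \<integral>t. (K\<^sub>0 (t - x j))\<^sup>2 \<partial>unif n)"
      unfolding g2_def using intK by (simp add: Bochner_Integration.integral_sum)
    also have "\<dots> \<le> (\<Sum>j<n. C\<^sub>0\<^sup>2 * ?h / n)" by (intro sum_mono integral_K0_square_le)
    finally show ?thesis using n_pos by simp
  qed
  have e3: "(\<integral>t. g3 t \<partial>unif n) \<le> \<kappa> / (C * n) * (S\<^sub>0\<^sup>2 * (\<Sum>i<n. nr x i))"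
  proof -
    have "(\<integral>t. g3 t \<partial>unif n) = (\<Sum>i<n. \<integral>t. (\<Sum>j<n. ?w t j * ?S i j)\<^sup>2 \<partial>unif n)"
      unfolding g3_def b_def using int_wc by (simp add: Bochner_Integration.integral_sum)
    also have "\<dots> \<le> (\<Sum>i<n. \<kappa> / (C * n) * (\<Sum>j<n. (?S i j)\<^sup>2))"
      by (intro sum_mono integral_weight_sum_square_le n_pos) auto
    also have "\<dots> = \<kappa> / (C * n) * (\<Sum>i<n. \<Sum>j<n. (?S i j)\<^sup>2)" by (simp only: sum_distrib_left)
    also have "\<dots> \<le> \<kappa> / (C * n) * (S\<^sub>0\<^sup>2 * (\<Sum>i<n. nr x i))"
      using \<kappa>_nonneg C_pos by (intro mult_left_mono sum_cov_obs_square_le) auto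
    finally show ?thesis .
  qed
  have k0: "0 \<le> \<kappa> / (C * n)" "0 \<le> C\<^sub>0\<^sup>2 * cc / n" using \<kappa>_nonneg C_pos cc_nonneg by auto
  have cov_int: "integrable (unif n) (\<lambda>s. (cov_resid x s t)\<^sup>2)" for t
  proof (rule integrable_unif[OF n_pos, of _ "phimax\<^sup>2"])
    show "(\<lambda>s. (cov_resid x s t)\<^sup>2) \<in> borel_measurable borel"
      by (intro borel_measurable_power borel_measurable_cov_resid) auto
    show "\<bar>(cov_resid x s t)\<^sup>2\<bar> \<le> phimax\<^sup>2" for s using power_mono[OF abs_cov_resid_le, of x s t 2] by simp
  qed
  have g0: "0 \<le> g t" for t using order_trans[OF _ inner, of 0 t] by (simp add: integral_nonneg_AE)
  have ig: "integrable (unif n) g" unfolding g_def[abs_def] using i1 i2 i3 by auto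
  have "(\<integral>\<^sup>+t. (\<integral>\<^sup>+s. ennreal ((cov_resid x s t)\<^sup>2) \<partial>unif n) \<partial>unif n) \<le> (\<integral>\<^sup>+t. ennreal (g t) \<partial>unif n)"
    by (intro nn_integral_mono) (subst nn_integral_eq_integral[OF cov_int], auto intro: ennreal_leI inner)
  also have "\<dots> = ennreal (\<integral>t. g t \<partial>unif n)" using ig g0 by (intro nn_integral_eq_integral) auto
  also have "(\<integral>t. g t \<partial>unif n) = 4 * (C\<^sub>0\<^sup>2 * ?h / n + C\<^sub>0\<^sup>2 * cc / n * (\<integral>t. g1 t \<partial>unif n) + \<kappa> / (C * n) * (\<integral>t. g2 t \<partial>unif n) + \<kappa> / (C * n) * (\<integral>t. g3 t \<partial>unif n))"
    unfolding g_def using i1 i2 i3 by (simp add: U.prob_space[simplified])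
  also have "\<dots> \<le> 4 * (C\<^sub>0\<^sup>2 * ?h / n + C\<^sub>0\<^sup>2 * cc / n * (\<kappa> / (C * n) * (\<Sum>j<n. nr x j)) + \<kappa> / (C * n) * (C\<^sub>0\<^sup>2 * ?h) + \<kappa> / (C * n) * (\<kappa> / (C * n) * (S\<^sub>0\<^sup>2 * (\<Sum>i<n. nr x i))))"
    by (intro mult_left_mono add_mono e1 e2 e3 k0 order_refl) auto
  also have "\<dots> \<le> cV * (1 + (\<Sum>i<n. nr x i) / n) / n"
  proof -
    define z where "z = (\<Sum>i<n. nr x i) / n"
    have z: "0 \<le> z" "(\<Sum>i<n. nr x i) = n * z"
      using n_pos by (auto simp: z_def intro!: divide_nonneg_nonneg sum_nonneg near_nonneg)
    define p where "p = C\<^sub>0\<^sup>2 * ?h * (1 + \<kappa> / C)"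
    define q where "q = C\<^sub>0\<^sup>2 * cc * \<kappa> / C + \<kappa>\<^sup>2 * S\<^sub>0\<^sup>2 / C\<^sup>2"
    have pq: "0 \<le> p" "0 \<le> q" using \<kappa>_nonneg C_pos cc_nonneg decay_mass_nonneg[where 'd='d]
      by (auto simp: p_def q_def intro!: mult_nonneg_nonneg add_nonneg_nonneg)
    have "4 * (C\<^sub>0\<^sup>2 * ?h / n + C\<^sub>0\<^sup>2 * cc / n * (\<kappa> / (C * n) * (n * z)) + \<kappa> / (C * n) * (C\<^sub>0\<^sup>2 * ?h) + \<kappa> / (C * n) * (\<kappa> / (C * n) * (S\<^sub>0\<^sup>2 * (n * z))))
        = 4 * (p + q * z) / n"
      using n_pos C_pos by (simp add: p_def q_def field_simps power2_eq_square)
    also have "\<dots> \<le> 4 * (p + q) * (1 + z) / n"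
    proof (rule divide_right_mono)
      have "0 \<le> p * z" using pq z by simp
      then show "4 * (p + q * z) \<le> 4 * (p + q) * (1 + z)" using pq by (simp add: algebra_simps)
    qed simp
    also have "4 * (p + q) = cV" by (simp add: cV_def p_def q_def)
    finally have "4 * (C\<^sub>0\<^sup>2 * ?h / n + C\<^sub>0\<^sup>2 * cc / n * (\<kappa> / (C * n) * (n * z)) + \<kappa> / (C * n) * (C\<^sub>0\<^sup>2 * ?h) + \<kappa> / (C * n) * (\<kappa> / (C * n) * (S\<^sub>0\<^sup>2 * (n * z))))
        \<le> cV * (1 + z) / n" .
    moreover have "real n * z / real n = z" using n_pos by simp
    ultimately show ?thesis unfolding z(2) by (simp only:)
  qed
  finally show ?thesis by (simp add: ennreal_leI)
qed

lemma measurable_resid_t: "(\<lambda>(t, \<omega>). resid {..<n} x t \<omega>) \<in> borel_measurable (unif n \<Otimes>\<^sub>M M)"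
  by (rule measurable_resid[OF M_generated eps_borel, where \<xi>="\<lambda>_. x" and \<tau>="\<lambda>t. t"]) auto

text \<open>The computation runs in the extended nonnegative reals, so that Tonelli applies before
  anything is known about the paths: \<open>I\<close> is the integral of the squared error, its mean
  is \<open>Phi\<close>, and Isserlis' formula under two integrals gives its second moment. The
  finite mean makes \<open>I\<close> finite almost surely, hence equal to \<open>ispe\<close>
  there.\<close>

lemma var_ispe_le:
  assumes w: "(\<integral>\<^sup>+t. (\<integral>\<^sup>+s. ennreal ((cov_resid x s t)\<^sup>2) \<partial>unif n) \<partial>unif n) \<le> ennreal w"
    and w0: "0 \<le> w"
  shows "(\<integral>\<^sup>+\<omega>. ennreal ((ispe x \<omega> - Phi {..<n} x)\<^sup>2) \<partial>M) \<le> ennreal (2 * w)"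
proof -
  let ?U = "unif n :: (real^'d) measure"
  interpret U: prob_space ?U by (rule prob_unif)
  interpret P: pair_sigma_finite ?U M ..
  let ?r = "resid {..<n} x" and ?p = "phi {..<n} x"
  define a where "a t \<omega> = ennreal ((?r t \<omega>)\<^sup>2)" for t \<omega>
  have r_pair [measurable]: "(\<lambda>q. ?r (fst q) (snd q)) \<in> borel_measurable (?U \<Otimes>\<^sub>M M)"
    using measurable_resid_t[of x] by (simp add: case_prod_beta')
  have a_pair [measurable]: "(\<lambda>q. a (fst q) (snd q)) \<in> borel_measurable (?U \<Otimes>\<^sub>M M)"
    unfolding a_def by measurable
  have lr: "?r t \<in> lin" for t by (intro lin_resid order_refl)
  have rm [measurable]: "?r t \<in> borel_measurable M" for t by (rule lin_borel[OF lr])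
  have am [measurable]: "a t \<in> borel_measurable M" for t unfolding a_def by measurable
  have at [measurable]: "(\<lambda>t. a t \<omega>) \<in> borel_measurable ?U" if "\<omega> \<in> space M" for \<omega>
    using measurable_compose[OF measurable_Pair2'[OF that] a_pair] by simp
  define I where "I \<omega> = (\<integral>\<^sup>+t. a t \<omega> \<partial>?U)" for \<omega>
  have [measurable]: "I \<in> borel_measurable M"
    unfolding I_def
    by (rule U.borel_measurable_nn_integral) (use measurable_pair_swap[OF a_pair] in \<open>simp add: case_prod_beta'\<close>)
  have p0: "0 \<le> ?p t" for t by (rule phi_nonneg)
  have ip: "integrable ?U ?p" by (rule integrable_unif[OF n_pos, of _ phimax]) (auto intro: abs_phi_le)
  have Ea: "(\<integral>\<^sup>+\<omega>. a t \<omega> \<partial>M) = ennreal (?p t)" for t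
    unfolding a_def phi_def by (rule nn_integral_eq_integral[OF lin_integrable(2)[OF lr lin_zero]]) simp
  have EI: "(\<integral>\<^sup>+\<omega>. I \<omega> \<partial>M) = ennreal (Phi {..<n} x)"
  proof -
    have "(\<integral>\<^sup>+\<omega>. I \<omega> \<partial>M) = (\<integral>\<^sup>+t. (\<integral>\<^sup>+\<omega>. a t \<omega> \<partial>M) \<partial>?U)"
      unfolding I_def by (rule P.Fubini') (simp add: case_prod_beta')
    also have "\<dots> = ennreal (Phi {..<n} x)"
      unfolding Ea Phi_def using p0 by (intro nn_integral_eq_integral[OF ip]) auto
    finally show ?thesis .
  qed
  let ?c = "\<lambda>s t. ennreal ((cov_resid x s t)\<^sup>2)"
  define W where "W = (\<integral>\<^sup>+t. (\<integral>\<^sup>+s. ?c s t \<partial>?U) \<partial>?U)"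
  have c_meas [measurable]: "(\<lambda>q. cov_resid x (fst q) (snd q)) \<in> borel_measurable (?U \<Otimes>\<^sub>M ?U)"
    by (rule borel_measurable_cov_resid) auto
  have EI2: "(\<integral>\<^sup>+\<omega>. I \<omega> * I \<omega> \<partial>M) = ennreal (Phi {..<n} x) * ennreal (Phi {..<n} x) + 2 * W"
  proof -
    have "(\<integral>\<^sup>+\<omega>. I \<omega> * I \<omega> \<partial>M) = (\<integral>\<^sup>+\<omega>. (\<integral>\<^sup>+t. (\<integral>\<^sup>+s. a s \<omega> * a t \<omega> \<partial>?U) \<partial>?U) \<partial>M)"
    proof (intro nn_integral_cong)
      fix \<omega> assume \<omega>: "\<omega> \<in> space M"
      note [measurable] = at[OF \<omega>]
      have "(\<integral>\<^sup>+t. (\<integral>\<^sup>+s. a s \<omega> * a t \<omega> \<partial>?U) \<partial>?U) = (\<integral>\<^sup>+t. I \<omega> * a t \<omega> \<partial>?U)"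
        unfolding I_def by (intro nn_integral_cong nn_integral_multc) simp
      also have "\<dots> = I \<omega> * I \<omega>" unfolding I_def[of \<omega>] by (intro nn_integral_cmult) simp
      finally show "I \<omega> * I \<omega> = (\<integral>\<^sup>+t. (\<integral>\<^sup>+s. a s \<omega> * a t \<omega> \<partial>?U) \<partial>?U)" ..
    qed
    also have "\<dots> = (\<integral>\<^sup>+t. (\<integral>\<^sup>+\<omega>. (\<integral>\<^sup>+s. a s \<omega> * a t \<omega> \<partial>?U) \<partial>M) \<partial>?U)"
    proof (rule P.Fubini')
      have "(\<lambda>(q, s). a s (snd q) * a (fst q) (snd q)) \<in> borel_measurable ((?U \<Otimes>\<^sub>M M) \<Otimes>\<^sub>M ?U)"
      proof -
        have "(\<lambda>z. (snd z, snd (fst z))) \<in> measurable ((?U \<Otimes>\<^sub>M M) \<Otimes>\<^sub>M ?U) (?U \<Otimes>\<^sub>M M)" by measurable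
        from measurable_compose[OF this a_pair] measurable_compose[OF measurable_fst a_pair]
        show ?thesis by (simp add: case_prod_beta' borel_measurable_times_ennreal)
      qed
      then show "(\<lambda>(t, \<omega>). \<integral>\<^sup>+s. a s \<omega> * a t \<omega> \<partial>?U) \<in> borel_measurable (?U \<Otimes>\<^sub>M M)"
        using U.borel_measurable_nn_integral[of "\<lambda>q s. a s (snd q) * a (fst q) (snd q)" "?U \<Otimes>\<^sub>M M"]
        by (simp add: case_prod_beta')
    qed
    also have "\<dots> = (\<integral>\<^sup>+t. (\<integral>\<^sup>+s. (\<integral>\<^sup>+\<omega>. a s \<omega> * a t \<omega> \<partial>M) \<partial>?U) \<partial>?U)"
    proof (intro nn_integral_cong P.Fubini')
      fix t
      have "(\<lambda>q. a t (snd q)) \<in> borel_measurable (?U \<Otimes>\<^sub>M M)" by (rule measurable_compose[OF measurable_snd am])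
      then show "(\<lambda>(s, \<omega>). a s \<omega> * a t \<omega>) \<in> borel_measurable (?U \<Otimes>\<^sub>M M)"
        using a_pair by (simp add: case_prod_beta' borel_measurable_times_ennreal)
    qed
    also have "\<dots> = (\<integral>\<^sup>+t. (\<integral>\<^sup>+s. ennreal (?p s) * ennreal (?p t) + 2 * ?c s t \<partial>?U) \<partial>?U)"
    proof (intro nn_integral_cong)
      fix s t
      have "(\<integral>\<^sup>+\<omega>. a s \<omega> * a t \<omega> \<partial>M) = (\<integral>\<^sup>+\<omega>. ennreal ((?r s \<omega>)\<^sup>2 * (?r t \<omega>)\<^sup>2) \<partial>M)"
        by (simp add: a_def ennreal_mult)
      also have "\<dots> = ennreal (expectation (\<lambda>\<omega>. (?r s \<omega>)\<^sup>2 * (?r t \<omega>)\<^sup>2))"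
        by (rule nn_integral_eq_integral[OF lin_integrable(4)[OF lr lr]]) simp
      also have "\<dots> = ennreal (?p s * ?p t + 2 * (cov_resid x s t)\<^sup>2)"
        by (simp add: lin_isserlis[OF lr lr] phi_def cov_resid_def)
      finally show "(\<integral>\<^sup>+\<omega>. a s \<omega> * a t \<omega> \<partial>M) = ennreal (?p s) * ennreal (?p t) + 2 * ?c s t"
        using p0 by (simp add: ennreal_plus ennreal_mult ennreal_mult')
    qed
    also have "\<dots> = (\<integral>\<^sup>+t. ennreal (Phi {..<n} x) * ennreal (?p t) + 2 * (\<integral>\<^sup>+s. ?c s t \<partial>?U) \<partial>?U)"
    proof (intro nn_integral_cong)
      fix t
      have ct [measurable]: "(\<lambda>s. cov_resid x s t) \<in> borel_measurable ?U"
        by (rule borel_measurable_cov_resid) auto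
      have "(\<integral>\<^sup>+s. ennreal (?p s) \<partial>?U) = ennreal (Phi {..<n} x)"
        unfolding Phi_def using p0 by (intro nn_integral_eq_integral[OF ip]) auto
      then show "(\<integral>\<^sup>+s. ennreal (?p s) * ennreal (?p t) + 2 * ?c s t \<partial>?U) = ennreal (Phi {..<n} x) * ennreal (?p t) + 2 * (\<integral>\<^sup>+s. ?c s t \<partial>?U)"
        by (subst nn_integral_add) (auto simp: nn_integral_multc nn_integral_cmult)
    qed
    also have "\<dots> = ennreal (Phi {..<n} x) * ennreal (Phi {..<n} x) + 2 * W"
    proof -
      have cm: "(\<lambda>t. \<integral>\<^sup>+s. ?c s t \<partial>?U) \<in> borel_measurable ?U"
      proof -
        have "(\<lambda>q. cov_resid x (snd q) (fst q)) \<in> borel_measurable (?U \<Otimes>\<^sub>M ?U)"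
          by (rule borel_measurable_cov_resid) auto
        then show ?thesis by (intro U.borel_measurable_nn_integral) (simp add: case_prod_beta')
      qed
      have "(\<integral>\<^sup>+t. ennreal (?p t) \<partial>?U) = ennreal (Phi {..<n} x)"
        unfolding Phi_def using p0 by (intro nn_integral_eq_integral[OF ip]) auto
      then show ?thesis
        unfolding W_def using cm by (subst nn_integral_add) (auto simp: nn_integral_cmult)
    qed
    finally show ?thesis .
  qed
  have Wfin: "W \<le> ennreal w" using w by (simp add: W_def)
  then obtain w' where w': "W = ennreal w'" "0 \<le> w'" "w' \<le> w"
    using w0 by (cases W) (auto simp: top_unique)
  have "(\<integral>\<^sup>+\<omega>. I \<omega> \<partial>M) \<noteq> \<infinity>" unfolding EI by simp
  then have fin: "AE \<omega> in M. I \<omega> \<noteq> \<infinity>" by (intro nn_integral_noteq_infinite) auto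
  have I_ispe: "enn2real (I \<omega>) = ispe x \<omega>" if "\<omega> \<in> space M" for \<omega>
  proof -
    have "(\<lambda>t. ?r t \<omega>) \<in> borel_measurable ?U"
      using measurable_compose[OF measurable_Pair2'[OF that] r_pair] by simp
    then show ?thesis
      unfolding ispe_def I_def a_def by (subst integral_eq_nn_integral) auto
  qed
  have ispe_meas [measurable]: "ispe x \<in> borel_measurable M"
  proof -
    have "(\<lambda>\<omega>. enn2real (I \<omega>)) \<in> borel_measurable M" by measurable
    then show ?thesis using I_ispe by (simp cong: measurable_cong)
  qed
  have ispe0: "0 \<le> ispe x \<omega>" for \<omega> unfolding ispe_def by (intro integral_nonneg_AE) simp
  have AEI: "AE \<omega> in M. I \<omega> = ennreal (ispe x \<omega>)"
    using fin AE_space by eventually_elim (metis I_ispe ennreal_enn2real_if infinity_ennreal_def)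
  have P0: "0 \<le> Phi {..<n} x" unfolding Phi_def by (intro integral_nonneg_AE) (simp add: p0)
  have e1: "(\<integral>\<^sup>+\<omega>. ennreal (ispe x \<omega>) \<partial>M) = ennreal (Phi {..<n} x)"
    unfolding EI[symmetric] using AEI by (intro nn_integral_cong_AE) auto
  have i1: "integrable M (ispe x)" "expectation (ispe x) = Phi {..<n} x"
    using e1 ispe0 P0 by (auto intro!: integrableI_nn_integral_finite simp: integral_eq_nn_integral)
  have e2: "(\<integral>\<^sup>+\<omega>. ennreal ((ispe x \<omega>)\<^sup>2) \<partial>M) = ennreal ((Phi {..<n} x)\<^sup>2 + 2 * w')"
  proof -
    have "(\<integral>\<^sup>+\<omega>. ennreal ((ispe x \<omega>)\<^sup>2) \<partial>M) = (\<integral>\<^sup>+\<omega>. I \<omega> * I \<omega> \<partial>M)"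
      using AEI by (intro nn_integral_cong_AE) (auto simp: power2_eq_square ennreal_mult ispe0)
    then show ?thesis
      unfolding EI2 w' using P0 w'(2) by (simp add: power2_eq_square ennreal_mult ennreal_plus ennreal_mult')
  qed
  have i2: "integrable M (\<lambda>\<omega>. (ispe x \<omega>)\<^sup>2)" "expectation (\<lambda>\<omega>. (ispe x \<omega>)\<^sup>2) = (Phi {..<n} x)\<^sup>2 + 2 * w'"
  proof -
    have nn: "0 \<le> (Phi {..<n} x)\<^sup>2 + 2 * w'" using w'(2) by simp
    show "integrable M (\<lambda>\<omega>. (ispe x \<omega>)\<^sup>2)"
      by (rule integrableI_nn_integral_finite[OF _ _ e2]) auto
    have "expectation (\<lambda>\<omega>. (ispe x \<omega>)\<^sup>2) = enn2real (\<integral>\<^sup>+\<omega>. ennreal ((ispe x \<omega>)\<^sup>2) \<partial>M)"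
      by (rule integral_eq_nn_integral) auto
    then show "expectation (\<lambda>\<omega>. (ispe x \<omega>)\<^sup>2) = (Phi {..<n} x)\<^sup>2 + 2 * w'"
      unfolding e2 enn2real_ennreal[OF nn] .
  qed
  have eq: "(ispe x \<omega> - Phi {..<n} x)\<^sup>2 = (ispe x \<omega>)\<^sup>2 - 2 * Phi {..<n} x * ispe x \<omega> + (Phi {..<n} x)\<^sup>2" for \<omega>
    by (simp add: power2_diff)
  have "(\<integral>\<^sup>+\<omega>. ennreal ((ispe x \<omega> - Phi {..<n} x)\<^sup>2) \<partial>M) = ennreal (expectation (\<lambda>\<omega>. (ispe x \<omega> - Phi {..<n} x)\<^sup>2))"
  proof (rule nn_integral_eq_integral)
    show "integrable M (\<lambda>\<omega>. (ispe x \<omega> - Phi {..<n} x)\<^sup>2)" unfolding eq using i1 i2 by auto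
  qed simp
  also have "expectation (\<lambda>\<omega>. (ispe x \<omega> - Phi {..<n} x)\<^sup>2) = 2 * w'"
    unfolding eq using i1 i2 by (simp add: prob_space power2_eq_square)
  finally show ?thesis using w' by (simp add: ennreal_leI)
qed

end

section \<open>Mean square convergence for a fixed parameter\<close>

context model
begin

lemma borel_measurable_u: "i < n \<Longrightarrow> u x i \<in> borel_measurable M"
  using lin_borel lin_u by blast

lemma borel_measurable_cv: "cv x \<in> borel_measurable M"
  unfolding cv_def[abs_def]
  by (intro borel_measurable_divide borel_measurable_sum borel_measurable_times borel_measurable_power borel_measurable_const borel_measurable_u) auto

lemma borel_measurable_ispe: "ispe x \<in> borel_measurable M"
proof -
  interpret U: prob_space "unif n :: (real^'d) measure" by (rule prob_unif)
  have "(\<lambda>(\<omega>, t). (resid {..<n} x t \<omega>)\<^sup>2) \<in> borel_measurable (M \<Otimes>\<^sub>M unif n)"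
    using measurable_pair_swap[OF measurable_resid_t[of x]] by (simp add: case_prod_beta')
  then show ?thesis unfolding ispe_def[abs_def] by (rule U.borel_measurable_lebesgue_integral)
qed

definition cr :: real where
  "cr = 3 * (2 * (A + \<delta>) ^ 4 * S\<^sub>0\<^sup>2 / C ^ 4 * e0 + 2 * cV * (1 + e0) + 3 * c3 + 6 * cs)"

lemma cV_nonneg: "0 \<le> cV"
  unfolding cV_def using \<kappa>_nonneg C_pos cc_nonneg decay_mass_nonneg[where 'd='d]
  by (intro mult_nonneg_nonneg add_nonneg_nonneg divide_nonneg_nonneg) auto

lemma c3_nonneg: "0 \<le> c3"
  using c4_nonneg by (simp add: c3_def e0_def)

lemma cs_nonneg: "0 \<le> cs"
  unfolding cs_def using cg_nonneg c4_nonneg A_pos \<kappa>_nonneg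
  by (intro mult_nonneg_nonneg add_nonneg_nonneg) (auto simp: e0_def)

text \<open>The difference is the fluctuation of \<open>cv\<close> about its conditional mean, minus
  that of \<open>ispe\<close>, plus \<open>mean_diff\<close>. After averaging over the design both
  fluctuations are of order 1 / \<open>n\<close> in mean square; the bias dominates and dictates the
  fourth root.\<close>

lemma nn_integral_cv_ispe_le:
  "(\<integral>\<^sup>+x. (\<integral>\<^sup>+\<omega>. ennreal ((cv x \<omega> - \<delta>\<^sub>0 - ispe x \<omega>)\<^sup>2) \<partial>M) \<partial>design n) \<le> ennreal (cr / sqrt (sqrt n))"
proof -
  interpret D: prob_space "design n :: (nat \<Rightarrow> real^'d) measure" by (rule prob_design)
  let ?V = "2 * (A + \<delta>) ^ 4 * S\<^sub>0\<^sup>2 / C ^ 4"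
  define z where "z x = (\<Sum>i<n. nr x i) / n" for x
  have z0: "0 \<le> z x" for x by (auto simp: z_def intro!: divide_nonneg_nonneg sum_nonneg near_nonneg)
  have V0: "0 \<le> ?V" by simp
  define b where "b x = ?V * z x / n + 2 * (cV * (1 + z x) / n) + (mean_diff x)\<^sup>2" for x
  have b0: "0 \<le> b x" for x unfolding b_def using V0 z0 cV_nonneg by (auto intro!: add_nonneg_nonneg mult_nonneg_nonneg divide_nonneg_nonneg)
  have inner: "(\<integral>\<^sup>+\<omega>. ennreal ((cv x \<omega> - \<delta>\<^sub>0 - ispe x \<omega>)\<^sup>2) \<partial>M) \<le> ennreal (3 * b x)" for x
  proof -
    let ?m = "(\<Sum>i<n. phi ({..<n} - {i}) x (x i)) / n"
    let ?p = "\<lambda>\<omega>. cv x \<omega> - \<delta>\<^sub>0 - ?m" and ?q = "\<lambda>\<omega>. ispe x \<omega> - Phi {..<n} x"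
    have [measurable]: "?p \<in> borel_measurable M" "?q \<in> borel_measurable M"
      by (intro borel_measurable_diff borel_measurable_cv borel_measurable_ispe borel_measurable_const)+
    have "(cv x \<omega> - \<delta>\<^sub>0 - ispe x \<omega>)\<^sup>2 \<le> 3 * ((?p \<omega>)\<^sup>2 + (?q \<omega>)\<^sup>2 + (mean_diff x)\<^sup>2)" for \<omega>
    proof -
      have alg: "(p - q + r)\<^sup>2 \<le> 3 * (p\<^sup>2 + q\<^sup>2 + r\<^sup>2)" for p q r :: real
        using zero_le_power2[of "p + q"] zero_le_power2[of "p - r"] zero_le_power2[of "q + r"]
        by (simp add: power2_eq_square algebra_simps)
      have "cv x \<omega> - \<delta>\<^sub>0 - ispe x \<omega> = ?p \<omega> - ?q \<omega> + mean_diff x" by (simp add: mean_diff_def)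
      then show ?thesis by (simp only: alg)
    qed
    then have "(\<integral>\<^sup>+\<omega>. ennreal ((cv x \<omega> - \<delta>\<^sub>0 - ispe x \<omega>)\<^sup>2) \<partial>M) \<le>
        (\<integral>\<^sup>+\<omega>. ennreal (3 * ((?p \<omega>)\<^sup>2 + (?q \<omega>)\<^sup>2 + (mean_diff x)\<^sup>2)) \<partial>M)"
      by (intro nn_integral_mono ennreal_leI)
    also have "\<dots> = (\<integral>\<^sup>+\<omega>. 3 * (ennreal ((?p \<omega>)\<^sup>2) + ennreal ((?q \<omega>)\<^sup>2) + ennreal ((mean_diff x)\<^sup>2)) \<partial>M)"
      by (intro nn_integral_cong) (simp add: ennreal_mult ennreal_plus)
    also have "\<dots> = 3 * ((\<integral>\<^sup>+\<omega>. ennreal ((?p \<omega>)\<^sup>2) \<partial>M) + (\<integral>\<^sup>+\<omega>. ennreal ((?q \<omega>)\<^sup>2) \<partial>M) + ennreal ((mean_diff x)\<^sup>2))"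
      by (simp add: nn_integral_cmult nn_integral_add emeasure_space_1)
    also have "\<dots> \<le> 3 * (ennreal (?V * z x / n) + ennreal (2 * (cV * (1 + z x) / n)) + ennreal ((mean_diff x)\<^sup>2))"
    proof (intro mult_left_mono add_mono order_refl)
      show "(\<integral>\<^sup>+\<omega>. ennreal ((?p \<omega>)\<^sup>2) \<partial>M) \<le> ennreal (?V * z x / n)"
        unfolding z_def by (rule var_cv_le)
      show "(\<integral>\<^sup>+\<omega>. ennreal ((?q \<omega>)\<^sup>2) \<partial>M) \<le> ennreal (2 * (cV * (1 + z x) / n))"
        using z0 cV_nonneg by (intro var_ispe_le) (auto simp: z_def intro!: nn_integral_cov_resid_square_le)
    qed auto
    also have "\<dots> = ennreal (3 * b x)"
      unfolding b_def using V0 z0 cV_nonneg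
      by (subst ennreal_mult) (auto simp: ennreal_plus intro!: add_nonneg_nonneg mult_nonneg_nonneg divide_nonneg_nonneg)
    finally show ?thesis .
  qed
  have iz: "integrable (design n) z"
    unfolding z_def[abs_def]
    by (intro Bochner_Integration.integrable_divide Bochner_Integration.integrable_sum integrable_design[of _ "real n"])
       (auto simp: near_nonneg near_le_n)
  have Ez: "(\<integral>x. z x \<partial>design n) \<le> e0"
  proof -
    have inr: "integrable (design n) (\<lambda>x. nr x i)" if "i < n" for i
      by (rule integrable_design[of _ "real n"]) (use that in \<open>auto simp: near_nonneg near_le_n\<close>)
    have iexp: "integrable (design n) (\<lambda>x. exp (nr x i))" if "i < n" for i
      by (rule integrable_design[of _ "exp (real n)"]) (use that in \<open>auto simp: near_le_n\<close>)
    have "(\<integral>x. z x \<partial>design n) = (\<Sum>i<n. \<integral>x. nr x i \<partial>design n) / n"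
      unfolding z_def using inr by (simp add: Bochner_Integration.integral_sum)
    also have "\<dots> \<le> (\<Sum>i<n. e0) / n"
    proof (intro divide_right_mono sum_mono)
      fix i assume i: "i \<in> {..<n}"
      have "nr x i \<le> exp (nr x i)" for x using exp_ge_add_one_self[of "nr x i"] by linarith
      then have "(\<integral>x. nr x i \<partial>design n) \<le> (\<integral>x. exp (nr x i) \<partial>design n)"
        using i by (intro integral_mono inr iexp) auto
      then show "(\<integral>x. nr x i \<partial>design n) \<le> e0" using integral_exp_near_le[of i] i by simp
    qed simp
    finally show ?thesis using n_pos by simp
  qed
  have md_meas: "mean_diff \<in> borel_measurable (design n)"
    unfolding mean_diff_def[abs_def]
    by (intro borel_measurable_diff borel_measurable_divide borel_measurable_sum borel_measurable_phi_coord borel_measurable_Phi borel_measurable_const) auto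
  have md_bd: "\<bar>mean_diff x\<bar> \<le> 2 * phimax" for x
  proof -
    have "\<bar>(\<Sum>i<n. phi ({..<n} - {i}) x (x i)) / n\<bar> \<le> (\<Sum>i<n. phimax) / n"
      unfolding abs_divide by (intro frac_le order_trans[OF sum_abs] sum_mono abs_phi_le) (use n_pos phimax_nonneg in auto)
    also have "\<dots> = phimax" using n_pos by simp
    finally show ?thesis unfolding mean_diff_def using abs_Phi_le[OF order_refl, of x] by linarith
  qed
  have imd: "integrable (design n) (\<lambda>x. (mean_diff x)\<^sup>2)"
  proof (rule integrable_design[of _ "(2 * phimax)\<^sup>2"])
    show "\<bar>(mean_diff x)\<^sup>2\<bar> \<le> (2 * phimax)\<^sup>2" for x using power_mono[OF md_bd, of x 2] by simp
  qed (intro borel_measurable_power md_meas)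
  have ib: "integrable (design n) b"
    unfolding b_def[abs_def] using iz imd by auto
  have "(\<integral>\<^sup>+x. (\<integral>\<^sup>+\<omega>. ennreal ((cv x \<omega> - \<delta>\<^sub>0 - ispe x \<omega>)\<^sup>2) \<partial>M) \<partial>design n) \<le> (\<integral>\<^sup>+x. ennreal (3 * b x) \<partial>design n)"
    by (intro nn_integral_mono inner)
  also have "\<dots> = ennreal (\<integral>x. 3 * b x \<partial>design n)"
    using ib b0 by (intro nn_integral_eq_integral) auto
  also have "(\<integral>x. 3 * b x \<partial>design n) = 3 * (?V * (\<integral>x. z x \<partial>design n) / n + 2 * (cV * (1 + (\<integral>x. z x \<partial>design n)) / n) + (\<integral>x. (mean_diff x)\<^sup>2 \<partial>design n))"
    unfolding b_def using iz imd D.prob_space by simp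
  also have "\<dots> \<le> 3 * (?V * e0 / n + 2 * (cV * (1 + e0) / n) + (2 * c3 / n + (4 * cs + c3) / sqrt (sqrt n) + 2 * cs / sqrt n))"
    using V0 cV_nonneg Ez
    by (intro mult_left_mono add_mono divide_right_mono integral_mean_diff_square_le order_refl) auto
  also have "\<dots> \<le> cr / sqrt (sqrt n)"
  proof -
    let ?r = "sqrt (sqrt n)"
    have 1: "1 \<le> ?r" using n_pos by simp
    have rr: "?r * ?r = sqrt n" by simp
    have le1: "w / sqrt n \<le> w / ?r" if "0 \<le> w" for w :: real
    proof (rule divide_left_mono[OF _ that])
      have "?r * 1 \<le> ?r * ?r" using 1 by (intro mult_left_mono) auto
      then show "?r \<le> sqrt n" unfolding rr by simp
      show "0 < sqrt n * ?r" using n_pos by simp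
    qed
    have le2: "w / n \<le> w / ?r" if "0 \<le> w" for w :: real
    proof -
      have "w / n \<le> w / sqrt n"
      proof (rule divide_left_mono[OF _ that])
        have "1 \<le> sqrt n" using n_pos by simp
        then show "sqrt n \<le> real n" using mult_left_mono[of 1 "sqrt n" "sqrt n"] by simp
        show "0 < real n * sqrt n" using n_pos by simp
      qed
      also have "\<dots> \<le> w / ?r" by (rule le1[OF that])
      finally show ?thesis .
    qed
    have e0: "0 \<le> e0" by (simp add: e0_def)
    have "3 * (?V * e0 / n + 2 * (cV * (1 + e0) / n) + (2 * c3 / n + (4 * cs + c3) / ?r + 2 * cs / sqrt n))
        \<le> 3 * (?V * e0 / ?r + 2 * (cV * (1 + e0) / ?r) + (2 * c3 / ?r + (4 * cs + c3) / ?r + 2 * cs / ?r))"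
      using V0 cV_nonneg e0 c3_nonneg cs_nonneg
      by (intro mult_left_mono add_mono le1 le2 order_refl mult_nonneg_nonneg) auto
    also have "\<dots> = cr / ?r"
    proof -
      have "3 * (a / r + 2 * (b / r) + (2 * c / r + (4 * d + c) / r + 2 * d / r)) = 3 * (a + 2 * b + 3 * c + 6 * d) / r" for a b c d r :: real
        by (simp add: add_divide_distrib algebra_simps)
      note eq = this
      show ?thesis unfolding cr_def by (subst eq) (simp add: mult.assoc)
    qed
    finally show ?thesis .
  qed
  finally show ?thesis by (simp add: ennreal_leI)
qed

section \<open>The modulus of continuity at a fixed parameter\<close>

text \<open>A count of neighbours of neighbours. It is the weight that Schur's test attaches to the
  index \<open>j\<close> when the \<open>decay\<close> matrix is applied to a vector.\<close>

definition gsum :: "(nat \<Rightarrow> real^'d) \<Rightarrow> nat \<Rightarrow> real" where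
  "gsum x j = (\<Sum>i<n. decay (x i - x j) * nr x i)"

text \<open>The \<open>decay\<close> matrix applied to the absolute values of a column of the
  inverse. It measures how strongly that column reacts to a change of the kernel.\<close>

definition arow :: "(nat \<Rightarrow> real^'d) \<Rightarrow> nat \<Rightarrow> real" where
  "arow x i = sqrt (\<Sum>l<n. (\<Sum>j<n. decay (x l - x j) * \<bar>invcol {..<n} x i j\<bar>)\<^sup>2)"

text \<open>The quadratic form behind the modulus of continuity in the parameter. The
  \<open>gsum\<close> part pays for the change of the solution and of the prediction function, the
  \<open>arow\<close> part for the change of the leave-one-out scales.\<close>

definition pf :: "(nat \<Rightarrow> real^'d) \<Rightarrow> 'w \<Rightarrow> real" where
  "pf x \<omega> = (\<Sum>i<n. (gsum x i + arow x i) * (u x i \<omega>)\<^sup>2)"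

definition psum :: "(nat \<Rightarrow> real^'d) \<Rightarrow> real" where
  "psum x = (\<Sum>i<n. exp (nr x i))"

lemma psum_nonneg: "0 \<le> psum x"
  by (simp add: psum_def sum_nonneg)

lemma gsum_nonneg: "0 \<le> gsum x j"
  unfolding gsum_def by (intro sum_nonneg mult_nonneg_nonneg near_nonneg) auto

lemma arow_nonneg: "0 \<le> arow x i"
  by (simp add: arow_def sum_nonneg)

lemma decay_row_square_le:
  "(\<Sum>l<n. (\<Sum>j<n. decay (x l - x j) * \<bar>z j\<bar>)\<^sup>2) \<le> (\<Sum>j<n. (z j)\<^sup>2 * gsum x j)"
proof -
  have "(\<Sum>l<n. (\<Sum>j<n. decay (x l - x j) * \<bar>z j\<bar>)\<^sup>2) \<le> (\<Sum>l<n. nr x l * (\<Sum>j<n. decay (x l - x j) * \<bar>z j\<bar>\<^sup>2))"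
    unfolding near_def by (intro sum_mono weighted_square_sum_le) auto
  also have "\<dots> = (\<Sum>l<n. \<Sum>j<n. (z j)\<^sup>2 * (decay (x l - x j) * nr x l))"
    by (simp add: sum_distrib_left mult_ac)
  also have "\<dots> = (\<Sum>j<n. (z j)\<^sup>2 * gsum x j)"
    unfolding gsum_def by (subst sum.swap) (simp add: sum_distrib_left)
  finally show ?thesis .
qed

lemma nr_power_le: "(\<Sum>i<n. nr x i ^ m) \<le> fact m * psum x"
  unfolding psum_def sum_distrib_left by (intro sum_mono power_le_fact_exp near_nonneg)

lemma sum_gsum: "(\<Sum>j<n. gsum x j) = (\<Sum>i<n. (nr x i)\<^sup>2)"
  unfolding gsum_def by (subst sum.swap) (simp add: near_def sum_distrib_right power2_eq_square)

text \<open>Weighted Cauchy-Schwarz and one arithmetic-geometric step reduce the sum to half the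
  third plus half the fifth powers of the neighbour counts. With
  \<open>z ^ m \<le> fact m * exp z\<close> this gives (6 + 120) / 2 = 63.\<close>

lemma sum_gsum_square_le: "(\<Sum>j<n. (gsum x j)\<^sup>2) \<le> 63 * psum x"
proof -
  let ?h = "nr x" and ?D = "\<lambda>i j. decay (x i - x j)"
  have row: "(\<Sum>j<n. ?D i j) = ?h i" for i by (simp add: near_def)
  have col: "(\<Sum>i<n. ?D i j) = ?h j" for j by (simp add: near_def decay_diff_commute[of _ "x j"])
  have "(\<Sum>j<n. (gsum x j)\<^sup>2) \<le> (\<Sum>j<n. ?h j * (\<Sum>i<n. ?D i j * (?h i)\<^sup>2))"
    unfolding gsum_def col[symmetric] by (intro sum_mono weighted_square_sum_le) auto
  also have "\<dots> = (\<Sum>j<n. \<Sum>i<n. ?D i j * (?h j * (?h i)\<^sup>2))"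
    by (simp add: sum_distrib_left mult_ac)
  also have "\<dots> \<le> (\<Sum>j<n. \<Sum>i<n. ?D i j * (?h j ^ 2 / 2 + ?h i ^ 4 / 2))"
  proof (intro sum_mono mult_left_mono)
    fix i j
    show "?h j * (?h i)\<^sup>2 \<le> ?h j ^ 2 / 2 + ?h i ^ 4 / 2"
      using mult_le_weighted_squares[of 1 "?h j" "(?h i)\<^sup>2"] by (simp add: add_divide_distrib)
  qed simp
  also have "\<dots> = (\<Sum>j<n. \<Sum>i<n. ?D i j * (?h j ^ 2 / 2)) + (\<Sum>j<n. \<Sum>i<n. ?D i j * (?h i ^ 4 / 2))"
    by (simp only: distrib_left sum.distrib)
  also have "(\<Sum>j<n. \<Sum>i<n. ?D i j * (?h j ^ 2 / 2)) = (\<Sum>j<n. ?h j ^ 3) / 2"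
    by (simp only: sum_distrib_right[symmetric] col) (simp add: sum_divide_distrib power2_eq_square power3_eq_cube mult.assoc)
  also have "(\<Sum>j<n. \<Sum>i<n. ?D i j * (?h i ^ 4 / 2)) = (\<Sum>i<n. ?h i ^ 5) / 2"
    by (subst sum.swap) (simp only: sum_distrib_right[symmetric] row, simp add: sum_divide_distrib power_Suc[symmetric] eval_nat_numeral)
  also have "(\<Sum>j<n. ?h j ^ 3) / 2 + (\<Sum>i<n. ?h i ^ 5) / 2 \<le> (fact 3 * psum x) / 2 + (fact 5 * psum x) / 2"
    by (intro add_mono divide_right_mono nr_power_le) auto
  finally show ?thesis by (simp add: fact_numeral)
qed

lemma arow_square_le: "i < n \<Longrightarrow> (arow x i)\<^sup>2 \<le> (\<Sum>j<n. (invcol {..<n} x i j)\<^sup>2 * gsum x j)"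
  using decay_row_square_le[of x "invcol {..<n} x i"] by (simp add: arow_def sum_nonneg)

lemma sum_arow_square_le: "(\<Sum>i<n. (arow x i)\<^sup>2) \<le> 2 / C\<^sup>2 * psum x"
proof -
  have "(\<Sum>i<n. (arow x i)\<^sup>2) \<le> (\<Sum>i<n. \<Sum>j<n. (invcol {..<n} x i j)\<^sup>2 * gsum x j)"
    by (intro sum_mono arow_square_le) auto
  also have "\<dots> = (\<Sum>j<n. (\<Sum>i<n. (invcol {..<n} x i j)\<^sup>2) * gsum x j)"
    by (subst sum.swap) (simp add: sum_distrib_right)
  also have "\<dots> \<le> (\<Sum>j<n. 1 / C\<^sup>2 * gsum x j)"
    by (intro sum_mono mult_right_mono invcol_row_norm_le gsum_nonneg) auto
  also have "\<dots> = 1 / C\<^sup>2 * (\<Sum>i<n. nr x i ^ 2)"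
    unfolding sum_distrib_left[symmetric] sum_gsum ..
  also have "\<dots> \<le> 1 / C\<^sup>2 * (fact 2 * psum x)"
    using C_pos by (intro mult_left_mono nr_power_le) auto
  finally show ?thesis by simp
qed

definition cP :: real where "cP = 63 + 2 / C\<^sup>2 + S\<^sub>0\<^sup>2 / C ^ 4"

lemma cP_nonneg: "0 \<le> cP"
  by (simp add: cP_def)

definition pmean :: "(nat \<Rightarrow> real^'d) \<Rightarrow> real" where
  "pmean x = (\<Sum>i<n. (gsum x i + arow x i) * cov_u x i i)"

lemma sum_nr_le: "(\<Sum>i<n. nr x i) \<le> psum x"
  using nr_power_le[of x 1] by simp

lemma pmean_le: "pmean x \<le> cP * psum x"
proof -
  have "pmean x \<le> (\<Sum>i<n. (gsum x i + arow x i)\<^sup>2) / 2 + (\<Sum>i<n. (cov_u x i i)\<^sup>2) / 2"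
    unfolding pmean_def by (rule sum_mult_le_half_squares)
  also have "(\<Sum>i<n. (gsum x i + arow x i)\<^sup>2) \<le> (\<Sum>i<n. 2 * (gsum x i)\<^sup>2 + 2 * (arow x i)\<^sup>2)"
    using square_diff_le[of "gsum x _" "- arow x _"] by (intro sum_mono) simp
  also have "\<dots> = 2 * (\<Sum>i<n. (gsum x i)\<^sup>2) + 2 * (\<Sum>i<n. (arow x i)\<^sup>2)"
    by (simp add: sum.distrib sum_distrib_left)
  also have "\<dots> \<le> 2 * (63 * psum x) + 2 * (2 / C\<^sup>2 * psum x)"
    by (intro add_mono mult_left_mono sum_gsum_square_le sum_arow_square_le) auto
  also have "(\<Sum>i<n. (cov_u x i i)\<^sup>2) \<le> S\<^sub>0\<^sup>2 / C ^ 4 * psum x"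
    by (intro order_trans[OF cov_u_diag_square_le] mult_left_mono sum_nr_le) auto
  finally have "pmean x \<le> (2 * (63 * psum x) + 2 * (2 / C\<^sup>2 * psum x)) / 2 + S\<^sub>0\<^sup>2 / C ^ 4 * psum x / 2"
    by simp
  also have "\<dots> \<le> cP * psum x"
  proof -
    have "0 \<le> S\<^sub>0\<^sup>2 / C ^ 4 * psum x" using psum_nonneg[of x] by simp
    moreover have "(2 * (63 * p) + 2 * q) / 2 + d / 2 \<le> 63 * p + q + d" if "0 \<le> d" for p q d :: real
      using that by (simp add: add_divide_distrib)
    ultimately show ?thesis unfolding cP_def distrib_right by blast
  qed
  finally show ?thesis .
qed

lemma nr_power8_le: "i < n \<Longrightarrow> nr x i ^ 8 \<le> fact 8 * psum x"
  using order_trans[OF member_le_sum[of i "{..<n}" "\<lambda>i. nr x i ^ 8"] nr_power_le[of x 8]] by auto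

definition cQ :: real where "cQ = 2 * ((1 + 1 / C)\<^sup>2 * sqrt (fact 8)) * (S\<^sub>0\<^sup>2 / C ^ 4)"

lemma cQ_nonneg: "0 \<le> cQ"
  by (simp add: cQ_def)

text \<open>The coefficients are bounded by a multiple of the squared maximal neighbour count
  \<open>H\<close>. This maximum is not bounded, but its eighth power is at most
  \<open>fact 8 * psum x\<close>, so \<open>H ^ 4\<close> is of the order of the root of
  \<open>psum x\<close>. For a typical design the variance is then of order n^(3/2), still below
  n^2.\<close>

lemma var_pf_le:
  "(\<integral>\<^sup>+\<omega>. ennreal ((pf x \<omega> - pmean x)\<^sup>2) \<partial>M) \<le> ennreal (cQ * (sqrt (psum x) * psum x))"
proof -
  define H where "H = Max (nr x ` {..<n})"
  have fin: "finite (nr x ` {..<n})" "nr x ` {..<n} \<noteq> {}" using n_pos by auto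
  have H: "nr x i \<le> H" if "i < n" for i unfolding H_def using that by (intro Max_ge fin) auto
  obtain i0 where i0: "i0 < n" "H = nr x i0" using Max_in[OF fin] by (auto simp: H_def)
  have H1: "1 \<le> H" using nr_ge_1[OF i0(1)] i0 by simp
  have H4: "H ^ 4 \<le> sqrt (fact 8) * sqrt (psum x)"
  proof -
    have "(H ^ 4)\<^sup>2 \<le> fact 8 * psum x" using nr_power8_le[OF i0(1), of x] i0(2) by simp
    from real_le_rsqrt[OF this] show ?thesis by (simp only: real_sqrt_mult)
  qed
  have g: "gsum x j \<le> H\<^sup>2" if "j < n" for j
  proof -
    have "gsum x j \<le> (\<Sum>i<n. decay (x i - x j) * H)"
      unfolding gsum_def by (intro sum_mono mult_left_mono H) auto
    also have "\<dots> = nr x j * H" by (simp add: near_def sum_distrib_right decay_diff_commute[of _ "x j"])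
    also have "\<dots> \<le> H * H" using H[OF that] H1 by (intro mult_right_mono) auto
    finally show ?thesis by (simp add: power2_eq_square)
  qed
  have a: "arow x i \<le> H / C" if i: "i < n" for i
  proof (rule power2_le_imp_le)
    have "(arow x i)\<^sup>2 \<le> (\<Sum>j<n. (invcol {..<n} x i j)\<^sup>2 * H\<^sup>2)"
      by (intro order_trans[OF arow_square_le[OF i]] sum_mono mult_left_mono g) auto
    also have "\<dots> \<le> 1 / C\<^sup>2 * H\<^sup>2"
      unfolding sum_distrib_right[symmetric] using i by (intro mult_right_mono invcol_norm_le) auto
    finally show "(arow x i)\<^sup>2 \<le> (H / C)\<^sup>2" by (simp add: power_divide)
  qed (use H1 C_pos in simp)
  let ?b = "\<lambda>i. gsum x i + arow x i"
  have b: "?b i \<le> (1 + 1 / C) * H\<^sup>2" if "i < n" for i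
  proof -
    have "H / C \<le> H\<^sup>2 / C" using H1 C_pos by (intro divide_right_mono) (auto simp: power2_eq_square)
    then show ?thesis using g[OF that] a[OF that] by (simp add: algebra_simps)
  qed
  have b0: "0 \<le> ?b i" for i using gsum_nonneg arow_nonneg by (intro add_nonneg_nonneg)
  have pm: "pmean x = (\<Sum>i<n. ?b i * expectation (\<lambda>\<omega>. (u x i \<omega>)\<^sup>2))"
    by (simp add: pmean_def cov_u_diag)
  have v: "expectation (\<lambda>\<omega>. (pf x \<omega> - pmean x)\<^sup>2) = 2 * (\<Sum>i<n. \<Sum>j<n. ?b i * ?b j * (cov_u x i j)\<^sup>2)"
    "integrable M (\<lambda>\<omega>. (pf x \<omega> - pmean x)\<^sup>2)"
    unfolding pm pf_def cov_u_def by (rule var_quadratic_form; auto intro: lin_u)+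
  let ?B = "(1 + 1 / C) * H\<^sup>2"
  have "(\<Sum>i<n. \<Sum>j<n. ?b i * ?b j * (cov_u x i j)\<^sup>2) \<le> (\<Sum>i<n. \<Sum>j<n. ?B * ?B * (cov_u x i j)\<^sup>2)"
    using C_pos by (intro sum_mono mult_right_mono mult_mono b b0) auto
  also have "\<dots> = ?B * ?B * (\<Sum>i<n. \<Sum>j<n. (cov_u x i j)\<^sup>2)" by (simp only: sum_distrib_left)
  also have "\<dots> \<le> ?B * ?B * (S\<^sub>0\<^sup>2 / C ^ 4 * psum x)"
    by (intro mult_left_mono order_trans[OF sum_cov_u_square_le] sum_nr_le) auto
  also have "?B * ?B = (1 + 1 / C)\<^sup>2 * H ^ 4" by (simp add: power2_eq_square power4_eq_xxxx)
  also have "(1 + 1 / C)\<^sup>2 * H ^ 4 * (S\<^sub>0\<^sup>2 / C ^ 4 * psum x) \<le> (1 + 1 / C)\<^sup>2 * (sqrt (fact 8) * sqrt (psum x)) * (S\<^sub>0\<^sup>2 / C ^ 4 * psum x)"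
    using psum_nonneg[of x] by (intro mult_right_mono mult_left_mono H4) auto
  finally have "expectation (\<lambda>\<omega>. (pf x \<omega> - pmean x)\<^sup>2) \<le> 2 * ((1 + 1 / C)\<^sup>2 * (sqrt (fact 8) * sqrt (psum x)) * (S\<^sub>0\<^sup>2 / C ^ 4 * psum x))"
    using v(1) by simp
  also have "\<dots> = cQ * (sqrt (psum x) * psum x)" by (simp only: cQ_def mult_ac)
  finally have "ennreal (expectation (\<lambda>\<omega>. (pf x \<omega> - pmean x)\<^sup>2)) \<le> ennreal (cQ * (sqrt (psum x) * psum x))"
    by (rule ennreal_leI)
  then show ?thesis using v(2) by (subst nn_integral_eq_integral) auto
qed

lemma borel_measurable_pf: "pf x \<in> borel_measurable M"
  unfolding pf_def[abs_def]
  by (intro borel_measurable_sum borel_measurable_times borel_measurable_power borel_measurable_const borel_measurable_u) auto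

text \<open>Chebyshev's inequality with deviation \<open>n\<close>: under the bound on
  \<open>psum x\<close> the mean is at most \<open>cP * c * n\<close> and the variance of order
  n^(3/2).\<close>

lemma emeasure_pf_gt_le:
  fixes c :: real
  assumes c: "0 \<le> c" "psum x \<le> c * n"
  shows "emeasure M {\<omega>\<in>space M. (cP * c + 1) * n < pf x \<omega>} \<le> ennreal (cQ * (sqrt c * c) / sqrt n)"
proof -
  note [measurable] = borel_measurable_pf
  have pm: "pmean x \<le> cP * c * n"
    using order_trans[OF pmean_le mult_left_mono[OF c(2) cP_nonneg]] by (simp add: mult.assoc)
  have "emeasure M {\<omega>\<in>space M. (cP * c + 1) * n < pf x \<omega>} \<le> emeasure M {\<omega>\<in>space M. 1 \<le> ennreal (1 / (real n)\<^sup>2) * ennreal ((pf x \<omega> - pmean x)\<^sup>2)}"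
  proof (intro emeasure_mono)
    show "{\<omega>\<in>space M. (cP * c + 1) * n < pf x \<omega>} \<subseteq> {\<omega>\<in>space M. 1 \<le> ennreal (1 / (real n)\<^sup>2) * ennreal ((pf x \<omega> - pmean x)\<^sup>2)}"
    proof safe
      fix \<omega> assume "(cP * c + 1) * n < pf x \<omega>"
      then have "real n \<le> pf x \<omega> - pmean x" using pm by (simp add: algebra_simps)
      then have "(real n)\<^sup>2 \<le> (pf x \<omega> - pmean x)\<^sup>2" by (intro power_mono) auto
      then have "1 \<le> 1 / (real n)\<^sup>2 * (pf x \<omega> - pmean x)\<^sup>2" using n_pos by simp
      then have "ennreal 1 \<le> ennreal (1 / (real n)\<^sup>2 * (pf x \<omega> - pmean x)\<^sup>2)" by (rule ennreal_leI)
      then show "1 \<le> ennreal (1 / (real n)\<^sup>2) * ennreal ((pf x \<omega> - pmean x)\<^sup>2)"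
        by (subst ennreal_mult[symmetric]) auto
    qed
  qed measurable
  also have "\<dots> \<le> ennreal (1 / (real n)\<^sup>2) * (\<integral>\<^sup>+\<omega>. ennreal ((pf x \<omega> - pmean x)\<^sup>2) * indicator (space M) \<omega> \<partial>M)"
  proof -
    show ?thesis by (rule nn_integral_Markov_inequality) measurable
  qed
  also have "(\<integral>\<^sup>+\<omega>. ennreal ((pf x \<omega> - pmean x)\<^sup>2) * indicator (space M) \<omega> \<partial>M) = (\<integral>\<^sup>+\<omega>. ennreal ((pf x \<omega> - pmean x)\<^sup>2) \<partial>M)"
    by (intro nn_integral_cong) simp
  also have "ennreal (1 / (real n)\<^sup>2) * \<dots> \<le> ennreal (1 / (real n)\<^sup>2) * ennreal (cQ * (sqrt (c * n) * (c * n)))"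
  proof (intro mult_left_mono order_trans[OF var_pf_le] ennreal_leI)
    show "sqrt (psum x) * psum x \<le> sqrt (c * n) * (c * n)"
      using c psum_nonneg[of x] by (intro mult_mono) auto
  qed (use cQ_nonneg in auto)
  also have "\<dots> = ennreal (1 / (real n)\<^sup>2 * (cQ * (sqrt (c * n) * (c * n))))"
    using cQ_nonneg c by (intro ennreal_mult[symmetric]) auto
  also have "1 / (real n)\<^sup>2 * (cQ * (sqrt (c * n) * (c * n))) = cQ * (sqrt c * c) / sqrt n"
  proof -
    have n: "sqrt n * sqrt n = real n" "0 < sqrt n" using n_pos by simp_all
    have "1 / (s * s)\<^sup>2 * (q * (r * s * (c * (s * s)))) = q * (r * c) / s" if "0 < s" for s q r c :: real
      using that by (simp add: power2_eq_square field_simps)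
    from this[OF n(2), of cQ "sqrt c" c] show ?thesis unfolding n(1) real_sqrt_mult .
  qed
  finally show ?thesis .
qed

end

section \<open>Cross validation and prediction error as functions of the data\<close>

context krig
begin

text \<open>The criteria as functions of deterministic data. Different models can now be compared at
  the same outcome, and the value at a random parameter makes sense.\<close>

definition cvd :: "nat \<Rightarrow> (nat \<Rightarrow> real^'d) \<Rightarrow> (nat \<Rightarrow> real) \<Rightarrow> real" where
  "cvd n x y = (\<Sum>i<n. (loo_scale {..<n} x i)\<^sup>2 * (solution {..<n} x y i)\<^sup>2) / n"

definition predd :: "nat \<Rightarrow> (nat \<Rightarrow> real^'d) \<Rightarrow> (nat \<Rightarrow> real) \<Rightarrow> real^'d \<Rightarrow> real" where
  "predd n x y t = (\<Sum>j<n. k (t - x j) * solution {..<n} x y j)"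

definition isped :: "nat \<Rightarrow> (nat \<Rightarrow> real^'d) \<Rightarrow> (nat \<Rightarrow> real) \<Rightarrow> (real^'d \<Rightarrow> real) \<Rightarrow> real" where
  "isped n x y f = (\<integral>t. (f t - predd n x y t)\<^sup>2 \<partial>unif n)"

lemma solution_reindex:
  assumes "inj_on e J" "finite J" "a \<in> J"
  shows "solution J (\<lambda>i. x (e i)) (\<lambda>i. y (e i)) a = solution (e ` J) x y (e a)"
proof (rule solution_eqI[OF assms(2) _ assms(3)])
  have s: "solves (e ` J) x y (solution (e ` J) x y)" using assms(2) by (intro solves_solution) simp
  show "solves J (\<lambda>i. x (e i)) (\<lambda>i. y (e i)) (\<lambda>a. solution (e ` J) x y (e a))"
    unfolding solves_def
  proof
    fix i assume i: "i \<in> J"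
    have "(\<Sum>j\<in>J. R (\<lambda>i. x (e i)) i j * solution (e ` J) x y (e j)) = (\<Sum>j\<in>J. R x (e i) (e j) * solution (e ` J) x y (e j))"
      using assms(1) i by (intro sum.cong) (auto simp: R_def inj_on_eq_iff)
    also have "\<dots> = (\<Sum>j\<in>e ` J. R x (e i) j * solution (e ` J) x y j)"
      using assms(1) by (simp add: sum.reindex)
    also have "\<dots> = y (e i)" using s i by (simp add: solves_def)
    finally show "(\<Sum>j\<in>J. R (\<lambda>i. x (e i)) i j * solution (e ` J) x y (e j)) = y (e i)" .
  qed
qed

text \<open>Unique solvability makes the determinant nonzero, so \<open>the\<close> is applied to an
  actual inverse. This is the bridge from the matrices of the problem statement to
  \<open>solution\<close>.\<close>

lemma mat_inverse_mult_vec: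
  fixes x :: "nat \<Rightarrow> real^'d"
  shows "the (mat_inverse (Matrix.mat m m (\<lambda>(a, b). R x a b))) *\<^sub>v Matrix.vec m y = Matrix.vec m (solution {..<m} x y)"
proof -
  define W where "W = Matrix.mat m m (\<lambda>(a, b). R x a b)"
  have W: "W \<in> carrier_mat m m" by (simp add: W_def)
  have mult: "vec_index (W *\<^sub>v v) i = (\<Sum>j<m. R x i j * vec_index v j)" if "v \<in> carrier_vec m" "i < m" for v i
    using that by (auto simp: W_def scalar_prod_def atLeast0LessThan intro!: sum.cong)
  have det: "Determinant.det W \<noteq> 0"
  proof
    assume "Determinant.det W = 0"
    then obtain v where v: "v \<in> carrier_vec m" "v \<noteq> 0\<^sub>v m" "W *\<^sub>v v = 0\<^sub>v m"
      using det_0_iff_vec_prod_zero_field[OF W] by auto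
    have "solves {..<m} x (\<lambda>_. 0) (vec_index v)"
      unfolding solves_def using mult[OF v(1)] v(3) by auto
    moreover have "solves {..<m} x (\<lambda>_. 0) (\<lambda>_. 0)" by (simp add: solves_def)
    ultimately have "vec_index v i = 0" if "i < m" for i
      using solves_unique[of "{..<m}"] that by blast
    then have "v = 0\<^sub>v m" using v(1) by (intro eq_vecI) auto
    with v(2) show False by simp
  qed
  then have "W \<in> Units (ring_mat TYPE(real) m ())" by (rule det_non_zero_imp_unit[OF W])
  then obtain B where B: "mat_inverse W = Some B"
    using mat_inverse(1)[OF W, where b="()"] by (cases "mat_inverse W") auto
  then have B': "W * B = 1\<^sub>m m" "B \<in> carrier_mat m m" using mat_inverse(2)[OF W] by auto
  define v where "v = B *\<^sub>v Matrix.vec m y"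
  have v: "v \<in> carrier_vec m" using B'(2) by (simp add: v_def)
  have Wv: "W *\<^sub>v v = Matrix.vec m y"
    unfolding v_def by (subst assoc_mult_mat_vec[OF W B'(2), symmetric]) (auto simp: B'(1))
  have "solves {..<m} x y (vec_index v)"
    unfolding solves_def
  proof
    fix i assume "i \<in> {..<m}"
    then show "(\<Sum>j<m. R x i j * vec_index v j) = y i" using mult[OF v, of i] Wv by simp
  qed
  then have "solution {..<m} x y i = vec_index v i" if "i < m" for i
    using that by (intro solution_eqI) auto
  then have "v = Matrix.vec m (solution {..<m} x y)" using v by (intro eq_vecI) auto
  then show ?thesis using B by (simp add: v_def W_def)
qed

lemma pred_eq: "pred k \<delta> n x y t = predd n x y t"
proof -
  have "cov_mat k \<delta> n x = Matrix.mat n n (\<lambda>(a, b). R x a b)" by (simp add: cov_mat_def R_def)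
  then show ?thesis
    by (simp add: pred_def predd_def mat_inverse_mult_vec scalar_prod_def atLeast0LessThan)
qed

text \<open>The renumbering by \<open>insert_index i\<close> is undone: the system with
  \<open>n - 1\<close> consecutive indices becomes the system on
  \<open>{..<n} - {i}\<close>.\<close>

lemma loo_pred_eq:
  assumes i: "i < n"
  shows "loo_pred k \<delta> n x y i = (\<Sum>j\<in>{..<n} - {i}. weight ({..<n} - {i}) x (x i) j * y j)"
proof -
  let ?e = "insert_index i" and ?m = "n - 1"
  have inj: "inj_on ?e {..<?m}" by (rule insert_index_inj_on)
  have im: "?e ` {..<?m} = {..<n} - {i}"
    using insert_index_image[of i "n - 1"] i by (simp add: atLeast0LessThan)
  have W: "mat_delete (cov_mat k \<delta> n x) i i = Matrix.mat ?m ?m (\<lambda>(a, b). R (\<lambda>j. x (?e j)) a b)"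
  proof (rule eq_matI)
    fix a b assume "a < dim_row (Matrix.mat ?m ?m (\<lambda>(a, b). R (\<lambda>j. x (?e j)) a b))"
      "b < dim_col (Matrix.mat ?m ?m (\<lambda>(a, b). R (\<lambda>j. x (?e j)) a b))"
    then show "mat_delete (cov_mat k \<delta> n x) i i $$ (a, b) = Matrix.mat ?m ?m (\<lambda>(a, b). R (\<lambda>j. x (?e j)) a b) $$ (a, b)"
      using i by (auto simp: mat_delete_def cov_mat_def R_def insert_index_def)
  qed (use i in \<open>auto simp: mat_delete_def cov_mat_def\<close>)
  have "loo_pred k \<delta> n x y i = (\<Sum>a<?m. k (x i - x (?e a)) * solution {..<?m} (\<lambda>j. x (?e j)) (\<lambda>j. y (?e j)) a)"
    unfolding loo_pred_def W mat_inverse_mult_vec by (simp add: scalar_prod_def atLeast0LessThan)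
  also have "\<dots> = (\<Sum>a<?m. k (x i - x (?e a)) * solution ({..<n} - {i}) x y (?e a))"
    by (intro sum.cong refl, subst solution_reindex[OF inj finite_lessThan, of _ x y, unfolded im]) auto
  also have "\<dots> = (\<Sum>j\<in>{..<n} - {i}. k (x i - x j) * solution ({..<n} - {i}) x y j)"
    unfolding im[symmetric] using inj by (simp add: sum.reindex)
  finally show ?thesis by (simp add: sum_weight_eq_sum_solution)
qed

lemma CV_eq: "CV k \<delta> n x y = cvd n x y"
proof -
  have "(y i - loo_pred k \<delta> n x y i)\<^sup>2 = (loo_scale {..<n} x i)\<^sup>2 * (solution {..<n} x y i)\<^sup>2" if "i < n" for i
    using loo_residual[of "{..<n}" i y x] that by (simp add: loo_pred_eq power_mult_distrib)
  then show ?thesis by (simp add: CV_def cvd_def)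
qed

lemma borel_measurable_predd:
  assumes "\<And>j. j < n \<Longrightarrow> (\<lambda>\<omega>. x \<omega> j) \<in> borel_measurable N" "\<And>j. j < n \<Longrightarrow> (\<lambda>\<omega>. y \<omega> j) \<in> borel_measurable N"
    and "\<tau> \<in> borel_measurable N"
  shows "(\<lambda>\<omega>. predd n (x \<omega>) (y \<omega>) (\<tau> \<omega>)) \<in> borel_measurable N"
  unfolding predd_def
  by (intro borel_measurable_sum borel_measurable_times borel_measurable_solution
      measurable_compose[OF _ k_measurable] borel_measurable_diff assms) (use assms in auto)

lemma borel_measurable_isped:
  assumes n: "0 < n"
    and x: "\<And>j. j < n \<Longrightarrow> (\<lambda>\<omega>. x \<omega> j) \<in> borel_measurable N"
    and y: "\<And>j. j < n \<Longrightarrow> (\<lambda>\<omega>. y \<omega> j) \<in> borel_measurable N"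
    and f: "(\<lambda>(t, \<omega>). f \<omega> t) \<in> borel_measurable (borel \<Otimes>\<^sub>M N)"
  shows "(\<lambda>\<omega>. isped n (x \<omega>) (y \<omega>) (f \<omega>)) \<in> borel_measurable N"
proof -
  interpret U: prob_space "unif n :: (real^'d) measure" by (rule prob_space_unif[OF n])
  have f': "(\<lambda>q. f (fst q) (snd q)) \<in> borel_measurable (N \<Otimes>\<^sub>M unif n)"
    using measurable_pair_swap[OF f] by (simp add: case_prod_beta' cong: measurable_cong_sets)
  have "(\<lambda>q. predd n (x (fst q)) (y (fst q)) (snd q)) \<in> borel_measurable (N \<Otimes>\<^sub>M unif n)"
    by (rule borel_measurable_predd)
       (auto intro: measurable_compose[OF measurable_fst] x y cong: measurable_cong_sets)
  with f' have "(\<lambda>q. (f (fst q) (snd q) - predd n (x (fst q)) (y (fst q)) (snd q))\<^sup>2) \<in> borel_measurable (N \<Otimes>\<^sub>M unif n)"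
    by (intro borel_measurable_power borel_measurable_diff)
  then show ?thesis
    unfolding isped_def by (intro U.borel_measurable_lebesgue_integral) (simp add: case_prod_beta')
qed

lemma predd_bounded: "\<bar>predd n x y t\<bar> \<le> (\<Sum>j<n. A * \<bar>solution {..<n} x y j\<bar>)"
  unfolding predd_def
  by (intro order_trans[OF sum_abs] sum_mono) (auto simp: abs_mult intro!: mult_right_mono k_abs_le)

lemma borel_measurable_predd_t [measurable]: "predd n x y \<in> borel_measurable borel"
  unfolding predd_def[abs_def] by measurable

lemma integrable_resid_square:
  assumes n: "0 < n" and f: "f \<in> borel_measurable borel" "integrable (unif n) (\<lambda>t. (f t)\<^sup>2)"
  shows "integrable (unif n) (\<lambda>t. (f t - predd n x y t)\<^sup>2)"
proof -
  have i: "integrable (unif n) (\<lambda>t. (predd n x y t)\<^sup>2)"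
  proof (rule integrable_unif[OF n, of _ "(\<Sum>j<n. A * \<bar>solution {..<n} x y j\<bar>)\<^sup>2"])
    show "\<bar>(predd n x y t)\<^sup>2\<bar> \<le> (\<Sum>j<n. A * \<bar>solution {..<n} x y j\<bar>)\<^sup>2" for t
      using power_mono[OF predd_bounded, of n x y t 2] by simp
  qed measurable
  have "integrable (unif n) (\<lambda>t. 2 * (f t)\<^sup>2 + 2 * (predd n x y t)\<^sup>2)" using i f(2) by auto
  then show ?thesis
    by (rule Bochner_Integration.integrable_bound)
       (use f(1) square_diff_le in \<open>auto intro!: AE_I2 borel_measurable_power borel_measurable_diff\<close>)
qed

end

lemma one_add_inverse_le: "0 < s \<Longrightarrow> s \<le> 1 \<Longrightarrow> 1 + 1 / s \<le> 2 / s" for s :: real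
  by (simp add: field_simps)

lemma square_add_le: "(a + b)\<^sup>2 \<le> 2 * a\<^sup>2 + 2 * b\<^sup>2" for a b :: real
  using square_diff_le[of a "- b"] by simp

text \<open>The free parameter \<open>s\<close> will be the square root of the size of the
  perturbation, since the sum of the \<open>e\<^sup>2\<close> terms is of the order of that
  size.\<close>

lemma abs_square_add_diff_le:
  fixes a e s :: real
  assumes "0 < s" shows "\<bar>(a + e)\<^sup>2 - a\<^sup>2\<bar> \<le> s * a\<^sup>2 + (1 + 1 / s) * e\<^sup>2"
proof -
  have "\<bar>(a + e)\<^sup>2 - a\<^sup>2\<bar> = \<bar>2 * (a * e) + e\<^sup>2\<bar>" by (simp add: power2_sum mult.assoc)
  also have "\<dots> \<le> 2 * (\<bar>a\<bar> * \<bar>e\<bar>) + e\<^sup>2" by (intro order_trans[OF abs_triangle_ineq]) (simp add: abs_mult)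
  also have "\<bar>a\<bar> * \<bar>e\<bar> \<le> (s * \<bar>a\<bar>\<^sup>2 + \<bar>e\<bar>\<^sup>2 / s) / 2" by (rule mult_le_weighted_squares[OF assms])
  finally show ?thesis by (simp add: distrib_right add_divide_distrib)
qed

section \<open>Perturbation of the model\<close>

context model
begin

lemma cv_eq_cvd: "cv x \<omega> = cvd n x (\<lambda>j. obs x j \<omega>)"
  by (simp add: cv_def cvd_def u_def)

lemma resid_eq: "resid {..<n} x t \<omega> = Y t \<omega> - predd n x (\<lambda>j. obs x j \<omega>) t"
  by (simp add: resid_def predd_def sum_weight_eq_sum_solution)

lemma ispe_eq_isped: "ispe x \<omega> = isped n x (\<lambda>j. obs x j \<omega>) (\<lambda>t. Y t \<omega>)"
  by (simp add: ispe_def isped_def resid_eq)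

definition pd :: "(nat \<Rightarrow> real^'d) \<Rightarrow> (nat \<Rightarrow> real) \<Rightarrow> real" where
  "pd x y = (\<Sum>i<n. (gsum x i + arow x i) * (solution {..<n} x y i)\<^sup>2)"

lemma pf_eq_pd: "pf x \<omega> = pd x (\<lambda>j. obs x j \<omega>)"
  by (simp add: pf_def pd_def u_def)

lemma pd_nonneg: "0 \<le> pd x y"
  unfolding pd_def using gsum_nonneg arow_nonneg by (intro sum_nonneg mult_nonneg_nonneg add_nonneg_nonneg) auto

lemma nr_le_gsum: "j < n \<Longrightarrow> nr x j \<le> gsum x j"
proof -
  have "nr x j = (\<Sum>i<n. decay (x i - x j) * 1)" by (simp add: near_def decay_diff_commute[of "x j"])
  also have "\<dots> \<le> gsum x j" unfolding gsum_def by (intro sum_mono mult_left_mono nr_ge_1) auto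
  finally show ?thesis .
qed

lemma sum_gsum_solution_le: "(\<Sum>i<n. (solution {..<n} x y i)\<^sup>2 * gsum x i) \<le> pd x y"
  unfolding pd_def using arow_nonneg by (intro sum_mono) (simp add: algebra_simps)

lemma sum_arow_solution_le: "(\<Sum>i<n. arow x i * (solution {..<n} x y i)\<^sup>2) \<le> pd x y"
  unfolding pd_def using gsum_nonneg by (intro sum_mono mult_right_mono) auto

lemma sum_solution_le: "(\<Sum>i<n. (solution {..<n} x y i)\<^sup>2) \<le> pd x y"
proof -
  have "(\<Sum>i<n. (solution {..<n} x y i)\<^sup>2) \<le> (\<Sum>i<n. (solution {..<n} x y i)\<^sup>2 * gsum x i)"
  proof (rule sum_mono)
    fix i assume "i \<in> {..<n}"
    then have "1 \<le> gsum x i" using nr_le_gsum[of i x] nr_ge_1[of i x] by auto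
    from mult_left_mono[OF this, of "(solution {..<n} x y i)\<^sup>2"]
    show "(solution {..<n} x y i)\<^sup>2 \<le> (solution {..<n} x y i)\<^sup>2 * gsum x i" by simp
  qed
  then show ?thesis using sum_gsum_solution_le[of x y] by linarith
qed

text \<open>A second model at distance \<open>q\<close>. All bounds below are in terms of
  \<open>pd x y\<close>, which belongs to the unperturbed model; one random variable at a centre
  therefore controls a whole neighbourhood of parameters.\<close>

context
  fixes k' :: "real^'d \<Rightarrow> real" and \<delta>' q D :: real
  assumes k': "krig k' A C \<delta>'"
    and dk: "\<And>t. \<bar>k t - k' t\<bar> \<le> q * decay t"
    and d\<delta>: "\<bar>\<delta> - \<delta>'\<bar> \<le> q"
    and q: "0 < q" "q \<le> 1"
    and D: "\<delta> \<le> D" "\<delta>' \<le> D"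
begin

interpretation K': krig k' A C \<delta>' by (rule k')

text \<open>The factor 2 covers the diagonal, where kernel and noise variance change
  together.\<close>

lemma abs_R_diff_le: "\<bar>R x i j - K'.R x i j\<bar> \<le> 2 * q * decay (x i - x j)"
proof (cases "i = j")
  case True
  then show ?thesis using dk[of 0] d\<delta> by (simp add: R_def K'.R_def)
next
  case False
  have "\<bar>R x i j - K'.R x i j\<bar> \<le> q * decay (x i - x j)" using dk[of "x i - x j"] False by (simp add: R_def K'.R_def)
  also have "\<dots> \<le> 2 * q * decay (x i - x j)" using q by (intro mult_right_mono) auto
  finally show ?thesis .
qed

text \<open>The resolvent identity: the change of the solution is the new inverse applied to the
  change of the matrix applied to the old solution. Only the old solution is multiplied by the
  \<open>decay\<close> matrix, and the new inverse is bounded by 1 / \<open>C\<close>.\<close>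

lemma solves_perturbed:
  assumes "solves {..<n} x b z" "K'.solves {..<n} x b z'"
  shows "K'.solves {..<n} x (\<lambda>i. \<Sum>j<n. (R x i j - K'.R x i j) * z j) (\<lambda>i. z' i - z i)"
proof -
  have "K'.solves {..<n} x (\<lambda>i. \<Sum>j<n. K'.R x i j * z j) z" by (simp add: K'.solves_def)
  from K'.solves_diff[OF assms(2) this]
  have "K'.solves {..<n} x (\<lambda>i. b i - (\<Sum>j<n. K'.R x i j * z j)) (\<lambda>i. z' i - z i)" .
  moreover have "b i - (\<Sum>j<n. K'.R x i j * z j) = (\<Sum>j<n. (R x i j - K'.R x i j) * z j)" if "i < n" for i
    using assms(1) that by (simp add: solves_def left_diff_distrib sum_subtractf)
  ultimately show ?thesis by (simp add: K'.solves_def)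
qed

lemma perturbation_rhs_le:
  "(\<Sum>i<n. (\<Sum>j<n. (R x i j - K'.R x i j) * z j)\<^sup>2) \<le> (2 * q)\<^sup>2 * (\<Sum>i<n. (\<Sum>j<n. decay (x i - x j) * \<bar>z j\<bar>)\<^sup>2)"
proof -
  have "(\<Sum>j<n. (R x i j - K'.R x i j) * z j)\<^sup>2 \<le> (2 * q)\<^sup>2 * (\<Sum>j<n. decay (x i - x j) * \<bar>z j\<bar>)\<^sup>2" for i
  proof -
    have "\<bar>\<Sum>j<n. (R x i j - K'.R x i j) * z j\<bar> \<le> (\<Sum>j<n. 2 * q * decay (x i - x j) * \<bar>z j\<bar>)"
      by (intro order_trans[OF sum_abs] sum_mono) (auto simp: abs_mult intro!: mult_right_mono abs_R_diff_le)
    also have "\<dots> = 2 * q * (\<Sum>j<n. decay (x i - x j) * \<bar>z j\<bar>)" by (simp add: sum_distrib_left mult.assoc)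
    finally have "\<bar>\<Sum>j<n. (R x i j - K'.R x i j) * z j\<bar> \<le> 2 * q * (\<Sum>j<n. decay (x i - x j) * \<bar>z j\<bar>)" .
    from power_mono[OF this, of 2] show ?thesis by (simp add: power_mult_distrib)
  qed
  then show ?thesis unfolding sum_distrib_left by (rule sum_mono)
qed

lemma perturbation_rhs_solution_le:
  "(\<Sum>i<n. (\<Sum>j<n. (R x i j - K'.R x i j) * solution {..<n} x y j)\<^sup>2) \<le> (2 * q)\<^sup>2 * pd x y"
  by (intro order_trans[OF perturbation_rhs_le] mult_left_mono order_trans[OF decay_row_square_le] sum_gsum_solution_le) simp

lemma solution_perturbed_le:
  "(\<Sum>i<n. (K'.solution {..<n} x y i - solution {..<n} x y i)\<^sup>2) \<le> 4 * q\<^sup>2 / C\<^sup>2 * pd x y"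
proof -
  have "(\<Sum>i<n. (K'.solution {..<n} x y i - solution {..<n} x y i)\<^sup>2) \<le>
      (\<Sum>i<n. (\<Sum>j<n. (R x i j - K'.R x i j) * solution {..<n} x y j)\<^sup>2) / C\<^sup>2"
    by (rule K'.solves_norm_le[OF finite_lessThan solves_perturbed[OF solves_solution K'.solves_solution]]) auto
  also have "\<dots> \<le> (2 * q)\<^sup>2 * pd x y / C\<^sup>2"
    by (intro divide_right_mono perturbation_rhs_solution_le) simp
  finally show ?thesis by (simp add: power_mult_distrib)
qed

text \<open>The scales are reciprocals of diagonal entries of the inverse, so their difference is
  their product times the difference of these entries. The latter is one component of the resolvent
  identity for the \<open>i\<close>-th column, and \<open>arow\<close> is the norm appearing
  there.\<close>

lemma loo_scale_perturbed_le:
  assumes i: "i < n"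
  shows "\<bar>K'.loo_scale {..<n} x i - loo_scale {..<n} x i\<bar> \<le> (A + D)\<^sup>2 * (2 * q / C * arow x i)"
proof -
  let ?N = "{..<n}"
  let ?d = "loo_scale ?N x i" and ?d' = "K'.loo_scale ?N x i"
  let ?q = "invcol ?N x i" and ?q' = "K'.invcol ?N x i"
  have "(\<Sum>j<n. (?q' j - ?q j)\<^sup>2) \<le> (\<Sum>l<n. (\<Sum>j<n. (R x l j - K'.R x l j) * ?q j)\<^sup>2) / C\<^sup>2"
    by (rule K'.solves_norm_le[OF finite_lessThan solves_perturbed[OF solves_invcol K'.solves_invcol]]) auto
  also have "\<dots> \<le> (2 * q)\<^sup>2 * (arow x i)\<^sup>2 / C\<^sup>2"
    using perturbation_rhs_le[of x ?q] by (intro divide_right_mono) (auto simp: arow_def sum_nonneg)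
  finally have "(?q' i - ?q i)\<^sup>2 \<le> (2 * q / C * arow x i)\<^sup>2"
    using member_le_sum[of i ?N "\<lambda>j. (?q' j - ?q j)\<^sup>2"] i by (simp add: power_mult_distrib power_divide)
  then have Q: "\<bar>?q' i - ?q i\<bar> \<le> 2 * q / C * arow x i"
    using q C_pos arow_nonneg[of x i] by (subst (asm) abs_le_square_iff[symmetric]) (simp add: abs_mult)
  have d: "?d = 1 / ?q i" "?q i \<noteq> 0" "?d' = 1 / ?q' i" "?q' i \<noteq> 0"
    using loo_scale_invcol[of ?N i x] K'.loo_scale_invcol[of ?N i x] i by auto
  have "?d' - ?d = ?d * ?d' * (?q i - ?q' i)"
    using d(2,4) unfolding d(1,3) by (simp add: field_simps)
  then have "\<bar>?d' - ?d\<bar> = ?d * ?d' * \<bar>?q' i - ?q i\<bar>"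
    using loo_scale_pos[of ?N x i] K'.loo_scale_pos[of ?N x i] by (simp add: abs_mult abs_minus_commute)
  also have "\<dots> \<le> (A + D) * (A + D) * (2 * q / C * arow x i)"
    using loo_scale_pos[of ?N x i] K'.loo_scale_pos[of ?N x i] loo_scale_le[of ?N x i] K'.loo_scale_le[of ?N x i] D A_pos \<delta>_pos
    by (intro mult_mono Q mult_nonneg_nonneg) auto
  finally show ?thesis by (simp add: power2_eq_square)
qed

text \<open>The changes \<open>e\<close> of the residuals have a square sum of order
  \<open>q\<close> times \<open>pd\<close>, the residuals themselves one of order \<open>pd\<close>.
  The choice \<open>s = sqrt q\<close> in \<open>abs_square_add_diff_le\<close> balances the two and
  leaves \<open>sqrt q\<close>.\<close>

lemma cvd_perturbed_le:
  "\<bar>K'.cvd n x y - cvd n x y\<bar> \<le> sqrt q * ((A + D)\<^sup>2 + 2 * (8 * (A + D)\<^sup>2 / C\<^sup>2 + 4 * (A + D) ^ 3 / C)) * (pd x y / n)"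
proof -
  let ?N = "{..<n}"
  let ?d = "loo_scale ?N x" and ?d' = "K'.loo_scale ?N x"
  let ?u = "solution ?N x y" and ?u' = "K'.solution ?N x y"
  define E where "E = A + D"
  define cb where "cb = 8 * E\<^sup>2 / C\<^sup>2 + 4 * E ^ 3 / C"
  have E: "0 < E" using A_pos \<delta>_pos D by (simp add: E_def)
  have cb: "0 \<le> cb" using E C_pos by (simp add: cb_def)
  have s: "0 < sqrt q" "sqrt q * sqrt q = q" using q by auto
  have d: "0 < ?d i" "?d i \<le> E" "0 < ?d' i" "?d' i \<le> E" for i
    using loo_scale_pos[of ?N x i] K'.loo_scale_pos[of ?N x i] loo_scale_le[of ?N x i] K'.loo_scale_le[of ?N x i] D
    by (auto simp: E_def)
  define e where "e i = ?d' i * ?u' i - ?d i * ?u i" for i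
  have e2: "(e i)\<^sup>2 \<le> 2 * E\<^sup>2 * (?u' i - ?u i)\<^sup>2 + 2 * E * (E\<^sup>2 * (2 * q / C * arow x i)) * (?u i)\<^sup>2" if i: "i < n" for i
  proof -
    have "(e i)\<^sup>2 \<le> 2 * (?d' i * (?u' i - ?u i))\<^sup>2 + 2 * ((?d' i - ?d i) * ?u i)\<^sup>2"
    proof -
      have "e i = ?d' i * (?u' i - ?u i) + (?d' i - ?d i) * ?u i" by (simp add: e_def algebra_simps)
      then show ?thesis by (simp only: square_add_le)
    qed
    also have "\<dots> = 2 * (?d' i)\<^sup>2 * (?u' i - ?u i)\<^sup>2 + 2 * (?d' i - ?d i)\<^sup>2 * (?u i)\<^sup>2" by (simp add: power_mult_distrib)
    also have "\<dots> \<le> 2 * E\<^sup>2 * (?u' i - ?u i)\<^sup>2 + 2 * (E * (E\<^sup>2 * (2 * q / C * arow x i))) * (?u i)\<^sup>2"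
    proof (intro add_mono mult_right_mono mult_left_mono power_mono)
      \<comment> \<open>One of the two factors is bounded crudely by \<open>E\<close>, so that
        \<open>arow\<close> appears to the first power, as in \<open>pd\<close>.\<close>
      have "\<bar>?d' i - ?d i\<bar> \<le> E" using d[of i] by linarith
      then have "\<bar>?d' i - ?d i\<bar> * \<bar>?d' i - ?d i\<bar> \<le> E * (E\<^sup>2 * (2 * q / C * arow x i))"
        using loo_scale_perturbed_le[OF i, of x] E by (intro mult_mono) (auto simp: E_def)
      then show "(?d' i - ?d i)\<^sup>2 \<le> E * (E\<^sup>2 * (2 * q / C * arow x i))" by (simp add: power2_eq_square)
    qed (use d[of i] in auto)
    finally show ?thesis by (simp add: mult.assoc)
  qed
  have "(\<Sum>i<n. (e i)\<^sup>2) \<le> (\<Sum>i<n. 2 * E\<^sup>2 * (?u' i - ?u i)\<^sup>2 + 2 * E * (E\<^sup>2 * (2 * q / C * arow x i)) * (?u i)\<^sup>2)"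
    by (intro sum_mono e2) auto
  also have "\<dots> = 2 * E\<^sup>2 * (\<Sum>i<n. (?u' i - ?u i)\<^sup>2) + 4 * E ^ 3 * q / C * (\<Sum>i<n. arow x i * (?u i)\<^sup>2)"
    by (simp add: sum.distrib sum_distrib_left power2_eq_square power3_eq_cube mult_ac)
  also have "\<dots> \<le> 2 * E\<^sup>2 * (4 * q\<^sup>2 / C\<^sup>2 * pd x y) + 4 * E ^ 3 * q / C * pd x y"
    using E q C_pos by (intro add_mono mult_left_mono solution_perturbed_le sum_arow_solution_le) auto
  also have "\<dots> \<le> 2 * E\<^sup>2 * (4 * q / C\<^sup>2 * pd x y) + 4 * E ^ 3 * q / C * pd x y"
  proof -
    have "q\<^sup>2 \<le> q" using q by (simp add: power2_eq_square mult_left_le)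
    then show ?thesis
      using pd_nonneg[of x y] by (intro add_right_mono mult_left_mono mult_right_mono divide_right_mono) auto
  qed
  also have "\<dots> = q * cb * pd x y" by (simp add: cb_def algebra_simps)
  finally have se: "(\<Sum>i<n. (e i)\<^sup>2) \<le> q * cb * pd x y" .
  have "\<bar>K'.cvd n x y - cvd n x y\<bar> = \<bar>\<Sum>i<n. (?d i * ?u i + e i)\<^sup>2 - (?d i * ?u i)\<^sup>2\<bar> / n"
    by (simp add: K'.cvd_def cvd_def e_def sum_subtractf diff_divide_distrib[symmetric] power_mult_distrib)
  also have "\<dots> \<le> (\<Sum>i<n. sqrt q * (?d i * ?u i)\<^sup>2 + (1 + 1 / sqrt q) * (e i)\<^sup>2) / n"
    by (intro divide_right_mono order_trans[OF sum_abs] sum_mono abs_square_add_diff_le s) auto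
  also have "\<dots> = (sqrt q * (\<Sum>i<n. (?d i * ?u i)\<^sup>2) + (1 + 1 / sqrt q) * (\<Sum>i<n. (e i)\<^sup>2)) / n"
    by (simp only: sum.distrib sum_distrib_left)
  also have "\<dots> \<le> (sqrt q * (E\<^sup>2 * pd x y) + (1 + 1 / sqrt q) * (q * cb * pd x y)) / n"
  proof (intro divide_right_mono add_mono mult_left_mono se)
    have "(\<Sum>i<n. (?d i * ?u i)\<^sup>2) \<le> (\<Sum>i<n. E\<^sup>2 * (?u i)\<^sup>2)"
      unfolding power_mult_distrib using d by (intro sum_mono mult_right_mono power_mono) (auto intro: less_imp_le)
    also have "\<dots> \<le> E\<^sup>2 * pd x y"
      unfolding sum_distrib_left[symmetric] by (intro mult_left_mono sum_solution_le) simp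
    finally show "(\<Sum>i<n. (?d i * ?u i)\<^sup>2) \<le> E\<^sup>2 * pd x y" .
  qed (use s in auto)
  also have "\<dots> \<le> (sqrt q * (E\<^sup>2 * pd x y) + (2 * sqrt q) * (cb * pd x y)) / n"
  proof -
    have "sqrt q \<le> 1" using q by simp
    then have "1 + 1 / sqrt q \<le> 2 / sqrt q" by (rule one_add_inverse_le[OF s(1)])
    then have "(1 + 1 / sqrt q) * q \<le> 2 / sqrt q * q" using q by (intro mult_right_mono) auto
    also have "2 / sqrt q * q = 2 * (q / sqrt q)" by simp
    also have "q / sqrt q = sqrt q" using q by (intro real_div_sqrt) simp
    finally have "(1 + 1 / sqrt q) * q * (cb * pd x y) \<le> 2 * sqrt q * (cb * pd x y)"
      using cb pd_nonneg[of x y] by (intro mult_right_mono) auto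
    then show ?thesis by (intro divide_right_mono add_left_mono) (simp_all add: mult.assoc)
  qed
  also have "\<dots> = sqrt q * (E\<^sup>2 + 2 * cb) * (pd x y / n)" by (simp add: algebra_simps add_divide_distrib)
  finally show ?thesis by (simp only: E_def cb_def)
qed

text \<open>The predictor changes by the difference of the kernels applied to the old solution plus
  the new kernel applied to the change of the solution. Decay and the convolution bound treat the
  first part. The second is a prediction function of the new model with small data, so the Hilbert
  space bound for \<open>k'\<close> applies.\<close>

lemma isped_perturbed_le:
  assumes f: "f \<in> borel_measurable borel" "integrable (unif n) (\<lambda>t. (f t)\<^sup>2)"
  shows "\<bar>K'.isped n x y f - isped n x y f\<bar> \<le> sqrt q * (isped n x y f + 2 * (2 * cc + 8 * \<kappa> / C) * (pd x y / n))"
proof -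
  let ?N = "{..<n}" and ?u = "solution {..<n} x y" and ?u' = "K'.solution {..<n} x y"
  define b where "b i = (\<Sum>j<n. (R x i j - K'.R x i j) * ?u j)" for i
  define w where "w t = K'.predd n x y t - predd n x y t" for t
  define ce where "ce = 2 * cc + 8 * \<kappa> / C"
  have ce: "0 \<le> ce" using cc_nonneg \<kappa>_nonneg C_pos by (simp add: ce_def)
  have s: "0 < sqrt q" "sqrt q * sqrt q = q" using q by auto
  let ?g1 = "\<lambda>t. \<Sum>j<n. decay (t - x j) * (q * \<bar>?u j\<bar>)"
  let ?g2 = "\<lambda>t. \<Sum>j<n. k' (t - x j) * K'.solution ?N x b j"
  have "?u' j - ?u j = K'.solution ?N x b j" if "j < n" for j
    unfolding b_def using that
    by (intro K'.solution_eqI[symmetric] solves_perturbed[OF solves_solution K'.solves_solution]) auto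
  then have w_eq: "w t = (\<Sum>j<n. (k' (t - x j) - k (t - x j)) * ?u j) + ?g2 t" for t
    unfolding w_def K'.predd_def predd_def sum_subtractf[symmetric] sum.distrib[symmetric]
    by (intro sum.cong refl) (simp add: algebra_simps flip: \<open>\<And>j. j < n \<Longrightarrow> ?u' j - ?u j = K'.solution ?N x b j\<close>)
  have w2: "(w t)\<^sup>2 \<le> 2 * (?g1 t)\<^sup>2 + 2 * (?g2 t)\<^sup>2" for t
  proof -
    have "\<bar>\<Sum>j<n. (k' (t - x j) - k (t - x j)) * ?u j\<bar> \<le> (\<Sum>j<n. (q * decay (t - x j)) * \<bar>?u j\<bar>)"
      using dk by (intro order_trans[OF sum_abs] sum_mono) (auto simp: abs_mult abs_minus_commute intro!: mult_right_mono)
    also have "\<dots> = ?g1 t" by (simp add: mult_ac)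
    finally have "\<bar>\<Sum>j<n. (k' (t - x j) - k (t - x j)) * ?u j\<bar> \<le> ?g1 t" .
    from power_mono[OF this, of 2] have "(\<Sum>j<n. (k' (t - x j) - k (t - x j)) * ?u j)\<^sup>2 \<le> (?g1 t)\<^sup>2" by simp
    moreover have "(w t)\<^sup>2 \<le> 2 * (\<Sum>j<n. (k' (t - x j) - k (t - x j)) * ?u j)\<^sup>2 + 2 * (?g2 t)\<^sup>2"
      unfolding w_eq using square_diff_le[of "\<Sum>j<n. (k' (t - x j) - k (t - x j)) * ?u j" "- ?g2 t"] by simp
    ultimately show ?thesis by linarith
  qed
  have i1: "integrable (unif n) (\<lambda>t. (?g1 t)\<^sup>2)"
  proof (rule integrable_unif[OF n_pos, of _ "(\<Sum>j<n. 1 * (q * \<bar>?u j\<bar>))\<^sup>2"])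
    fix t
    have "?g1 t \<le> (\<Sum>j<n. 1 * (q * \<bar>?u j\<bar>))" using q by (intro sum_mono mult_right_mono decay_le_1) auto
    moreover have "0 \<le> ?g1 t" using q by (intro sum_nonneg) auto
    ultimately show "\<bar>(?g1 t)\<^sup>2\<bar> \<le> (\<Sum>j<n. 1 * (q * \<bar>?u j\<bar>))\<^sup>2" using power_mono by fastforce
  qed measurable
  have i2: "integrable (unif n) (\<lambda>t. (?g2 t)\<^sup>2)"
  proof -
    have "integrable (unif n) (\<lambda>t. (0 - K'.predd n x b t)\<^sup>2)"
      by (rule K'.integrable_resid_square[OF n_pos]) auto
    then show ?thesis by (simp add: K'.predd_def)
  qed
  have w_meas [measurable]: "w \<in> borel_measurable borel" unfolding w_def[abs_def] by measurable
  have iw: "integrable (unif n) (\<lambda>t. (w t)\<^sup>2)"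
    by (rule Bochner_Integration.integrable_bound[of _ "\<lambda>t. 2 * (?g1 t)\<^sup>2 + 2 * (?g2 t)\<^sup>2"])
       (use i1 i2 w2 in \<open>auto intro!: AE_I2\<close>)
  have "(\<integral>t. (w t)\<^sup>2 \<partial>unif n) \<le> (\<integral>t. 2 * (?g1 t)\<^sup>2 + 2 * (?g2 t)\<^sup>2 \<partial>unif n)"
    using i1 i2 iw by (intro integral_mono w2) auto
  also have "\<dots> = 2 * (\<integral>t. (?g1 t)\<^sup>2 \<partial>unif n) + 2 * (\<integral>t. (?g2 t)\<^sup>2 \<partial>unif n)"
    using i1 i2 by simp
  also have "(\<integral>t. (?g1 t)\<^sup>2 \<partial>unif n) \<le> cc / n * (\<Sum>j<n. (q * \<bar>?u j\<bar>)\<^sup>2 * nr x j)"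
    by (rule integral_decay_sum_square_le) simp
  also have "(\<integral>t. (?g2 t)\<^sup>2 \<partial>unif n) \<le> \<kappa> / (C * n) * (\<Sum>j<n. (b j)\<^sup>2)"
    using K'.integral_prediction_square_le[OF n_pos, of "{..<n}" x b] by (simp add: K'.\<kappa>_def \<kappa>_def)
  also have "(\<Sum>j<n. (q * \<bar>?u j\<bar>)\<^sup>2 * nr x j) \<le> q\<^sup>2 * pd x y"
  proof -
    have "(\<Sum>j<n. (q * \<bar>?u j\<bar>)\<^sup>2 * nr x j) \<le> (\<Sum>j<n. q\<^sup>2 * ((?u j)\<^sup>2 * gsum x j))"
      by (intro sum_mono) (simp add: power_mult_distrib mult.assoc mult_left_mono nr_le_gsum)
    also have "\<dots> \<le> q\<^sup>2 * pd x y"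
      unfolding sum_distrib_left[symmetric] by (intro mult_left_mono sum_gsum_solution_le) simp
    finally show ?thesis .
  qed
  also have "(\<Sum>j<n. (b j)\<^sup>2) \<le> (2 * q)\<^sup>2 * pd x y"
    unfolding b_def by (rule perturbation_rhs_solution_le)
  finally have "(\<integral>t. (w t)\<^sup>2 \<partial>unif n) \<le> 2 * (cc / n * (q\<^sup>2 * pd x y)) + 2 * (\<kappa> / (C * n) * ((2 * q)\<^sup>2 * pd x y))"
    using cc_nonneg \<kappa>_nonneg C_pos by (simp add: mult_left_mono divide_right_mono)
  also have "\<dots> = q\<^sup>2 * ce * (pd x y / n)"
    using C_pos n_pos by (simp add: ce_def power_mult_distrib field_simps)
  finally have Ew: "(\<integral>t. (w t)\<^sup>2 \<partial>unif n) \<le> q\<^sup>2 * ce * (pd x y / n)" .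
  let ?e = "\<lambda>t. f t - predd n x y t"
  have ie: "integrable (unif n) (\<lambda>t. (?e t)\<^sup>2)" "integrable (unif n) (\<lambda>t. (f t - K'.predd n x y t)\<^sup>2)"
    by (intro integrable_resid_square K'.integrable_resid_square n_pos f)+
  have "\<bar>K'.isped n x y f - isped n x y f\<bar> = \<bar>\<integral>t. (?e t + - w t)\<^sup>2 - (?e t)\<^sup>2 \<partial>unif n\<bar>"
    unfolding K'.isped_def isped_def using ie by (simp add: w_def)
  also have "\<dots> \<le> (\<integral>t. sqrt q * (?e t)\<^sup>2 + (1 + 1 / sqrt q) * (- w t)\<^sup>2 \<partial>unif n)"
  proof (intro order_trans[OF integral_abs_bound] integral_mono abs_square_add_diff_le s)
    show "integrable (unif n) (\<lambda>t. \<bar>(?e t + - w t)\<^sup>2 - (?e t)\<^sup>2\<bar>)"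
      using ie by (intro integrable_abs) (simp add: w_def)
  qed (use ie iw in auto)
  also have "\<dots> = sqrt q * isped n x y f + (1 + 1 / sqrt q) * (\<integral>t. (w t)\<^sup>2 \<partial>unif n)"
    using ie iw by (simp add: isped_def)
  also have "\<dots> \<le> sqrt q * isped n x y f + (1 + 1 / sqrt q) * (q\<^sup>2 * ce * (pd x y / n))"
    using s by (intro add_left_mono mult_left_mono Ew) auto
  also have "\<dots> \<le> sqrt q * isped n x y f + 2 * sqrt q * (ce * (pd x y / n))"
  proof -
    have "sqrt q \<le> 1" using q by simp
    then have "1 + 1 / sqrt q \<le> 2 / sqrt q" by (rule one_add_inverse_le[OF s(1)])
    then have "(1 + 1 / sqrt q) * q\<^sup>2 \<le> 2 / sqrt q * q\<^sup>2" using q by (intro mult_right_mono) auto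
    also have "\<dots> \<le> 2 / sqrt q * q" using q by (intro mult_left_mono) (auto simp: power2_eq_square mult_left_le)
    also have "2 / sqrt q * q = 2 * (q / sqrt q)" by simp
    also have "q / sqrt q = sqrt q" using q by (intro real_div_sqrt) simp
    finally have "(1 + 1 / sqrt q) * q\<^sup>2 * (ce * (pd x y / n)) \<le> 2 * sqrt q * (ce * (pd x y / n))"
      using ce pd_nonneg[of x y] by (intro mult_right_mono) auto
    then show ?thesis by (simp add: mult.assoc)
  qed
  finally show ?thesis by (simp add: ce_def algebra_simps)
qed

end

end

section \<open>Lipschitz dependence on the parameter\<close>

text \<open>\<open>partial_deriv\<close> differentiates at 0 along a line through the current point.
  Shifting the variable by \<open>s0\<close> turns these into derivatives of one function on the
  interval \<open>T\<close>, to which the mean value bound applies; at the end points they are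
  one-sided.\<close>

lemma box_lipschitz_direction:
  fixes f :: "real^'p::finite \<Rightarrow> real"
  assumes \<Theta>: "\<Theta> = cbox a b"
    and diff: "\<And>j \<theta>. \<theta> \<in> \<Theta> \<Longrightarrow> (\<lambda>s. f (\<theta> + s *\<^sub>R axis j 1)) differentiable (at 0 within {s. \<theta> + s *\<^sub>R axis j 1 \<in> \<Theta>})"
    and bd: "\<And>j \<theta>. \<theta> \<in> \<Theta> \<Longrightarrow> \<bar>partial_deriv \<Theta> j f \<theta>\<bar> \<le> B"
    and m: "m \<in> \<Theta>" "m + d *\<^sub>R axis j 1 \<in> \<Theta>"
  shows "\<bar>f (m + d *\<^sub>R axis j 1) - f m\<bar> \<le> B * \<bar>d\<bar>"
proof -
  let ?e = "axis j 1 :: real^'p"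
  define T where "T = {s. m + s *\<^sub>R ?e \<in> \<Theta>}"
  have T: "T = {vec_nth a j - vec_nth m j .. vec_nth b j - vec_nth m j}"
  proof (rule Set.set_eqI)
    fix s
    have "m + s *\<^sub>R ?e \<in> \<Theta> \<longleftrightarrow> (\<forall>i. vec_nth a i \<le> vec_nth m i + s * (if i = j then 1 else 0) \<and> vec_nth m i + s * (if i = j then 1 else 0) \<le> vec_nth b i)"
      unfolding \<Theta> mem_box_cart by (simp add: axis_def)
    also have "\<dots> \<longleftrightarrow> vec_nth a j \<le> vec_nth m j + s \<and> vec_nth m j + s \<le> vec_nth b j"
      using m(1) unfolding \<Theta> mem_box_cart by auto
    finally show "s \<in> T \<longleftrightarrow> s \<in> {vec_nth a j - vec_nth m j .. vec_nth b j - vec_nth m j}"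
      by (auto simp: T_def)
  qed
  define g where "g s = f (m + s *\<^sub>R ?e)" for s
  have "norm (g d - g 0) \<le> B * norm (d - 0)"
  proof (rule field_differentiable_bound)
    show "convex T" unfolding T by (rule convex_real_interval)
    fix s0 assume s0: "s0 \<in> T"
    let ?p = "m + s0 *\<^sub>R ?e"
    have p: "?p \<in> \<Theta>" using s0 by (simp add: T_def)
    have "((\<lambda>s. f (?p + s *\<^sub>R ?e)) has_vector_derivative partial_deriv \<Theta> j f ?p) (at 0 within {s. ?p + s *\<^sub>R ?e \<in> \<Theta>})"
      using diff[OF p, of j] unfolding partial_deriv_def by (simp add: vector_derivative_works)
    moreover have "(\<lambda>s. s - s0) ` T \<subseteq> {s. ?p + s *\<^sub>R ?e \<in> \<Theta>}"
      by (auto simp: T_def algebra_simps)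
    ultimately have "((\<lambda>s. f (?p + s *\<^sub>R ?e)) has_vector_derivative partial_deriv \<Theta> j f ?p) (at (s0 - s0) within (\<lambda>s. s - s0) ` T)"
      by (simp add: has_vector_derivative_within_subset)
    moreover have "((\<lambda>s. s - s0) has_vector_derivative 1) (at s0 within T)"
      by (auto intro!: derivative_eq_intros)
    ultimately have "((\<lambda>s. f (?p + s *\<^sub>R ?e)) \<circ> (\<lambda>s. s - s0) has_vector_derivative (1 *\<^sub>R partial_deriv \<Theta> j f ?p)) (at s0 within T)"
      by (intro vector_diff_chain_within)
    moreover have "(\<lambda>s. f (?p + s *\<^sub>R ?e)) \<circ> (\<lambda>s. s - s0) = g"
      by (auto simp: g_def algebra_simps)
    ultimately show "(g has_field_derivative partial_deriv \<Theta> j f ?p) (at s0 within T)"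
      by (simp add: has_real_derivative_iff_has_vector_derivative)
    show "norm (partial_deriv \<Theta> j f ?p) \<le> B" using bd[OF p] by simp
  next
    show "d \<in> T" "0 \<in> T" using m by (auto simp: T_def)
  qed
  then show ?thesis by (simp add: g_def)
qed

text \<open>Replace the coordinates of \<open>x\<close> by those of \<open>y\<close> one at a time.
  In a box all intermediate points \<open>mix S\<close> stay inside.\<close>

lemma box_lipschitz:
  fixes f :: "real^'p::finite \<Rightarrow> real"
  assumes \<Theta>: "\<Theta> = cbox a b"
    and diff: "\<And>j \<theta>. \<theta> \<in> \<Theta> \<Longrightarrow> (\<lambda>s. f (\<theta> + s *\<^sub>R axis j 1)) differentiable (at 0 within {s. \<theta> + s *\<^sub>R axis j 1 \<in> \<Theta>})"
    and bd: "\<And>j \<theta>. \<theta> \<in> \<Theta> \<Longrightarrow> \<bar>partial_deriv \<Theta> j f \<theta>\<bar> \<le> B"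
    and xy: "x \<in> \<Theta>" "y \<in> \<Theta>"
  shows "\<bar>f y - f x\<bar> \<le> B * CARD('p) * dist x y"
proof -
  define mix where "mix S = (\<chi> j. if j \<in> S then vec_nth y j else vec_nth x j)" for S
  have mix: "mix S \<in> \<Theta>" for S
    using xy unfolding \<Theta> mem_box_cart by (simp add: mix_def)
  have B: "0 \<le> B" using bd[OF xy(1), of undefined] by linarith
  have "\<bar>f (mix S) - f x\<bar> \<le> (\<Sum>j\<in>S. B * dist x y)" if "finite S" for S
    using that
  proof (induction S rule: finite_induct)
    case empty
    have "mix {} = x" by (simp add: mix_def Finite_Cartesian_Product.vec_eq_iff)
    then show ?case by simp
  next
    case (insert j S)
    let ?d = "vec_nth y j - vec_nth x j"
    have step: "mix (insert j S) = mix S + ?d *\<^sub>R axis j 1"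
      using insert(2) by (auto simp: mix_def Finite_Cartesian_Product.vec_eq_iff axis_def)
    have "\<bar>f (mix (insert j S)) - f (mix S)\<bar> \<le> B * \<bar>?d\<bar>"
      unfolding step by (rule box_lipschitz_direction[OF \<Theta> diff bd mix]) (use mix[of "insert j S"] step in auto)
    also have "\<dots> \<le> B * dist x y"
      using B component_le_norm_cart[of "y - x" j] by (intro mult_left_mono) (auto simp: dist_norm norm_minus_commute)
    finally show ?case using insert by (simp add: algebra_simps)
  qed
  from this[of UNIV] have "\<bar>f (mix UNIV) - f x\<bar> \<le> CARD('p) * (B * dist x y)" by simp
  moreover have "mix UNIV = y" by (simp add: mix_def Finite_Cartesian_Product.vec_eq_iff)
  ultimately show ?thesis by (simp add: mult_ac)
qed

lemma coordinates_props: "distinct (coordinates :: 'p::finite list)" "set (coordinates :: 'p list) = UNIV"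
proof -
  have "\<exists>js :: 'p list. distinct js \<and> set js = UNIV" using finite_distinct_list[OF finite[of "UNIV::'p set"]] by blast
  from someI_ex[OF this] show "distinct (coordinates :: 'p::finite list)" "set (coordinates :: 'p list) = UNIV"
    by (auto simp: coordinates_def)
qed

lemma multi_partial_0: "multi_partial S (\<lambda>_. 0) f = f"
proof -
  have "foldr (\<lambda>j. partial_deriv S j ^^ 0) js f = f" for js by (induction js) auto
  then show ?thesis by (simp add: multi_partial_def)
qed

lemma multi_partial_single: "multi_partial S (\<lambda>i. if i = j then 1 else 0) f = partial_deriv S j f"
proof -
  have "foldr (\<lambda>i. partial_deriv S i ^^ (if i = j then 1 else 0)) js f = (if j \<in> set js then partial_deriv S j f else f)"
    if "distinct js" for js
    using that by (induction js) auto
  then show ?thesis by (simp add: multi_partial_def coordinates_props)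
qed

section \<open>The sequence of experiments\<close>

context krig
begin

lemma loo_scale_cong:
  assumes "finite I" "\<And>j. j \<in> I \<Longrightarrow> x j = x' j" "i \<in> I"
  shows "loo_scale I x i = loo_scale I x' i"
proof -
  have "weight (I - {i}) x (x i) j = weight (I - {i}) x' (x' i) j" if "j \<in> I - {i}" for j
    unfolding weight_def using assms that by (intro solution_cong) auto
  then show ?thesis using assms by (auto simp: loo_scale_def intro!: sum.cong)
qed

lemma cvd_cong:
  assumes "\<And>j. j < n \<Longrightarrow> x j = x' j" "\<And>j. j < n \<Longrightarrow> y j = y' j"
  shows "cvd n x y = cvd n x' y'"
  unfolding cvd_def
  by (intro arg_cong2[where f="(/)"] sum.cong refl arg_cong2[where f="(*)"] arg_cong[where f="\<lambda>z. z\<^sup>2"] loo_scale_cong solution_cong)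
     (use assms in auto)

lemma predd_cong:
  assumes "\<And>j. j < n \<Longrightarrow> x j = x' j" "\<And>j. j < n \<Longrightarrow> y j = y' j"
  shows "predd n x y t = predd n x' y' t"
  unfolding predd_def by (intro sum.cong refl arg_cong2[where f="(*)"] solution_cong) (use assms in auto)

lemma borel_measurable_loo_scale:
  assumes I: "finite I" "i \<in> I" and x: "\<And>j. j \<in> I \<Longrightarrow> (\<lambda>\<omega>. x \<omega> j) \<in> borel_measurable N"
  shows "(\<lambda>\<omega>. loo_scale I (x \<omega>) i) \<in> borel_measurable N"
  unfolding loo_scale_def weight_def
  by (intro borel_measurable_diff borel_measurable_const borel_measurable_sum borel_measurable_times borel_measurable_solution
      measurable_compose[OF _ k_measurable] x) (use I in auto)

lemma borel_measurable_cvd: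
  assumes "\<And>j. j < n \<Longrightarrow> (\<lambda>\<omega>. x \<omega> j) \<in> borel_measurable N" "\<And>j. j < n \<Longrightarrow> (\<lambda>\<omega>. y \<omega> j) \<in> borel_measurable N"
  shows "(\<lambda>\<omega>. cvd n (x \<omega>) (y \<omega>)) \<in> borel_measurable N"
  unfolding cvd_def
  by (intro borel_measurable_divide borel_measurable_const borel_measurable_sum borel_measurable_times borel_measurable_power
      borel_measurable_solution borel_measurable_loo_scale) (use assms in auto)

end

text \<open>The quantity \<open>psum\<close> freed from the model locale: it depends on the design
  only, so one exceptional event serves all parameters.\<close>

definition crowding :: "nat \<Rightarrow> (nat \<Rightarrow> real^'d::finite) \<Rightarrow> real" where
  "crowding n x = (\<Sum>i<n. exp (\<Sum>j<n. decay (x i - x j)))"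

locale experiments = prob_space M
  for M :: "'w measure" +
  fixes Y :: "real^'d::finite \<Rightarrow> 'w \<Rightarrow> real" and X :: "nat \<Rightarrow> nat \<Rightarrow> 'w \<Rightarrow> real^'d"
    and \<epsilon> :: "nat \<Rightarrow> nat \<Rightarrow> 'w \<Rightarrow> real" and K\<^sub>0 :: "real^'d \<Rightarrow> real" and \<delta>\<^sub>0 C\<^sub>0 :: real
    and \<Theta> :: "(real^'p::finite) set" and K :: "real^'p \<Rightarrow> real^'d \<Rightarrow> real" and \<delta> :: "real^'p \<Rightarrow> real"
    and Cinf A D L :: real
  assumes Y_gauss: "centered_gaussian M UNIV Y (\<lambda>s t. K\<^sub>0 (s - t))"
    and Y_meas: "measurable_process M Y"
    and \<delta>0_nonneg: "0 \<le> \<delta>\<^sub>0"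
    and eps_gauss: "0 < n \<Longrightarrow> centered_gaussian M {..<n} (\<epsilon> n) (\<lambda>i j. if i = j then \<delta>\<^sub>0 else 0)"
    and X_indep: "0 < n \<Longrightarrow> indep_vars (\<lambda>i. borel) (X n) {..<n}"
    and X_distr: "i < n \<Longrightarrow> distr M borel (X n i) = uniform_measure lborel (obs_domain n)"
    and all_indep: "0 < n \<Longrightarrow> indep_sets
        (\<lambda>l. [sets (generated M UNIV Y), sets (generated M {..<n} (X n)), sets (generated M {..<n} (\<epsilon> n))] ! l) {..<3}"
    and K0_bound: "\<bar>K\<^sub>0 t\<bar> \<le> C\<^sub>0 * decay t"
    and \<Theta>_compact: "compact \<Theta>"
    and K_krig: "\<theta> \<in> \<Theta> \<Longrightarrow> krig (K \<theta>) A Cinf (\<delta> \<theta>)"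
    and K_lip: "\<theta> \<in> \<Theta> \<Longrightarrow> \<theta>' \<in> \<Theta> \<Longrightarrow> \<bar>K \<theta> t - K \<theta>' t\<bar> \<le> L * dist \<theta> \<theta>' * decay t"
    and \<delta>_lip: "\<theta> \<in> \<Theta> \<Longrightarrow> \<theta>' \<in> \<Theta> \<Longrightarrow> \<bar>\<delta> \<theta> - \<delta> \<theta>'\<bar> \<le> L * dist \<theta> \<theta>'"
    and \<delta>_le: "\<theta> \<in> \<Theta> \<Longrightarrow> \<delta> \<theta> \<le> D"
    and L_pos: "0 < L"
begin

section \<open>Independence of the design from process and noise\<close>

definition Xv :: "nat \<Rightarrow> 'w \<Rightarrow> nat \<Rightarrow> real^'d" where
  "Xv n \<omega> = (\<lambda>i\<in>{..<n}. X n i \<omega>)"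

lemma X_borel: "i < n \<Longrightarrow> X n i \<in> borel_measurable M"
  using X_indep[of n] by (auto simp: indep_vars_def)

lemma Xv_measurable: "Xv n \<in> measurable M (Pi\<^sub>M {..<n} (\<lambda>_. borel))"
  unfolding Xv_def[abs_def] by (rule measurable_restrict) (auto intro: X_borel)

lemma Y_eps_indep:
  assumes n: "0 < n"
  shows "indep_set (sets (generated M UNIV Y)) (sets (generated M {..<n} (\<epsilon> n)))"
proof -
  let ?F = "\<lambda>l. [sets (generated M UNIV Y), sets (generated M {..<n} (X n)), sets (generated M {..<n} (\<epsilon> n))] ! l"
  show ?thesis
  proof (rule indep_setI)
    have ev: "?F l \<subseteq> events" if "l \<in> {..<3}" for l
      using all_indep[OF n] that unfolding indep_sets_def by blast
    show "sets (generated M UNIV Y) \<subseteq> events" using ev[of 0] by simp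
    show "sets (generated M {..<n} (\<epsilon> n)) \<subseteq> events" using ev[of 2] by simp
    fix a b assume ab: "a \<in> sets (generated M UNIV Y)" "b \<in> sets (generated M {..<n} (\<epsilon> n))"
    have "prob (\<Inter>l\<in>{0, 2::nat}. if l = 0 then a else b) = (\<Prod>l\<in>{0, 2}. prob (if l = (0::nat) then a else b))"
      by (rule indep_setsD[OF all_indep[OF n]]) (use ab in auto)
    then show "prob (a \<inter> b) = prob a * prob b" by (simp add: Int_commute)
  qed
qed

lemma model:
  assumes "0 < n" "\<theta> \<in> \<Theta>"
  shows "model M Y K\<^sub>0 (\<epsilon> n) \<delta>\<^sub>0 C\<^sub>0 n (K \<theta>) A Cinf (\<delta> \<theta>)"
proof -
  have "observed M Y K\<^sub>0 (\<epsilon> n) \<delta>\<^sub>0 C\<^sub>0 n"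
    by unfold_locales (use assms Y_gauss Y_meas \<delta>0_nonneg eps_gauss Y_eps_indep K0_bound in auto)
  then show ?thesis using K_krig[OF assms(2)] by (simp add: model_def)
qed

text \<open>The identity on the sample space, observed through this algebra, is a random element
  independent of the design. A functional of the process and noise can thus be integrated by Fubini
  without naming a path space.\<close>

definition noise_alg :: "nat \<Rightarrow> 'w measure" where
  "noise_alg n = sigma (space M) (sets (generated M UNIV Y) \<union> sets (generated M {..<n} (\<epsilon> n)))"

lemma generated_subset_Pow: "sets (generated M I Z) \<subseteq> Pow (space M)"
proof -
  have "space (generated M I Z) = space M" unfolding generated_def by (rule space_measure_of) auto
  then show ?thesis using sets.space_closed[of "generated M I Z"] by simp
qed

lemma space_noise_alg [simp]: "space (noise_alg n) = space M"
  unfolding noise_alg_def by (rule space_measure_of) (intro Un_least generated_subset_Pow)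

lemma sets_noise_alg: "sets (noise_alg n) = sigma_sets (space M) (sets (generated M UNIV Y) \<union> sets (generated M {..<n} (\<epsilon> n)))"
  unfolding noise_alg_def by (rule sets_measure_of) (intro Un_least generated_subset_Pow)

lemma noise_alg_Y: "sets (generated M UNIV Y) \<subseteq> sets (noise_alg n)"
  by (auto simp: sets_noise_alg intro: sigma_sets.Basic)

lemma noise_alg_eps: "i < n \<Longrightarrow> \<epsilon> n i \<in> borel_measurable (noise_alg n)"
proof -
  assume i: "i < n"
  have "\<epsilon> n i -` B \<inter> space M \<in> sets (generated M {..<n} (\<epsilon> n))" if "B \<in> sets borel" for B
    unfolding generated_def using i that by (subst sets_measure_of) (auto intro!: sigma_sets.Basic)
  then show ?thesis by (intro measurableI) (auto simp: sets_noise_alg intro!: sigma_sets.Basic)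
qed

lemma noise_alg_subset: "0 < n \<Longrightarrow> sets (noise_alg n) \<subseteq> sets M"
proof -
  assume n: "0 < n"
  have "sets (generated M UNIV Y) \<subseteq> events" "sets (generated M {..<n} (\<epsilon> n)) \<subseteq> events"
    using Y_eps_indep[OF n] by (auto simp: indep_set_def indep_sets_def split: bool.splits)
  then show ?thesis unfolding sets_noise_alg by (intro sets.sigma_sets_subset) auto
qed

lemma noise_alg_id: "0 < n \<Longrightarrow> (\<lambda>\<omega>. \<omega>) \<in> measurable M (noise_alg n)"
  using noise_alg_subset[of n] sets.sets_into_space[of _ "noise_alg n"]
  by (intro measurableI) (auto simp: Int_absorb2)

text \<open>The design is independent of the pair of process and noise, not only of each. Mutual
  independence of three algebras gives this by grouping, and it is then verified on measurable
  rectangles.\<close>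

lemma Xv_noise_distr:
  assumes n: "0 < n"
  shows "distr M (Pi\<^sub>M {..<n} (\<lambda>_. borel)) (Xv n) \<Otimes>\<^sub>M distr M (noise_alg n) (\<lambda>\<omega>. \<omega>) =
    distr M (Pi\<^sub>M {..<n} (\<lambda>_. borel) \<Otimes>\<^sub>M noise_alg n) (\<lambda>\<omega>. (Xv n \<omega>, \<omega>))"
proof -
  let ?P = "Pi\<^sub>M {..<n} (\<lambda>_. borel) :: (nat \<Rightarrow> real^'d) measure" and ?N = "noise_alg n"
  let ?F = "\<lambda>l::nat. [sets (generated M UNIV Y), sets (generated M {..<n} (X n)), sets (generated M {..<n} (\<epsilon> n))] ! l"
  \<comment> \<open>The design has index 1; process and noise, 0 and 2, form the other
    group.\<close>
  define J where "J b = (if b then {1} else {0, 2::nat})" for b :: bool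
  have un: "(\<Union>b\<in>UNIV. J b) = {..<3}" by (auto simp: J_def UNIV_bool)
  have stable: "Int_stable (?F l)" if "l < 3" for l
  proof -
    have "l = 0 \<or> l = 1 \<or> l = 2" using that by linarith
    then show ?thesis by (auto simp: Int_stable_def)
  qed
  have ind: "indep_sets (\<lambda>b. sigma_sets (space M) (\<Union>l\<in>J b. ?F l)) UNIV"
  proof (rule indep_sets_collect_sigma)
    show "indep_sets ?F (\<Union>b\<in>UNIV. J b)" unfolding un by (rule all_indep[OF n])
    show "Int_stable (?F l)" if "b \<in> UNIV" "l \<in> J b" for b l
      by (rule stable) (use that in \<open>auto simp: J_def split: if_splits\<close>)
    show "disjoint_family_on J UNIV" by (auto simp: disjoint_family_on_def J_def)
  qed
  have prob_Int: "prob (a \<inter> b) = prob a * prob b"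
    if a: "a \<in> sets (generated M {..<n} (X n))" and b: "b \<in> sets ?N" for a b
  proof -
    have "prob (\<Inter>l\<in>UNIV. if l then a else b) = (\<Prod>l\<in>UNIV. prob (if l then a else b))"
      by (rule indep_setsD[OF ind])
         (use a b in \<open>auto simp: J_def sets_noise_alg intro: sigma_sets.Basic\<close>)
    then show ?thesis by (simp add: UNIV_bool Int_commute mult.commute)
  qed
  have gen: "space (generated M {..<n} (X n)) = space M"
    unfolding generated_def by (rule space_measure_of) auto
  have X_gen: "X n i \<in> borel_measurable (generated M {..<n} (X n))" if "i < n" for i
    unfolding generated_def using that
    by (intro measurableI) (auto simp: space_measure_of_conv sets_measure_of_conv intro!: sigma_sets.Basic)
  have Xv_gen: "Xv n \<in> measurable (generated M {..<n} (X n)) ?P"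
    unfolding Xv_def[abs_def] by (rule measurable_restrict) (auto intro: X_gen)
  note id = noise_alg_id[OF n]
  interpret P: prob_space "distr M ?P (Xv n)" by (rule prob_space_distr[OF Xv_measurable])
  interpret N: prob_space "distr M ?N (\<lambda>\<omega>. \<omega>)" by (rule prob_space_distr[OF id])
  show ?thesis
  proof (rule pair_measure_eqI)
    show "sigma_finite_measure (distr M ?P (Xv n))" "sigma_finite_measure (distr M ?N (\<lambda>\<omega>. \<omega>))"
      by unfold_locales
    show "sets (distr M ?P (Xv n) \<Otimes>\<^sub>M distr M ?N (\<lambda>\<omega>. \<omega>)) = sets (distr M (?P \<Otimes>\<^sub>M ?N) (\<lambda>\<omega>. (Xv n \<omega>, \<omega>)))"
      by (simp cong: sets_pair_measure_cong)
    fix a b assume "a \<in> sets (distr M ?P (Xv n))" "b \<in> sets (distr M ?N (\<lambda>\<omega>. \<omega>))"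
    then have a: "a \<in> sets ?P" and b: "b \<in> sets ?N" by auto
    have bM: "b \<in> events" "b \<subseteq> space M"
      using b noise_alg_subset[OF n] sets.sets_into_space[OF b] by auto
    have aX: "Xv n -` a \<inter> space M \<in> sets (generated M {..<n} (X n))"
      using measurable_sets[OF Xv_gen a] gen by simp
    have "emeasure (distr M (?P \<Otimes>\<^sub>M ?N) (\<lambda>\<omega>. (Xv n \<omega>, \<omega>))) (a \<times> b) =
        emeasure M ((\<lambda>\<omega>. (Xv n \<omega>, \<omega>)) -` (a \<times> b) \<inter> space M)"
      by (rule emeasure_distr) (use a b in \<open>auto intro!: measurable_Pair Xv_measurable id\<close>)
    also have "(\<lambda>\<omega>. (Xv n \<omega>, \<omega>)) -` (a \<times> b) \<inter> space M = (Xv n -` a \<inter> space M) \<inter> b"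
      using bM by auto
    finally show "emeasure (distr M ?P (Xv n)) a * emeasure (distr M ?N (\<lambda>\<omega>. \<omega>)) b =
        emeasure (distr M (?P \<Otimes>\<^sub>M ?N) (\<lambda>\<omega>. (Xv n \<omega>, \<omega>))) (a \<times> b)"
      using prob_Int[OF aX b] bM
      by (simp add: emeasure_distr[OF Xv_measurable a] emeasure_distr[OF id b] emeasure_eq_measure
          ennreal_mult' Int_absorb2)
  qed
qed

lemma Xv_distr:
  assumes n: "0 < n"
  shows "distr M (Pi\<^sub>M {..<n} (\<lambda>_. borel)) (Xv n) = design n"
proof -
  have "distr M (Pi\<^sub>M {..<n} (\<lambda>_. borel)) (\<lambda>\<omega>. \<lambda>i\<in>{..<n}. X n i \<omega>) = Pi\<^sub>M {..<n} (\<lambda>i. distr M borel (X n i))"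
    using indep_vars_iff_distr_eq_PiM'[of "{..<n}" "X n" "\<lambda>_. borel"] X_indep[OF n] X_borel n by auto
  also have "\<dots> = design n" by (rule PiM_cong) (auto simp: X_distr unif_def)
  finally show ?thesis by (simp add: Xv_def[abs_def])
qed

text \<open>Conditioning on the design as an iterated integral: inside, the design is frozen and
  \<open>\<omega>\<close> drives only process and noise. The estimates for a deterministic design
  enter the random experiment here.\<close>

lemma nn_integral_split:
  assumes n: "0 < n" and G: "(\<lambda>(x, \<omega>). G x \<omega>) \<in> borel_measurable (Pi\<^sub>M {..<n} (\<lambda>_. borel) \<Otimes>\<^sub>M noise_alg n)"
  shows "(\<integral>\<^sup>+\<omega>. G (Xv n \<omega>) \<omega> \<partial>M) = (\<integral>\<^sup>+x. (\<integral>\<^sup>+\<omega>. G x \<omega> \<partial>M) \<partial>design n)"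
proof -
  let ?P = "Pi\<^sub>M {..<n} (\<lambda>_. borel) :: (nat \<Rightarrow> real^'d) measure" and ?N = "noise_alg n"
  note id = noise_alg_id[OF n] and XN = Xv_noise_distr[OF n]
  interpret N: prob_space "distr M ?N (\<lambda>\<omega>. \<omega>)" by (rule prob_space_distr[OF id])
  have "(\<integral>\<^sup>+\<omega>. G (Xv n \<omega>) \<omega> \<partial>M) = (\<integral>\<^sup>+p. (case p of (x, \<omega>) \<Rightarrow> G x \<omega>) \<partial>distr M (?P \<Otimes>\<^sub>M ?N) (\<lambda>\<omega>. (Xv n \<omega>, \<omega>)))"
    using G by (subst nn_integral_distr) (auto intro!: measurable_Pair Xv_measurable id)
  also have "\<dots> = (\<integral>\<^sup>+p. (case p of (x, \<omega>) \<Rightarrow> G x \<omega>) \<partial>(distr M ?P (Xv n) \<Otimes>\<^sub>M distr M ?N (\<lambda>\<omega>. \<omega>)))"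
    by (simp only: XN)
  also have "\<dots> = (\<integral>\<^sup>+x. (\<integral>\<^sup>+\<omega>. G x \<omega> \<partial>distr M ?N (\<lambda>\<omega>. \<omega>)) \<partial>distr M ?P (Xv n))"
  proof -
    have "(\<lambda>p. case p of (x, \<omega>) \<Rightarrow> G x \<omega>) \<in> borel_measurable (distr M ?P (Xv n) \<Otimes>\<^sub>M distr M ?N (\<lambda>\<omega>. \<omega>))"
      using G by (simp cong: measurable_cong_sets)
    from N.nn_integral_fst[OF this] show ?thesis by simp
  qed
  also have "\<dots> = (\<integral>\<^sup>+x. (\<integral>\<^sup>+\<omega>. G x \<omega> \<partial>M) \<partial>design n)"
    unfolding Xv_distr[OF n]
  proof (intro nn_integral_cong)
    fix x assume "x \<in> space (design n :: (nat \<Rightarrow> real^'d) measure)"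
    then have "x \<in> space ?P" by (simp add: space_PiM)
    then have "(\<lambda>\<omega>. G x \<omega>) \<in> borel_measurable ?N" using measurable_Pair2[OF G] by simp
    then show "(\<integral>\<^sup>+\<omega>. G x \<omega> \<partial>distr M ?N (\<lambda>\<omega>. \<omega>)) = (\<integral>\<^sup>+\<omega>. G x \<omega> \<partial>M)"
      by (subst nn_integral_distr[OF id]) auto
  qed
  finally show ?thesis .
qed

end

section \<open>Uniform closeness of cross validation and prediction error\<close>

context krig
begin

lemma borel_measurable_crowding:
  assumes "\<And>j. j < n \<Longrightarrow> (\<lambda>\<omega>. x \<omega> j) \<in> borel_measurable N"
  shows "(\<lambda>\<omega>. crowding n (x \<omega>)) \<in> borel_measurable N"
  unfolding crowding_def
  by (intro borel_measurable_sum borel_measurable_exp[THEN measurable_compose[rotated]] measurable_compose[OF _ borel_measurable_decay]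
      borel_measurable_diff assms) auto

end

context model
begin

lemma borel_measurable_pd:
  assumes x: "\<And>j. j < n \<Longrightarrow> (\<lambda>\<omega>. x \<omega> j) \<in> borel_measurable N"
    and y: "\<And>j. j < n \<Longrightarrow> (\<lambda>\<omega>. y \<omega> j) \<in> borel_measurable N"
  shows "(\<lambda>\<omega>. pd (x \<omega>) (y \<omega>)) \<in> borel_measurable N"
  unfolding pd_def gsum_def arow_def invcol_def near_def
  by (intro borel_measurable_sum borel_measurable_add borel_measurable_times borel_measurable_power borel_measurable_sqrt[THEN measurable_compose[rotated]]
      borel_measurable_abs[THEN measurable_compose[rotated]]
      measurable_compose[OF _ borel_measurable_decay] borel_measurable_solution borel_measurable_diff borel_measurable_const)
     (auto intro: x y)

lemma cvd_le_pd: "cvd n x y \<le> (A + \<delta>)\<^sup>2 * (pd x y / n)"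
proof -
  have "(\<Sum>i<n. (loo_scale {..<n} x i)\<^sup>2 * (solution {..<n} x y i)\<^sup>2) \<le> (\<Sum>i<n. (A + \<delta>)\<^sup>2 * (solution {..<n} x y i)\<^sup>2)"
    by (intro sum_mono mult_right_mono power_mono loo_scale_le less_imp_le[OF loo_scale_pos]) auto
  also have "\<dots> \<le> (A + \<delta>)\<^sup>2 * pd x y"
    unfolding sum_distrib_left[symmetric] by (intro mult_left_mono sum_solution_le) simp
  finally show ?thesis unfolding cvd_def by (simp add: divide_right_mono)
qed

end

lemma (in prob_space) prob_gt_le:
  fixes f :: "'a \<Rightarrow> real"
  assumes [measurable]: "f \<in> borel_measurable M"
    and f: "(\<integral>\<^sup>+\<omega>. ennreal (f \<omega>) \<partial>M) \<le> ennreal b" and b: "0 \<le> b" and a: "0 < a"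
  shows "prob {\<omega> \<in> space M. a < f \<omega>} \<le> b / a"
proof -
  have "emeasure M {\<omega> \<in> space M. a < f \<omega>} \<le> emeasure M {\<omega> \<in> space M. 1 \<le> ennreal (1 / a) * ennreal (f \<omega>)}"
  proof (intro emeasure_mono subsetI)
    fix \<omega> assume "\<omega> \<in> {\<omega> \<in> space M. a < f \<omega>}"
    then have \<omega>: "\<omega> \<in> space M" and f: "a < f \<omega>" by auto
    have "ennreal 1 \<le> ennreal (1 / a * f \<omega>)" using a f by (intro ennreal_leI) (simp add: field_simps)
    also have "\<dots> = ennreal (1 / a) * ennreal (f \<omega>)" using a by (intro ennreal_mult') simp
    finally show "\<omega> \<in> {\<omega> \<in> space M. 1 \<le> ennreal (1 / a) * ennreal (f \<omega>)}" using \<omega> by simp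
  qed measurable
  also have "\<dots> \<le> ennreal (1 / a) * (\<integral>\<^sup>+\<omega>. ennreal (f \<omega>) * indicator (space M) \<omega> \<partial>M)"
    by (rule nn_integral_Markov_inequality) measurable
  also have "(\<integral>\<^sup>+\<omega>. ennreal (f \<omega>) * indicator (space M) \<omega> \<partial>M) = (\<integral>\<^sup>+\<omega>. ennreal (f \<omega>) \<partial>M)"
    by (intro nn_integral_cong) simp
  also have "ennreal (1 / a) * \<dots> \<le> ennreal (1 / a) * ennreal b" by (intro mult_left_mono f) simp
  also have "\<dots> = ennreal (b / a)" using a b by (simp flip: ennreal_mult')
  finally show ?thesis using a b by (simp add: emeasure_eq_measure)
qed

context experiments
begin

section \<open>The criteria at the random design\<close>

definition yv :: "nat \<Rightarrow> 'w \<Rightarrow> nat \<Rightarrow> real" where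
  "yv n \<omega> j = Y (Xv n \<omega> j) \<omega> + \<epsilon> n j \<omega>"

definition cvr :: "nat \<Rightarrow> real^'p \<Rightarrow> 'w \<Rightarrow> real" where
  "cvr n \<theta> \<omega> = krig.cvd (K \<theta>) (\<delta> \<theta>) n (Xv n \<omega>) (yv n \<omega>)"

definition isr :: "nat \<Rightarrow> real^'p \<Rightarrow> 'w \<Rightarrow> real" where
  "isr n \<theta> \<omega> = krig.isped (K \<theta>) (\<delta> \<theta>) n (Xv n \<omega>) (yv n \<omega>) (\<lambda>t. Y t \<omega>)"

definition gap :: "nat \<Rightarrow> real^'p \<Rightarrow> 'w \<Rightarrow> real" where
  "gap n \<theta> \<omega> = cvr n \<theta> \<omega> - \<delta>\<^sub>0 - isr n \<theta> \<omega>"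

definition pdr :: "nat \<Rightarrow> real^'p \<Rightarrow> 'w \<Rightarrow> real" where
  "pdr n \<theta> \<omega> = model.pd n (K \<theta>) (\<delta> \<theta>) (Xv n \<omega>) (yv n \<omega>)"

text \<open>For other paths the integral in \<open>isr\<close> may take its default value 0, and its
  continuity in the parameter would not follow from the perturbation bounds.\<close>

definition regular :: "nat \<Rightarrow> 'w \<Rightarrow> bool" where
  "regular n \<omega> \<longleftrightarrow> (\<integral>\<^sup>+t. ennreal ((Y t \<omega>)\<^sup>2) \<partial>unif n) < \<infinity>"

lemma Xv_nth: "i < n \<Longrightarrow> Xv n \<omega> i = X n i \<omega>"
  by (simp add: Xv_def)

lemma measurable_Y_joint:
  fixes n :: nat
  assumes "0 < n" "\<theta> \<in> \<Theta>" "sets (generated M UNIV Y) \<subseteq> sets H" "space H = space M"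
  shows "(\<lambda>(t, \<omega>). Y t \<omega>) \<in> borel_measurable (borel \<Otimes>\<^sub>M H)"
proof -
  interpret m: model M Y K\<^sub>0 "\<epsilon> n" \<delta>\<^sub>0 C\<^sub>0 n "K \<theta>" A Cinf "\<delta> \<theta>" by (rule model) fact+
  show ?thesis using m.measurable_Y_compose[OF assms(3,4), of "\<lambda>t. t" borel] by simp
qed

lemma Y_path_borel:
  assumes "\<omega> \<in> space M"
  shows "(\<lambda>t. Y t \<omega>) \<in> borel_measurable borel"
proof -
  have "space (generated M UNIV Y) = space M" unfolding generated_def by (rule space_measure_of) auto
  then show ?thesis
    using measurable_Pair1[OF Y_meas[unfolded measurable_process_def], of \<omega>] assms by simp
qed

lemma measurable_isr:
  assumes n: "0 < n" and \<theta>: "\<theta> \<in> \<Theta>" and H: "sets (generated M UNIV Y) \<subseteq> sets H" "space H = space M"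
    and x: "\<And>i. i < n \<Longrightarrow> X n i \<in> borel_measurable H"
    and y: "\<And>i. i < n \<Longrightarrow> (\<lambda>\<omega>. yv n \<omega> i) \<in> borel_measurable H"
  shows "isr n \<theta> \<in> borel_measurable H"
proof -
  interpret m: model M Y K\<^sub>0 "\<epsilon> n" \<delta>\<^sub>0 C\<^sub>0 n "K \<theta>" A Cinf "\<delta> \<theta>" by (rule model) fact+
  show ?thesis
    unfolding isr_def[abs_def]
    by (rule m.borel_measurable_isped[OF n _ y measurable_Y_joint[OF n \<theta> H]]) (simp_all add: Xv_nth x)
qed

lemma measurable_regular:
  assumes n: "0 < n" and \<theta>: "\<theta> \<in> \<Theta>" and H: "sets (generated M UNIV Y) \<subseteq> sets H" "space H = space M"
  shows "{\<omega> \<in> space M. regular n \<omega>} \<in> sets H"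
proof -
  interpret U: prob_space "unif n :: (real^'d) measure" by (rule prob_space_unif[OF n])
  have "(\<lambda>(\<omega>, t). ennreal ((Y t \<omega>)\<^sup>2)) \<in> borel_measurable (H \<Otimes>\<^sub>M unif n)"
    using measurable_pair_swap[OF measurable_Y_joint[OF n \<theta> H]]
    by (simp add: case_prod_beta' cong: measurable_cong_sets)
  from U.borel_measurable_nn_integral[OF this]
  have "{\<omega> \<in> space H. (\<integral>\<^sup>+t. ennreal ((Y t \<omega>)\<^sup>2) \<partial>unif n) < \<infinity>} \<in> sets H" by measurable
  then show ?thesis by (simp add: regular_def H(2))
qed

lemma generated_Y_subset: "sets (generated M UNIV Y) \<subseteq> events"
  using noise_alg_Y[of 1] noise_alg_subset[of 1] by simp

lemma joint_x: "i < n \<Longrightarrow> (\<lambda>p. fst p i) \<in> borel_measurable (Pi\<^sub>M {..<n} (\<lambda>_. borel) \<Otimes>\<^sub>M noise_alg n)"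
  by (rule measurable_compose[OF measurable_fst measurable_component_singleton]) simp

lemma joint_y:
  assumes n: "i < n" and \<theta>: "\<theta> \<in> \<Theta>"
  shows "(\<lambda>p. Y (fst p i) (snd p) + \<epsilon> n i (snd p)) \<in> borel_measurable (Pi\<^sub>M {..<n} (\<lambda>_. borel) \<Otimes>\<^sub>M noise_alg n)"
proof -
  have n0: "0 < n" using n by simp
  interpret m: model M Y K\<^sub>0 "\<epsilon> n" \<delta>\<^sub>0 C\<^sub>0 n "K \<theta>" A Cinf "\<delta> \<theta>" by (rule model[OF n0 \<theta>])
  have "(\<lambda>(x, \<omega>). Y (x i) \<omega>) \<in> borel_measurable (Pi\<^sub>M {..<n} (\<lambda>_. borel) \<Otimes>\<^sub>M noise_alg n)"
    by (rule m.measurable_Y_compose[OF noise_alg_Y]) (use n in auto)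
  then show ?thesis
    by (intro borel_measurable_add measurable_compose[OF measurable_snd noise_alg_eps]) (use n in \<open>auto simp: case_prod_beta'\<close>)
qed

lemma measurable_Xv_id: "0 < n \<Longrightarrow> (\<lambda>\<omega>. (Xv n \<omega>, \<omega>)) \<in> measurable M (Pi\<^sub>M {..<n} (\<lambda>_. borel) \<Otimes>\<^sub>M noise_alg n)"
  by (intro measurable_Pair Xv_measurable noise_alg_id)

lemma yv_borel:
  assumes "i < n" "\<theta> \<in> \<Theta>"
  shows "(\<lambda>\<omega>. yv n \<omega> i) \<in> borel_measurable M"
proof -
  have "0 < n" using assms by simp
  from measurable_compose[OF measurable_Xv_id[OF this] joint_y[OF assms]] show ?thesis by (simp add: yv_def)
qed

lemma isr_borel: "0 < n \<Longrightarrow> \<theta> \<in> \<Theta> \<Longrightarrow> isr n \<theta> \<in> borel_measurable M"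
  by (rule measurable_isr[OF _ _ generated_Y_subset]) (auto intro: X_borel yv_borel)

lemma cvr_borel:
  assumes "0 < n" "\<theta> \<in> \<Theta>" shows "cvr n \<theta> \<in> borel_measurable M"
proof -
  interpret m: model M Y K\<^sub>0 "\<epsilon> n" \<delta>\<^sub>0 C\<^sub>0 n "K \<theta>" A Cinf "\<delta> \<theta>" by (rule model) fact+
  show ?thesis unfolding cvr_def[abs_def]
    by (rule m.borel_measurable_cvd) (use assms in \<open>auto simp: Xv_nth intro: X_borel yv_borel\<close>)
qed

lemma gap_borel: "0 < n \<Longrightarrow> \<theta> \<in> \<Theta> \<Longrightarrow> gap n \<theta> \<in> borel_measurable M"
  unfolding gap_def[abs_def] by (intro borel_measurable_diff isr_borel cvr_borel borel_measurable_const)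

lemma pdr_borel:
  assumes "0 < n" "\<theta> \<in> \<Theta>" shows "pdr n \<theta> \<in> borel_measurable M"
proof -
  interpret m: model M Y K\<^sub>0 "\<epsilon> n" \<delta>\<^sub>0 C\<^sub>0 n "K \<theta>" A Cinf "\<delta> \<theta>" by (rule model) fact+
  show ?thesis unfolding pdr_def[abs_def]
    by (rule m.borel_measurable_pd) (use assms in \<open>auto simp: Xv_nth intro: X_borel yv_borel\<close>)
qed

lemma crowding_borel:
  "(\<lambda>\<omega>. crowding n (Xv n \<omega>)) \<in> borel_measurable M"
  unfolding crowding_def
  by (intro borel_measurable_sum borel_measurable_exp[THEN measurable_compose[rotated]] measurable_compose[OF _ borel_measurable_decay]
      borel_measurable_diff) (auto simp: Xv_nth X_borel)

text \<open>The constant \<open>cr\<close> does not mention the sample size, so \<open>c\<close> can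
  be fixed before \<open>n\<close>. The maximum with 0 supplies its sign.\<close>

lemma nn_integral_gap_square_le:
  assumes \<theta>: "\<theta> \<in> \<Theta>"
  obtains c where "0 \<le> c" "\<And>n. 0 < n \<Longrightarrow> (\<integral>\<^sup>+\<omega>. ennreal ((gap n \<theta> \<omega>)\<^sup>2) \<partial>M) \<le> ennreal (c / sqrt (sqrt (real n)))"
proof -
  define c where "c = model.cr TYPE('d) \<delta>\<^sub>0 C\<^sub>0 A Cinf (\<delta> \<theta>)"
  have "(\<integral>\<^sup>+\<omega>. ennreal ((gap n \<theta> \<omega>)\<^sup>2) \<partial>M) \<le> ennreal (c / sqrt (sqrt (real n)))" if n: "0 < n" for n
  proof -
    interpret m: model M Y K\<^sub>0 "\<epsilon> n" \<delta>\<^sub>0 C\<^sub>0 n "K \<theta>" A Cinf "\<delta> \<theta>" by (rule model[OF n \<theta>])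
    let ?J = "Pi\<^sub>M {..<n} (\<lambda>_. borel) \<Otimes>\<^sub>M noise_alg n :: ((nat \<Rightarrow> real^'d) \<times> 'w) measure"
    have y: "(\<lambda>p. m.obs (fst p) i (snd p)) \<in> borel_measurable ?J" if "i < n" for i
      using joint_y[OF that \<theta>] by (simp add: m.obs_def)
    have Yj: "(\<lambda>(t, p). Y t (snd p)) \<in> borel_measurable (borel \<Otimes>\<^sub>M ?J)"
      using measurable_compose[OF _ measurable_Y_joint[OF n \<theta> noise_alg_Y space_noise_alg], of "\<lambda>q. (fst q, snd (snd q))" "borel \<Otimes>\<^sub>M ?J"]
      by (simp add: case_prod_beta')
    have cv: "(\<lambda>p. m.cv (fst p) (snd p)) \<in> borel_measurable ?J"
      unfolding m.cv_eq_cvd by (rule m.borel_measurable_cvd[OF joint_x y])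
    have isp: "(\<lambda>p. m.ispe (fst p) (snd p)) \<in> borel_measurable ?J"
      unfolding m.ispe_eq_isped by (rule m.borel_measurable_isped[OF n joint_x y Yj])
    have "(\<integral>\<^sup>+\<omega>. ennreal ((m.cv (Xv n \<omega>) \<omega> - \<delta>\<^sub>0 - m.ispe (Xv n \<omega>) \<omega>)\<^sup>2) \<partial>M) =
        (\<integral>\<^sup>+x. (\<integral>\<^sup>+\<omega>. ennreal ((m.cv x \<omega> - \<delta>\<^sub>0 - m.ispe x \<omega>)\<^sup>2) \<partial>M) \<partial>design n)"
      by (rule nn_integral_split[OF n, where G = "\<lambda>x \<omega>. ennreal ((m.cv x \<omega> - \<delta>\<^sub>0 - m.ispe x \<omega>)\<^sup>2)"])
         (use cv isp in \<open>simp add: case_prod_beta'\<close>)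
    also have "\<dots> \<le> ennreal (c / sqrt (sqrt (real n)))" unfolding c_def by (rule m.nn_integral_cv_ispe_le)
    finally show ?thesis
      unfolding gap_def cvr_def isr_def m.cv_eq_cvd m.ispe_eq_isped
      by (simp add: m.obs_def yv_def[abs_def])
  qed
  note bd = this
  show thesis
  proof (rule that[of "max c 0"])
    fix n :: nat assume n: "0 < n"
    have "ennreal (c / sqrt (sqrt (real n))) \<le> ennreal (max c 0 / sqrt (sqrt (real n)))"
      by (intro ennreal_leI divide_right_mono) auto
    with bd[OF n] show "(\<integral>\<^sup>+\<omega>. ennreal ((gap n \<theta> \<omega>)\<^sup>2) \<partial>M) \<le> ennreal (max c 0 / sqrt (sqrt (real n)))" by (rule order_trans)
  qed simp
qed

lemma prob_gap_tendsto:
  fixes e :: real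
  assumes \<theta>: "\<theta> \<in> \<Theta>" and e: "0 < e"
  shows "(\<lambda>n. prob {\<omega> \<in> space M. e < \<bar>gap n \<theta> \<omega>\<bar>}) \<longlonglongrightarrow> 0"
proof -
  obtain c where c: "0 \<le> c" "\<And>n. 0 < n \<Longrightarrow> (\<integral>\<^sup>+\<omega>. ennreal ((gap n \<theta> \<omega>)\<^sup>2) \<partial>M) \<le> ennreal (c / sqrt (sqrt (real n)))"
    using nn_integral_gap_square_le[OF \<theta>] by blast
  have bd: "prob {\<omega> \<in> space M. e < \<bar>gap n \<theta> \<omega>\<bar>} \<le> c / e\<^sup>2 / sqrt (sqrt (real n))" if n: "0 < n" for n
  proof -
    note [measurable] = gap_borel[OF n \<theta>]
    have "prob {\<omega> \<in> space M. e\<^sup>2 < (gap n \<theta> \<omega>)\<^sup>2} \<le> c / sqrt (sqrt (real n)) / e\<^sup>2"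
      by (rule prob_gt_le) (use c n e in auto)
    moreover have "e < \<bar>gap n \<theta> \<omega>\<bar> \<longleftrightarrow> e\<^sup>2 < (gap n \<theta> \<omega>)\<^sup>2" for \<omega>
      using e abs_le_square_iff[of "gap n \<theta> \<omega>" e] by (simp add: not_le[symmetric])
    ultimately show ?thesis by (simp add: mult.commute)
  qed
  show ?thesis
  proof (rule tendsto_sandwich[of "\<lambda>_. 0" _ _ "\<lambda>n. c / e\<^sup>2 / sqrt (sqrt (real n))"])
    show "\<forall>\<^sub>F n in sequentially. prob {\<omega> \<in> space M. e < \<bar>gap n \<theta> \<omega>\<bar>} \<le> c / e\<^sup>2 / sqrt (sqrt (real n))"
      using eventually_gt_at_top[of 0] by eventually_elim (rule bd)
    show "(\<lambda>n. c / e\<^sup>2 / sqrt (sqrt (real n))) \<longlonglongrightarrow> 0"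
      by (intro real_tendsto_divide_at_top[OF tendsto_const] filterlim_compose[OF sqrt_at_top] filterlim_real_sequentially)
  qed auto
qed

text \<open>The condition on the design is part of the event: given an uncrowded design the
  Chebyshev bound for \<open>pf\<close> applies, and a crowded one contributes nothing. The
  threshold \<open>a\<close> does not depend on \<open>n\<close>.\<close>

lemma prob_pdr_tendsto:
  fixes c :: real
  assumes \<theta>: "\<theta> \<in> \<Theta>" and c: "0 \<le> c"
  obtains a :: real where "0 \<le> a"
    "(\<lambda>n. prob {\<omega> \<in> space M. crowding n (Xv n \<omega>) \<le> c * n \<and> a * n < pdr n \<theta> \<omega>}) \<longlonglongrightarrow> 0"
proof -
  define a where "a = model.cP \<delta>\<^sub>0 C\<^sub>0 Cinf * c + 1"
  define b where "b = \<bar>model.cQ \<delta>\<^sub>0 C\<^sub>0 Cinf * (sqrt c * c)\<bar>"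
  have bd: "prob {\<omega> \<in> space M. crowding n (Xv n \<omega>) \<le> c * n \<and> a * n < pdr n \<theta> \<omega>} \<le> b / sqrt (real n)" if n: "0 < n" for n
  proof -
    interpret m: model M Y K\<^sub>0 "\<epsilon> n" \<delta>\<^sub>0 C\<^sub>0 n "K \<theta>" A Cinf "\<delta> \<theta>" by (rule model[OF n \<theta>])
    interpret D: prob_space "design n :: (nat \<Rightarrow> real^'d) measure" by (rule prob_space_design[OF n])
    let ?J = "Pi\<^sub>M {..<n} (\<lambda>_. borel) \<Otimes>\<^sub>M noise_alg n :: ((nat \<Rightarrow> real^'d) \<times> 'w) measure"
    have y: "(\<lambda>p. m.obs (fst p) i (snd p)) \<in> borel_measurable ?J" if "i < n" for i
      using joint_y[OF that \<theta>] by (simp add: m.obs_def)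
    have pf: "(\<lambda>p. m.pf (fst p) (snd p)) \<in> borel_measurable ?J"
      unfolding m.pf_eq_pd by (rule m.borel_measurable_pd[OF joint_x y])
    have cr: "(\<lambda>p. crowding n (fst p)) \<in> borel_measurable ?J"
      by (rule m.borel_measurable_crowding[OF joint_x])
    have pdr: "pdr n \<theta> \<omega> = m.pf (Xv n \<omega>) \<omega>" for \<omega>
      by (simp add: pdr_def m.pf_eq_pd m.obs_def yv_def[abs_def])
    define S where "S = {(x, \<omega>). crowding n x \<le> c * n \<and> a * n < m.pf x \<omega>}"
    note [measurable] = crowding_borel pdr_borel[OF n \<theta>]
    have "{\<omega> \<in> space M. crowding n (Xv n \<omega>) \<le> c * n \<and> a * n < pdr n \<theta> \<omega>} \<in> events" by measurable
    then have "emeasure M {\<omega> \<in> space M. crowding n (Xv n \<omega>) \<le> c * n \<and> a * n < pdr n \<theta> \<omega>} =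
        (\<integral>\<^sup>+\<omega>. indicator {\<omega> \<in> space M. crowding n (Xv n \<omega>) \<le> c * n \<and> a * n < pdr n \<theta> \<omega>} \<omega> \<partial>M)"
      by (rule nn_integral_indicator[symmetric])
    also have "\<dots> = (\<integral>\<^sup>+\<omega>. indicator S (Xv n \<omega>, \<omega>) \<partial>M)"
      by (intro nn_integral_cong) (simp add: S_def pdr indicator_def)
    also have "\<dots> = (\<integral>\<^sup>+x. (\<integral>\<^sup>+\<omega>. indicator S (x, \<omega>) \<partial>M) \<partial>design n)"
    proof (rule nn_integral_split[OF n, where G = "\<lambda>x \<omega>. indicator S (x, \<omega>)"])
      have "Measurable.pred ?J (\<lambda>p. crowding n (fst p) \<le> c * n \<and> a * n < m.pf (fst p) (snd p))"
        using cr pf by measurable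
      then have "(\<lambda>p. indicator {p. crowding n (fst p) \<le> c * n \<and> a * n < m.pf (fst p) (snd p)} p :: ennreal) \<in> borel_measurable ?J"
        by measurable
      then show "(\<lambda>(x, \<omega>). indicator S (x, \<omega>) :: ennreal) \<in> borel_measurable ?J"
        by (simp add: S_def case_prod_beta')
    qed
    also have "\<dots> \<le> (\<integral>\<^sup>+x. ennreal (b / sqrt (real n)) \<partial>(design n :: (nat \<Rightarrow> real^'d) measure))"
    proof (rule nn_integral_mono)
      fix x :: "nat \<Rightarrow> real^'d"
      show "(\<integral>\<^sup>+\<omega>. indicator S (x, \<omega>) \<partial>M) \<le> ennreal (b / sqrt (real n))"
      proof (cases "crowding n x \<le> c * n")
        case True
        then have "m.psum x \<le> c * n" by (simp add: m.psum_def m.near_def crowding_def)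
        note em = m.emeasure_pf_gt_le[OF c this]
        have "(\<integral>\<^sup>+\<omega>. indicator S (x, \<omega>) \<partial>M) = (\<integral>\<^sup>+\<omega>. indicator {\<omega> \<in> space M. a * n < m.pf x \<omega>} \<omega> \<partial>M)"
          using True by (intro nn_integral_cong) (simp add: S_def indicator_def)
        also have "\<dots> = emeasure M {\<omega> \<in> space M. a * n < m.pf x \<omega>}"
          using m.borel_measurable_pf[of x] by (intro nn_integral_indicator) measurable
        also have "\<dots> \<le> ennreal (m.cQ * (sqrt c * c) / sqrt (real n))" using em unfolding a_def .
        also have "\<dots> \<le> ennreal (b / sqrt (real n))"
          unfolding b_def by (intro ennreal_leI divide_right_mono) auto
        finally show ?thesis .
      next
        case False
        then have "(\<integral>\<^sup>+\<omega>. indicator S (x, \<omega>) \<partial>M) = (\<integral>\<^sup>+\<omega>. 0 \<partial>M)"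
          by (intro nn_integral_cong) (simp add: S_def)
        then show ?thesis by simp
      qed
    qed
    also have "\<dots> = ennreal (b / sqrt (real n))" by (simp add: D.emeasure_space_1[simplified])
    finally show ?thesis by (simp add: emeasure_eq_measure b_def)
  qed
  show thesis
  proof (rule that)
    have "0 \<le> model.cP \<delta>\<^sub>0 C\<^sub>0 Cinf"
    proof -
      interpret m: model M Y K\<^sub>0 "\<epsilon> 1" \<delta>\<^sub>0 C\<^sub>0 1 "K \<theta>" A Cinf "\<delta> \<theta>" by (rule model[OF _ \<theta>]) simp
      show ?thesis by (rule m.cP_nonneg)
    qed
    then show "0 \<le> a" using c by (simp add: a_def)
    show "(\<lambda>n. prob {\<omega> \<in> space M. crowding n (Xv n \<omega>) \<le> c * n \<and> a * n < pdr n \<theta> \<omega>}) \<longlonglongrightarrow> 0"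
    proof (rule tendsto_sandwich[of "\<lambda>_. 0" _ _ "\<lambda>n. b / sqrt (real n)"])
      show "\<forall>\<^sub>F n in sequentially. prob {\<omega> \<in> space M. crowding n (Xv n \<omega>) \<le> c * n \<and> a * n < pdr n \<theta> \<omega>} \<le> b / sqrt (real n)"
        using eventually_gt_at_top[of 0] by eventually_elim (rule bd)
      show "(\<lambda>n. b / sqrt (real n)) \<longlonglongrightarrow> 0"
        by (intro real_tendsto_divide_at_top[OF tendsto_const] filterlim_compose[OF sqrt_at_top] filterlim_real_sequentially)
    qed auto
  qed
qed

text \<open>Markov's inequality. The bound does not vanish as \<open>n\<close> grows, but
  \<open>c\<close> makes it as small as desired, uniformly in \<open>n\<close>.\<close>

lemma prob_crowding_le:
  fixes c :: real
  assumes n: "0 < n" and c: "0 < c"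
  shows "prob {\<omega> \<in> space M. c * n < crowding n (Xv n \<omega>)} \<le> exp (1 + 2 * decay_mass TYPE('d)) / c"
proof -
  let ?e = "exp (1 + 2 * decay_mass TYPE('d))"
  note [measurable] = crowding_borel
  have cr: "(\<lambda>x. ennreal (exp (\<Sum>j<n. decay (x i - x j)))) \<in> borel_measurable (Pi\<^sub>M {..<n} (\<lambda>_. borel) :: (nat \<Rightarrow> real^'d) measure)"
    if "i < n" for i
    by (intro measurable_compose[OF _ measurable_ennreal] borel_measurable_exp[THEN measurable_compose[rotated]] borel_measurable_sum
        measurable_compose[OF _ borel_measurable_decay] borel_measurable_diff measurable_component_singleton) (use that in auto)
  have "(\<integral>\<^sup>+\<omega>. ennreal (crowding n (Xv n \<omega>)) \<partial>M) = (\<integral>\<^sup>+\<omega>. (\<Sum>i<n. ennreal (exp (\<Sum>j<n. decay (Xv n \<omega> i - Xv n \<omega> j)))) \<partial>M)"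
    unfolding crowding_def by (intro nn_integral_cong) (simp add: sum_ennreal)
  also have "\<dots> = (\<Sum>i<n. \<integral>\<^sup>+\<omega>. ennreal (exp (\<Sum>j<n. decay (Xv n \<omega> i - Xv n \<omega> j))) \<partial>M)"
    by (intro nn_integral_sum measurable_compose[OF Xv_measurable cr]) simp
  also have "\<dots> \<le> (\<Sum>i<n. ennreal ?e)"
  proof (rule sum_mono)
    fix i assume "i \<in> {..<n}"
    then have i: "i < n" by simp
    have "(\<integral>\<^sup>+\<omega>. ennreal (exp (\<Sum>j<n. decay (Xv n \<omega> i - Xv n \<omega> j))) \<partial>M) =
        (\<integral>\<^sup>+x. ennreal (exp (\<Sum>j<n. decay (x i - x j))) \<partial>distr M (Pi\<^sub>M {..<n} (\<lambda>_. borel)) (Xv n))"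
      using cr[OF i] by (subst nn_integral_distr[OF Xv_measurable]) auto
    also have "\<dots> \<le> ennreal ?e" unfolding Xv_distr[OF n] by (rule nn_integral_exp_near_le[OF i])
    finally show "(\<integral>\<^sup>+\<omega>. ennreal (exp (\<Sum>j<n. decay (Xv n \<omega> i - Xv n \<omega> j))) \<partial>M) \<le> ennreal ?e" .
  qed
  also have "\<dots> = ennreal (n * ?e)" by (simp flip: ennreal_of_nat_eq_real_of_nat add: ennreal_mult')
  finally have E: "(\<integral>\<^sup>+\<omega>. ennreal (crowding n (Xv n \<omega>)) \<partial>M) \<le> ennreal (n * ?e)" .
  have "prob {\<omega> \<in> space M. c * n < crowding n (Xv n \<omega>)} \<le> (n * ?e) / (c * n)"
    by (rule prob_gt_le[OF crowding_borel E]) (use n c in auto)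
  then show ?thesis using n by simp
qed

lemma regular_integrable:
  assumes "\<omega> \<in> space M" "regular n \<omega>"
  shows "integrable (unif n) (\<lambda>t. (Y t \<omega>)\<^sup>2)"
proof (rule integrableI_bounded)
  show "(\<lambda>t. (Y t \<omega>)\<^sup>2) \<in> borel_measurable (unif n)" using Y_path_borel[OF assms(1)] by measurable
  show "(\<integral>\<^sup>+t. ennreal (norm ((Y t \<omega>)\<^sup>2)) \<partial>unif n) < \<infinity>" using assms(2) by (simp add: regular_def)
qed

lemma gap_perturbed_le:
  fixes P q :: real
  assumes n: "0 < n" and \<omega>: "\<omega> \<in> space M" "regular n \<omega>"
    and \<theta>: "\<theta> \<in> \<Theta>" "\<theta>' \<in> \<Theta>" and q: "L * dist \<theta> \<theta>' \<le> q" "0 < q" "q \<le> 1"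
    and P: "pdr n \<theta> \<omega> \<le> P * n"
  defines "a1 \<equiv> (A + D)\<^sup>2 + 2 * (8 * (A + D)\<^sup>2 / Cinf\<^sup>2 + 4 * (A + D) ^ 3 / Cinf)"
    and "a2 \<equiv> (A + D)\<^sup>2 + 2 * (2 * model.cc TYPE('d) + 8 * krig.\<kappa> TYPE('d) A / Cinf)"
  shows "\<bar>isr n \<theta>' \<omega> - isr n \<theta> \<omega>\<bar> \<le> sqrt q * (\<bar>gap n \<theta> \<omega>\<bar> + a2 * P)"
    and "\<bar>gap n \<theta>' \<omega>\<bar> \<le> \<bar>gap n \<theta> \<omega>\<bar> + sqrt q * (\<bar>gap n \<theta> \<omega>\<bar> + (a1 + a2) * P)"
proof -
  interpret m: model M Y K\<^sub>0 "\<epsilon> n" \<delta>\<^sub>0 C\<^sub>0 n "K \<theta>" A Cinf "\<delta> \<theta>" by (rule model[OF n \<theta>(1)])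
  interpret m': krig "K \<theta>'" A Cinf "\<delta> \<theta>'" by (rule K_krig[OF \<theta>(2)])
  have k: "\<bar>K \<theta> t - K \<theta>' t\<bar> \<le> q * decay t" for t
    using K_lip[OF \<theta>, of t] q(1) by (rule_tac order_trans) (auto intro!: mult_right_mono)
  have d: "\<bar>\<delta> \<theta> - \<delta> \<theta>'\<bar> \<le> q" using \<delta>_lip[OF \<theta>] q(1) by linarith
  have nP: "pdr n \<theta> \<omega> / n \<le> P" using P n by (simp add: field_simps)
  have AD: "0 < A + D" using m.A_pos m.\<delta>_pos \<delta>_le[OF \<theta>(1)] by linarith
  have a1: "0 \<le> a1" using AD m.C_pos by (simp add: a1_def)
  have a3: "0 \<le> 2 * (2 * m.cc + 8 * m.\<kappa> / Cinf)" using m.cc_nonneg m.\<kappa>_nonneg m.C_pos by simp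
  have sq: "0 \<le> sqrt q" using q by simp
  have V: "\<bar>cvr n \<theta>' \<omega> - cvr n \<theta> \<omega>\<bar> \<le> sqrt q * (a1 * P)"
  proof -
    have "\<bar>cvr n \<theta>' \<omega> - cvr n \<theta> \<omega>\<bar> \<le> sqrt q * a1 * (pdr n \<theta> \<omega> / n)"
      unfolding cvr_def pdr_def a1_def
      by (rule m.cvd_perturbed_le[OF m'.krig_axioms k d q(2,3) \<delta>_le[OF \<theta>(1)] \<delta>_le[OF \<theta>(2)]])
    also have "\<dots> \<le> sqrt q * a1 * P" by (intro mult_left_mono nP mult_nonneg_nonneg sq a1)
    finally show ?thesis by (simp add: mult.assoc)
  qed
  \<comment> \<open>The perturbation bound contains the prediction error itself. It is controlled
    through the cross validation criterion, which is at most a multiple of \<open>P\<close>, and the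
    gap.\<close>
  have "isr n \<theta> \<omega> \<le> cvr n \<theta> \<omega> + \<bar>gap n \<theta> \<omega>\<bar>" using \<delta>0_nonneg by (simp add: gap_def)
  also have "cvr n \<theta> \<omega> \<le> (A + D)\<^sup>2 * P"
  proof -
    have "cvr n \<theta> \<omega> \<le> (A + \<delta> \<theta>)\<^sup>2 * (pdr n \<theta> \<omega> / n)" unfolding cvr_def pdr_def by (rule m.cvd_le_pd)
    also have "\<dots> \<le> (A + D)\<^sup>2 * P"
      using \<delta>_le[OF \<theta>(1)] m.A_pos m.\<delta>_pos nP m.pd_nonneg
      by (intro mult_mono power_mono) (auto simp: pdr_def)
    finally show ?thesis .
  qed
  finally have G: "isr n \<theta> \<omega> \<le> (A + D)\<^sup>2 * P + \<bar>gap n \<theta> \<omega>\<bar>" by simp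
  show I: "\<bar>isr n \<theta>' \<omega> - isr n \<theta> \<omega>\<bar> \<le> sqrt q * (\<bar>gap n \<theta> \<omega>\<bar> + a2 * P)"
  proof -
    have "\<bar>isr n \<theta>' \<omega> - isr n \<theta> \<omega>\<bar> \<le> sqrt q * (isr n \<theta> \<omega> + 2 * (2 * m.cc + 8 * m.\<kappa> / Cinf) * (pdr n \<theta> \<omega> / n))"
      unfolding isr_def pdr_def
      by (rule m.isped_perturbed_le[OF m'.krig_axioms k d q(2,3) \<delta>_le[OF \<theta>(1)] \<delta>_le[OF \<theta>(2)] Y_path_borel[OF \<omega>(1)] regular_integrable[OF \<omega>]])
    also have "\<dots> \<le> sqrt q * (((A + D)\<^sup>2 * P + \<bar>gap n \<theta> \<omega>\<bar>) + 2 * (2 * m.cc + 8 * m.\<kappa> / Cinf) * P)"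
      by (intro mult_left_mono add_mono G nP sq a3)
    finally show ?thesis by (simp add: a2_def algebra_simps)
  qed
  have "\<bar>gap n \<theta>' \<omega>\<bar> \<le> \<bar>gap n \<theta> \<omega>\<bar> + \<bar>cvr n \<theta>' \<omega> - cvr n \<theta> \<omega>\<bar> + \<bar>isr n \<theta>' \<omega> - isr n \<theta> \<omega>\<bar>"
    by (simp add: gap_def)
  then show "\<bar>gap n \<theta>' \<omega>\<bar> \<le> \<bar>gap n \<theta> \<omega>\<bar> + sqrt q * (\<bar>gap n \<theta> \<omega>\<bar> + (a1 + a2) * P)"
    using V I by (simp add: algebra_simps)
qed

text \<open>This makes \<open>isr\<close> a version of the prediction error with continuous paths in
  the parameter, to be compared with the one that \<open>is_ISPE\<close> prescribes.\<close>

lemma continuous_isr: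
  assumes n: "0 < n" and \<omega>: "\<omega> \<in> space M" "regular n \<omega>"
  shows "continuous_on \<Theta> (\<lambda>\<theta>. isr n \<theta> \<omega>)"
  unfolding continuous_on_iff
proof (intro ballI allI impI)
  fix \<theta> e assume \<theta>: "\<theta> \<in> \<Theta>" and e: "(0::real) < e"
  define P where "P = pdr n \<theta> \<omega> / n"
  define z where "z = \<bar>gap n \<theta> \<omega>\<bar> + ((A + D)\<^sup>2 + 2 * (2 * model.cc TYPE('d) + 8 * krig.\<kappa> TYPE('d) A / Cinf)) * P"
  define b where "b = \<bar>z\<bar> + 1"
  \<comment> \<open>Chosen so that \<open>sqrt q * b\<close> is at most \<open>e / 2\<close>; by the
    Lipschitz bounds the radius \<open>q / L\<close> keeps the models within distance
    \<open>q\<close>.\<close>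
  define q where "q = min 1 ((e / (2 * b))\<^sup>2)"
  have b: "0 < b" by (simp add: b_def)
  have q: "0 < q" "q \<le> 1" using b e by (auto simp: q_def)
  have "sqrt q \<le> sqrt ((e / (2 * b))\<^sup>2)" unfolding q_def by (intro real_sqrt_le_mono) simp
  then have sq: "sqrt q \<le> e / (2 * b)" using e b by simp
  show "\<exists>d>0. \<forall>\<theta>'\<in>\<Theta>. dist \<theta>' \<theta> < d \<longrightarrow> dist (isr n \<theta>' \<omega>) (isr n \<theta> \<omega>) < e"
  proof (intro exI[of _ "q / L"] conjI ballI impI)
    show "0 < q / L" using q L_pos by simp
    fix \<theta>' assume \<theta>': "\<theta>' \<in> \<Theta>" and "dist \<theta>' \<theta> < q / L"
    then have "L * dist \<theta> \<theta>' \<le> q" using L_pos by (simp add: field_simps dist_commute)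
    from gap_perturbed_le(1)[OF n \<omega> \<theta> \<theta>' this q, of P]
    have "dist (isr n \<theta>' \<omega>) (isr n \<theta> \<omega>) \<le> sqrt q * z"
      using n by (simp add: P_def z_def dist_real_def)
    also have "\<dots> \<le> sqrt q * b" using q by (intro mult_left_mono) (auto simp: b_def)
    also have "\<dots> \<le> e / (2 * b) * b" using sq b by (intro mult_right_mono) auto
    also have "\<dots> < e" using b e by simp
    finally show "dist (isr n \<theta>' \<omega>) (isr n \<theta> \<omega>) < e" .
  qed
qed

text \<open>The exceptional event concerns the centre \<open>\<theta>\<close> only: there the gap or
  the quadratic form is too large. Off it, the modulus of continuity carries smallness to a ball
  whose radius is fixed before \<open>n\<close>, because the threshold for the quadratic form
  is.\<close>

lemma gap_small_near:
  fixes c e :: real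
  assumes \<theta>: "\<theta> \<in> \<Theta>" and c: "0 \<le> c" and e: "0 < e"
  shows "\<exists>\<eta> B. 0 < \<eta> \<and> (\<forall>n>0. B n \<in> events) \<and> (\<lambda>n. prob (B n)) \<longlonglongrightarrow> 0 \<and>
    (\<forall>n>0. \<forall>\<omega>\<in>space M. regular n \<omega> \<longrightarrow> crowding n (Xv n \<omega>) \<le> c * n \<longrightarrow> \<omega> \<notin> B n \<longrightarrow>
      (\<forall>\<theta>'\<in>\<Theta>. dist \<theta> \<theta>' < \<eta> \<longrightarrow> \<bar>gap n \<theta>' \<omega>\<bar> \<le> e))"
proof -
  obtain a :: real where a: "0 \<le> a"
    "(\<lambda>n. prob {\<omega> \<in> space M. crowding n (Xv n \<omega>) \<le> c * n \<and> a * n < pdr n \<theta> \<omega>}) \<longlonglongrightarrow> 0"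
    using prob_pdr_tendsto[OF \<theta> c] by blast
  define h where "h = (A + D)\<^sup>2 + 2 * (8 * (A + D)\<^sup>2 / Cinf\<^sup>2 + 4 * (A + D) ^ 3 / Cinf) +
    ((A + D)\<^sup>2 + 2 * (2 * model.cc TYPE('d) + 8 * krig.\<kappa> TYPE('d) A / Cinf))"
  define b where "b = \<bar>e / 2 + h * a\<bar> + 1"
  define q where "q = min 1 ((e / (2 * b))\<^sup>2)"
  have b: "0 < b" by (simp add: b_def)
  have q: "0 < q" "q \<le> 1" using b e by (auto simp: q_def)
  have "sqrt q \<le> sqrt ((e / (2 * b))\<^sup>2)" unfolding q_def by (intro real_sqrt_le_mono) simp
  then have sq: "sqrt q \<le> e / (2 * b)" using e b by simp
  define B1 where "B1 n = {\<omega> \<in> space M. crowding n (Xv n \<omega>) \<le> c * n \<and> a * n < pdr n \<theta> \<omega>}" for n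
  define B2 where "B2 n = {\<omega> \<in> space M. e / 2 < \<bar>gap n \<theta> \<omega>\<bar>}" for n
  have B1: "B1 n \<in> events" and B2: "B2 n \<in> events" if n: "0 < n" for n
  proof -
    note [measurable] = crowding_borel pdr_borel[OF n \<theta>] gap_borel[OF n \<theta>]
    show "B1 n \<in> events" "B2 n \<in> events" unfolding B1_def B2_def by measurable
  qed
  show ?thesis
  proof (intro exI conjI allI impI ballI)
    show "0 < q / L" using q L_pos by simp
    show "B1 n \<union> B2 n \<in> events" if "0 < n" for n using B1[OF that] B2[OF that] by auto
    have lim: "(\<lambda>n. prob (B1 n) + prob (B2 n)) \<longlonglongrightarrow> 0"
      using tendsto_add[OF a(2) prob_gap_tendsto[OF \<theta>, of "e / 2"]] e unfolding B1_def B2_def by simp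
    show "(\<lambda>n. prob (B1 n \<union> B2 n)) \<longlonglongrightarrow> 0"
    proof (rule tendsto_sandwich[OF _ _ tendsto_const lim])
      show "\<forall>\<^sub>F n in sequentially. prob (B1 n \<union> B2 n) \<le> prob (B1 n) + prob (B2 n)"
        using eventually_gt_at_top[of 0] by eventually_elim (intro measure_Un_le B1 B2)
    qed simp
    fix n :: nat and \<omega> \<theta>'
    assume n: "0 < n" and \<omega>: "\<omega> \<in> space M" "regular n \<omega>" and cr: "crowding n (Xv n \<omega>) \<le> c * n"
      and nB: "\<omega> \<notin> B1 n \<union> B2 n" and \<theta>': "\<theta>' \<in> \<Theta>" and d: "dist \<theta> \<theta>' < q / L"
    have p: "pdr n \<theta> \<omega> \<le> a * n" and g: "\<bar>gap n \<theta> \<omega>\<bar> \<le> e / 2"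
      using nB \<omega> cr by (auto simp: B1_def B2_def)
    have "L * dist \<theta> \<theta>' \<le> q" using d L_pos by (simp add: field_simps)
    from gap_perturbed_le(2)[OF n \<omega> \<theta> \<theta>' this q p]
    have "\<bar>gap n \<theta>' \<omega>\<bar> \<le> \<bar>gap n \<theta> \<omega>\<bar> + sqrt q * (\<bar>gap n \<theta> \<omega>\<bar> + h * a)" unfolding h_def .
    also have "\<dots> \<le> e / 2 + sqrt q * b" using q g by (intro add_mono mult_left_mono) (auto simp: b_def)
    also have "\<dots> \<le> e / 2 + e / (2 * b) * b" using sq b by (intro add_mono mult_right_mono) auto
    also have "\<dots> = e" using b by simp
    finally show "\<bar>gap n \<theta>' \<omega>\<bar> \<le> e" .
  qed
qed

lemma gap_small:
  fixes c e :: real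
  assumes c: "0 \<le> c" and e: "0 < e"
  shows "\<exists>B. (\<forall>n>0. B n \<in> events) \<and> (\<lambda>n. prob (B n)) \<longlonglongrightarrow> 0 \<and>
    (\<forall>n>0. \<forall>\<omega>\<in>space M. regular n \<omega> \<longrightarrow> crowding n (Xv n \<omega>) \<le> c * n \<longrightarrow> \<omega> \<notin> B n \<longrightarrow>
      (\<forall>\<theta>\<in>\<Theta>. \<bar>gap n \<theta> \<omega>\<bar> \<le> e))"
proof -
  define Q where "Q \<theta> \<eta> B \<longleftrightarrow> 0 < \<eta> \<and> (\<forall>n>0. B n \<in> events) \<and> (\<lambda>n. prob (B n)) \<longlonglongrightarrow> 0 \<and>
    (\<forall>n>0. \<forall>\<omega>\<in>space M. regular n \<omega> \<longrightarrow> crowding n (Xv n \<omega>) \<le> c * n \<longrightarrow> \<omega> \<notin> B n \<longrightarrow>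
      (\<forall>\<theta>'\<in>\<Theta>. dist \<theta> \<theta>' < \<eta> \<longrightarrow> \<bar>gap n \<theta>' \<omega>\<bar> \<le> e))" for \<theta> \<eta> B
  have "\<forall>\<theta>\<in>\<Theta>. \<exists>\<eta> B. Q \<theta> \<eta> B" using gap_small_near[OF _ c e] unfolding Q_def by blast
  from bchoice[OF this] obtain \<eta> where "\<forall>\<theta>\<in>\<Theta>. \<exists>B. Q \<theta> (\<eta> \<theta>) B" by blast
  from bchoice[OF this] obtain B where Q: "\<forall>\<theta>\<in>\<Theta>. Q \<theta> (\<eta> \<theta>) (B \<theta>)" by blast
  have \<eta>: "0 < \<eta> \<theta>" and B: "0 < n \<Longrightarrow> B \<theta> n \<in> events" "(\<lambda>n. prob (B \<theta> n)) \<longlonglongrightarrow> 0" if "\<theta> \<in> \<Theta>" for \<theta> n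
    using Q[rule_format, OF that] by (auto simp: Q_def)
  have near: "\<bar>gap n \<theta>' \<omega>\<bar> \<le> e"
    if "\<theta> \<in> \<Theta>" "0 < n" "\<omega> \<in> space M" "regular n \<omega>" "crowding n (Xv n \<omega>) \<le> c * n" "\<omega> \<notin> B \<theta> n" "\<theta>' \<in> \<Theta>" "dist \<theta> \<theta>' < \<eta> \<theta>"
    for \<theta> n \<omega> \<theta>'
    using Q[rule_format, OF that(1)] that by (simp add: Q_def)
  obtain T where T: "T \<subseteq> \<Theta>" "finite T" "\<Theta> \<subseteq> (\<Union>\<theta>\<in>T. ball \<theta> (\<eta> \<theta>))"
  proof (rule compactE_image[OF \<Theta>_compact, of \<Theta> "\<lambda>\<theta>. ball \<theta> (\<eta> \<theta>)"])
    show "\<Theta> \<subseteq> (\<Union>\<theta>\<in>\<Theta>. ball \<theta> (\<eta> \<theta>))" using \<eta> by force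
  qed (use that in auto)
  show ?thesis
  proof (intro exI[of _ "\<lambda>n. \<Union>\<theta>\<in>T. B \<theta> n"] conjI allI impI ballI)
    show "(\<Union>\<theta>\<in>T. B \<theta> n) \<in> events" if "0 < n" for n
      using T B(1) that by (intro sets.finite_UN) auto
    have lim: "(\<lambda>n. \<Sum>\<theta>\<in>T. prob (B \<theta> n)) \<longlonglongrightarrow> 0"
      using tendsto_sum[of T "\<lambda>\<theta> n. prob (B \<theta> n)" "\<lambda>_. 0" sequentially] B(2) T(1) by auto
    show "(\<lambda>n. prob (\<Union>\<theta>\<in>T. B \<theta> n)) \<longlonglongrightarrow> 0"
    proof (rule tendsto_sandwich[OF _ _ tendsto_const lim])
      show "\<forall>\<^sub>F n in sequentially. prob (\<Union>\<theta>\<in>T. B \<theta> n) \<le> (\<Sum>\<theta>\<in>T. prob (B \<theta> n))"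
        using eventually_gt_at_top[of 0]
        by eventually_elim (intro measure_UNION_le T(2), use T(1) B(1) in auto)
    qed simp
    fix n :: nat and \<omega> \<theta>
    assume *: "0 < n" "\<omega> \<in> space M" "regular n \<omega>" "crowding n (Xv n \<omega>) \<le> c * n"
      "\<omega> \<notin> (\<Union>\<theta>\<in>T. B \<theta> n)" "\<theta> \<in> \<Theta>"
    then obtain \<tau> where "\<tau> \<in> T" "dist \<tau> \<theta> < \<eta> \<tau>" using T(3) by force
    then show "\<bar>gap n \<theta> \<omega>\<bar> \<le> e" using near[of \<tau> n \<omega> \<theta>] * T(1) by auto
  qed
qed

text \<open>Tonelli: the expected integral is \<open>K\<^sub>0 0\<close>, the variance of the
  process at any point, and so is finite.\<close>

lemma AE_regular:
  assumes n: "0 < n" and \<theta>: "\<theta> \<in> \<Theta>"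
  shows "AE \<omega> in M. regular n \<omega>"
proof -
  interpret m: model M Y K\<^sub>0 "\<epsilon> n" \<delta>\<^sub>0 C\<^sub>0 n "K \<theta>" A Cinf "\<delta> \<theta>" by (rule model[OF n \<theta>])
  interpret U: prob_space "unif n :: (real^'d) measure" by (rule prob_space_unif[OF n])
  interpret UM: pair_sigma_finite "unif n :: (real^'d) measure" M ..
  have Y: "(\<lambda>(t, \<omega>). ennreal ((Y t \<omega>)\<^sup>2)) \<in> borel_measurable (unif n \<Otimes>\<^sub>M M)"
    using measurable_Y_joint[OF n \<theta> generated_Y_subset refl]
    by (simp add: case_prod_beta' cong: measurable_cong_sets)
  have sq: "integrable M (\<lambda>\<omega>. (Y t \<omega>)\<^sup>2)" "expectation (\<lambda>\<omega>. (Y t \<omega>)\<^sup>2) = K\<^sub>0 0" for t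
    using m.lin_integrable(2)[OF m.lin_Y m.lin_Y, of t] m.cov_YY[of t t] by (auto simp: power2_eq_square)
  have "(\<integral>\<^sup>+\<omega>. (\<integral>\<^sup>+t. ennreal ((Y t \<omega>)\<^sup>2) \<partial>unif n) \<partial>M) = (\<integral>\<^sup>+t. (\<integral>\<^sup>+\<omega>. ennreal ((Y t \<omega>)\<^sup>2) \<partial>M) \<partial>unif n)"
    using UM.Fubini[OF Y] by simp
  also have "\<dots> = (\<integral>\<^sup>+t. ennreal (K\<^sub>0 0) \<partial>(unif n :: (real^'d) measure))"
    by (intro nn_integral_cong) (simp add: nn_integral_eq_integral sq)
  also have "\<dots> < \<infinity>" by (simp add: U.emeasure_space_1[simplified])
  finally have fin: "(\<integral>\<^sup>+\<omega>. (\<integral>\<^sup>+t. ennreal ((Y t \<omega>)\<^sup>2) \<partial>unif n) \<partial>M) \<noteq> \<infinity>" by simp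
  have "(\<lambda>\<omega>. \<integral>\<^sup>+t. ennreal ((Y t \<omega>)\<^sup>2) \<partial>unif n) \<in> borel_measurable M"
    using U.borel_measurable_nn_integral[of "\<lambda>\<omega> t. ennreal ((Y t \<omega>)\<^sup>2)" M] measurable_pair_swap[OF Y] by (simp add: case_prod_beta')
  from nn_integral_PInf_AE[OF this fin] show ?thesis
    by (auto simp: regular_def less_top)
qed

end

section \<open>Integrals in the mean square sense\<close>

lemma integrable_square_sum:
  fixes f :: "'i \<Rightarrow> 'a \<Rightarrow> real"
  assumes "finite I" "\<And>i. i \<in> I \<Longrightarrow> f i \<in> borel_measurable M" "\<And>i. i \<in> I \<Longrightarrow> integrable M (\<lambda>\<omega>. (f i \<omega>)\<^sup>2)"
  shows "integrable M (\<lambda>\<omega>. (\<Sum>i\<in>I. f i \<omega>)\<^sup>2)"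
  using assms
proof (induction I rule: finite_induct)
  case (insert j I)
  have [measurable]: "f j \<in> borel_measurable M" "(\<lambda>\<omega>. \<Sum>i\<in>I. f i \<omega>) \<in> borel_measurable M"
    using insert.prems by (auto intro!: borel_measurable_sum)
  have "integrable M (\<lambda>\<omega>. 2 * (f j \<omega>)\<^sup>2 + 2 * (\<Sum>i\<in>I. f i \<omega>)\<^sup>2)" using insert by auto
  then have "integrable M (\<lambda>\<omega>. (f j \<omega> + (\<Sum>i\<in>I. f i \<omega>))\<^sup>2)"
    by (rule Bochner_Integration.integrable_bound) (auto intro!: AE_I2 square_add_le)
  then show ?case using insert.hyps by simp
qed simp

context prob_space
begin

text \<open>Multiplied by a bounded \<open>W\<close> and integrated, the random Riemann sums become
  Riemann sums of a deterministic function, along the same filter. By the Cauchy-Schwarz inequality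
  their error is at most the mean square error, so the limit is an ordinary gauge integral.\<close>

lemma has_integral_expectation_mult:
  fixes Z :: "'b::euclidean_space \<Rightarrow> 'a \<Rightarrow> real"
  assumes J: "has_L2_integral M Z J (cbox a b)"
    and W [measurable]: "W \<in> borel_measurable M" and W1: "\<And>\<omega>. \<bar>W \<omega>\<bar> \<le> 1"
  shows "((\<lambda>t. expectation (\<lambda>\<omega>. Z t \<omega> * W \<omega>)) has_integral expectation (\<lambda>\<omega>. J \<omega> * W \<omega>)) (cbox a b)"
proof -
  let ?S = "cbox a b"
  have Jm [measurable]: "J \<in> borel_measurable M" and J2: "integrable M (\<lambda>\<omega>. (J \<omega>)\<^sup>2)"
    and Z: "\<And>t. t \<in> ?S \<Longrightarrow> Z t \<in> borel_measurable M" "\<And>t. t \<in> ?S \<Longrightarrow> integrable M (\<lambda>\<omega>. (Z t \<omega>)\<^sup>2)"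
    and lim: "((\<lambda>D. \<integral>\<omega>. ((\<Sum>(t, B)\<in>D. measure lborel B * Z t \<omega>) - J \<omega>)\<^sup>2 \<partial>M) \<longlongrightarrow> 0) (division_filter ?S)"
    using J by (auto simp: has_L2_integral_def)
  have mult_W: "integrable M (\<lambda>\<omega>. f \<omega> * W \<omega>)" if "integrable M f" for f
    using that by (rule Bochner_Integration.integrable_bound)
      (use that W1 in \<open>auto intro!: AE_I2 mult_right_le_one_le simp: abs_mult\<close>)
  define r where "r D \<omega> = (\<Sum>(t, B)\<in>D. measure lborel B * Z t \<omega>) - J \<omega>" for D :: "('b \<times> 'b set) set" and \<omega>
  have bound: "norm ((\<Sum>(t, B)\<in>D. measure lborel B *\<^sub>R expectation (\<lambda>\<omega>. Z t \<omega> * W \<omega>)) - expectation (\<lambda>\<omega>. J \<omega> * W \<omega>)) \<le>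
      sqrt (expectation (\<lambda>\<omega>. (r D \<omega>)\<^sup>2))" if D: "D tagged_division_of ?S" for D
  proof -
    have fin: "finite D" and tag: "\<And>t B. (t, B) \<in> D \<Longrightarrow> t \<in> ?S" using tagged_division_ofD[OF D] by blast+
    let ?R = "\<lambda>\<omega>. \<Sum>(t, B)\<in>D. measure lborel B * Z t \<omega>"
    have Rm [measurable]: "?R \<in> borel_measurable M"
      using tag Z(1) by (intro borel_measurable_sum) (auto intro!: borel_measurable_times)
    have R2: "integrable M (\<lambda>\<omega>. (?R \<omega>)\<^sup>2)"
      using tag Z by (intro integrable_square_sum fin) (auto simp: power_mult_distrib intro!: borel_measurable_times)
    have rm [measurable]: "r D \<in> borel_measurable M" unfolding r_def[abs_def] by measurable
    have r2: "integrable M (\<lambda>\<omega>. (r D \<omega>)\<^sup>2)"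
      by (rule Bochner_Integration.integrable_bound[of M "\<lambda>\<omega>. 2 * (?R \<omega>)\<^sup>2 + 2 * (J \<omega>)\<^sup>2"])
         (use R2 J2 in \<open>auto intro!: AE_I2 square_diff_le simp: r_def\<close>)
    have ri: "integrable M (r D)" by (rule square_integrable_imp_integrable) (use r2 in auto)
    have Ji: "integrable M J" by (rule square_integrable_imp_integrable) (use J2 in auto)
    have Zi: "integrable M (Z t)" if "t \<in> ?S" for t by (rule square_integrable_imp_integrable) (use Z that in auto)
    have "(\<Sum>(t, B)\<in>D. measure lborel B *\<^sub>R expectation (\<lambda>\<omega>. Z t \<omega> * W \<omega>)) =
        (\<Sum>d\<in>D. expectation (\<lambda>\<omega>. measure lborel (snd d) * (Z (fst d) \<omega> * W \<omega>)))"
      by (simp add: case_prod_beta')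
    also have "\<dots> = expectation (\<lambda>\<omega>. \<Sum>d\<in>D. measure lborel (snd d) * (Z (fst d) \<omega> * W \<omega>))"
      by (rule Bochner_Integration.integral_sum[symmetric]) (use tag Zi in \<open>auto intro!: mult_W\<close>)
    also have "\<dots> - expectation (\<lambda>\<omega>. J \<omega> * W \<omega>) =
        expectation (\<lambda>\<omega>. (\<Sum>d\<in>D. measure lborel (snd d) * (Z (fst d) \<omega> * W \<omega>)) - J \<omega> * W \<omega>)"
      by (rule Bochner_Integration.integral_diff[symmetric])
         (use tag Zi Ji in \<open>auto intro!: mult_W Bochner_Integration.integrable_sum\<close>)
    also have "(\<lambda>\<omega>. (\<Sum>d\<in>D. measure lborel (snd d) * (Z (fst d) \<omega> * W \<omega>)) - J \<omega> * W \<omega>) = (\<lambda>\<omega>. r D \<omega> * W \<omega>)"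
      by (simp add: r_def case_prod_beta' left_diff_distrib sum_distrib_right mult.assoc)
    finally have eq: "(\<Sum>(t, B)\<in>D. measure lborel B *\<^sub>R expectation (\<lambda>\<omega>. Z t \<omega> * W \<omega>)) - expectation (\<lambda>\<omega>. J \<omega> * W \<omega>) =
        expectation (\<lambda>\<omega>. r D \<omega> * W \<omega>)" .
    have le: "(r D \<omega> * W \<omega>)\<^sup>2 \<le> (r D \<omega>)\<^sup>2" for \<omega>
      using W1[of \<omega>] abs_le_square_iff[of "W \<omega>" 1] by (simp add: power_mult_distrib mult_left_le)
    have rW2: "integrable M (\<lambda>\<omega>. (r D \<omega> * W \<omega>)\<^sup>2)"
      using r2 by (rule Bochner_Integration.integrable_bound) (use le in auto)
    have "(expectation (\<lambda>\<omega>. r D \<omega> * W \<omega>))\<^sup>2 \<le> expectation (\<lambda>\<omega>. (r D \<omega> * W \<omega>)\<^sup>2)"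
      by (rule square_expectation_le[OF mult_W[OF ri] rW2])
    also have "\<dots> \<le> expectation (\<lambda>\<omega>. (r D \<omega>)\<^sup>2)" by (rule integral_mono[OF rW2 r2 le])
    finally show ?thesis unfolding eq by (simp add: real_le_rsqrt)
  qed
  have "((\<lambda>D. (\<Sum>(t, B)\<in>D. measure lborel B *\<^sub>R expectation (\<lambda>\<omega>. Z t \<omega> * W \<omega>)) - expectation (\<lambda>\<omega>. J \<omega> * W \<omega>)) \<longlongrightarrow> 0)
      (division_filter ?S)"
  proof (rule Lim_null_comparison)
    show "((\<lambda>D. sqrt (expectation (\<lambda>\<omega>. (r D \<omega>)\<^sup>2))) \<longlongrightarrow> 0) (division_filter ?S)"
      using tendsto_real_sqrt[OF lim] by (simp add: r_def)
    show "\<forall>\<^sub>F D in division_filter ?S. norm ((\<Sum>(t, B)\<in>D. measure lborel B *\<^sub>R expectation (\<lambda>\<omega>. Z t \<omega> * W \<omega>)) -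
        expectation (\<lambda>\<omega>. J \<omega> * W \<omega>)) \<le> sqrt (expectation (\<lambda>\<omega>. (r D \<omega>)\<^sup>2))"
      using eventually_division_filter_tagged_division by eventually_elim (rule bound)
  qed
  then show ?thesis unfolding has_integral_cbox by (simp add: LIM_zero_iff)
qed

text \<open>The test variable 1 gives a gauge integral of the nonnegative function of means, which
  is then a Lebesgue integral; hence \<open>Z\<close> is integrable on the product space and the
  pathwise integral \<open>I\<close> is integrable. Fubini and the uniqueness of gauge integrals
  give \<open>J\<close> and \<open>I\<close> equal expectations against every bounded
  \<open>W\<close>. The test variable \<open>sgn (J \<omega> - I \<omega>)\<close> finally shows
  that the mean of the absolute difference is zero.\<close>

lemma has_L2_integral_AE_eq:
  fixes Z :: "'b::euclidean_space \<Rightarrow> 'a \<Rightarrow> real"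
  assumes J: "has_L2_integral M Z J (cbox a b)"
    and Z_meas: "(\<lambda>(t, \<omega>). Z t \<omega>) \<in> borel_measurable (borel \<Otimes>\<^sub>M M)" and Z0: "\<And>t \<omega>. 0 \<le> Z t \<omega>"
  shows "AE \<omega> in M. J \<omega> = (\<integral>t. indicator (cbox a b) t * Z t \<omega> \<partial>lborel)"
proof -
  let ?S = "cbox a b"
  interpret P: pair_sigma_finite "lborel :: 'b measure" M ..
  have Zm: "(\<lambda>p. Z (fst p) (snd p)) \<in> borel_measurable (lborel \<Otimes>\<^sub>M M)"
    using Z_meas by (simp add: case_prod_beta' cong: measurable_cong_sets)
  have Jm [measurable]: "J \<in> borel_measurable M" and J2: "integrable M (\<lambda>\<omega>. (J \<omega>)\<^sup>2)"
    and Z: "\<And>t. t \<in> ?S \<Longrightarrow> Z t \<in> borel_measurable M" "\<And>t. t \<in> ?S \<Longrightarrow> integrable M (\<lambda>\<omega>. (Z t \<omega>)\<^sup>2)"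
    using J by (auto simp: has_L2_integral_def)
  have Ji: "integrable M J" by (rule square_integrable_imp_integrable) (use J2 in auto)
  have Zi: "integrable M (Z t)" if "t \<in> ?S" for t by (rule square_integrable_imp_integrable) (use Z that in auto)
  have EZ: "(\<lambda>t. expectation (Z t)) \<in> borel_measurable borel"
    using borel_measurable_lebesgue_integral[of "\<lambda>t \<omega>. Z t \<omega>" borel] Z_meas by simp
  have "((\<lambda>t. indicator ?S t * expectation (Z t)) has_integral expectation J) UNIV"
  proof -
    have "((\<lambda>t. if t \<in> ?S then expectation (Z t) else 0) has_integral expectation J) UNIV"
      unfolding has_integral_restrict_UNIV using has_integral_expectation_mult[OF J, of "\<lambda>_. 1"] by simp
    moreover have "(\<lambda>t. if t \<in> ?S then expectation (Z t) else 0) = (\<lambda>t. indicator ?S t * expectation (Z t))"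
      by auto
    ultimately show ?thesis by (simp only:)
  qed
  then have nn: "(\<integral>\<^sup>+t. ennreal (indicator ?S t * expectation (Z t)) \<partial>lborel) = ennreal (expectation J)"
    by (intro nn_integral_has_integral_lborel) (use EZ Z0 in \<open>auto intro!: mult_nonneg_nonneg\<close>)
  have int: "integrable (lborel \<Otimes>\<^sub>M M) (\<lambda>p. indicator ?S (fst p) * Z (fst p) (snd p))"
  proof (rule integrableI_bounded)
    show m: "(\<lambda>p. indicator ?S (fst p) * Z (fst p) (snd p)) \<in> borel_measurable (lborel \<Otimes>\<^sub>M M)"
      by (intro borel_measurable_times Zm measurable_compose[OF measurable_fst borel_measurable_indicator]) simp
    have m': "(\<lambda>p. ennreal (norm (indicator ?S (fst p) * Z (fst p) (snd p)))) \<in> borel_measurable (lborel \<Otimes>\<^sub>M M)"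
      using m by measurable
    have "(\<integral>\<^sup>+p. ennreal (norm (indicator ?S (fst p) * Z (fst p) (snd p))) \<partial>(lborel \<Otimes>\<^sub>M M)) =
        (\<integral>\<^sup>+t. (\<integral>\<^sup>+\<omega>. ennreal (norm (indicator ?S t * Z t \<omega>)) \<partial>M) \<partial>lborel)"
      using nn_integral_fst[OF m'] by simp
    also have "\<dots> = (\<integral>\<^sup>+t. ennreal (indicator ?S t * expectation (Z t)) \<partial>lborel)"
    proof (intro nn_integral_cong)
      fix t show "(\<integral>\<^sup>+\<omega>. ennreal (norm (indicator ?S t * Z t \<omega>)) \<partial>M) = ennreal (indicator ?S t * expectation (Z t))"
        by (cases "t \<in> ?S") (use Z0 Zi in \<open>auto simp: nn_integral_eq_integral\<close>)
    qed
    finally show "(\<integral>\<^sup>+p. ennreal (norm (indicator ?S (fst p) * Z (fst p) (snd p))) \<partial>(lborel \<Otimes>\<^sub>M M)) < \<infinity>"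
      by (simp add: nn)
  qed
  define I where "I \<omega> = (\<integral>t. indicator ?S t * Z t \<omega> \<partial>lborel)" for \<omega>
  have Ii: "integrable M I"
    using P.integrable_snd[of "\<lambda>t \<omega>. indicator ?S t * Z t \<omega>"] int by (simp add: I_def[abs_def] case_prod_beta')
  then have [measurable]: "I \<in> borel_measurable M" by simp
  have test: "expectation (\<lambda>\<omega>. J \<omega> * W \<omega>) = expectation (\<lambda>\<omega>. I \<omega> * W \<omega>)"
    if W [measurable]: "W \<in> borel_measurable M" and W1: "\<And>\<omega>. \<bar>W \<omega>\<bar> \<le> 1" for W
  proof -
    have Wm: "(\<lambda>p. W (snd p)) \<in> borel_measurable (lborel \<Otimes>\<^sub>M M :: ('b \<times> 'a) measure)" by measurable
    have intW: "integrable (lborel \<Otimes>\<^sub>M M) (\<lambda>(t, \<omega>). indicator ?S t * Z t \<omega> * W \<omega>)"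
      by (rule Bochner_Integration.integrable_bound[OF int])
         (use borel_measurable_times[OF borel_measurable_integrable[OF int] Wm] W1
           in \<open>auto intro!: AE_I2 mult_right_le_one_le simp: abs_mult case_prod_beta'\<close>)
    have "((\<lambda>t. \<integral>\<omega>. indicator ?S t * Z t \<omega> * W \<omega> \<partial>M) has_integral (\<integral>t. (\<integral>\<omega>. indicator ?S t * Z t \<omega> * W \<omega> \<partial>M) \<partial>lborel)) UNIV"
      by (rule has_integral_integral_lborel[OF P.integrable_fst[OF intW]])
    moreover have "(\<integral>\<omega>. indicator ?S t * Z t \<omega> * W \<omega> \<partial>M) = (if t \<in> ?S then expectation (\<lambda>\<omega>. Z t \<omega> * W \<omega>) else 0)" for t
      by simp
    ultimately have "((\<lambda>t. expectation (\<lambda>\<omega>. Z t \<omega> * W \<omega>)) has_integral (\<integral>t. (\<integral>\<omega>. indicator ?S t * Z t \<omega> * W \<omega> \<partial>M) \<partial>lborel)) ?S"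
      by (simp only: has_integral_restrict_UNIV)
    from has_integral_unique[OF has_integral_expectation_mult[OF J W W1] this]
    have "expectation (\<lambda>\<omega>. J \<omega> * W \<omega>) = (\<integral>t. (\<integral>\<omega>. indicator ?S t * Z t \<omega> * W \<omega> \<partial>M) \<partial>lborel)" .
    also have "\<dots> = (\<integral>\<omega>. (\<integral>t. indicator ?S t * Z t \<omega> * W \<omega> \<partial>lborel) \<partial>M)"
      by (rule P.Fubini_integral[OF intW, symmetric])
    also have "\<dots> = expectation (\<lambda>\<omega>. I \<omega> * W \<omega>)" by (simp add: I_def)
    finally show ?thesis .
  qed
  have JI: "integrable M (\<lambda>\<omega>. J \<omega> - I \<omega>)" using Ji Ii by simp
  have sg: "(J \<omega> - I \<omega>) * sgn (J \<omega> - I \<omega>) = \<bar>J \<omega> - I \<omega>\<bar>" for \<omega> by (rule abs_sgn[symmetric])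
  have sgm: "(\<lambda>\<omega>. sgn (J \<omega> - I \<omega>)) \<in> borel_measurable M" by measurable
  have si: "integrable M (\<lambda>\<omega>. f \<omega> * sgn (J \<omega> - I \<omega>))" if "integrable M f" for f :: "'a \<Rightarrow> real"
    using that by (rule Bochner_Integration.integrable_bound)
      (use that sgm in \<open>auto intro!: AE_I2 mult_right_le_one_le simp: abs_mult abs_sgn_eq\<close>)
  have "expectation (\<lambda>\<omega>. \<bar>J \<omega> - I \<omega>\<bar>) = expectation (\<lambda>\<omega>. J \<omega> * sgn (J \<omega> - I \<omega>)) - expectation (\<lambda>\<omega>. I \<omega> * sgn (J \<omega> - I \<omega>))"
    unfolding sg[symmetric] left_diff_distrib
    by (rule Bochner_Integration.integral_diff[OF si[OF Ji] si[OF Ii]])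
  also have "\<dots> = 0" using test[OF sgm] by (simp add: abs_sgn_eq)
  finally have "AE \<omega> in M. \<bar>J \<omega> - I \<omega>\<bar> = 0"
    using integral_nonneg_eq_0_iff_AE[of M "\<lambda>\<omega>. \<bar>J \<omega> - I \<omega>\<bar>"] JI by auto
  then show ?thesis by eventually_elim (simp add: I_def)
qed

end

lemma integral_unif:
  fixes f :: "real^'d::finite \<Rightarrow> real"
  assumes n: "0 < n" and f [measurable]: "f \<in> borel_measurable borel"
  shows "(\<integral>t. f t \<partial>unif n) = (\<integral>t. indicator (obs_domain n) t * f t \<partial>lborel) / real n"
proof -
  have "unif n = density lborel (\<lambda>t :: real^'d. ennreal (indicator (obs_domain n) t / real n))"
    unfolding unif_def uniform_measure_def
    using divide_ennreal[of 1 "real n"] n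
    by (intro arg_cong[where f = "density lborel"] ext) (simp add: emeasure_obs_domain indicator_def)
  then have "(\<integral>t. f t \<partial>unif n) = (\<integral>t. indicator (obs_domain n) t / real n * f t \<partial>lborel)"
    by (simp add: integral_density)
  also have "\<dots> = (\<integral>t. indicator (obs_domain n) t * f t / real n \<partial>lborel)" by simp
  finally show ?thesis by simp
qed

lemma dense_eq:
  fixes f g :: "'a::metric_space \<Rightarrow> real"
  assumes "continuous_on S f" "continuous_on S g" "closed S" "T \<subseteq> S" "S \<subseteq> closure T"
    and eq: "\<And>x. x \<in> T \<Longrightarrow> f x = g x" and x: "x \<in> S"
  shows "f x = g x"
proof -
  have "closed {x \<in> S. f x - g x = 0}"
    by (intro continuous_closed_preimage_constant continuous_on_diff assms)
  then have "closure T \<subseteq> {x \<in> S. f x - g x = 0}"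
    by (intro closure_minimal) (use assms(4) eq in auto)
  then show ?thesis using assms(5) x by auto
qed

context experiments
begin

lemma predd_joint:
  assumes n: "0 < n" and \<theta>: "\<theta> \<in> \<Theta>"
  shows "(\<lambda>(t, \<omega>). krig.predd (K \<theta>) (\<delta> \<theta>) n (Xv n \<omega>) (yv n \<omega>) t) \<in> borel_measurable (borel \<Otimes>\<^sub>M M)"
proof -
  interpret m: model M Y K\<^sub>0 "\<epsilon> n" \<delta>\<^sub>0 C\<^sub>0 n "K \<theta>" A Cinf "\<delta> \<theta>" by (rule model[OF n \<theta>])
  show ?thesis
    unfolding case_prod_beta'
    by (rule m.borel_measurable_predd)
       (auto simp: Xv_nth intro!: measurable_compose[OF measurable_snd] X_borel yv_borel[OF _ \<theta>])
qed

lemma ISPE_eq: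
  assumes n: "0 < n" and \<theta>: "\<theta> \<in> \<Theta>" and E: "is_ISPE M Y X \<epsilon> \<Theta> K \<delta> n E"
  shows "AE \<omega> in M. E \<theta> \<omega> = isr n \<theta> \<omega>"
proof -
  interpret m: model M Y K\<^sub>0 "\<epsilon> n" \<delta>\<^sub>0 C\<^sub>0 n "K \<theta>" A Cinf "\<delta> \<theta>" by (rule model[OF n \<theta>])
  define Z where "Z t \<omega> = (krig.predd (K \<theta>) (\<delta> \<theta>) n (Xv n \<omega>) (yv n \<omega>) t - Y t \<omega>)\<^sup>2" for t \<omega>
  have pr: "pred (K \<theta>) (\<delta> \<theta>) n (\<lambda>i. X n i \<omega>) (\<lambda>i. observations Y X \<epsilon> n i \<omega>) t =
      m.predd n (Xv n \<omega>) (yv n \<omega>) t" for t \<omega>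
    unfolding m.pred_eq by (rule m.predd_cong) (simp_all add: Xv_nth yv_def observations_def)
  have "\<exists>J. has_L2_integral M Z J (obs_domain n) \<and> (\<forall>\<omega>\<in>space M. E \<theta> \<omega> = J \<omega> / real n)"
    using bspec[OF conjunct1[OF E[unfolded is_ISPE_def]] \<theta>] unfolding pr Z_def[abs_def] .
  then obtain J where J: "has_L2_integral M Z J (obs_domain n)" "\<And>\<omega>. \<omega> \<in> space M \<Longrightarrow> E \<theta> \<omega> = J \<omega> / real n"
    by blast
  have Zm: "(\<lambda>(t, \<omega>). Z t \<omega>) \<in> borel_measurable (borel \<Otimes>\<^sub>M M)"
    using borel_measurable_power[OF borel_measurable_diff[OF predd_joint[OF n \<theta>] measurable_Y_joint[OF n \<theta> generated_Y_subset refl]], of 2]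
    by (simp add: Z_def case_prod_beta')
  have "AE \<omega> in M. J \<omega> = (\<integral>t. indicator (obs_domain n) t * Z t \<omega> \<partial>lborel)"
    unfolding obs_domain_def by (rule has_L2_integral_AE_eq[OF J(1)[unfolded obs_domain_def] Zm]) (simp add: Z_def)
  then show ?thesis
  proof (rule AE_mp, intro AE_I2 impI)
    fix \<omega> assume \<omega>: "\<omega> \<in> space M" and eq: "J \<omega> = (\<integral>t. indicator (obs_domain n) t * Z t \<omega> \<partial>lborel)"
    have "(\<lambda>t. Z t \<omega>) \<in> borel_measurable borel"
      unfolding Z_def using Y_path_borel[OF \<omega>] by measurable
    from integral_unif[OF n this] have "E \<theta> \<omega> = (\<integral>t. Z t \<omega> \<partial>unif n)" by (simp add: J(2)[OF \<omega>] eq)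
    then show "E \<theta> \<omega> = isr n \<theta> \<omega>" by (simp add: isr_def m.isped_def Z_def power2_commute)
  qed
qed

text \<open>For each parameter the two versions agree outside a null set depending on it. A
  countable dense set of parameters gives one null set, and continuity of both paths extends the
  equality to all parameters.\<close>

lemma AE_ISPE_eq:
  assumes n: "0 < n" and ne: "\<Theta> \<noteq> {}" and E: "is_ISPE M Y X \<epsilon> \<Theta> K \<delta> n E"
  shows "AE \<omega> in M. \<forall>\<theta>\<in>\<Theta>. E \<theta> \<omega> = isr n \<theta> \<omega>"
proof -
  obtain T where T: "countable T" "T \<subseteq> \<Theta>" "\<Theta> \<subseteq> closure T" by (rule separable)
  obtain \<theta>0 where \<theta>0: "\<theta>0 \<in> \<Theta>" using ne by blast
  have "AE \<omega> in M. \<forall>\<theta>\<in>T. E \<theta> \<omega> = isr n \<theta> \<omega>"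
    using T(2) by (subst AE_ball_countable[OF T(1)]) (auto intro!: ISPE_eq[OF n _ E])
  moreover have "AE \<omega> in M. continuous_on \<Theta> (\<lambda>\<theta>. E \<theta> \<omega>)" using E by (simp add: is_ISPE_def)
  ultimately show ?thesis using AE_regular[OF n \<theta>0] AE_space
  proof eventually_elim
    case (elim \<omega>)
    show ?case
    proof
      fix \<theta> assume "\<theta> \<in> \<Theta>"
      then show "E \<theta> \<omega> = isr n \<theta> \<omega>"
        using dense_eq[of \<Theta> "\<lambda>\<theta>. E \<theta> \<omega>" "\<lambda>\<theta>. isr n \<theta> \<omega>" T \<theta>, OF elim(2) continuous_isr[OF n elim(4,3)]
          compact_imp_closed[OF \<Theta>_compact] T(2,3)] elim(1) by blast
    qed
  qed
qed

end

section \<open>The cross validation estimator\<close>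

lemma measurable_generated:
  fixes Z :: "'i \<Rightarrow> 'w \<Rightarrow> 'b::topological_space"
  assumes "i \<in> I" "sets (generated M I Z) \<subseteq> sets H" "space H = space M"
  shows "Z i \<in> borel_measurable H"
proof (rule measurableI)
  fix B :: "'b set" assume "B \<in> sets borel"
  then have "Z i -` B \<inter> space M \<in> sets (generated M I Z)"
    unfolding generated_def using assms(1) by (subst sets_measure_of) (auto intro!: sigma_sets.Basic)
  then show "Z i -` B \<inter> space H \<in> sets H" using assms by auto
qed simp

text \<open>Turns the infimum over all parameters into a countable one, which is measurable.\<close>

lemma INF_dense:
  fixes f :: "'a::metric_space \<Rightarrow> real"
  assumes "continuous_on S f" "closed S" "T \<subseteq> S" "S \<subseteq> closure T" "S \<noteq> {}" "\<And>x. x \<in> S \<Longrightarrow> 0 \<le> f x"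
  shows "(INF x\<in>S. f x) = (INF x\<in>T. f x)"
proof (rule antisym)
  have T: "T \<noteq> {}" using assms(4,5) by auto
  have bd: "bdd_below (f ` S)" "bdd_below (f ` T)" using assms(3,6) by (auto intro!: bdd_belowI2[of _ 0])
  show "(INF x\<in>S. f x) \<le> (INF x\<in>T. f x)" by (rule cINF_superset_mono[OF T bd(1) assms(3)]) simp
  have "closed {x \<in> S. (INF x\<in>T. f x) \<le> f x}"
    by (rule continuous_on_closed_Collect_le[OF continuous_on_const assms(1,2)])
  then have "closure T \<subseteq> {x \<in> S. (INF x\<in>T. f x) \<le> f x}"
    by (rule closure_minimal[rotated]) (use assms(3) cINF_lower[OF bd(2)] in auto)
  then show "(INF x\<in>T. f x) \<le> (INF x\<in>S. f x)" using assms(4,5) by (intro cINF_greatest) auto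
qed

context experiments
begin

lemma isr_nonneg:
  assumes "\<theta> \<in> \<Theta>" shows "0 \<le> isr n \<theta> \<omega>"
proof -
  interpret m: krig "K \<theta>" A Cinf "\<delta> \<theta>" by (rule K_krig[OF assms])
  show ?thesis unfolding isr_def m.isped_def by simp
qed

text \<open>Zero on the null event of irregular paths, so that continuity in the parameter is at
  hand wherever the definition is not trivial.\<close>

definition remainder :: "(nat \<Rightarrow> 'w \<Rightarrow> real^'p) \<Rightarrow> nat \<Rightarrow> 'w \<Rightarrow> real" where
  "remainder \<theta>CV n \<omega> = (if regular n \<omega> then isr n (\<theta>CV n \<omega>) \<omega> - (INF \<theta>\<in>\<Theta>. isr n \<theta> \<omega>) else 0)"

text \<open>The value of \<open>isr\<close> at a random parameter is a limit: \<open>\<tau>\<close>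
  is approximated by the first member of a dense sequence within distance 1 / (m + 1), an index that
  is a measurable function with countably many values. The algebra \<open>H\<close> is left open
  since the claim is needed both for \<open>M\<close> and for the algebra generated by design, data
  and process.\<close>

lemma measurable_remainder:
  assumes n: "0 < n" and H: "sets (generated M UNIV Y) \<subseteq> sets H" "space H = space M"
    and x: "\<And>i. i < n \<Longrightarrow> X n i \<in> borel_measurable H"
    and y: "\<And>i. i < n \<Longrightarrow> (\<lambda>\<omega>. yv n \<omega> i) \<in> borel_measurable H"
    and \<tau>: "\<tau> n \<in> borel_measurable H" and mem: "\<And>\<omega>. \<omega> \<in> space M \<Longrightarrow> \<tau> n \<omega> \<in> \<Theta>" and ne: "\<Theta> \<noteq> {}"
  shows "remainder \<tau> n \<in> borel_measurable H"
proof -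
  obtain T where T: "countable T" "T \<subseteq> \<Theta>" "\<Theta> \<subseteq> closure T" by (rule separable)
  have T0: "T \<noteq> {}" using T(3) ne by auto
  define t where "t = from_nat_into T"
  have t: "t k \<in> \<Theta>" for k using from_nat_into[OF T0] T(2) by (auto simp: t_def)
  have isr: "isr n \<theta> \<in> borel_measurable H" if "\<theta> \<in> \<Theta>" for \<theta>
    by (rule measurable_isr[OF n that H x y])
  have reg: "{\<omega> \<in> space H. regular n \<omega>} \<in> sets H"
    using measurable_regular[OF n t H] H(2) by simp
  define ix where "ix m \<omega> = (LEAST k. dist (t k) (\<tau> n \<omega>) < inverse (real (Suc m)))" for m \<omega>
  have near: "dist (t (ix m \<omega>)) (\<tau> n \<omega>) < inverse (real (Suc m))" if "\<omega> \<in> space M" for m \<omega>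
  proof -
    have "\<tau> n \<omega> \<in> closure T" using mem[OF that] T(3) by auto
    then obtain z where z: "z \<in> T" "dist z (\<tau> n \<omega>) < inverse (real (Suc m))"
      unfolding closure_approachable by (elim allE[of _ "inverse (real (Suc m))"]) auto
    obtain k where "from_nat_into T k = z" using from_nat_into_surj[OF T(1) z(1)] by blast
    then have "dist (t k) (\<tau> n \<omega>) < inverse (real (Suc m))" using z(2) by (simp only: t_def)
    from LeastI[of "\<lambda>k. dist (t k) (\<tau> n \<omega>) < inverse (real (Suc m))", OF this] show ?thesis
      by (simp only: ix_def)
  qed
  have ixm: "ix m \<in> measurable H (count_space UNIV)" for m
    unfolding ix_def
  proof (rule measurable_Least)
    fix k
    have "(\<lambda>\<omega>. dist (t k) (\<tau> n \<omega>)) \<in> borel_measurable H" using \<tau> by (intro borel_measurable_dist) auto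
    then show "(\<lambda>\<omega>. dist (t k) (\<tau> n \<omega>) < inverse (real (Suc m))) \<in> measurable H (count_space UNIV)" by measurable
  qed
  have step: "(\<lambda>\<omega>. if regular n \<omega> then isr n (t (ix m \<omega>)) \<omega> else 0) \<in> borel_measurable H" for m
  proof -
    have "(\<lambda>\<omega>. isr n (t (ix m \<omega>)) \<omega>) \<in> borel_measurable H"
      by (rule measurable_compose_countable[OF isr[OF t] ixm])
    then show ?thesis using reg by (intro measurable_If) auto
  qed
  have 1: "(\<lambda>\<omega>. if regular n \<omega> then isr n (\<tau> n \<omega>) \<omega> else 0) \<in> borel_measurable H"
  proof (rule borel_measurable_LIMSEQ_real[OF _ step])
    fix \<omega> assume "\<omega> \<in> space H"
    then have \<omega>: "\<omega> \<in> space M" using H by simp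
    show "(\<lambda>m. if regular n \<omega> then isr n (t (ix m \<omega>)) \<omega> else 0) \<longlonglongrightarrow> (if regular n \<omega> then isr n (\<tau> n \<omega>) \<omega> else 0)"
    proof (cases "regular n \<omega>")
      case True
      have "(\<lambda>m. dist (t (ix m \<omega>)) (\<tau> n \<omega>)) \<longlonglongrightarrow> 0"
      proof (rule tendsto_sandwich[OF _ _ tendsto_const LIMSEQ_inverse_real_of_nat])
        show "\<forall>\<^sub>F m in sequentially. dist (t (ix m \<omega>)) (\<tau> n \<omega>) \<le> inverse (real (Suc m))"
          by (intro always_eventually allI less_imp_le near \<omega>)
      qed simp
      then have lim: "(\<lambda>m. t (ix m \<omega>)) \<longlonglongrightarrow> \<tau> n \<omega>" by (simp only: tendsto_dist_iff[symmetric])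
      have "(\<lambda>m. isr n (t (ix m \<omega>)) \<omega>) \<longlonglongrightarrow> isr n (\<tau> n \<omega>) \<omega>"
        by (rule continuous_on_tendsto_compose[OF continuous_isr[OF n \<omega> True] lim mem[OF \<omega>]])
           (intro always_eventually allI t)
      then show ?thesis using True by simp
    qed simp
  qed
  have "(\<lambda>\<omega>. INF \<theta>\<in>T. isr n \<theta> \<omega>) \<in> borel_measurable H"
    by (rule borel_measurable_cINF_real[OF T(1)]) (use isr T(2) in auto)
  then have 2: "(\<lambda>\<omega>. if regular n \<omega> then INF \<theta>\<in>T. isr n \<theta> \<omega> else 0) \<in> borel_measurable H"
    using reg by (intro measurable_If) auto
  have "remainder \<tau> n \<omega> = (if regular n \<omega> then isr n (\<tau> n \<omega>) \<omega> else 0) - (if regular n \<omega> then INF \<theta>\<in>T. isr n \<theta> \<omega> else 0)"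
    if "\<omega> \<in> space M" for \<omega>
    using INF_dense[OF continuous_isr[OF n that] compact_imp_closed[OF \<Theta>_compact] T(2,3) ne] isr_nonneg
    by (simp add: remainder_def)
  then show ?thesis
    using borel_measurable_diff[OF 1 2] H(2) by (subst measurable_cong) auto
qed

lemma remainder_le:
  fixes e :: real
  assumes gap: "\<And>\<theta>. \<theta> \<in> \<Theta> \<Longrightarrow> \<bar>gap n \<theta> \<omega>\<bar> \<le> e" and mem: "\<tau> n \<omega> \<in> \<Theta>"
    and min: "\<And>\<theta>. \<theta> \<in> \<Theta> \<Longrightarrow> cvr n (\<tau> n \<omega>) \<omega> \<le> cvr n \<theta> \<omega>"
  shows "\<bar>remainder \<tau> n \<omega>\<bar> \<le> 2 * e"
proof -
  have bd: "bdd_below ((\<lambda>\<theta>. isr n \<theta> \<omega>) ` \<Theta>)" by (auto intro!: bdd_belowI2[of _ 0] isr_nonneg)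
  have up: "(INF \<theta>\<in>\<Theta>. isr n \<theta> \<omega>) \<le> isr n (\<tau> n \<omega>) \<omega>" by (rule cINF_lower[OF bd mem])
  have "isr n (\<tau> n \<omega>) \<omega> - 2 * e \<le> (INF \<theta>\<in>\<Theta>. isr n \<theta> \<omega>)"
  proof (rule cINF_greatest)
    show "\<Theta> \<noteq> {}" using mem by auto
    fix \<theta> assume "\<theta> \<in> \<Theta>"
    from gap[OF this] gap[OF mem] min[OF this] show "isr n (\<tau> n \<omega>) \<omega> - 2 * e \<le> isr n \<theta> \<omega>"
      by (simp add: gap_def abs_le_iff)
  qed
  moreover have "0 \<le> e" using gap[OF mem] by linarith
  ultimately show ?thesis using up by (simp add: remainder_def abs_le_iff)
qed

lemma remainder_tendsto:
  fixes e :: real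
  assumes e: "0 < e" and meas: "\<And>n. 0 < n \<Longrightarrow> remainder \<tau> n \<in> borel_measurable M"
    and mem: "\<And>n \<omega>. 0 < n \<Longrightarrow> \<omega> \<in> space M \<Longrightarrow> \<tau> n \<omega> \<in> \<Theta>"
    and min: "\<And>n \<omega> \<theta>. 0 < n \<Longrightarrow> \<omega> \<in> space M \<Longrightarrow> \<theta> \<in> \<Theta> \<Longrightarrow> cvr n (\<tau> n \<omega>) \<omega> \<le> cvr n \<theta> \<omega>"
  shows "(\<lambda>n. prob {\<omega> \<in> space M. e < \<bar>remainder \<tau> n \<omega>\<bar>}) \<longlonglongrightarrow> 0"
proof (rule LIMSEQ_I)
  fix r :: real assume r: "0 < r"
  let ?e0 = "exp (1 + 2 * decay_mass TYPE('d))"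
  \<comment> \<open>With this level the Markov bound for the crowding is \<open>r / 2\<close>; the
    other half of \<open>r\<close> is left to the exceptional event of
    \<open>gap_small\<close>.\<close>
  define c where "c = 2 * ?e0 / r"
  have c: "0 < c" "?e0 / c = r / 2" using r by (auto simp: c_def)
  have "0 \<le> c" "0 < e / 2" using c e by auto
  from gap_small[OF this] obtain B where BB: "(\<forall>n>0. B n \<in> events) \<and> (\<lambda>n. prob (B n)) \<longlonglongrightarrow> 0 \<and>
    (\<forall>n>0. \<forall>\<omega>\<in>space M. regular n \<omega> \<longrightarrow> crowding n (Xv n \<omega>) \<le> c * n \<longrightarrow> \<omega> \<notin> B n \<longrightarrow>
      (\<forall>\<theta>\<in>\<Theta>. \<bar>gap n \<theta> \<omega>\<bar> \<le> e / 2))"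
    by blast
  then have B: "\<And>n. 0 < n \<Longrightarrow> B n \<in> events" "(\<lambda>n. prob (B n)) \<longlonglongrightarrow> 0"
    and small: "\<And>n \<omega> \<theta>. 0 < n \<Longrightarrow> \<omega> \<in> space M \<Longrightarrow> regular n \<omega> \<Longrightarrow> crowding n (Xv n \<omega>) \<le> c * n \<Longrightarrow> \<omega> \<notin> B n \<Longrightarrow>
      \<theta> \<in> \<Theta> \<Longrightarrow> \<bar>gap n \<theta> \<omega>\<bar> \<le> e / 2"
    by blast+
  obtain N where N: "\<And>n. N \<le> n \<Longrightarrow> prob (B n) < r / 2"
    using LIMSEQ_D[OF B(2), of "r / 2"] r by auto
  have "norm (prob {\<omega> \<in> space M. e < \<bar>remainder \<tau> n \<omega>\<bar>} - 0) < r" if "max N 1 \<le> n" for n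
  proof -
    have n: "0 < n" "N \<le> n" using that by auto
    note [measurable] = crowding_borel
    have Cm: "{\<omega> \<in> space M. c * n < crowding n (Xv n \<omega>)} \<in> events" by measurable
    have "{\<omega> \<in> space M. e < \<bar>remainder \<tau> n \<omega>\<bar>} \<subseteq> {\<omega> \<in> space M. c * n < crowding n (Xv n \<omega>)} \<union> B n"
    proof
      fix \<omega> assume "\<omega> \<in> {\<omega> \<in> space M. e < \<bar>remainder \<tau> n \<omega>\<bar>}"
      then have \<omega>: "\<omega> \<in> space M" "e < \<bar>remainder \<tau> n \<omega>\<bar>" by auto
      show "\<omega> \<in> {\<omega> \<in> space M. c * n < crowding n (Xv n \<omega>)} \<union> B n"
      proof (rule ccontr)
        assume "\<not> ?thesis"
        then have *: "crowding n (Xv n \<omega>) \<le> c * n" "\<omega> \<notin> B n" using \<omega> by auto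
        have reg: "regular n \<omega>" using \<omega>(2) e by (cases "regular n \<omega>") (auto simp: remainder_def)
        have "\<bar>remainder \<tau> n \<omega>\<bar> \<le> 2 * (e / 2)"
          by (rule remainder_le[where \<tau> = \<tau> and n = n, OF small[OF n(1) \<omega>(1) reg *] mem[OF n(1) \<omega>(1)] min[OF n(1) \<omega>(1)]])
        then show False using \<omega>(2) by simp
      qed
    qed
    then have "prob {\<omega> \<in> space M. e < \<bar>remainder \<tau> n \<omega>\<bar>} \<le> prob ({\<omega> \<in> space M. c * n < crowding n (Xv n \<omega>)} \<union> B n)"
      by (rule finite_measure_mono) (use Cm B(1)[OF n(1)] in auto)
    also have "\<dots> \<le> prob {\<omega> \<in> space M. c * n < crowding n (Xv n \<omega>)} + prob (B n)"
      by (rule measure_Un_le[OF Cm B(1)[OF n(1)]])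
    also have "\<dots> < r / 2 + r / 2"
      using prob_crowding_le[OF n(1) c(1)] N[OF n(2)] c(2) by (intro add_le_less_mono) simp_all
    finally show ?thesis by simp
  qed
  then show "\<exists>no. \<forall>n\<ge>no. norm (prob {\<omega> \<in> space M. e < \<bar>remainder \<tau> n \<omega>\<bar>} - 0) < r" by blast
qed

end

lemma times_cont_diff_lipschitz:
  fixes f :: "real^'p::finite \<Rightarrow> real" and B :: real
  assumes \<Theta>: "\<Theta> = cbox a b" and f: "times_cont_diff_on (Suc k) \<Theta> f"
    and B: "\<And>j \<theta>. \<theta> \<in> \<Theta> \<Longrightarrow> \<bar>multi_partial \<Theta> (\<lambda>i. if i = j then 1 else 0) f \<theta>\<bar> \<le> B"
    and xy: "x \<in> \<Theta>" "y \<in> \<Theta>"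
  shows "\<bar>f x - f y\<bar> \<le> CARD('p) * B * dist x y"
proof -
  have "\<bar>f y - f x\<bar> \<le> B * CARD('p) * dist x y"
    by (rule box_lipschitz[OF \<Theta> _ _ xy]) (use f B in \<open>auto simp: multi_partial_single\<close>)
  then show ?thesis by (simp add: abs_minus_commute mult_ac)
qed

theorem theorem3p4:
  fixes M :: "'w measure"
    and Y :: "real^'d::finite \<Rightarrow> 'w \<Rightarrow> real"
    and X :: "nat \<Rightarrow> nat \<Rightarrow> 'w \<Rightarrow> real^'d"
    and \<epsilon> :: "nat \<Rightarrow> nat \<Rightarrow> 'w \<Rightarrow> real"
    and K\<^sub>0 :: "real^'d \<Rightarrow> real" and \<delta>\<^sub>0 C\<^sub>0 :: real
    and \<theta>inf \<theta>sup :: real and \<Theta> :: "(real^'p::finite) set"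
    and K :: "real^'p \<Rightarrow> real^'d \<Rightarrow> real" and \<delta> :: "real^'p \<Rightarrow> real" and Cinf :: real
    and E :: "nat \<Rightarrow> real^'p \<Rightarrow> 'w \<Rightarrow> real"
    and \<theta>CV :: "nat \<Rightarrow> 'w \<Rightarrow> real^'p"
  assumes "prob_space M"
    and "\<theta>inf < \<theta>sup" and \<Theta>_eq: "\<Theta> = cbox (\<chi> j. \<theta>inf) (\<chi> j. \<theta>sup)"
    \<comment> \<open>the process and the noise\<close>
    and "centered_gaussian M UNIV Y (\<lambda>s t. K\<^sub>0 (s - t))"
    and "measurable_process M Y"
    and "0 \<le> \<delta>\<^sub>0"
    and "\<And>n. 0 < n \<Longrightarrow> centered_gaussian M {..<n} (\<epsilon> n) (\<lambda>i j. if i = j then \<delta>\<^sub>0 else 0)"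
    \<comment> \<open>(i) sampling design and mutual independence\<close>
    and "\<And>n. 0 < n \<Longrightarrow> prob_space.indep_vars M (\<lambda>i. borel) (X n) {..<n}"
    and "\<And>n i. i < n \<Longrightarrow> distr M borel (X n i) = uniform_measure lborel (obs_domain n)"
    and "\<And>n. 0 < n \<Longrightarrow>
      prob_space.indep_sets M
        (\<lambda>l. [sets (generated M UNIV Y), sets (generated M {..<n} (X n)),
              sets (generated M {..<n} (\<epsilon> n))] ! l) {..<3}"
    \<comment> \<open>(ii) true covariance\<close>
    and "continuous_on UNIV K\<^sub>0"
    and "\<And>t. \<bar>K\<^sub>0 t\<bar> \<le> C\<^sub>0 / (1 + infnorm t ^ (CARD('d) + 1))"
    \<comment> \<open>(iii) parametric model\<close>
    and "\<And>\<theta>. \<theta> \<in> \<Theta> \<Longrightarrow> stationary_covariance (K \<theta>)"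
    and "\<And>\<theta>. \<theta> \<in> \<Theta> \<Longrightarrow> K \<theta> \<in> borel_measurable borel"
    and "\<And>t. times_cont_diff_on (CARD('p) + 1) \<Theta> (\<lambda>\<theta>. K \<theta> t)"
    and "\<And>\<alpha>. (\<Sum>j\<in>UNIV. \<alpha> j) \<le> CARD('p) + 1 \<Longrightarrow>
      \<exists>A. \<forall>t. \<forall>\<theta>\<in>\<Theta>.
        \<bar>multi_partial \<Theta> \<alpha> (\<lambda>\<theta>'. K \<theta>' t) \<theta>\<bar> \<le> A / (1 + infnorm t ^ (CARD('d) + 1))"
    and "0 < Cinf" and "\<And>\<theta>. \<theta> \<in> \<Theta> \<Longrightarrow> Cinf \<le> \<delta> \<theta>"
    and "times_cont_diff_on (CARD('p) + 1) \<Theta> \<delta>"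
    and "\<And>\<alpha>. (\<Sum>j\<in>UNIV. \<alpha> j) \<le> CARD('p) + 1 \<Longrightarrow>
      \<exists>B. \<forall>\<theta>\<in>\<Theta>. \<bar>multi_partial \<Theta> \<alpha> \<delta> \<theta>\<bar> \<le> B"
    \<comment> \<open>the integrated square prediction error and the cross validation estimator\<close>
    and "\<And>n. 0 < n \<Longrightarrow> is_ISPE M Y X \<epsilon> \<Theta> K \<delta> n (E n)"
    and "\<And>n. 0 < n \<Longrightarrow> \<theta>CV n \<in> borel_measurable M"
    and "\<And>n \<omega>. 0 < n \<Longrightarrow> \<omega> \<in> space M \<Longrightarrow>
      is_arg_min
        (\<lambda>\<theta>. CV (K \<theta>) (\<delta> \<theta>) n (\<lambda>i. X n i \<omega>) (\<lambda>i. observations Y X \<epsilon> n i \<omega>))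
        (\<lambda>\<theta>. \<theta> \<in> \<Theta>) (\<theta>CV n \<omega>)"
  shows "\<exists>\<rho> :: nat \<Rightarrow> 'w \<Rightarrow> real.
    (\<forall>n>0. \<rho> n \<in> borel_measurable M \<and>
      (AE \<omega> in M. E n (\<theta>CV n \<omega>) \<omega> = (INF \<theta>\<in>\<Theta>. E n \<theta> \<omega>) + \<rho> n \<omega>) \<and>
      \<comment> \<open>if the minimizer is chosen as a function of the data \<open>(X, y)\<close>, then the remainder is a
         function of \<open>(X, y, Y)\<close>\<close>
      (\<theta>CV n \<in> borel_measurable
          (sigma (space M) (sets (generated M {..<n} (X n)) \<union>
                            sets (generated M {..<n} (observations Y X \<epsilon> n)))) \<longrightarrow>
       \<rho> n \<in> borel_measurable
          (sigma (space M) (sets (generated M {..<n} (X n)) \<union>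
                            sets (generated M {..<n} (observations Y X \<epsilon> n)) \<union>
                            sets (generated M UNIV Y))))) \<and>
    (\<forall>e>0. (\<lambda>n. measure M {\<omega> \<in> space M. e < \<bar>\<rho> n \<omega>\<bar>}) \<longlonglongrightarrow> 0)"
proof -
  interpret prob_space M by (rule assms(1))
  \<comment> \<open>The multi-index of the first derivative in direction \<open>j\<close>. Its total
    order is 1, so the derivative bounds of (iii) apply to it.\<close>
  let ?S = "\<lambda>j::'p. \<lambda>i. if i = j then 1 else 0::nat"
  have sS: "(\<Sum>i\<in>UNIV. ?S j i) \<le> CARD('p) + 1" for j by simp
  have \<Theta>_ne: "\<Theta> \<noteq> {}" unfolding \<Theta>_eq interval_ne_empty_cart using assms(2) by simp
  obtain A0 where A0: "\<And>t \<theta>. \<theta> \<in> \<Theta> \<Longrightarrow> \<bar>K \<theta> t\<bar> \<le> A0 / (1 + infnorm t ^ (CARD('d) + 1))"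
    using assms(16)[of "\<lambda>_. 0"] unfolding multi_partial_0 by auto
  have "\<forall>j. \<exists>A. \<forall>t. \<forall>\<theta>\<in>\<Theta>. \<bar>multi_partial \<Theta> (?S j) (\<lambda>\<theta>'. K \<theta>' t) \<theta>\<bar> \<le> A / (1 + infnorm t ^ (CARD('d) + 1))"
    using assms(16)[OF sS] by blast
  from choice[OF this] obtain A1 where A1: "\<And>j t \<theta>. \<theta> \<in> \<Theta> \<Longrightarrow>
      \<bar>multi_partial \<Theta> (?S j) (\<lambda>\<theta>'. K \<theta>' t) \<theta>\<bar> \<le> A1 j / (1 + infnorm t ^ (CARD('d) + 1))" by blast
  obtain D where D: "\<And>\<theta>. \<theta> \<in> \<Theta> \<Longrightarrow> \<bar>\<delta> \<theta>\<bar> \<le> D"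
    using assms(20)[of "\<lambda>_. 0"] unfolding multi_partial_0 by auto
  have "\<forall>j. \<exists>B. \<forall>\<theta>\<in>\<Theta>. \<bar>multi_partial \<Theta> (?S j) \<delta> \<theta>\<bar> \<le> B" using assms(20)[OF sS] by blast
  from choice[OF this] obtain B1 where B1: "\<And>j \<theta>. \<theta> \<in> \<Theta> \<Longrightarrow> \<bar>multi_partial \<Theta> (?S j) \<delta> \<theta>\<bar> \<le> B1 j" by blast
  \<comment> \<open>The locale \<open>krig\<close> asks for a positive constant.\<close>
  define A where "A = max A0 1"
  \<comment> \<open>One constant for all first derivatives of kernel and noise variance. The added 1
    keeps \<open>L\<close> positive, as radii are quotients by \<open>L\<close>.\<close>
  define B where "B = (\<Sum>j\<in>UNIV. \<bar>A1 j\<bar> + \<bar>B1 j\<bar>) + 1"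
  define L where "L = CARD('p) * B"
  have le_B: "\<bar>A1 j\<bar> + \<bar>B1 j\<bar> \<le> B" for j
    using member_le_sum[of j UNIV "\<lambda>j. \<bar>A1 j\<bar> + \<bar>B1 j\<bar>"] by (simp add: B_def)
  have B_pos: "0 < B" using sum_nonneg[of UNIV "\<lambda>j. \<bar>A1 j\<bar> + \<bar>B1 j\<bar>"] by (simp add: B_def)
  have krig: "krig (K \<theta>) A Cinf (\<delta> \<theta>)" if \<theta>: "\<theta> \<in> \<Theta>" for \<theta>
  proof
    show "stationary_covariance (K \<theta>)" "K \<theta> \<in> borel_measurable borel" "Cinf \<le> \<delta> \<theta>" "0 < Cinf"
      using assms \<theta> by auto
    show "\<bar>K \<theta> t\<bar> \<le> A * decay t" for t
      using A0[OF \<theta>, of t] mult_right_mono[of A0 A "decay t"] decay_pos[of t] by (simp add: A_def decay_def)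
  qed (simp add: A_def)
  have K_lip: "\<bar>K \<theta> t - K \<theta>' t\<bar> \<le> L * dist \<theta> \<theta>' * decay t" if \<theta>: "\<theta> \<in> \<Theta>" "\<theta>' \<in> \<Theta>" for \<theta> \<theta>' t
  proof -
    have "\<bar>K \<theta> t - K \<theta>' t\<bar> \<le> CARD('p) * (B * decay t) * dist \<theta> \<theta>'"
    proof (rule times_cont_diff_lipschitz[OF \<Theta>_eq _ _ \<theta>])
      show "times_cont_diff_on (Suc CARD('p)) \<Theta> (\<lambda>\<theta>. K \<theta> t)" using assms(15)[of t] by simp
      fix j \<tau> assume "\<tau> \<in> \<Theta>"
      from A1[OF this, of j t] have "\<bar>multi_partial \<Theta> (?S j) (\<lambda>\<theta>. K \<theta> t) \<tau>\<bar> \<le> A1 j * decay t" by (simp add: decay_def)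
      also have "\<dots> \<le> B * decay t" using le_B[of j] decay_pos[of t] by (intro mult_right_mono) auto
      finally show "\<bar>multi_partial \<Theta> (?S j) (\<lambda>\<theta>. K \<theta> t) \<tau>\<bar> \<le> B * decay t" .
    qed
    then show ?thesis by (simp add: L_def mult_ac)
  qed
  have \<delta>_lip: "\<bar>\<delta> \<theta> - \<delta> \<theta>'\<bar> \<le> L * dist \<theta> \<theta>'" if \<theta>: "\<theta> \<in> \<Theta>" "\<theta>' \<in> \<Theta>" for \<theta> \<theta>'
    unfolding L_def
  proof (rule times_cont_diff_lipschitz[OF \<Theta>_eq _ _ \<theta>])
    show "times_cont_diff_on (Suc CARD('p)) \<Theta> \<delta>" using assms(19) by simp
    show "\<bar>multi_partial \<Theta> (?S j) \<delta> \<tau>\<bar> \<le> B" if "\<tau> \<in> \<Theta>" for j \<tau> using B1[OF that, of j] le_B[of j] by linarith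
  qed
  interpret experiments M Y X \<epsilon> K\<^sub>0 \<delta>\<^sub>0 C\<^sub>0 \<Theta> K \<delta> Cinf A D L
  proof (intro experiments.intro experiments_axioms.intro)
    show "\<bar>K\<^sub>0 t\<bar> \<le> C\<^sub>0 * decay t" for t using assms(12)[of t] by (simp add: decay_def)
    show "compact \<Theta>" unfolding \<Theta>_eq by (rule compact_cbox)
    show "\<delta> \<theta> \<le> D" if "\<theta> \<in> \<Theta>" for \<theta> using D[OF that] by linarith
    show "0 < L" using B_pos by (simp add: L_def)
  qed (fact assms krig K_lip \<delta>_lip)+
  have CV: "CV (K \<theta>) (\<delta> \<theta>) n (\<lambda>i. X n i \<omega>) (\<lambda>i. observations Y X \<epsilon> n i \<omega>) = cvr n \<theta> \<omega>" if "\<theta> \<in> \<Theta>" for n \<theta> \<omega>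
  proof -
    interpret m: krig "K \<theta>" A Cinf "\<delta> \<theta>" by (rule krig[OF that])
    show ?thesis unfolding m.CV_eq cvr_def by (rule m.cvd_cong) (simp_all add: Xv_nth yv_def observations_def)
  qed
  have mem: "\<theta>CV n \<omega> \<in> \<Theta>" and min: "\<And>\<theta>. \<theta> \<in> \<Theta> \<Longrightarrow> cvr n (\<theta>CV n \<omega>) \<omega> \<le> cvr n \<theta> \<omega>" if "0 < n" "\<omega> \<in> space M" for n \<omega>
    using assms(23)[OF that] CV by (auto simp: is_arg_min_def not_less)
  have yv: "yv n \<omega> i = observations Y X \<epsilon> n i \<omega>" if "i < n" for n \<omega> i
    using that by (simp add: yv_def observations_def Xv_nth)
  have meas: "remainder \<theta>CV n \<in> borel_measurable M" if n: "0 < n" for n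
  proof -
    obtain \<theta>0 where "\<theta>0 \<in> \<Theta>" using \<Theta>_ne by blast
    then show ?thesis
      by (intro measurable_remainder[OF n generated_Y_subset refl] X_borel assms(22) n mem[OF n] \<Theta>_ne yv_borel) auto
  qed
  show ?thesis
  proof (intro exI[of _ "remainder \<theta>CV"] conjI allI impI)
    fix n :: nat assume n: "0 < n"
    show "remainder \<theta>CV n \<in> borel_measurable M" by (rule meas[OF n])
    obtain \<theta>0 where \<theta>0: "\<theta>0 \<in> \<Theta>" using \<Theta>_ne by blast
    show "AE \<omega> in M. E n (\<theta>CV n \<omega>) \<omega> = (INF \<theta>\<in>\<Theta>. E n \<theta> \<omega>) + remainder \<theta>CV n \<omega>"
      using AE_ISPE_eq[OF n \<Theta>_ne assms(21)[OF n]] AE_regular[OF n \<theta>0] AE_space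
    proof eventually_elim
      case (elim \<omega>)
      have "(INF \<theta>\<in>\<Theta>. E n \<theta> \<omega>) = (INF \<theta>\<in>\<Theta>. isr n \<theta> \<omega>)" by (rule INF_cong) (use elim(1) in auto)
      then show ?case using elim mem[OF n elim(3)] by (simp add: remainder_def)
    qed
    let ?G = "sets (generated M {..<n} (X n)) \<union> sets (generated M {..<n} (observations Y X \<epsilon> n))"
    let ?H1 = "sigma (space M) ?G" and ?H = "sigma (space M) (?G \<union> sets (generated M UNIV Y))"
    assume \<tau>: "\<theta>CV n \<in> borel_measurable ?H1"
    have G: "?G \<subseteq> Pow (space M)" "?G \<union> sets (generated M UNIV Y) \<subseteq> Pow (space M)"
      by (intro Un_least generated_subset_Pow)+
    have spH: "space ?H = space M" "space ?H1 = space M" using G by (simp_all add: space_measure_of)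
    have sub: "?G \<union> sets (generated M UNIV Y) \<subseteq> sets ?H" using G(2) by auto
    have "sets ?H1 \<subseteq> sets ?H" using G by (simp add: sigma_sets_mono')
    then have "\<theta>CV n \<in> borel_measurable ?H"
      using measurable_mono[of borel borel ?H1 ?H] \<tau> spH by auto
    then show "remainder \<theta>CV n \<in> borel_measurable ?H"
    proof (rule measurable_remainder[OF n _ spH(1), rotated 3])
      show "sets (generated M UNIV Y) \<subseteq> sets ?H" using sub by blast
      show "X n i \<in> borel_measurable ?H" if "i < n" for i
        by (rule measurable_generated[of i "{..<n}" M "X n"]) (use sub that spH in auto)
      show "(\<lambda>\<omega>. yv n \<omega> i) \<in> borel_measurable ?H" if "i < n" for i
        unfolding yv[OF that]
        by (rule measurable_generated[of i "{..<n}" M "observations Y X \<epsilon> n"]) (use sub that spH in auto)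
    qed (use mem[OF n] \<Theta>_ne in auto)
  next
    fix e :: real assume "0 < e"
    then show "(\<lambda>n. measure M {\<omega> \<in> space M. e < \<bar>remainder \<theta>CV n \<omega>\<bar>}) \<longlonglongrightarrow> 0"
      by (rule remainder_tendsto[OF _ meas mem min])
  qed
qed

end
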